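(* Let $s>2$ and let $\delta>0$ be a sufficiently small constant (as described in the context). Let $(u_0,\tau_0)\in H^s(\mathbb{R}^2)$, with ${\rm div}\,u_0=0$ and $\tau_0$ symmetric, satisfy $$\|(u_0,\tau_0)\|_{H^1}+\|(\Omega_0,\tau_0)\|_{B^0_{\infty,1}}\le\delta,\qquad \Omega_0=\mathrm{curl}\,u_0,$$ and let $(u,\tau)\in C([0,\infty);H^s)$ be the corresponding global strong solution of the inviscid Oldroyd-B system $$\partial_tu+u\cdot\nabla u+\nabla P={\rm div}\,\tau,\quad{\rm div}\,u=0,\quad \partial_t\tau+u\cdot\nabla\tau+\tau+Q(\nabla u,\tau)=D(u)+\Delta\tau,\quad (u,\tau)|_{t=0}=(u_0,\tau_0).$$ If in addition $(u_0,\tau_0)\in L^1$, then there exists $C>0$ such that for every $t>0$, $$\|(u,\tau)(t)\|_{H^1}\le C(1+t)^{-\frac12}.$$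
   Context: The space variable is $x\in\mathbb{R}^2$; $u(t,x)\in\mathbb{R}^2$, $\tau(t,x)$ is a symmetric $2\times2$ tensor, $P$ is the pressure. $D(u)=\frac{\nabla u+(\nabla u)^T}{2}$, $\Omega=\frac{\nabla u-(\nabla u)^T}{2}$ (with $(\nabla u)_{ij}=\partial_ju_i$), and $Q(\nabla u,\tau)=\tau\Omega-\Omega\tau+b\,(D(u)\tau+\tau D(u))$ with $b=1$. $\mathrm{curl}\,u=\partial_1u_2-\partial_2u_1$. $B^0_{\infty,1}$ is the nonhomogeneous Besov space with norm $\sum_{j\ge-1}\|\Delta_jf\|_{L^\infty}$, $\Delta_j$ being the Littlewood–Paley blocks. Meaning of $\delta$ (known theorem of Elgindi and Rousset, taken as given): for $s>2$ there is a sufficiently small constant $\delta>0$ such that, for data $(u_0,\tau_0)\in H^s$ satisfying the displayed smallness condition, the system admits a unique global strong solution $(u,\tau)\in C([0,\infty);H^s)$, and moreover $\frac{d}{dt}\|(u,\tau)\|_{H^1}^2+\|\nabla u\|_{L^2}^2+\|\tau\|_{H^2}^2\le0$. The $H^1$ norm in this inequality is the one for which the estimate holds (up to equivalence of norms). *)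

theory Defs
  imports "HOL-Analysis.Analysis" "HOL-Probability.Essential_Supremum"
begin

text \<open>
  Fields on the plane are functions on \<^typ>\<open>real^2\<close>; elements of a Lebesgue or Sobolev space are
  represented by Borel functions, so identities between them hold almost everywhere.  Norms of
  vector and tensor fields are taken componentwise with respect to \<^term>\<open>Basis\<close>; in particular a
  pair \<open>(u, \<tau>)\<close> is the single field \<open>\<lambda>x. (u x, \<tau> x)\<close>.
\<close>

subsection \<open>Weak derivatives\<close>

definition partial_derivative :: "2 \<Rightarrow> (real^2 \<Rightarrow> real) \<Rightarrow> real^2 \<Rightarrow> real" where
  "partial_derivative k f x = frechet_derivative f (at x) (axis k 1)"

definition smooth :: "(real^2 \<Rightarrow> real) \<Rightarrow> bool" where
  "smooth f \<longleftrightarrow> (\<forall>ks. foldr partial_derivative ks f differentiable_on UNIV)"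

definition test_function :: "(real^2 \<Rightarrow> real) \<Rightarrow> bool" where
  "test_function \<psi> \<longleftrightarrow> smooth \<psi> \<and> (\<exists>K. compact K \<and> (\<forall>x. x \<notin> K \<longrightarrow> \<psi> x = 0))"

definition locally_integrable :: "(real^2 \<Rightarrow> real) \<Rightarrow> bool" where
  "locally_integrable f \<longleftrightarrow> (\<forall>K. compact K \<longrightarrow> set_integrable lborel K f)"

definition is_weak_partial :: "2 \<Rightarrow> (real^2 \<Rightarrow> real) \<Rightarrow> (real^2 \<Rightarrow> real) \<Rightarrow> bool" where
  "is_weak_partial k f g \<longleftrightarrow> locally_integrable f \<and> locally_integrable g \<and>
     (\<forall>\<psi>. test_function \<psi> \<longrightarrow>
        (LINT x|lborel. f x * partial_derivative k \<psi> x) = - (LINT x|lborel. g x * \<psi> x))"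

definition weakly_differentiable :: "(real^2 \<Rightarrow> real) \<Rightarrow> bool" where
  "weakly_differentiable f \<longleftrightarrow> (\<forall>k. \<exists>g. is_weak_partial k f g)"

text \<open>Meaningful (and then unique almost everywhere) only if the weak derivative exists.\<close>

definition weak_partial :: "2 \<Rightarrow> (real^2 \<Rightarrow> real) \<Rightarrow> real^2 \<Rightarrow> real" where
  "weak_partial k f = (SOME g. is_weak_partial k f g)"

definition gradient :: "(real^2 \<Rightarrow> real) \<Rightarrow> real^2 \<Rightarrow> real^2" where
  "gradient p x = (\<chi> k. weak_partial k p x)"

text \<open>Convention: the entry \<open>(i, j)\<close> of the velocity gradient is \<open>\<partial>\<^sub>j u\<^sub>i\<close>.\<close>

definition velocity_gradient :: "(real^2 \<Rightarrow> real^2) \<Rightarrow> real^2 \<Rightarrow> real^2^2" where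
  "velocity_gradient u x = (\<chi> i j. weak_partial j (\<lambda>y. u y $ i) x)"

definition divergence :: "(real^2 \<Rightarrow> real^2) \<Rightarrow> real^2 \<Rightarrow> real" where
  "divergence u x = (\<Sum>i\<in>UNIV. weak_partial i (\<lambda>y. u y $ i) x)"

definition curl :: "(real^2 \<Rightarrow> real^2) \<Rightarrow> real^2 \<Rightarrow> real" where
  "curl u x = weak_partial 1 (\<lambda>y. u y $ 2) x - weak_partial 2 (\<lambda>y. u y $ 1) x"

definition tensor_divergence :: "(real^2 \<Rightarrow> real^2^2) \<Rightarrow> real^2 \<Rightarrow> real^2" where
  "tensor_divergence \<tau> x = (\<chi> i. \<Sum>j\<in>UNIV. weak_partial j (\<lambda>y. \<tau> y $ i $ j) x)"

definition tensor_laplacian :: "(real^2 \<Rightarrow> real^2^2) \<Rightarrow> real^2 \<Rightarrow> real^2^2" where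
  "tensor_laplacian \<tau> x =
     (\<chi> i j. \<Sum>k\<in>UNIV. weak_partial k (weak_partial k (\<lambda>y. \<tau> y $ i $ j)) x)"

definition velocity_convection :: "(real^2 \<Rightarrow> real^2) \<Rightarrow> (real^2 \<Rightarrow> real^2) \<Rightarrow> real^2 \<Rightarrow> real^2" where
  "velocity_convection u v x = (\<chi> i. \<Sum>k\<in>UNIV. u x $ k * weak_partial k (\<lambda>y. v y $ i) x)"

definition tensor_convection :: "(real^2 \<Rightarrow> real^2) \<Rightarrow> (real^2 \<Rightarrow> real^2^2) \<Rightarrow> real^2 \<Rightarrow> real^2^2" where
  "tensor_convection u \<tau> x = (\<chi> i j. \<Sum>k\<in>UNIV. u x $ k * weak_partial k (\<lambda>y. \<tau> y $ i $ j) x)"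

subsection \<open>Fourier transform and Sobolev spaces\<close>

definition square_integrable :: "(real^2 \<Rightarrow> 'b::euclidean_space) \<Rightarrow> bool" where
  "square_integrable f \<longleftrightarrow>
     f \<in> borel_measurable lborel \<and> integrable lborel (\<lambda>x. (norm (f x))\<^sup>2)"

definition l2_norm :: "(real^2 \<Rightarrow> 'b::euclidean_space) \<Rightarrow> real" where
  "l2_norm f = sqrt (LINT x|lborel. (norm (f x))\<^sup>2)"

text \<open>
  Plancherel's definition: the \<open>L\<^sup>2\<close> limit, as \<open>R\<close> tends to infinity, of the integrals of
  \<open>exp (-i x \<cdot> \<xi>) f(x)\<close> over the ball of radius \<open>R\<close>.
\<close>

definition fourier :: "(real^2 \<Rightarrow> real) \<Rightarrow> real^2 \<Rightarrow> complex" where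
  "fourier f = (SOME g. square_integrable g \<and>
     ((\<lambda>R. \<integral>\<^sup>+\<xi>. ennreal ((cmod ((LINT x:cball 0 R|lborel. cis (- (x \<bullet> \<xi>)) * of_real (f x)) - g \<xi>))\<^sup>2)
        \<partial>lborel) \<longlongrightarrow> 0) at_top)"

text \<open>The following is the usual space for \<open>s \<ge> 0\<close> only, where it is contained in \<open>L\<^sup>2\<close>.\<close>

definition in_sobolev :: "real \<Rightarrow> (real^2 \<Rightarrow> 'b::euclidean_space) \<Rightarrow> bool" where
  "in_sobolev s f \<longleftrightarrow> square_integrable f \<and>
     (\<forall>e\<in>Basis. integrable lborel
        (\<lambda>\<xi>. (1 + (norm \<xi>)\<^sup>2) powr s * (cmod (fourier (\<lambda>x. f x \<bullet> e) \<xi>))\<^sup>2))"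

text \<open>The factor \<open>(2\<pi>)\<^sup>-\<^sup>2\<close> makes the norm of order zero the \<open>L\<^sup>2\<close> norm.\<close>

definition sobolev_norm :: "real \<Rightarrow> (real^2 \<Rightarrow> 'b::euclidean_space) \<Rightarrow> real" where
  "sobolev_norm s f = sqrt (\<Sum>e\<in>Basis. (1 / (2 * pi)\<^sup>2) *
     (LINT \<xi>|lborel. (1 + (norm \<xi>)\<^sup>2) powr s * (cmod (fourier (\<lambda>x. f x \<bullet> e) \<xi>))\<^sup>2))"

text \<open>Curves in \<open>C([0,\<infinity>); H\<^sup>s)\<close>; values at negative times play no role.\<close>

definition continuous_in_sobolev :: "real \<Rightarrow> (real \<Rightarrow> real^2 \<Rightarrow> 'b::euclidean_space) \<Rightarrow> bool" where
  "continuous_in_sobolev s w \<longleftrightarrow>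
     (\<forall>t\<ge>0. in_sobolev s (w t) \<and>
        ((\<lambda>r. sobolev_norm s (\<lambda>x. w r x - w t x)) \<longlongrightarrow> 0) (at t within {0..}))"

text \<open>The time derivative is the limit of the difference quotients in \<open>L\<^sup>2\<close>, one-sided at time \<open>0\<close>.\<close>

definition has_time_derivative ::
    "(real \<Rightarrow> real^2 \<Rightarrow> 'b::euclidean_space) \<Rightarrow> (real^2 \<Rightarrow> 'b) \<Rightarrow> real \<Rightarrow> bool" where
  "has_time_derivative w v t \<longleftrightarrow>
     (\<forall>r\<ge>0. square_integrable (w r)) \<and> square_integrable v \<and>
     ((\<lambda>r. l2_norm (\<lambda>x. (1 / (r - t)) *\<^sub>R (w r x - w t x) - v x)) \<longlongrightarrow> 0) (at t within {0..})"

subsection \<open>Littlewood--Paley blocks and the Besov norm\<close>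

definition littlewood_paley :: "(real^2 \<Rightarrow> real) \<Rightarrow> (real^2 \<Rightarrow> real) \<Rightarrow> bool" where
  "littlewood_paley \<theta> \<phi> \<longleftrightarrow> smooth \<theta> \<and> smooth \<phi> \<and>
     (\<forall>\<xi> \<eta>. norm \<xi> = norm \<eta> \<longrightarrow> \<theta> \<xi> = \<theta> \<eta> \<and> \<phi> \<xi> = \<phi> \<eta>) \<and>
     (\<forall>\<xi>. \<theta> \<xi> \<in> {0..1} \<and> \<phi> \<xi> \<in> {0..1}) \<and>
     (\<forall>\<xi>. \<theta> \<xi> \<noteq> 0 \<longrightarrow> norm \<xi> \<le> 4/3) \<and>
     (\<forall>\<xi>. \<phi> \<xi> \<noteq> 0 \<longrightarrow> 3/4 \<le> norm \<xi> \<and> norm \<xi> \<le> 8/3) \<and>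
     (\<forall>\<xi>. (\<lambda>j. \<phi> ((1/2)^j *\<^sub>R \<xi>)) sums (1 - \<theta> \<xi>))"

definition lp_symbol :: "(real^2 \<Rightarrow> real) \<Rightarrow> (real^2 \<Rightarrow> real) \<Rightarrow> int \<Rightarrow> real^2 \<Rightarrow> real" where
  "lp_symbol \<theta> \<phi> j \<xi> = (if j = -1 then \<theta> \<xi> else \<phi> ((2 powi (-j)) *\<^sub>R \<xi>))"

text \<open>
  The block is the inverse Fourier transform of symbol times \<^term>\<open>fourier f\<close>, for \<open>f\<close> in \<open>L\<^sup>2\<close>.
  The integrand is integrable because the symbol has compact support, and the integral is real
  because the symbol is real and even; \<^const>\<open>Re\<close> only adjusts the type.
\<close>

definition lp_block ::
    "(real^2 \<Rightarrow> real) \<Rightarrow> (real^2 \<Rightarrow> real) \<Rightarrow> int \<Rightarrow> (real^2 \<Rightarrow> 'b::euclidean_space) \<Rightarrow> real^2 \<Rightarrow> 'b" where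
  "lp_block \<theta> \<phi> j f x = (\<Sum>e\<in>Basis. Re ((1 / (2 * pi)\<^sup>2) *
     (LINT \<xi>|lborel. cis (x \<bullet> \<xi>) * of_real (lp_symbol \<theta> \<phi> j \<xi>) * fourier (\<lambda>y. f y \<bullet> e) \<xi>)) *\<^sub>R e)"

definition besov_norm_0_inf_1 ::
    "(real^2 \<Rightarrow> real) \<Rightarrow> (real^2 \<Rightarrow> real) \<Rightarrow> (real^2 \<Rightarrow> 'b::euclidean_space) \<Rightarrow> ennreal" where
  "besov_norm_0_inf_1 \<theta> \<phi> f =
     (\<Sum>\<^sub>\<infinity>j\<in>{-1..}. esssup lborel (\<lambda>x. ennreal (norm (lp_block \<theta> \<phi> j f x))))"

subsection \<open>The inviscid Oldroyd-B system\<close>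

definition sym_part :: "real^2^2 \<Rightarrow> real^2^2" where
  "sym_part G = (1/2) *\<^sub>R (G + transpose G)"

definition skew_part :: "real^2^2 \<Rightarrow> real^2^2" where
  "skew_part G = (1/2) *\<^sub>R (G - transpose G)"

definition Q_term :: "real \<Rightarrow> real^2^2 \<Rightarrow> real^2^2 \<Rightarrow> real^2^2" where
  "Q_term b G T = T ** skew_part G - skew_part G ** T
     + b *\<^sub>R (sym_part G ** T + T ** sym_part G)"

definition oldroyd_b_solution ::
    "real \<Rightarrow> (real^2 \<Rightarrow> real^2) \<Rightarrow> (real^2 \<Rightarrow> real^2^2) \<Rightarrow>
     (real \<Rightarrow> real^2 \<Rightarrow> real^2) \<Rightarrow> (real \<Rightarrow> real^2 \<Rightarrow> real^2^2) \<Rightarrow> bool" where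
  "oldroyd_b_solution s u0 \<tau>0 u \<tau> \<longleftrightarrow>
     continuous_in_sobolev s (\<lambda>t x. (u t x, \<tau> t x)) \<and>
     (AE x in lborel. u 0 x = u0 x \<and> \<tau> 0 x = \<tau>0 x) \<and>
     (\<exists>P u_t \<tau>_t. \<forall>t\<ge>0.
        weakly_differentiable (P t) \<and>
        has_time_derivative u (u_t t) t \<and>
        has_time_derivative \<tau> (\<tau>_t t) t \<and>
        (AE x in lborel.
           transpose (\<tau> t x) = \<tau> t x \<and>
           divergence (u t) x = 0 \<and>
           u_t t x + velocity_convection (u t) (u t) x + gradient (P t) x
             = tensor_divergence (\<tau> t) x \<and>
           \<tau>_t t x + tensor_convection (u t) (\<tau> t) x + \<tau> t x
               + Q_term 1 (velocity_gradient (u t) x) (\<tau> t x)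
             = sym_part (velocity_gradient (u t) x) + tensor_laplacian (\<tau> t) x))"

subsection \<open>Initial data and the smallness constant\<close>

definition admissible_data :: "real \<Rightarrow> (real^2 \<Rightarrow> real^2) \<Rightarrow> (real^2 \<Rightarrow> real^2^2) \<Rightarrow> bool" where
  "admissible_data s u0 \<tau>0 \<longleftrightarrow>
     in_sobolev s (\<lambda>x. (u0 x, \<tau>0 x)) \<and>
     (AE x in lborel. divergence u0 x = 0 \<and> transpose (\<tau>0 x) = \<tau>0 x)"

definition small_data ::
    "(real^2 \<Rightarrow> real) \<Rightarrow> (real^2 \<Rightarrow> real) \<Rightarrow> real \<Rightarrow>
     (real^2 \<Rightarrow> real^2) \<Rightarrow> (real^2 \<Rightarrow> real^2^2) \<Rightarrow> bool" where
  "small_data \<theta> \<phi> \<delta> u0 \<tau>0 \<longleftrightarrow>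
     ennreal (sobolev_norm 1 (\<lambda>x. (u0 x, \<tau>0 x)))
       + besov_norm_0_inf_1 \<theta> \<phi> (\<lambda>x. (curl u0 x, \<tau>0 x)) \<le> ennreal \<delta>"

definition equivalent_H1_norm :: "((real^2 \<Rightarrow> (real^2) \<times> (real^2^2)) \<Rightarrow> real) \<Rightarrow> bool" where
  "equivalent_H1_norm N \<longleftrightarrow>
     (\<forall>f g. in_sobolev 1 f \<longrightarrow> in_sobolev 1 g \<longrightarrow> N (\<lambda>x. f x + g x) \<le> N f + N g) \<and>
     (\<forall>c f. in_sobolev 1 f \<longrightarrow> N (\<lambda>x. c *\<^sub>R f x) = \<bar>c\<bar> * N f) \<and>
     (\<exists>a>0. \<exists>A>0. \<forall>f. in_sobolev 1 f \<longrightarrow>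
        a * sobolev_norm 1 f \<le> N f \<and> N f \<le> A * sobolev_norm 1 f)"

text \<open>
  The property of \<open>\<delta>\<close> provided by the theorem of Elgindi and Rousset: every admissible datum of
  size at most \<open>\<delta>\<close> launches a unique global solution in \<open>C([0,\<infinity>); H\<^sup>s)\<close>, and it satisfies
  \<open>d/dt \<parallel>(u,\<tau>)\<parallel>\<^sup>2 + \<parallel>\<nabla>u\<parallel>\<^sup>2 + \<parallel>\<tau>\<parallel>\<^sup>2 \<le> 0\<close> (in \<open>H\<^sup>1\<close>, \<open>L\<^sup>2\<close> and \<open>H\<^sup>2\<close> respectively).  The first norm is an
  equivalent norm \<open>N\<close> of \<open>H\<^sup>1\<close>, the same for all data.
\<close>

definition elgindi_rousset_constant ::
    "(real^2 \<Rightarrow> real) \<Rightarrow> (real^2 \<Rightarrow> real) \<Rightarrow> real \<Rightarrow> real \<Rightarrow> bool" where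
  "elgindi_rousset_constant \<theta> \<phi> s \<delta> \<longleftrightarrow> 0 < \<delta> \<and>
     (\<exists>N. equivalent_H1_norm N \<and>
       (\<forall>u0 \<tau>0. admissible_data s u0 \<tau>0 \<longrightarrow> small_data \<theta> \<phi> \<delta> u0 \<tau>0 \<longrightarrow>
          (\<exists>u \<tau>. oldroyd_b_solution s u0 \<tau>0 u \<tau>) \<and>
          (\<forall>u \<tau> v \<sigma>. oldroyd_b_solution s u0 \<tau>0 u \<tau> \<longrightarrow> oldroyd_b_solution s u0 \<tau>0 v \<sigma> \<longrightarrow>
             (\<forall>t\<ge>0. AE x in lborel. u t x = v t x \<and> \<tau> t x = \<sigma> t x)) \<and>
          (\<forall>u \<tau>. oldroyd_b_solution s u0 \<tau>0 u \<tau> \<longrightarrow>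
             (\<forall>t>0. \<exists>E'.
                ((\<lambda>r. (N (\<lambda>x. (u r x, \<tau> r x)))\<^sup>2) has_real_derivative E') (at t) \<and>
                E' + (l2_norm (velocity_gradient (u t)))\<^sup>2 + (sobolev_norm 2 (\<tau> t))\<^sup>2 \<le> 0))))"

end

(*
Fourier splitting.  By Plancherel and the dissipation inequality, E = N(u, \<tau>)^2 satisfies
E' + c R^2 E <= C R^2 Y_R for 0 < R <= 1, where Y_R is the energy of (u, \<tau>) at frequencies below R.
In the equation for Y_R the coupling terms div \<tau> and D(u) cancel, the pressure drops out, and the
quadratic terms have Fourier transforms bounded by their L^1 norms, that is by a multiple of
sqrt(E |E'|).  Since the data are integrable, sqrt(Y_R(t)) <= C R (1 + int_0^t sqrt(E |E'|)).
Choosing R^2 proportional to 1/(1 + t) gives (1 + t) E(t) <= K (1 + int_0^t sqrt(E |E'|))^2.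
As |E'| is integrable, its tail is small; absorbing it yields E = O((1 + t)^(-3/4)), and then
sqrt(E |E'|) <= ((1 + t)^(-1/2) E + (1 + t)^(1/2) |E'|) / 2 is integrable in time, so that
E = O(1 / (1 + t)).  The divergence form of the transport terms is never used.
*)
theory Submission
  imports Defs "HOL-Probability.Characteristic_Functions"
begin

section \<open>Square integrable fields\<close>

text \<open>The bound (1 + t) E <= K (1 + int sqrt(E |E'|))^2 is critical: if E = O((1 + t)^(-a))
  with 0 < a < 1, Cauchy-Schwarz in time returns exactly the exponent a, multiplied by the tail of
  int |E'|. The gain has to come from the smallness of that tail, not from iterating exponents. Any
  a strictly between 1/2 and 1 could serve as intermediate rate: above 1/2 both (1 + t)^(-1/2) E
  and, after integration by parts, (1 + t)^(1/2) |E'| are integrable. The final rate is the area of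
  a disc in the plane: bounded transforms carry energy O(R^2) below R, and R^2 is of order 1 / (1 +
  t). The analytic obstacle is the pressure, known only as a weakly differentiable function whose
  gradient is an L2 field minus an L1 field. It enters through being curl free, hence parallel to
  the frequency and orthogonal to the transform of a divergence-free velocity. The Fourier transform
  is a chosen L2 limit, so identities in frequency hold almost everywhere and are reached by
  approximation in L1 and L2.\<close>

lemma square_integrable_measurable [measurable_dest]:
  "square_integrable f \<Longrightarrow> f \<in> borel_measurable lborel"
  by (simp add: square_integrable_def)

lemma square_integrable_integrable:
  "square_integrable f \<Longrightarrow> integrable lborel (\<lambda>x. (norm (f x))\<^sup>2)"
  by (simp add: square_integrable_def)

lemma square_integrable_bound:
  fixes f :: "real^2 \<Rightarrow> 'b::euclidean_space" and g :: "real^2 \<Rightarrow> 'c::euclidean_space"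
  assumes g: "square_integrable g" and f: "f \<in> borel_measurable lborel"
    and le: "AE x in lborel. norm (f x) \<le> c * norm (g x)"
  shows "square_integrable f"
  unfolding square_integrable_def
proof (intro conjI f)
  show "integrable lborel (\<lambda>x. (norm (f x))\<^sup>2)"
  proof (rule Bochner_Integration.integrable_bound)
    show "integrable lborel (\<lambda>x. c\<^sup>2 * (norm (g x))\<^sup>2)"
      using g by (simp add: square_integrable_def)
    show "(\<lambda>x. (norm (f x))\<^sup>2) \<in> borel_measurable lborel" using f by measurable
    show "AE x in lborel. norm ((norm (f x))\<^sup>2) \<le> norm (c\<^sup>2 * (norm (g x))\<^sup>2)"
      using le by eventually_elim (auto simp: power_mult_distrib[symmetric] intro!: power_mono)
  qed
qed

lemma square_integrable_zero [simp]: "square_integrable (\<lambda>x. 0)"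
  by (simp add: square_integrable_def)

lemma norm_add_power2_le: "(norm (a + b :: 'b::real_normed_vector))\<^sup>2 \<le> 2 * (norm a)\<^sup>2 + 2 * (norm b)\<^sup>2"
proof -
  have "(norm (a + b))\<^sup>2 \<le> (norm a + norm b)\<^sup>2" by (intro power_mono norm_triangle_ineq) auto
  also have "\<dots> \<le> 2 * (norm a)\<^sup>2 + 2 * (norm b)\<^sup>2"
    using zero_le_power2[of "norm a - norm b"] by (simp add: power2_eq_square algebra_simps)
  finally show ?thesis .
qed

lemma square_integrable_add [intro]:
  assumes "square_integrable f" "square_integrable g"
  shows "square_integrable (\<lambda>x. f x + g x)"
  unfolding square_integrable_def
proof (intro conjI)
  note [measurable] = assms[THEN square_integrable_measurable]
  show "(\<lambda>x. f x + g x) \<in> borel_measurable lborel" by measurable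
  show "integrable lborel (\<lambda>x. (norm (f x + g x))\<^sup>2)"
  proof (rule Bochner_Integration.integrable_bound)
    show "integrable lborel (\<lambda>x. 2 * (norm (f x))\<^sup>2 + 2 * (norm (g x))\<^sup>2)"
      using assms by (simp add: square_integrable_def)
  qed (use norm_add_power2_le in \<open>auto simp: abs_le_iff\<close>)
qed

lemma square_integrable_scaleR [intro]:
  assumes "square_integrable f" shows "square_integrable (\<lambda>x. c *\<^sub>R f x)"
  using assms by (intro square_integrable_bound[OF assms, where c="\<bar>c\<bar>"]) (auto simp: square_integrable_def)

lemma square_integrable_uminus [intro]:
  assumes "square_integrable f" shows "square_integrable (\<lambda>x. - f x)"
  using square_integrable_scaleR[OF assms, of "-1"] by simp

lemma square_integrable_diff [intro]:
  assumes "square_integrable f" "square_integrable g"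
  shows "square_integrable (\<lambda>x. f x - g x)"
  using square_integrable_add[OF assms(1) square_integrable_uminus[OF assms(2)]] by simp

lemma square_integrable_inner [intro]:
  fixes f :: "real^2 \<Rightarrow> 'b::euclidean_space"
  assumes "square_integrable f" shows "square_integrable (\<lambda>x. f x \<bullet> e)"
  using assms Cauchy_Schwarz_ineq2[of _ e]
  by (intro square_integrable_bound[OF assms, where c="norm e"])
     (auto simp: square_integrable_def mult.commute[of "norm e"])

lemma square_integrable_cmult_bounded:
  fixes f :: "real^2 \<Rightarrow> 'b::{euclidean_space,real_normed_field}"
  assumes "square_integrable f" and [measurable]: "m \<in> borel_measurable borel"
    and "\<And>x. norm (m x) \<le> c"
  shows "square_integrable (\<lambda>x. m x * f x)"
  using assms
  by (intro square_integrable_bound[OF assms(1), where c=c])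
     (auto simp: square_integrable_def norm_mult intro!: mult_right_mono)

lemma l2_norm_nonneg [simp]: "0 \<le> l2_norm f"
  by (simp add: l2_norm_def)

lemma l2_norm_power2: "(l2_norm f)\<^sup>2 = (LINT x|lborel. (norm (f x))\<^sup>2)"
  by (simp add: l2_norm_def)

lemma nn_integral_l2_norm:
  "square_integrable f \<Longrightarrow> (\<integral>\<^sup>+x. ennreal ((norm (f x))\<^sup>2) \<partial>lborel) = ennreal ((l2_norm f)\<^sup>2)"
  unfolding l2_norm_power2 by (rule nn_integral_eq_integral) (auto simp: square_integrable_def)

lemma square_integrableI_nn:
  assumes "f \<in> borel_measurable lborel" "(\<integral>\<^sup>+x. ennreal ((norm (f x))\<^sup>2) \<partial>lborel) \<le> ennreal (c\<^sup>2)" "0 \<le> c"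
  shows "square_integrable f" "l2_norm f \<le> c"
proof -
  show sq: "square_integrable f"
    unfolding square_integrable_def
    by (intro conjI assms integrableI_bounded)
       (use assms in \<open>auto intro: order_le_less_trans\<close>)
  have "ennreal ((l2_norm f)\<^sup>2) \<le> ennreal (c\<^sup>2)" using assms(2) nn_integral_l2_norm[OF sq] by simp
  hence "(l2_norm f)\<^sup>2 \<le> c\<^sup>2" by simp
  thus "l2_norm f \<le> c" using assms(3) by (simp add: power2_le_iff_abs_le)
qed

lemma l2_norm_cong_AE:
  assumes "square_integrable f" "square_integrable g" "AE x in lborel. f x = g x"
  shows "l2_norm f = l2_norm g"
proof -
  note [measurable] = assms(1,2)[THEN square_integrable_measurable]
  have "(LINT x|lborel. (norm (f x))\<^sup>2) = (LINT x|lborel. (norm (g x))\<^sup>2)"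
    by (rule integral_cong_AE) (use assms(3) in auto)
  thus ?thesis by (simp add: l2_norm_def)
qed

lemma l2_norm_mono_AE:
  fixes f :: "real^2 \<Rightarrow> 'b::euclidean_space" and g :: "real^2 \<Rightarrow> 'c::euclidean_space"
  assumes "square_integrable g" "f \<in> borel_measurable lborel"
    "AE x in lborel. norm (f x) \<le> norm (g x)"
  shows "l2_norm f \<le> l2_norm g"
proof -
  have "square_integrable f" by (rule square_integrable_bound[OF assms(1,2), where c=1]) (use assms in auto)
  hence "(LINT x|lborel. (norm (f x))\<^sup>2) \<le> (LINT x|lborel. (norm (g x))\<^sup>2)"
    by (intro integral_mono_AE) (use assms in \<open>auto simp: square_integrable_def intro: power_mono\<close>)
  thus ?thesis by (simp add: l2_norm_def)
qed

lemma l2_norm_scaleR: "l2_norm (\<lambda>x. c *\<^sub>R f x) = \<bar>c\<bar> * l2_norm f"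
  by (simp add: l2_norm_def power_mult_distrib real_sqrt_mult)

lemma l2_norm_minus_commute: "l2_norm (\<lambda>x. f x - g x) = l2_norm (\<lambda>x. g x - f x)"
  by (simp add: l2_norm_def norm_minus_commute)

lemma l2_norm_eq_0_iff:
  assumes "square_integrable f" shows "l2_norm f = 0 \<longleftrightarrow> (AE x in lborel. f x = 0)"
proof -
  have "l2_norm f = 0 \<longleftrightarrow> (LINT x|lborel. (norm (f x))\<^sup>2) = 0" by (simp add: l2_norm_def)
  also have "\<dots> \<longleftrightarrow> (AE x in lborel. (norm (f x))\<^sup>2 = 0)"
    using assms by (intro integral_nonneg_eq_0_iff_AE) (auto simp: square_integrable_def)
  finally show ?thesis by simp
qed

lemma integrable_norm_mult:
  fixes f :: "real^2 \<Rightarrow> 'b::euclidean_space" and g :: "real^2 \<Rightarrow> 'c::euclidean_space"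
  assumes "square_integrable f" "square_integrable g"
  shows "integrable lborel (\<lambda>x. norm (f x) * norm (g x))"
proof (rule Bochner_Integration.integrable_bound)
  note [measurable] = assms[THEN square_integrable_measurable]
  show "integrable lborel (\<lambda>x. (norm (f x))\<^sup>2 + (norm (g x))\<^sup>2)"
    using assms by (simp add: square_integrable_def)
  show "(\<lambda>x. norm (f x) * norm (g x)) \<in> borel_measurable lborel" by measurable
  have "a * b \<le> a\<^sup>2 + b\<^sup>2" if "a \<ge> 0" "b \<ge> 0" for a b :: real
  proof -
    have "2 * (a * b) \<le> a\<^sup>2 + b\<^sup>2" using zero_le_power2[of "a - b"] by (simp add: power2_eq_square algebra_simps)
    moreover have "0 \<le> a * b" using that by simp
    ultimately show ?thesis by linarith
  qed
  thus "AE x in lborel. norm (norm (f x) * norm (g x)) \<le> norm ((norm (f x))\<^sup>2 + (norm (g x))\<^sup>2)"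
    by simp
qed

lemma integral_norm_mult_le:
  fixes f :: "real^2 \<Rightarrow> 'b::euclidean_space" and g :: "real^2 \<Rightarrow> 'c::euclidean_space"
  assumes f: "square_integrable f" and g: "square_integrable g"
  shows "(LINT x|lborel. norm (f x) * norm (g x)) \<le> l2_norm f * l2_norm g"
proof (cases "l2_norm f = 0")
  case True
  note [measurable] = assms[THEN square_integrable_measurable]
  have "(LINT x|lborel. norm (f x) * norm (g x)) = (LINT x::real^2|lborel. 0)"
    by (rule integral_cong_AE) (use True l2_norm_eq_0_iff[OF f] in auto)
  thus ?thesis using True by simp
next
  case False
  define A where "A = (l2_norm f)\<^sup>2"
  define B where "B = (LINT x|lborel. norm (f x) * norm (g x))"
  define C where "C = (l2_norm g)\<^sup>2"
  have A: "A > 0" using False by (simp add: A_def)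
  note i = integrable_norm_mult[OF f g] square_integrable_integrable[OF f] square_integrable_integrable[OF g]
  have B0: "B \<ge> 0" unfolding B_def by (rule integral_nonneg_AE) auto
  \<comment> \<open>The minimiser of the nonnegative quadratic s^2 A - 2 s B + C in s; nonnegativity
    of its least value is B^2 <= A C.\<close>
  define t where "t = B / A"
  have "0 \<le> (LINT x|lborel. (t * norm (f x) - norm (g x))\<^sup>2)" by simp
  also have "\<dots> = (LINT x|lborel. t\<^sup>2 * (norm (f x))\<^sup>2 - 2 * t * (norm (f x) * norm (g x)) + (norm (g x))\<^sup>2)"
    by (simp add: power2_eq_square algebra_simps)
  also have "\<dots> = t\<^sup>2 * A - 2 * t * B + C"
    using i by (simp add: A_def B_def C_def l2_norm_power2)
  also have "\<dots> = C - B\<^sup>2 / A" using A by (simp add: t_def power2_eq_square field_simps)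
  finally have "B\<^sup>2 \<le> A * C" using A by (simp add: field_simps)
  hence "B\<^sup>2 \<le> (l2_norm f * l2_norm g)\<^sup>2" by (simp add: A_def C_def power_mult_distrib)
  hence "B \<le> l2_norm f * l2_norm g" by (rule power2_le_imp_le) simp
  thus ?thesis by (simp add: B_def)
qed

lemma l2_norm_triangle:
  assumes f: "square_integrable f" and g: "square_integrable g"
  shows "l2_norm (\<lambda>x. f x + g x) \<le> l2_norm f + l2_norm g"
proof (rule power2_le_imp_le)
  note i = integrable_norm_mult[OF f g] square_integrable_integrable[OF f] square_integrable_integrable[OF g]
  have "(l2_norm (\<lambda>x. f x + g x))\<^sup>2 = (LINT x|lborel. (norm (f x + g x))\<^sup>2)" by (rule l2_norm_power2)
  also have "\<dots> \<le> (LINT x|lborel. (norm (f x))\<^sup>2 + 2 * (norm (f x) * norm (g x)) + (norm (g x))\<^sup>2)"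
  proof (rule integral_mono)
    fix x
    have "(norm (f x + g x))\<^sup>2 \<le> (norm (f x) + norm (g x))\<^sup>2" by (intro power_mono norm_triangle_ineq) auto
    thus "(norm (f x + g x))\<^sup>2 \<le> (norm (f x))\<^sup>2 + 2 * (norm (f x) * norm (g x)) + (norm (g x))\<^sup>2"
      by (simp add: power2_eq_square algebra_simps)
  qed (use i square_integrable_add[OF f g] in \<open>auto simp: square_integrable_def\<close>)
  also have "\<dots> = (l2_norm f)\<^sup>2 + 2 * (LINT x|lborel. norm (f x) * norm (g x)) + (l2_norm g)\<^sup>2"
    using i by (simp add: l2_norm_power2)
  also have "\<dots> \<le> (l2_norm f)\<^sup>2 + 2 * (l2_norm f * l2_norm g) + (l2_norm g)\<^sup>2"
    using integral_norm_mult_le[OF f g] by simp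
  finally show "(l2_norm (\<lambda>x. f x + g x))\<^sup>2 \<le> (l2_norm f + l2_norm g)\<^sup>2"
    by (simp add: power2_eq_square algebra_simps)
qed simp

lemma l2_norm_triangle3:
  assumes "square_integrable f" "square_integrable g" "square_integrable h"
  shows "l2_norm (\<lambda>x. f x - h x) \<le> l2_norm (\<lambda>x. f x - g x) + l2_norm (\<lambda>x. g x - h x)"
  using l2_norm_triangle[OF square_integrable_diff[OF assms(1,2)] square_integrable_diff[OF assms(2,3)]]
  by simp

lemma l2_norm_triangle_diff:
  assumes "square_integrable f" "square_integrable g"
  shows "\<bar>l2_norm f - l2_norm g\<bar> \<le> l2_norm (\<lambda>x. f x - g x)"
  using l2_norm_triangle3[of f g "\<lambda>x. 0"] l2_norm_triangle3[of g f "\<lambda>x. 0"] assms l2_norm_minus_commute[of f g]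
  by simp

lemma tendsto_l2_norm:
  assumes "\<And>n. square_integrable (f n)" "square_integrable g"
    and "((\<lambda>n. l2_norm (\<lambda>x. f n x - g x)) \<longlongrightarrow> 0) F"
  shows "((\<lambda>n. l2_norm (f n)) \<longlongrightarrow> l2_norm g) F"
proof -
  have "((\<lambda>n. l2_norm (f n) - l2_norm g) \<longlongrightarrow> 0) F"
    by (rule Lim_null_comparison[OF always_eventually assms(3)])
       (use l2_norm_triangle_diff[OF assms(1,2)] in auto)
  thus ?thesis by (simp add: LIM_zero_iff)
qed

lemma AE_eq_if_l2_limit:
  assumes "\<And>n. square_integrable (f n)" "square_integrable g" "square_integrable h" "F \<noteq> bot"
    and "((\<lambda>n. l2_norm (\<lambda>x. f n x - g x)) \<longlongrightarrow> 0) F"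
    and "((\<lambda>n. l2_norm (\<lambda>x. f n x - h x)) \<longlongrightarrow> 0) F"
  shows "AE x in lborel. g x = h x"
proof -
  have "((\<lambda>n. l2_norm (\<lambda>x. f n x - g x) + l2_norm (\<lambda>x. f n x - h x)) \<longlongrightarrow> 0 + 0) F"
    by (intro tendsto_add assms)
  moreover have "l2_norm (\<lambda>x. g x - h x) \<le> l2_norm (\<lambda>x. f n x - g x) + l2_norm (\<lambda>x. f n x - h x)" for n
    using l2_norm_triangle3[OF assms(2,1,3), of n] l2_norm_minus_commute[of g "f n"] by simp
  ultimately have "l2_norm (\<lambda>x. g x - h x) \<le> 0 + 0"
    by (intro tendsto_lowerbound[OF _ always_eventually \<open>F \<noteq> bot\<close>]) auto
  hence "l2_norm (\<lambda>x. g x - h x) = 0" by (simp add: antisym)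
  thus ?thesis using l2_norm_eq_0_iff[OF square_integrable_diff[OF assms(2,3)]] by simp
qed

text \<open>One subsequence has to serve all indices at once, so the subsequence theorem for L1 is
  applied to the sum of the squared errors. \<open>fourier_curl_free\<close> needs this for four
  sequences at the same frequency.\<close>

lemma AE_subsequence_l2_limit:
  assumes "finite I" "\<And>i n. i \<in> I \<Longrightarrow> square_integrable (f i n)" "\<And>i. i \<in> I \<Longrightarrow> square_integrable (g i)"
    and "\<And>i. i \<in> I \<Longrightarrow> (\<lambda>n. l2_norm (\<lambda>x. f i n x - g i x)) \<longlonglongrightarrow> 0"
  obtains r :: "nat \<Rightarrow> nat" where "strict_mono r"
    "AE x in lborel. \<forall>i\<in>I. (\<lambda>n. f i (r n) x) \<longlonglongrightarrow> g i x"
proof -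
  define s where "s n x = (\<Sum>i\<in>I. (norm (f i n x - g i x))\<^sup>2)" for n x
  have i: "integrable lborel (\<lambda>x. (norm (f i n x - g i x))\<^sup>2)" if "i \<in> I" for i n
    using assms(2,3)[OF that] by (intro square_integrable_integrable square_integrable_diff)
  have int_s: "integrable lborel (s n)" for n
    unfolding s_def using i by (intro Bochner_Integration.integrable_sum)
  have "(\<lambda>n. \<Sum>i\<in>I. (l2_norm (\<lambda>x. f i n x - g i x))\<^sup>2) \<longlonglongrightarrow> (\<Sum>i\<in>I. 0\<^sup>2)"
    by (intro tendsto_sum tendsto_power assms)
  moreover have "(LINT x|lborel. norm (s n x)) = (\<Sum>i\<in>I. (l2_norm (\<lambda>x. f i n x - g i x))\<^sup>2)" for n
    using i by (simp add: s_def l2_norm_power2 sum_nonneg)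
  ultimately have "(\<lambda>n. LINT x|lborel. norm (s n x)) \<longlonglongrightarrow> 0" by simp
  from tendsto_L1_AE_subseq[OF int_s this] obtain r :: "nat \<Rightarrow> nat" where
    r: "strict_mono r" "AE x in lborel. (\<lambda>n. s (r n) x) \<longlonglongrightarrow> 0" by blast
  have "AE x in lborel. \<forall>i\<in>I. (\<lambda>n. f i (r n) x) \<longlonglongrightarrow> g i x"
    using r(2)
  proof eventually_elim
    case (elim x)
    show ?case
    proof
      fix i assume i: "i \<in> I"
      have "(\<lambda>n. (norm (f i (r n) x - g i x))\<^sup>2) \<longlonglongrightarrow> 0"
        by (rule tendsto_sandwich[OF _ _ tendsto_const elim])
           (use assms(1) i in \<open>auto simp: s_def intro!: always_eventually member_le_sum\<close>)
      hence "(\<lambda>n. sqrt ((norm (f i (r n) x - g i x))\<^sup>2)) \<longlonglongrightarrow> sqrt 0" by (rule tendsto_real_sqrt)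
      hence "(\<lambda>n. norm (f i (r n) x - g i x)) \<longlonglongrightarrow> 0" by simp
      thus "(\<lambda>n. f i (r n) x) \<longlonglongrightarrow> g i x" by (simp add: LIM_zero_iff tendsto_norm_zero_iff)
    qed
  qed
  with r(1) show thesis by (rule that)
qed

text \<open>Riesz-Fischer: a rapidly converging subsequence converges pointwise almost everywhere,
  and Fatou's lemma shows that its limit is also the limit in L2.\<close>

lemma l2_complete:
  fixes f :: "nat \<Rightarrow> real^2 \<Rightarrow> 'b::euclidean_space"
  assumes sq: "\<And>n. square_integrable (f n)"
    and cauchy: "\<And>e. e > 0 \<Longrightarrow> \<exists>N. \<forall>m\<ge>N. \<forall>n\<ge>N. l2_norm (\<lambda>x. f m x - f n x) < e"
  obtains g where "square_integrable g" "(\<lambda>n. l2_norm (\<lambda>x. f n x - g x)) \<longlonglongrightarrow> 0"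
proof -
  note [measurable] = sq[THEN square_integrable_measurable]
  have "\<forall>k. \<exists>N. \<forall>m\<ge>N. \<forall>n\<ge>N. l2_norm (\<lambda>x. f m x - f n x) < (1/2)^k"
    using cauchy by simp
  then obtain N where N: "\<And>k m n. m \<ge> N k \<Longrightarrow> n \<ge> N k \<Longrightarrow> l2_norm (\<lambda>x. f m x - f n x) < (1/2)^k"
    by metis
  \<comment> \<open>Summing the thresholds makes \<open>r\<close> monotone and at least
    \<open>N k\<close>; the added \<open>k\<close> makes it tend to infinity.\<close>
  define r where "r k = (\<Sum>i\<le>k. N i) + k" for k
  have rN: "r k \<ge> N k" for k unfolding r_def by (simp add: lessThan_Suc_atMost[symmetric])
  have rmono: "r (Suc k) \<ge> r k" for k by (simp add: r_def)
  have rk: "r k \<ge> k" for k by (simp add: r_def)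
  have step: "l2_norm (\<lambda>x. f (r (Suc k)) x - f (r k) x) \<le> (1/2)^k" for k
    using N[of k "r (Suc k)" "r k"] rN[of k] rmono[of k] by simp
  \<comment> \<open>The squared increments have integral at most 4^(-k), so they stay summable in
    mean after multiplication by 2^k. Where the weighted sum is finite, the increments are
    O(2^(-k/2)) and therefore summable.\<close>
  define d where "d k x = norm (f (r (Suc k)) x - f (r k) x)" for k x
  have [measurable]: "d k \<in> borel_measurable lborel" for k unfolding d_def by measurable
  have "(\<integral>\<^sup>+x. (\<Sum>k. ennreal (2^k * (d k x)\<^sup>2)) \<partial>lborel) = (\<Sum>k. \<integral>\<^sup>+x. ennreal (2^k * (d k x)\<^sup>2) \<partial>lborel)"
    by (rule nn_integral_suminf) measurable
  also have "\<dots> \<le> (\<Sum>k. ennreal ((1/2)^k))"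
  proof (intro suminf_le summableI)
    fix k
    have "(\<integral>\<^sup>+x. ennreal (2^k * (d k x)\<^sup>2) \<partial>lborel) = ennreal (2^k) * (\<integral>\<^sup>+x. ennreal ((d k x)\<^sup>2) \<partial>lborel)"
      by (simp add: ennreal_mult nn_integral_cmult)
    also have "(\<integral>\<^sup>+x. ennreal ((d k x)\<^sup>2) \<partial>lborel) = ennreal ((l2_norm (\<lambda>x. f (r (Suc k)) x - f (r k) x))\<^sup>2)"
      unfolding d_def by (rule nn_integral_l2_norm) (intro square_integrable_diff sq)
    also have "ennreal (2^k) * \<dots> \<le> ennreal (2^k) * ennreal (((1/2)^k)\<^sup>2)"
      by (intro mult_left_mono ennreal_leI power_mono step) auto
    also have "\<dots> = ennreal ((1/2)^k)"
      by (simp add: ennreal_mult[symmetric] power2_eq_square power_one_over field_simps)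
    finally show "(\<integral>\<^sup>+x. ennreal (2^k * (d k x)\<^sup>2) \<partial>lborel) \<le> ennreal ((1/2)^k)" .
  qed
  also have "\<dots> = ennreal (\<Sum>k. (1/2)^k)" by (rule suminf_ennreal2) (auto intro: summable_geometric)
  also have "\<dots> < \<infinity>" by simp
  finally have "(\<integral>\<^sup>+x. (\<Sum>k. ennreal (2^k * (d k x)\<^sup>2)) \<partial>lborel) \<noteq> \<infinity>" by simp
  hence ae: "AE x in lborel. (\<Sum>k. ennreal (2^k * (d k x)\<^sup>2)) \<noteq> \<infinity>"
    by (intro nn_integral_PInf_AE) auto
  define g where "g x = lim (\<lambda>k. f (r k) x)" for x
  have [measurable]: "g \<in> borel_measurable lborel" unfolding g_def by (rule borel_measurable_lim_metric) measurable
  have lim: "AE x in lborel. (\<lambda>k. f (r k) x) \<longlonglongrightarrow> g x"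
    using ae
  proof eventually_elim
    case (elim x)
    define C where "C = enn2real (\<Sum>k. ennreal (2^k * (d k x)\<^sup>2))"
    have C: "(\<Sum>k. ennreal (2^k * (d k x)\<^sup>2)) = ennreal C" using elim by (simp add: C_def top.not_eq_extremum)
    have "d k x \<le> sqrt C * (sqrt (1/2))^k" for k
    proof -
      have "ennreal (2^k * (d k x)\<^sup>2) \<le> ennreal C"
        using sum_le_suminf[of "\<lambda>k. ennreal (2^k * (d k x)\<^sup>2)" "{k}"] by (simp add: C)
      hence "2^k * (d k x)\<^sup>2 \<le> C" by (simp add: C_def)
      hence "(d k x)\<^sup>2 \<le> C * (1/2)^k" by (simp add: field_simps power_one_over)
      hence "sqrt ((d k x)\<^sup>2) \<le> sqrt (C * (1/2)^k)" by (rule real_sqrt_le_mono)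
      thus ?thesis by (simp add: real_sqrt_mult real_sqrt_power d_def)
    qed
    hence "norm (f (r (Suc k)) x - f (r k) x) \<le> sqrt C * (sqrt (1/2))^k" for k
      unfolding d_def .
    moreover have "summable (\<lambda>k. sqrt C * (sqrt (1/2))^k)"
      by (intro summable_mult summable_geometric) simp
    ultimately have "summable (\<lambda>k. f (r (Suc k)) x - f (r k) x)"
      by (rule summable_comparison_test'[where N=0, rotated])
    hence "convergent (\<lambda>n. \<Sum>k<n. f (r (Suc k)) x - f (r k) x)" by (simp add: summable_iff_convergent)
    hence "convergent (\<lambda>n. f (r n) x - f (r 0) x)" by (simp add: sum_lessThan_telescope[of "\<lambda>k. f (r k) x"])
    hence "convergent (\<lambda>n. f (r n) x)" using convergent_diff_const_right_iff by blast
    thus ?case by (simp add: g_def convergent_LIMSEQ_iff)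
  qed
  \<comment> \<open>Fatou along the subsequence turns convergence almost everywhere into an L2
    bound; square integrability of the error comes with it.\<close>
  have bd: "(\<integral>\<^sup>+x. ennreal ((norm (f n x - g x))\<^sup>2) \<partial>lborel) \<le> ennreal (e\<^sup>2)"
    if "\<forall>m\<ge>M. l2_norm (\<lambda>x. f n x - f m x) < e" "e > 0" for n M e
  proof -
    have "(\<integral>\<^sup>+x. ennreal ((norm (f n x - g x))\<^sup>2) \<partial>lborel)
       = (\<integral>\<^sup>+x. liminf (\<lambda>k. ennreal ((norm (f n x - f (r k) x))\<^sup>2)) \<partial>lborel)"
    proof (rule nn_integral_cong_AE, use lim in eventually_elim)
      case (elim x)
      have "(\<lambda>k. ennreal ((norm (f n x - f (r k) x))\<^sup>2)) \<longlonglongrightarrow> ennreal ((norm (f n x - g x))\<^sup>2)"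
        by (intro tendsto_ennrealI tendsto_intros elim)
      thus ?case by (intro lim_imp_Liminf[symmetric]) simp_all
    qed
    also have "\<dots> \<le> liminf (\<lambda>k. \<integral>\<^sup>+x. ennreal ((norm (f n x - f (r k) x))\<^sup>2) \<partial>lborel)"
      by (rule nn_integral_liminf) measurable
    also have "\<dots> \<le> liminf (\<lambda>k. ennreal (e\<^sup>2))"
    proof (intro Liminf_mono eventually_sequentiallyI[of M])
      fix k assume "k \<ge> M"
      hence "l2_norm (\<lambda>x. f n x - f (r k) x) \<le> e" using that rk[of k] by (simp add: less_imp_le)
      thus "(\<integral>\<^sup>+x. ennreal ((norm (f n x - f (r k) x))\<^sup>2) \<partial>lborel) \<le> ennreal (e\<^sup>2)"
        by (subst nn_integral_l2_norm) (auto intro!: square_integrable_diff sq ennreal_leI power_mono)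
    qed
    finally show ?thesis by (simp add: Liminf_const)
  qed
  have le: "square_integrable (\<lambda>x. f n x - g x) \<and> l2_norm (\<lambda>x. f n x - g x) \<le> e"
    if "\<forall>m\<ge>M. l2_norm (\<lambda>x. f n x - f m x) < e" "e > 0" for n M e
    using square_integrableI_nn[OF _ bd[OF that]] that by simp
  have "\<exists>N. \<forall>n\<ge>N. l2_norm (\<lambda>x. f n x - g x) < e" if "e > 0" for e
  proof -
    obtain M where M: "\<And>m n. m \<ge> M \<Longrightarrow> n \<ge> M \<Longrightarrow> l2_norm (\<lambda>x. f m x - f n x) < e/2"
      using cauchy[of "e/2"] \<open>e > 0\<close> by auto
    have "l2_norm (\<lambda>x. f n x - g x) \<le> e/2" if "n \<ge> M" for n
      using le[of M n "e/2"] M[OF that] \<open>e > 0\<close> by auto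
    moreover have "e/2 < e" using \<open>e > 0\<close> by simp
    ultimately show ?thesis by (blast intro: order_le_less_trans)
  qed
  hence "(\<lambda>n. l2_norm (\<lambda>x. f n x - g x)) \<longlonglongrightarrow> 0" by (simp add: LIMSEQ_iff)
  moreover obtain n where "\<forall>m\<ge>n. l2_norm (\<lambda>x. f n x - f m x) < 1"
    using cauchy[of 1] by auto
  hence "square_integrable (\<lambda>x. f n x - g x)" using le[of n n 1] by simp
  hence "square_integrable (\<lambda>x. f n x - (f n x - g x))" by (rule square_integrable_diff[OF sq])
  hence "square_integrable g" by simp
  ultimately show thesis using that by blast
qed

section \<open>Continuity of translations\<close>

lemma lborel_integrable_shift:
  fixes f :: "'a::euclidean_space \<Rightarrow> 'b::{banach,second_countable_topology}"
  assumes "integrable lborel f"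
  shows "integrable lborel (\<lambda>x. f (x + h))" "(LINT x|lborel. f (x + h)) = (LINT x|lborel. f x)"
proof -
  have [measurable]: "f \<in> borel_measurable borel" using borel_measurable_integrable[OF assms] by simp
  have "integrable (distr lborel borel ((+) h)) f" using assms by (simp add: lborel_distr_plus)
  thus "integrable lborel (\<lambda>x. f (x + h))" by (subst (asm) integrable_distr_eq) (auto simp: add.commute)
  have "(LINT x|lborel. f x) = (LINT x|distr lborel borel ((+) h). f x)" by (simp add: lborel_distr_plus)
  also have "\<dots> = (LINT x|lborel. f (x + h))" by (subst integral_distr) (auto simp: add.commute)
  finally show "(LINT x|lborel. f (x + h)) = (LINT x|lborel. f x)" ..
qed

lemma lborel_integrable_scale:
  fixes f :: "'a::euclidean_space \<Rightarrow> 'b::{banach,second_countable_topology}"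
  assumes "integrable lborel f" "c \<noteq> 0"
  shows "integrable lborel (\<lambda>x. f (c *\<^sub>R x))"
    "(LINT x|lborel. f x) = \<bar>c\<bar> ^ DIM('a) *\<^sub>R (LINT x|lborel. f (c *\<^sub>R x))"
proof -
  have [measurable]: "f \<in> borel_measurable borel" using borel_measurable_integrable[OF assms(1)] by simp
  have eq: "(lborel :: 'a measure) = density (distr lborel borel (\<lambda>x. c *\<^sub>R x)) (\<lambda>_. ennreal (\<bar>c\<bar> ^ DIM('a)))"
    using lborel_affine[OF assms(2), of "0::'a"] by simp
  have "integrable (density (distr lborel borel (\<lambda>x. c *\<^sub>R x)) (\<lambda>_. ennreal (\<bar>c\<bar> ^ DIM('a)))) f"
    using assms(1) eq by simp
  hence "integrable (distr lborel borel (\<lambda>x. c *\<^sub>R x)) (\<lambda>x. \<bar>c\<bar> ^ DIM('a) *\<^sub>R f x)"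
    by (subst (asm) integrable_density) auto
  hence "integrable lborel (\<lambda>x. \<bar>c\<bar> ^ DIM('a) *\<^sub>R f (c *\<^sub>R x))"
    by (subst (asm) integrable_distr_eq) auto
  hence "integrable lborel (\<lambda>x. inverse (\<bar>c\<bar> ^ DIM('a)) *\<^sub>R (\<bar>c\<bar> ^ DIM('a) *\<^sub>R f (c *\<^sub>R x)))"
    by (rule integrable_scaleR_right)
  thus "integrable lborel (\<lambda>x. f (c *\<^sub>R x))" using assms(2) by simp
  have "(LINT x|lborel. f x) = (LINT x|density (distr lborel borel (\<lambda>x. c *\<^sub>R x)) (\<lambda>_. ennreal (\<bar>c\<bar> ^ DIM('a))). f x)"
    using eq by simp
  also have "\<dots> = (LINT x|distr lborel borel (\<lambda>x. c *\<^sub>R x). \<bar>c\<bar> ^ DIM('a) *\<^sub>R f x)"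
    by (subst integral_density) auto
  also have "\<dots> = (LINT x|lborel. \<bar>c\<bar> ^ DIM('a) *\<^sub>R f (c *\<^sub>R x))"
    by (subst integral_distr) auto
  finally show "(LINT x|lborel. f x) = \<bar>c\<bar> ^ DIM('a) *\<^sub>R (LINT x|lborel. f (c *\<^sub>R x))" by simp
qed

definition L1_translation_continuous :: "(real^2 \<Rightarrow> real) \<Rightarrow> bool" where
  "L1_translation_continuous f \<longleftrightarrow>
     (\<forall>h. h \<longlonglongrightarrow> 0 \<longrightarrow> (\<lambda>n::nat. LINT x|lborel. \<bar>f (x + h n) - f x\<bar>) \<longlonglongrightarrow> 0)"

text \<open>Translations are isometries of L1, so replacing f by g costs the approximation error
  twice, once shifted and once not. The property is thereby closed under L1 limits.\<close>

lemma L1_translation_continuous_approx: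
  assumes f: "integrable lborel f"
    and ap: "\<And>e. e > 0 \<Longrightarrow> \<exists>g. integrable lborel g \<and> L1_translation_continuous g \<and> (LINT x|lborel. \<bar>f x - g x\<bar>) < e"
  shows "L1_translation_continuous f"
  unfolding L1_translation_continuous_def
proof (intro allI impI)
  fix h :: "nat \<Rightarrow> real^2" assume h: "h \<longlonglongrightarrow> 0"
  show "(\<lambda>n::nat. LINT x|lborel. \<bar>f (x + h n) - f x\<bar>) \<longlonglongrightarrow> 0"
  proof (rule tendstoI)
    fix e :: real assume "e > 0"
    obtain g where g: "integrable lborel g" "L1_translation_continuous g" "(LINT x|lborel. \<bar>f x - g x\<bar>) < e / 4"
      using ap[of "e/4"] \<open>e > 0\<close> by auto
    have fg: "integrable lborel (\<lambda>x. \<bar>f x - g x\<bar>)" using f g by auto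
    have "eventually (\<lambda>n. dist (LINT x|lborel. \<bar>g (x + h n) - g x\<bar>) 0 < e / 4) sequentially"
      using g(2) h \<open>e > 0\<close> unfolding L1_translation_continuous_def by (intro tendstoD) auto
    thus "eventually (\<lambda>n. dist (LINT x|lborel. \<bar>f (x + h n) - f x\<bar>) 0 < e) sequentially"
    proof eventually_elim
      case (elim n)
      note i = f g(1) lborel_integrable_shift(1)[OF f, of "h n"] lborel_integrable_shift(1)[OF g(1), of "h n"]
      have "(LINT x|lborel. \<bar>f (x + h n) - f x\<bar>)
         \<le> (LINT x|lborel. \<bar>f (x + h n) - g (x + h n)\<bar> + \<bar>g (x + h n) - g x\<bar> + \<bar>f x - g x\<bar>)"
        by (rule integral_mono) (use i in auto)
      also have "\<dots> = (LINT x|lborel. \<bar>f (x + h n) - g (x + h n)\<bar>) + (LINT x|lborel. \<bar>g (x + h n) - g x\<bar>)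
          + (LINT x|lborel. \<bar>f x - g x\<bar>)" using i by simp
      also have "(LINT x|lborel. \<bar>f (x + h n) - g (x + h n)\<bar>) = (LINT x|lborel. \<bar>f x - g x\<bar>)"
        by (rule lborel_integrable_shift(2)[OF fg])
      finally have "(LINT x|lborel. \<bar>f (x + h n) - f x\<bar>) < e" using elim g(3) \<open>e > 0\<close> by simp
      thus ?case by simp
    qed
  qed
qed

lemma L1_translation_continuous_open:
  assumes U: "open U" "emeasure lborel U < \<infinity>"
  shows "L1_translation_continuous (\<lambda>x. indicator U x * c)"
  unfolding L1_translation_continuous_def
proof (intro allI impI)
  fix h :: "nat \<Rightarrow> real^2" assume h: "h \<longlonglongrightarrow> 0"
  have [measurable]: "U \<in> sets borel" using U by simp
  have iU: "integrable lborel (indicator U :: _ \<Rightarrow> real)" using U by simp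
  note iUh = lborel_integrable_shift(1)[OF iU]
  have iUU: "integrable lborel (\<lambda>x. indicator U x * indicator U (x + h n) :: real)" for n
    by (rule Bochner_Integration.integrable_bound[OF iU]) (auto simp: indicator_def)
  \<comment> \<open>At boundary points of U the shifted indicator need not converge. The overlap of
    U with its translate does converge at every point, because U is open, and the L1 distance is
    expressed through it.\<close>
  have eq: "(LINT x|lborel. \<bar>indicator U (x + h n) * c - indicator U x * c\<bar>)
      = \<bar>c\<bar> * (2 * (LINT x|lborel. indicator U x) - 2 * (LINT x|lborel. indicator U x * indicator U (x + h n)))" for n
  proof -
    have "(LINT x|lborel. \<bar>indicator U (x + h n) * c - indicator U x * c\<bar>)
       = (LINT x|lborel. \<bar>c\<bar> * (indicator U (x + h n) + indicator U x - 2 * (indicator U x * indicator U (x + h n))))"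
      by (rule Bochner_Integration.integral_cong) (auto simp: indicator_def)
    also have "\<dots> = \<bar>c\<bar> * ((LINT x|lborel. indicator U (x + h n)) + (LINT x|lborel. indicator U x)
         - 2 * (LINT x|lborel. indicator U x * indicator U (x + h n)))"
      using iU iUh[of "h n"] iUU[of n] by simp
    also have "(LINT x|lborel. indicator U (x + h n) :: real) = (LINT x|lborel. indicator U x)"
      by (rule lborel_integrable_shift(2)[OF iU])
    finally show ?thesis by simp
  qed
  have "(\<lambda>n. LINT x|lborel. indicator U x * indicator U (x + h n) :: real) \<longlonglongrightarrow> (LINT x|lborel. indicator U x)"
  proof (rule integral_dominated_convergence[OF _ _ iU])
    show "AE x in lborel. (\<lambda>n. indicator U x * indicator U (x + h n) :: real) \<longlonglongrightarrow> indicator U x"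
    proof (rule AE_I2)
      fix x
      show "(\<lambda>n. indicator U x * indicator U (x + h n) :: real) \<longlonglongrightarrow> indicator U x"
      proof (cases "x \<in> U")
        case True
        have "(\<lambda>n. x + h n) \<longlonglongrightarrow> x + 0" by (intro tendsto_intros h)
        hence "eventually (\<lambda>n. x + h n \<in> U) sequentially" using U(1) True by (auto dest: topological_tendstoD)
        hence "eventually (\<lambda>n. indicator U x * indicator U (x + h n) = (indicator U x :: real)) sequentially"
          by eventually_elim (use True in simp)
        thus ?thesis by (rule tendsto_eventually)
      qed simp
    qed
  qed (auto simp: indicator_def)
  hence "(\<lambda>n. \<bar>c\<bar> * (2 * (LINT x|lborel. indicator U x) - 2 * (LINT x|lborel. indicator U x * indicator U (x + h n))))
     \<longlonglongrightarrow> \<bar>c\<bar> * (2 * (LINT x|lborel. indicator U x) - 2 * (LINT x|lborel. indicator U x))"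
    by (intro tendsto_intros)
  thus "(\<lambda>n. LINT x|lborel. \<bar>indicator U (x + h n) * c - indicator U x * c\<bar>) \<longlonglongrightarrow> 0"
    by (simp add: eq)
qed

text \<open>Induction over integrable functions. Indicators of measurable sets are approximated from
  outside by open sets, and limits by \<open>L1_translation_continuous_approx\<close>.\<close>

lemma L1_translation_continuous:
  assumes "integrable lborel f" shows "L1_translation_continuous f"
  using assms
proof (induction f rule: integrable_induct)
  case (base A c)
  hence [measurable]: "A \<in> sets borel" by simp
  have iA: "integrable lborel (\<lambda>x. indicator A x * c)" using base by simp
  have "L1_translation_continuous (\<lambda>x. indicator A x * c)"
  proof (rule L1_translation_continuous_approx[OF iA])
    fix e :: real assume e: "e > 0"
    \<comment> \<open>Dividing by |c| + 1 keeps |c| d below e also for c = 0.\<close>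
    define d where "d = e / (\<bar>c\<bar> + 1)"
    have d: "d > 0" using e by (simp add: d_def)
    obtain U where U: "open U" "A \<subseteq> U" "emeasure lborel (U - A) < d"
      using outer_regular_lborel[of A d] d by auto
    have [measurable]: "U \<in> sets borel" using U by simp
    have "emeasure lborel U = emeasure lborel (A \<union> (U - A))" using U(2) by (simp add: Un_absorb1)
    also have "\<dots> \<le> emeasure lborel A + emeasure lborel (U - A)" by (rule emeasure_subadditive) auto
    also have "\<dots> < \<infinity>" using less_trans[OF U(3), of top] base(2) by (auto simp: less_top)
    finally have fU: "emeasure lborel U < \<infinity>" .
    have "(LINT x|lborel. \<bar>indicator A x * c - indicator U x * c\<bar>) = (LINT x|lborel. \<bar>c\<bar> * indicator (U - A) x)"
      by (rule Bochner_Integration.integral_cong) (use U(2) in \<open>auto simp: indicator_def\<close>)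
    also have "\<dots> = \<bar>c\<bar> * measure lborel (U - A)" by simp
    also have "\<dots> \<le> \<bar>c\<bar> * d"
      using U(3) d by (intro mult_left_mono) (auto simp: measure_def intro!: enn2real_leI)
    also have "\<dots> < e" using e by (simp add: d_def field_simps)
    finally show "\<exists>g. integrable lborel g \<and> L1_translation_continuous g \<and> (LINT x|lborel. \<bar>indicator A x * c - g x\<bar>) < e"
      using L1_translation_continuous_open[OF U(1) fU, of c] fU
      by (intro exI[of _ "\<lambda>x. indicator U x * c"]) simp
  qed
  thus ?case by simp
next
  case (add f g)
  show ?case unfolding L1_translation_continuous_def
  proof (intro allI impI)
    fix h :: "nat \<Rightarrow> real^2" assume h: "h \<longlonglongrightarrow> 0"
    have lim: "(\<lambda>n. (LINT x|lborel. \<bar>f (x + h n) - f x\<bar>) + (LINT x|lborel. \<bar>g (x + h n) - g x\<bar>)) \<longlonglongrightarrow> 0 + 0"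
      using add h unfolding L1_translation_continuous_def by (intro tendsto_add) auto
    show "(\<lambda>n. LINT x|lborel. \<bar>f (x + h n) + g (x + h n) - (f x + g x)\<bar>) \<longlonglongrightarrow> 0"
    proof (rule tendsto_sandwich[OF _ _ tendsto_const])
      show "eventually (\<lambda>n. (LINT x|lborel. \<bar>f (x + h n) + g (x + h n) - (f x + g x)\<bar>)
          \<le> (LINT x|lborel. \<bar>f (x + h n) - f x\<bar>) + (LINT x|lborel. \<bar>g (x + h n) - g x\<bar>)) sequentially"
      proof (rule always_eventually, rule allI)
        fix n
        note i = add(1,2) lborel_integrable_shift(1)[OF add(1), of "h n"] lborel_integrable_shift(1)[OF add(2), of "h n"]
        have "(LINT x|lborel. \<bar>f (x + h n) + g (x + h n) - (f x + g x)\<bar>)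
           \<le> (LINT x|lborel. \<bar>f (x + h n) - f x\<bar> + \<bar>g (x + h n) - g x\<bar>)"
          by (rule integral_mono) (use i in auto)
        thus "(LINT x|lborel. \<bar>f (x + h n) + g (x + h n) - (f x + g x)\<bar>)
          \<le> (LINT x|lborel. \<bar>f (x + h n) - f x\<bar>) + (LINT x|lborel. \<bar>g (x + h n) - g x\<bar>)" using i by simp
      qed
    qed (use lim in auto)
  qed
next
  case (lim f s)
  show ?case
  proof (rule L1_translation_continuous_approx[OF lim(4)])
    fix e :: real assume e: "e > 0"
    have "(\<lambda>i. LINT x|lborel. \<bar>f x - s i x\<bar>) \<longlonglongrightarrow> (LINT x::real^2|lborel. 0)"
    proof (rule integral_dominated_convergence[where w="\<lambda>x. 3 * \<bar>f x\<bar>"])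
      show "AE x in lborel. (\<lambda>i. \<bar>f x - s i x\<bar>) \<longlonglongrightarrow> 0"
      proof (rule AE_I2)
        fix x :: "real^2"
        have "(\<lambda>i. \<bar>f x - s i x\<bar>) \<longlonglongrightarrow> \<bar>f x - f x\<bar>" by (intro tendsto_intros lim) simp
        thus "(\<lambda>i. \<bar>f x - s i x\<bar>) \<longlonglongrightarrow> 0" by simp
      qed
      show "AE x in lborel. norm \<bar>f x - s i x\<bar> \<le> 3 * \<bar>f x\<bar>" for i
      proof (rule AE_I2)
        fix x :: "real^2" show "norm \<bar>f x - s i x\<bar> \<le> 3 * \<bar>f x\<bar>" using lim(3)[of x i] by simp
      qed
    qed (use lim in auto)
    hence "eventually (\<lambda>i. dist (LINT x|lborel. \<bar>f x - s i x\<bar>) 0 < e) sequentially" using e by (intro tendstoD) auto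
    then obtain i where "dist (LINT x|lborel. \<bar>f x - s i x\<bar>) 0 < e" by (auto simp: eventually_sequentially)
    thus "\<exists>g. integrable lborel g \<and> L1_translation_continuous g \<and> (LINT x|lborel. \<bar>f x - g x\<bar>) < e"
      using lim by (intro exI[of _ "s i"]) auto
  qed
qed

lemma tendsto_L1_translation:
  fixes f :: "real^2 \<Rightarrow> real"
  assumes "integrable lborel f" "h \<longlonglongrightarrow> 0"
  shows "(\<lambda>n::nat. LINT x|lborel. \<bar>f (x + h n) - f x\<bar>) \<longlonglongrightarrow> 0"
  using L1_translation_continuous[OF assms(1)] assms(2) by (simp add: L1_translation_continuous_def)

lemma square_integrable_shift [intro]:
  assumes "square_integrable f"
  shows "square_integrable (\<lambda>x. f (x + h))" "l2_norm (\<lambda>x. f (x + h)) = l2_norm f"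
proof -
  have [measurable]: "f \<in> borel_measurable borel" using assms by (simp add: square_integrable_def)
  show "square_integrable (\<lambda>x. f (x + h))"
    using lborel_integrable_shift(1)[OF square_integrable_integrable[OF assms]] by (simp add: square_integrable_def)
  show "l2_norm (\<lambda>x. f (x + h)) = l2_norm f"
    using lborel_integrable_shift(2)[OF square_integrable_integrable[OF assms]] by (simp add: l2_norm_def)
qed

text \<open>The map \<open>f \<mapsto> f |f|\<close> reduces continuity of translations in \<open>L\<^sup>2\<close> to \<open>L\<^sup>1\<close>.\<close>

lemma diff_power2_le_signed_square: "(a - b)\<^sup>2 \<le> 2 * \<bar>a * \<bar>a\<bar> - b * \<bar>b\<bar>\<bar>" for a b :: real
proof -
  have *: "(a - b)\<^sup>2 \<le> 2 * \<bar>a * a - b * b\<bar>" if "a \<ge> 0" "b \<ge> 0" for a b :: real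
  proof -
    have "(a - b)\<^sup>2 = \<bar>a - b\<bar> * \<bar>a - b\<bar>" by (simp add: power2_eq_square abs_mult[symmetric])
    also have "\<dots> \<le> \<bar>a - b\<bar> * \<bar>a + b\<bar>" using that by (intro mult_left_mono) auto
    also have "\<dots> = \<bar>a * a - b * b\<bar>" by (simp add: abs_mult[symmetric] algebra_simps)
    finally show ?thesis by (rule order_trans) simp
  qed
  have **: "(a - b)\<^sup>2 \<le> 2 * \<bar>a * a + b * b\<bar>" for a b :: real
    using zero_le_power2[of "a + b"] abs_ge_self[of "a * a + b * b"]
    by (simp add: power2_eq_square algebra_simps)
  consider "a \<ge> 0" "b \<ge> 0" | "a \<ge> 0" "b < 0" | "a < 0" "b \<ge> 0" | "a < 0" "b < 0" by linarith
  thus ?thesis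
  proof cases
    case 1 thus ?thesis using *[of a b] by simp
  next
    case 2 thus ?thesis using **[of a b] by simp
  next
    case 3 thus ?thesis using **[of a b] by (simp add: abs_minus_commute[of "- (a*a)"])
  next
    case 4 thus ?thesis using *[of "-a" "-b"] by (simp add: power2_commute abs_minus_commute)
  qed
qed

lemma tendsto_l2_translation:
  fixes f :: "real^2 \<Rightarrow> real"
  assumes f: "square_integrable f" and h: "h \<longlonglongrightarrow> 0"
  shows "(\<lambda>n::nat. l2_norm (\<lambda>x. f (x + h n) - f x)) \<longlonglongrightarrow> 0"
proof -
  note [measurable] = square_integrable_measurable[OF f]
  have i: "integrable lborel (\<lambda>x. f x * \<bar>f x\<bar>)"
    using square_integrable_integrable[OF f]
    by (rule Bochner_Integration.integrable_bound) (auto simp: abs_mult power2_eq_square)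
  note ih = lborel_integrable_shift(1)[OF i]
  have "(\<lambda>n. 2 * (LINT x|lborel. \<bar>f (x + h n) * \<bar>f (x + h n)\<bar> - f x * \<bar>f x\<bar>\<bar>)) \<longlonglongrightarrow> 2 * 0"
    by (intro tendsto_intros tendsto_L1_translation[OF i h])
  hence lim: "(\<lambda>n. 2 * (LINT x|lborel. \<bar>f (x + h n) * \<bar>f (x + h n)\<bar> - f x * \<bar>f x\<bar>\<bar>)) \<longlonglongrightarrow> 0" by simp
  have "(\<lambda>n. (l2_norm (\<lambda>x. f (x + h n) - f x))\<^sup>2) \<longlonglongrightarrow> 0"
  proof (rule tendsto_sandwich[OF _ _ tendsto_const lim])
    show "eventually (\<lambda>n. (l2_norm (\<lambda>x. f (x + h n) - f x))\<^sup>2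
        \<le> 2 * (LINT x|lborel. \<bar>f (x + h n) * \<bar>f (x + h n)\<bar> - f x * \<bar>f x\<bar>\<bar>)) sequentially"
    proof (rule always_eventually, rule allI)
      fix n
      have "(l2_norm (\<lambda>x. f (x + h n) - f x))\<^sup>2
         \<le> (LINT x|lborel. 2 * \<bar>f (x + h n) * \<bar>f (x + h n)\<bar> - f x * \<bar>f x\<bar>\<bar>)"
        unfolding l2_norm_power2
        by (rule integral_mono)
           (use diff_power2_le_signed_square i ih square_integrable_diff[OF square_integrable_shift(1)[OF f] f]
             in \<open>auto simp: square_integrable_def\<close>)
      thus "(l2_norm (\<lambda>x. f (x + h n) - f x))\<^sup>2
        \<le> 2 * (LINT x|lborel. \<bar>f (x + h n) * \<bar>f (x + h n)\<bar> - f x * \<bar>f x\<bar>\<bar>)" by simp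
    qed
  qed auto
  from tendsto_real_sqrt[OF this] show ?thesis by simp
qed

section \<open>The Plancherel identity\<close>

lemma borel_measurable_cis [measurable (raw)]:
  "f \<in> borel_measurable M \<Longrightarrow> (\<lambda>x. cis (f x)) \<in> borel_measurable M"
  by (rule borel_measurable_continuous_on[where f=cis]) (auto intro: continuous_intros)

lemma borel_measurable_cnj_comp [measurable (raw)]:
  "f \<in> borel_measurable M \<Longrightarrow> (\<lambda>x. cnj (f x)) \<in> borel_measurable M"
  by (rule borel_measurable_continuous_on[where f=cnj]) (auto intro: continuous_intros)

lemma integrable_bounded_mult:
  fixes f :: "'a \<Rightarrow> 'b::{real_normed_field,banach,second_countable_topology}"
  assumes f: "integrable M f" and m [measurable]: "m \<in> borel_measurable M" and c: "\<And>x. norm (m x) \<le> c"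
  shows "integrable M (\<lambda>x. m x * f x)"
proof (rule Bochner_Integration.integrable_bound)
  show "integrable M (\<lambda>x. c * norm (f x))" using f by auto
  show "(\<lambda>x. m x * f x) \<in> borel_measurable M" using borel_measurable_integrable[OF f] by measurable
  have "norm (m x * f x) \<le> norm (c * norm (f x))" for x
  proof -
    have "norm (m x * f x) \<le> c * norm (f x)" by (simp add: norm_mult c mult_right_mono)
    thus ?thesis by simp
  qed
  thus "AE x in M. norm (m x * f x) \<le> norm (c * norm (f x))" by simp
qed

section \<open>The Fourier transform of the gaussian\<close>

lemma gaussian_fourier_real:
  fixes x :: real
  shows "integrable lborel (\<lambda>t::real. cis (- (x * t)) * of_real (exp (- t\<^sup>2 / 2)))"
    "(LINT t|lborel. cis (- (x * t)) * of_real (exp (- t\<^sup>2 / 2))) = of_real (sqrt (2 * pi) * exp (- x\<^sup>2 / 2))"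
proof -
  have "integrable lborel (\<lambda>t. sqrt (2 * pi) * std_normal_density t)"
    by (intro integrable_mult_right integrable_normal_density) simp
  moreover have "(\<lambda>t. sqrt (2 * pi) * std_normal_density t) = (\<lambda>t. exp (- t\<^sup>2 / 2))"
    by (auto simp: std_normal_density_def)
  ultimately have "integrable lborel (\<lambda>t. exp (- t\<^sup>2 / 2) :: real)" by metis
  hence "integrable lborel (\<lambda>t. of_real (exp (- t\<^sup>2 / 2)) :: complex)" by (rule integrable_of_real)
  thus i: "integrable lborel (\<lambda>t::real. cis (- (x * t)) * of_real (exp (- t\<^sup>2 / 2)))" for x
    by (rule integrable_bounded_mult[where c=1]) auto
  have "of_real (exp (- ((-x)\<^sup>2) / 2)) = char std_normal_distribution (-x)"
    by (simp add: char_std_normal_distribution)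
  also have "\<dots> = (LINT t|lborel. std_normal_density t *\<^sub>R iexp (- x * t))"
    unfolding char_def by (subst integral_density) auto
  also have "\<dots> = (LINT t|lborel. of_real (1 / sqrt (2 * pi)) * (cis (- (x * t)) * of_real (exp (- t\<^sup>2 / 2))))"
    by (rule Bochner_Integration.integral_cong) (auto simp: std_normal_density_def cis_conv_exp scaleR_conv_of_real)
  also have "\<dots> = of_real (1 / sqrt (2 * pi)) * (LINT t|lborel. cis (- (x * t)) * of_real (exp (- t\<^sup>2 / 2)))"
    by simp
  finally show "(LINT t|lborel. cis (- (x * t)) * of_real (exp (- t\<^sup>2 / 2))) = of_real (sqrt (2 * pi) * exp (- x\<^sup>2 / 2))"
    by (simp add: field_simps flip: of_real_mult)
qed

definition gaussian :: "'a::euclidean_space \<Rightarrow> real" where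
  "gaussian x = exp (- (norm x)\<^sup>2 / 2)"

lemma gaussian_pos [simp]: "gaussian x > 0" and gaussian_le_1 [simp]: "gaussian x \<le> 1"
  and gaussian_minus [simp]: "gaussian (- x) = gaussian x"
  by (simp_all add: gaussian_def)

lemma gaussian_nonneg [simp]: "gaussian x \<ge> 0" by (rule less_imp_le) simp

lemma borel_measurable_gaussian [measurable]: "gaussian \<in> borel_measurable borel"
  unfolding gaussian_def by measurable

text \<open>The gaussian and the exponential both factor over the coordinates, and Lebesgue measure
  is the image of a product measure, so the integral is a product of one-dimensional characteristic
  functions of the normal law.\<close>

lemma gaussian_fourier:
  fixes x :: "'a::euclidean_space"
  shows "integrable lborel (\<lambda>\<xi>. cis (- (x \<bullet> \<xi>)) * of_real (gaussian \<xi>))"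
    "(LINT \<xi>|lborel. cis (- (x \<bullet> \<xi>)) * of_real (gaussian \<xi>)) = of_real (sqrt (2 * pi) ^ DIM('a) * gaussian x)"
proof -
  interpret product_sigma_finite "\<lambda>b::'a. lborel :: real measure" by standard
  define F where "F b t = cis (- ((x \<bullet> b) * t)) * of_real (exp (- t\<^sup>2 / 2))" for b :: 'a and t :: real
  have cis_sum: "cis (\<Sum>b\<in>B. g b) = (\<Prod>b\<in>B. cis (g b))" for B and g :: "'a \<Rightarrow> real"
    by (induction B rule: infinite_finite_induct) (auto simp: cis_mult[symmetric])
  have norm2: "(norm y)\<^sup>2 = (\<Sum>b\<in>Basis. (y \<bullet> b)\<^sup>2)" for y :: 'a
    unfolding power2_norm_eq_inner by (subst euclidean_inner) (simp add: power2_eq_square)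
  have gauss: "of_real (gaussian y) = (\<Prod>b\<in>Basis. of_real (exp (- (y \<bullet> b)\<^sup>2 / 2)) :: complex)" for y :: 'a
    by (simp add: gaussian_def norm2 exp_sum sum_negf sum_divide_distrib flip: of_real_prod exp_sum)
  have eq: "cis (- (x \<bullet> \<xi>)) * of_real (gaussian \<xi>) = (\<Prod>b\<in>Basis. F b (\<xi> \<bullet> b))" for \<xi>
  proof -
    have "- (x \<bullet> \<xi>) = (\<Sum>b\<in>Basis. - ((x \<bullet> b) * (\<xi> \<bullet> b)))" by (subst euclidean_inner) (simp add: sum_negf)
    thus ?thesis by (simp add: F_def prod.distrib cis_sum gauss)
  qed
  have [measurable]: "F b \<in> borel_measurable borel" for b unfolding F_def by measurable
  have iF: "integrable lborel (F b)" for b unfolding F_def by (rule gaussian_fourier_real)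
  have comp: "(\<Sum>b\<in>Basis. f b *\<^sub>R b) \<bullet> c = f c" if "c \<in> Basis" for f and c :: 'a
    using that by (simp add: inner_sum_left_Basis)
  have iP: "integrable (Pi\<^sub>M Basis (\<lambda>b::'a. lborel)) (\<lambda>f. \<Prod>b\<in>Basis. F b (f b))"
    by (rule product_integrable_prod) (auto intro: iF)
  have m: "(\<lambda>f. \<Sum>b\<in>Basis. f b *\<^sub>R b) \<in> measurable (Pi\<^sub>M Basis (\<lambda>b::'a. lborel :: real measure)) (borel :: 'a measure)"
    by measurable
  have mF: "(\<lambda>\<xi>::'a. \<Prod>b\<in>Basis. F b (\<xi> \<bullet> b)) \<in> borel_measurable borel" by measurable
  have e: "(lborel :: 'a measure) = distr (Pi\<^sub>M Basis (\<lambda>b::'a. lborel)) borel (\<lambda>f. \<Sum>b\<in>Basis. f b *\<^sub>R b)"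
    by (rule lborel_eq)
  show "integrable lborel (\<lambda>\<xi>. cis (- (x \<bullet> \<xi>)) * of_real (gaussian \<xi>))"
    unfolding eq by (subst e, subst integrable_distr_eq[OF m mF]) (use iP in \<open>simp add: comp\<close>)
  have "(LINT \<xi>|lborel. cis (- (x \<bullet> \<xi>)) * of_real (gaussian \<xi>)) = (LINT f|(Pi\<^sub>M Basis (\<lambda>b::'a. lborel)). (\<Prod>b\<in>Basis. F b (f b)))"
    unfolding eq by (subst e, subst integral_distr[OF m mF]) (simp add: comp)
  also have "\<dots> = (\<Prod>b\<in>Basis. integral\<^sup>L lborel (F b))"
    by (rule product_integral_prod) (auto intro: iF)
  also have "\<dots> = (\<Prod>b\<in>Basis. of_real (sqrt (2 * pi)) * of_real (exp (- (x \<bullet> b)\<^sup>2 / 2)))"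
    unfolding F_def gaussian_fourier_real(2) by simp
  also have "\<dots> = of_real (sqrt (2 * pi) ^ DIM('a) * gaussian x)" by (simp add: prod.distrib gauss)
  finally show "(LINT \<xi>|lborel. cis (- (x \<bullet> \<xi>)) * of_real (gaussian \<xi>)) = of_real (sqrt (2 * pi) ^ DIM('a) * gaussian x)" .
qed

lemma integrable_gaussian: "integrable lborel (gaussian :: 'a::euclidean_space \<Rightarrow> real)"
proof -
  have "integrable lborel (\<lambda>\<xi>::'a. of_real (gaussian \<xi>) :: complex)"
    using gaussian_fourier(1)[of "0::'a"] by (simp add: cis_zero)
  thus ?thesis by (simp add: complex_of_real_integrable_eq)
qed

lemma integral_gaussian: "(LINT z|lborel. gaussian (z :: real^2)) = 2 * pi"
proof -
  have "complex_of_real (LINT z|lborel. gaussian (z :: real^2)) = of_real (2 * pi)"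
    using gaussian_fourier(2)[of "0::real^2"] by (simp add: gaussian_def)
  thus ?thesis by (simp only: of_real_eq_iff)
qed

section \<open>The Fourier integral of integrable functions, normalised as in
  \<open>fourier\<close>\<close>

definition ft :: "(real^2 \<Rightarrow> real) \<Rightarrow> real^2 \<Rightarrow> complex" where
  "ft f \<xi> = (LINT x|lborel. cis (- (x \<bullet> \<xi>)) * of_real (f x))"

lemma integrable_ft:
  assumes "integrable lborel f"
  shows "integrable lborel (\<lambda>x. cis (c * (x \<bullet> \<xi>)) * (of_real (f x) :: complex))"
  by (rule integrable_bounded_mult[where c=1]) (use assms in auto)

lemma integrable_ft':
  assumes "integrable lborel f"
  shows "integrable lborel (\<lambda>x. cis (- (x \<bullet> \<xi>)) * (of_real (f x) :: complex))"
  using integrable_ft[OF assms, of "-1"] by simp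

lemma borel_measurable_ft [measurable]:
  assumes [measurable]: "f \<in> borel_measurable borel" shows "ft f \<in> borel_measurable borel"
  unfolding ft_def by measurable

lemma norm_ft_le: "norm (ft f \<xi>) \<le> (LINT x|lborel. \<bar>f x\<bar>)"
proof -
  have "norm (ft f \<xi>) \<le> (LINT x|lborel. norm (cis (- (x \<bullet> \<xi>)) * (of_real (f x) :: complex)))"
    unfolding ft_def by (rule integral_norm_bound)
  thus ?thesis by (simp add: norm_mult)
qed

lemma ft_add:
  assumes "integrable lborel f" "integrable lborel g"
  shows "ft (\<lambda>x. f x + g x) \<xi> = ft f \<xi> + ft g \<xi>"
  using integrable_ft'[OF assms(1), of \<xi>] integrable_ft'[OF assms(2), of \<xi>]
  by (simp add: ft_def ring_distribs)

lemma ft_cmult: "ft (\<lambda>x. c * f x) \<xi> = of_real c * ft f \<xi>"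
  by (simp add: ft_def mult.left_commute)

lemma ft_diff:
  assumes "integrable lborel f" "integrable lborel g"
  shows "ft (\<lambda>x. f x - g x) \<xi> = ft f \<xi> - ft g \<xi>"
  using ft_add[OF assms(1), of "\<lambda>x. -1 * g x"] ft_cmult[of "-1" g] assms(2) by simp

lemma ft_shift:
  assumes "integrable lborel f"
  shows "ft (\<lambda>x. f (x + h)) \<xi> = cis (h \<bullet> \<xi>) * ft f \<xi>"
proof -
  have i: "integrable lborel (\<lambda>x. cis (- ((x - h) \<bullet> \<xi>)) * (of_real (f x) :: complex))"
    by (rule integrable_bounded_mult[where c=1]) (use assms in auto)
  have "ft (\<lambda>x. f (x + h)) \<xi> = (LINT x|lborel. cis (- (((x + h) - h) \<bullet> \<xi>)) * of_real (f (x + h)))"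
    by (simp add: ft_def)
  also have "\<dots> = (LINT x|lborel. cis (- ((x - h) \<bullet> \<xi>)) * of_real (f x))"
    by (rule lborel_integrable_shift(2)[OF i])
  also have "\<dots> = (LINT x|lborel. cis (h \<bullet> \<xi>) * (cis (- (x \<bullet> \<xi>)) * of_real (f x)))"
    by (simp add: inner_diff_left mult.assoc[symmetric] cis_mult)
  also have "\<dots> = cis (h \<bullet> \<xi>) * ft f \<xi>" by (simp add: ft_def)
  finally show ?thesis .
qed

lemma ft_cong_AE:
  assumes "AE x in lborel. f x = g x" "f \<in> borel_measurable borel" "g \<in> borel_measurable borel"
  shows "ft f \<xi> = ft g \<xi>"
  unfolding ft_def by (rule integral_cong_AE) (use assms in auto)

text \<open>The multiplication formula: Fubini moves the transform from one factor to the
  other.\<close>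

lemma integral_ft_mult:
  fixes f :: "real^2 \<Rightarrow> real" and g :: "real^2 \<Rightarrow> complex"
  assumes f: "integrable lborel f" and g: "integrable lborel g"
  shows "(LINT \<xi>|lborel. ft f \<xi> * g \<xi>) = (LINT x|lborel. of_real (f x) * (LINT \<xi>|lborel. cis (- (x \<bullet> \<xi>)) * g \<xi>))"
proof -
  have [measurable]: "f \<in> borel_measurable borel" "g \<in> borel_measurable borel"
    using borel_measurable_integrable[OF f] borel_measurable_integrable[OF g] by auto
  define K where "K x \<xi> = cis (- (x \<bullet> \<xi>)) * of_real (f x) * g \<xi>" for x \<xi>
  have [measurable]: "case_prod K \<in> borel_measurable (lborel \<Otimes>\<^sub>M lborel)" unfolding K_def by measurable
  have "integrable (lborel \<Otimes>\<^sub>M lborel) (case_prod K)"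
  proof (rule lborel_pair.Fubini_integrable)
    have "(\<lambda>x. LINT \<xi>|lborel. norm (case_prod K (x, \<xi>))) = (\<lambda>x. \<bar>f x\<bar> * (LINT \<xi>|lborel. norm (g \<xi>)))"
      by (simp add: K_def norm_mult)
    thus "integrable lborel (\<lambda>x. LINT \<xi>|lborel. norm (case_prod K (x, \<xi>)))" using f by simp
    have "integrable lborel (\<lambda>\<xi>. (cis (- (x \<bullet> \<xi>)) * of_real (f x)) * g \<xi>)" for x
      by (rule integrable_bounded_mult[OF g, where c="\<bar>f x\<bar>"]) (auto simp: norm_mult)
    thus "AE x in lborel. integrable lborel (\<lambda>\<xi>. case_prod K (x, \<xi>))" by (simp add: K_def)
  qed measurable
  from lborel_pair.Fubini_integral[OF this]
  have "(LINT \<xi>|lborel. LINT x|lborel. K x \<xi>) = (LINT x|lborel. LINT \<xi>|lborel. K x \<xi>)" .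
  moreover have "(LINT x|lborel. K x \<xi>) = ft f \<xi> * g \<xi>" for \<xi> by (simp add: K_def ft_def)
  moreover have "(LINT \<xi>|lborel. K x \<xi>) = of_real (f x) * (LINT \<xi>|lborel. cis (- (x \<bullet> \<xi>)) * g \<xi>)" for x
    by (simp add: K_def mult_ac flip: integral_mult_right_zero)
  ultimately show ?thesis by simp
qed

lemma gaussian_fourier_scaled:
  fixes x :: "real^2" and n :: real
  assumes n: "n > 0"
  shows "integrable lborel (\<lambda>\<xi>. cis (- (x \<bullet> \<xi>)) * of_real (gaussian (\<xi> /\<^sub>R n)))"
    "(LINT \<xi>|lborel. cis (- (x \<bullet> \<xi>)) * of_real (gaussian (\<xi> /\<^sub>R n))) = of_real (2 * pi * n\<^sup>2 * gaussian (n *\<^sub>R x))"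
proof -
  have 1: "cis (- (x \<bullet> \<xi>)) * of_real (gaussian (\<xi> /\<^sub>R n)) =
     cis (- ((n *\<^sub>R x) \<bullet> (inverse n *\<^sub>R \<xi>))) * of_real (gaussian (inverse n *\<^sub>R \<xi>))" for \<xi>
    using n by (simp add: mult.assoc[symmetric])
  note g = gaussian_fourier[of "n *\<^sub>R x"]
  show "integrable lborel (\<lambda>\<xi>. cis (- (x \<bullet> \<xi>)) * of_real (gaussian (\<xi> /\<^sub>R n)))"
    unfolding 1 by (rule lborel_integrable_scale(1)[OF g(1)]) (use n in auto)
  have "of_real (sqrt (2 * pi) ^ DIM(real^2) * gaussian (n *\<^sub>R x)) =
    \<bar>inverse n\<bar> ^ DIM(real^2) *\<^sub>R (LINT \<xi>|lborel. cis (- ((n *\<^sub>R x) \<bullet> (inverse n *\<^sub>R \<xi>))) * of_real (gaussian (inverse n *\<^sub>R \<xi>)))"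
    unfolding g(2)[symmetric] by (rule lborel_integrable_scale(2)[OF g(1)]) (use n in auto)
  hence eq: "of_real (2 * pi * gaussian (n *\<^sub>R x)) =
    of_real ((inverse n)\<^sup>2) * (LINT \<xi>|lborel. cis (- (x \<bullet> \<xi>)) * of_real (gaussian (\<xi> /\<^sub>R n)))" (is "_ = _ * ?J")
    unfolding 1[symmetric] using n by (simp add: scaleR_conv_of_real)
  have "complex_of_real (2 * pi * n\<^sup>2 * gaussian (n *\<^sub>R x)) = of_real (n\<^sup>2) * of_real (2 * pi * gaussian (n *\<^sub>R x))"
    by simp
  also have "\<dots> = of_real (n\<^sup>2 * (inverse n)\<^sup>2) * ?J" unfolding eq by simp
  also have "n\<^sup>2 * (inverse n)\<^sup>2 = 1" using n by (simp add: field_simps)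
  finally show "?J = of_real (2 * pi * n\<^sup>2 * gaussian (n *\<^sub>R x))" by simp
qed

lemma integrable_gaussian_scaled:
  "n > 0 \<Longrightarrow> integrable lborel (\<lambda>\<xi>::real^2. gaussian (\<xi> /\<^sub>R n))"
  using lborel_integrable_scale(1)[OF integrable_gaussian, of "inverse n"] by simp

text \<open>Fourier inversion with a gaussian convergence factor. The multiplication formula moves
  the transform onto the factor, where it becomes a gaussian of width 1/n centred at x; rescaling
  leaves an average of f around x.\<close>

lemma gaussian_inversion:
  fixes f :: "real^2 \<Rightarrow> real" and n :: real
  assumes f: "integrable lborel f" and n: "n > 0"
  shows "(LINT \<xi>|lborel. ft f \<xi> * (cis (x \<bullet> \<xi>) * of_real (gaussian (\<xi> /\<^sub>R n))))
    = of_real (2 * pi * (LINT z|lborel. f (x + z /\<^sub>R n) * gaussian z))"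
proof -
  have [measurable]: "f \<in> borel_measurable borel" using borel_measurable_integrable[OF f] by simp
  have ig: "integrable lborel (\<lambda>\<xi>. cis (x \<bullet> \<xi>) * (of_real (gaussian (\<xi> /\<^sub>R n)) :: complex))"
    using gaussian_fourier_scaled(1)[OF n, of "-x"] by simp
  have fg: "integrable lborel (\<lambda>y. f y * gaussian (n *\<^sub>R (y - x)))"
    using integrable_bounded_mult[OF f, of "\<lambda>y. gaussian (n *\<^sub>R (y - x))" 1] by (simp add: mult.commute)
  hence fg1: "integrable lborel (\<lambda>y. f (y + x) * gaussian (n *\<^sub>R (y + x - x)))"
    by (rule lborel_integrable_shift(1))
  have "(LINT \<xi>|lborel. ft f \<xi> * (cis (x \<bullet> \<xi>) * of_real (gaussian (\<xi> /\<^sub>R n)))) =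
    (LINT y|lborel. of_real (f y) * (LINT \<xi>|lborel. cis (- (y \<bullet> \<xi>)) * (cis (x \<bullet> \<xi>) * of_real (gaussian (\<xi> /\<^sub>R n)))))"
    by (rule integral_ft_mult[OF f ig])
  also have "\<dots> = (LINT y|lborel. of_real (2 * pi * n\<^sup>2 * (f y * gaussian (n *\<^sub>R (y - x)))))"
  proof (rule Bochner_Integration.integral_cong[OF refl])
    fix y
    have "(LINT \<xi>|lborel. cis (- (y \<bullet> \<xi>)) * (cis (x \<bullet> \<xi>) * of_real (gaussian (\<xi> /\<^sub>R n)))) =
       (LINT \<xi>|lborel. cis (- ((y - x) \<bullet> \<xi>)) * of_real (gaussian (\<xi> /\<^sub>R n)))"
      by (simp add: mult.assoc[symmetric] cis_mult inner_diff_left)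
    thus "of_real (f y) * (LINT \<xi>|lborel. cis (- (y \<bullet> \<xi>)) * (cis (x \<bullet> \<xi>) * of_real (gaussian (\<xi> /\<^sub>R n)))) =
      of_real (2 * pi * n\<^sup>2 * (f y * gaussian (n *\<^sub>R (y - x))))"
      by (simp add: gaussian_fourier_scaled(2)[OF n])
  qed
  also have "\<dots> = of_real (2 * pi * n\<^sup>2 * (LINT y|lborel. f y * gaussian (n *\<^sub>R (y - x))))"
    unfolding integral_complex_of_real by simp
  also have "(LINT y|lborel. f y * gaussian (n *\<^sub>R (y - x))) = (LINT y|lborel. f (y + x) * gaussian (n *\<^sub>R (y + x - x)))"
    by (rule lborel_integrable_shift(2)[symmetric, OF fg])
  also have "\<dots> = \<bar>inverse n\<bar> ^ DIM(real^2) *\<^sub>R (LINT z|lborel. f (inverse n *\<^sub>R z + x) * gaussian (n *\<^sub>R (inverse n *\<^sub>R z + x - x)))"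
    by (rule lborel_integrable_scale(2)[OF fg1]) (use n in auto)
  also have "2 * pi * n\<^sup>2 * \<dots> = 2 * pi * (LINT z|lborel. f (x + z /\<^sub>R n) * gaussian z)"
    using n by (simp add: add.commute power2_eq_square field_simps)
  finally show ?thesis .
qed

text \<open>Injectivity on L1. By regularised inversion every gaussian average of f vanishes, so
  f(x) times the gaussian mass is minus the average of f(x + z/n) - f(x). Integrating absolute
  values in x bounds the L1 norm of f by an average of translation errors, which tends to 0.\<close>

lemma ft_eq_0_imp_AE_0:
  fixes f :: "real^2 \<Rightarrow> real"
  assumes f: "integrable lborel f" and 0: "\<And>\<xi>. ft f \<xi> = 0"
  shows "AE x in lborel. f x = 0"
proof -
  have [measurable]: "f \<in> borel_measurable borel" using borel_measurable_integrable[OF f] by simp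
  define w where "w n z = (LINT x|lborel. \<bar>f (x + z /\<^sub>R real (Suc n)) - f x\<bar>)" for n z
  define I where "I = (LINT z|lborel. gaussian (z :: real^2))"
  have I: "I = 2 * pi" by (simp add: I_def integral_gaussian)
  have wle: "w n z \<le> 2 * (LINT x|lborel. \<bar>f x\<bar>)" for n z
  proof -
    note s = lborel_integrable_shift[OF f, of "z /\<^sub>R real (Suc n)"]
      lborel_integrable_shift(2)[OF integrable_abs[OF f], of "z /\<^sub>R real (Suc n)"]
    have "w n z \<le> (LINT x|lborel. \<bar>f (x + z /\<^sub>R real (Suc n))\<bar> + \<bar>f x\<bar>)"
      unfolding w_def by (rule integral_mono) (use s f in auto)
    also have "\<dots> = 2 * (LINT x|lborel. \<bar>f x\<bar>)" using s f by simp
    finally show ?thesis .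
  qed
  have w0: "w n z \<ge> 0" for n z by (simp add: w_def)
  have [measurable]: "w n \<in> borel_measurable borel" for n unfolding w_def by measurable
  have lim: "(\<lambda>n. LINT z|lborel. gaussian z * w n z) \<longlonglongrightarrow> (LINT z::real^2|lborel. 0)"
  proof (rule integral_dominated_convergence[where w="\<lambda>z. gaussian z * (2 * (LINT x|lborel. \<bar>f x\<bar>))"])
    show "AE z in lborel. (\<lambda>n. gaussian z * w n z) \<longlonglongrightarrow> 0"
    proof (rule AE_I2)
      fix z :: "real^2"
      have "(\<lambda>n. inverse (real (Suc n)) *\<^sub>R z) \<longlonglongrightarrow> 0 *\<^sub>R z"
        by (intro tendsto_scaleR LIMSEQ_inverse_real_of_nat tendsto_const)
      hence "(\<lambda>n. z /\<^sub>R real (Suc n)) \<longlonglongrightarrow> 0" by simp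
      from tendsto_L1_translation[OF f this] have "(\<lambda>n. w n z) \<longlonglongrightarrow> 0" by (simp add: w_def)
      from tendsto_mult_left[OF this, of "gaussian z"] show "(\<lambda>n. gaussian z * w n z) \<longlonglongrightarrow> 0" by simp
    qed
    show "AE z in lborel. norm (gaussian z * w n z) \<le> gaussian z * (2 * (LINT x|lborel. \<bar>f x\<bar>))" for n
      using wle w0 by (auto simp: abs_mult intro!: AE_I2 mult_left_mono)
  qed (auto intro: integrable_gaussian)
  have "(LINT x|lborel. \<bar>f x\<bar>) * I \<le> (LINT z|lborel. gaussian z * w n z)" for n
  proof -
    define K where "K x z = gaussian z * (f (x + z /\<^sub>R real (Suc n)) - f x)" for x z :: "real^2"
    have [measurable]: "case_prod K \<in> borel_measurable (lborel \<Otimes>\<^sub>M lborel)" unfolding K_def by measurable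
    have n1: "(LINT x|lborel. norm (K x z)) = gaussian z * w n z" for z by (simp add: K_def w_def abs_mult)
    have iw: "integrable lborel (\<lambda>z. gaussian z * w n z)"
      by (rule Bochner_Integration.integrable_bound[of _ "\<lambda>z. gaussian z * (2 * (LINT x|lborel. \<bar>f x\<bar>))"])
         (use wle w0 in \<open>auto simp: abs_mult integrable_gaussian intro!: AE_I2 mult_left_mono\<close>)
    have "integrable (lborel \<Otimes>\<^sub>M lborel) (\<lambda>(z, x). K x z)"
    proof (rule lborel_pair.Fubini_integrable)
      show "integrable lborel (\<lambda>z. LINT x|lborel. norm (case (z, x) of (z, x) \<Rightarrow> K x z))" using iw by (simp only: n1 split_conv)
      show "AE z in lborel. integrable lborel (\<lambda>x. case (z, x) of (z, x) \<Rightarrow> K x z)"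
        using lborel_integrable_shift(1)[OF f] f by (simp add: K_def)
    qed measurable
    hence iK: "integrable (lborel \<Otimes>\<^sub>M lborel) (\<lambda>(z, x). norm (K x z))"
      by (simp add: split_def)
    from lborel_pair.integrable_product_swap[OF iK] have iK': "integrable (lborel \<Otimes>\<^sub>M lborel) (\<lambda>(x, z). norm (K x z))"
      by (simp add: split_def)
    have K0: "\<bar>f x\<bar> * I \<le> (LINT z|lborel. norm (K x z))" if "integrable lborel (K x)" for x
    proof -
      have n: "real (Suc n) > 0" by simp
      have "(LINT z|lborel. f (x + z /\<^sub>R real (Suc n)) * gaussian z) = 0"
        using gaussian_inversion[OF f n, of x] 0 by simp
      moreover have ifg: "integrable lborel (\<lambda>z. f (x + z /\<^sub>R real (Suc n)) * gaussian z)"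
      proof -
        have "integrable lborel (\<lambda>z. K x z + gaussian z * f x)"
          using that integrable_gaussian by (intro Bochner_Integration.integrable_add) auto
        thus ?thesis by (simp add: K_def algebra_simps)
      qed
      moreover have "K x = (\<lambda>z. f (x + z /\<^sub>R real (Suc n)) * gaussian z - f x * gaussian z)"
        by (auto simp: K_def algebra_simps)
      ultimately have "(LINT z|lborel. K x z) = - f x * I"
        by (simp add: I_def integrable_gaussian)
      hence "\<bar>f x\<bar> * I = norm (LINT z|lborel. K x z)" using I by (simp add: abs_mult)
      also have "\<dots> \<le> (LINT z|lborel. norm (K x z))" by (rule integral_norm_bound)
      finally show ?thesis .
    qed
    have "(LINT x|lborel. \<bar>f x\<bar> * I) \<le> (LINT x|lborel. LINT z|lborel. norm (K x z))"
    proof (rule integral_mono_AE)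
      show "integrable lborel (\<lambda>x. \<bar>f x\<bar> * I)" using f by simp
      show "integrable lborel (\<lambda>x. LINT z|lborel. norm (K x z))"
        using lborel_pair.integrable_fst'[OF iK'] by simp
      have "AE x in lborel. integrable lborel (\<lambda>z. norm (K x z))"
        using lborel_pair.AE_integrable_fst'[OF iK'] by simp
      thus "AE x in lborel. \<bar>f x\<bar> * I \<le> (LINT z|lborel. norm (K x z))"
      proof eventually_elim
        case (elim x)
        have "integrable lborel (K x)" using elim by (subst (asm) integrable_norm_iff) (auto simp: K_def)
        thus ?case by (rule K0)
      qed
    qed
    also have "\<dots> = (LINT z|lborel. LINT x|lborel. norm (K x z))"
      using lborel_pair.Fubini_integral[OF iK'] by simp
    finally show ?thesis by (simp only: n1 integral_mult_left_zero)
  qed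
  hence "(LINT x|lborel. \<bar>f x\<bar>) * I \<le> 0" using lim by (intro LIMSEQ_le_const[of _ 0]) auto
  hence "(LINT x|lborel. \<bar>f x\<bar>) \<le> 0" using I pi_gt_zero by (auto simp: mult_le_0_iff not_le[symmetric])
  hence "(LINT x|lborel. \<bar>f x\<bar>) = 0" by (simp add: antisym)
  thus ?thesis using integral_nonneg_eq_0_iff_AE[OF integrable_abs[OF f]] by simp
qed

text \<open>A wide gaussian makes all integrals absolutely convergent. Inversion then turns the
  regularised energy \<open>L n\<close> into 2 pi times a gaussian average of the autocorrelation of
  f, which is continuous at 0 with value the squared L2 norm. One factor 2 pi comes from inversion,
  the other from the gaussian mass.\<close>

lemma plancherel_integrable:
  fixes f :: "real^2 \<Rightarrow> real"
  assumes f: "integrable lborel f" and f2: "square_integrable f"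
  shows "square_integrable (ft f)" "l2_norm (ft f) = 2 * pi * l2_norm f"
proof -
  have [measurable]: "f \<in> borel_measurable borel" using borel_measurable_integrable[OF f] by simp
  define A where "A = (l2_norm f)\<^sup>2"
  define c where "c n z = (LINT x|lborel. f x * f (x + z /\<^sub>R real (Suc n)))" for n z
  define L where "L n = (LINT \<xi>|lborel. (cmod (ft f \<xi>))\<^sup>2 * gaussian (\<xi> /\<^sub>R real (Suc n)))" for n
  note I = integral_gaussian
  have [measurable]: "c n \<in> borel_measurable borel" for n unfolding c_def by measurable
  note sh = square_integrable_shift[OF f2]
  have cle: "(LINT x|lborel. norm (f x) * norm (f (x + h))) \<le> A" for h
    using integral_norm_mult_le[OF f2 sh(1)[of h]] by (simp add: A_def power2_eq_square sh(2))
  have iff: "integrable lborel (\<lambda>x. f x * f (x + h))" for h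
    using integrable_norm_mult[OF f2 sh(1)[of h]]
    by (rule Bochner_Integration.integrable_bound) (auto simp: abs_mult)
  have c_le: "\<bar>c n z\<bar> \<le> A" for n z
  proof -
    have "\<bar>c n z\<bar> \<le> (LINT x|lborel. norm (f x * f (x + z /\<^sub>R real (Suc n))))"
      unfolding c_def real_norm_def[symmetric] by (rule integral_norm_bound)
    thus ?thesis using cle[of "z /\<^sub>R real (Suc n)"] by (simp add: abs_mult)
  qed
  have c_lim: "(\<lambda>n. c n z) \<longlonglongrightarrow> A" for z
  proof -
    have "(\<lambda>n. inverse (real (Suc n)) *\<^sub>R z) \<longlonglongrightarrow> 0 *\<^sub>R z"
      by (intro tendsto_scaleR LIMSEQ_inverse_real_of_nat tendsto_const)
    hence h: "(\<lambda>n. z /\<^sub>R real (Suc n)) \<longlonglongrightarrow> 0" by simp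
    have lim: "(\<lambda>n. l2_norm f * l2_norm (\<lambda>x. f (x + z /\<^sub>R real (Suc n)) - f x)) \<longlonglongrightarrow> 0"
      using tendsto_mult_left[OF tendsto_l2_translation[OF f2 h], of "l2_norm f"] by simp
    have A: "A = (LINT x|lborel. f x * f x)" by (simp add: A_def l2_norm_power2) (simp add: power2_eq_square)
    have "norm (c n z - A) \<le> l2_norm f * l2_norm (\<lambda>x. f (x + z /\<^sub>R real (Suc n)) - f x)" for n
    proof -
      have sd: "square_integrable (\<lambda>x. f (x + z /\<^sub>R real (Suc n)) - f x)"
        by (intro square_integrable_diff sh f2)
      have "c n z - A = (LINT x|lborel. f x * (f (x + z /\<^sub>R real (Suc n)) - f x))"
        using iff[of "z /\<^sub>R real (Suc n)"] iff[of 0] by (simp add: A c_def right_diff_distrib)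
      also have "norm \<dots> \<le> (LINT x|lborel. norm (f x * (f (x + z /\<^sub>R real (Suc n)) - f x)))"
        by (rule integral_norm_bound)
      also have "\<dots> \<le> l2_norm f * l2_norm (\<lambda>x. f (x + z /\<^sub>R real (Suc n)) - f x)"
        using integral_norm_mult_le[OF f2 sd] by (simp add: abs_mult)
      finally show ?thesis .
    qed
    hence "(\<lambda>n. c n z - A) \<longlonglongrightarrow> 0" by (intro Lim_null_comparison[OF _ lim]) auto
    thus ?thesis by (simp add: LIM_zero_iff)
  qed
  have ftb: "cmod (ft f \<xi>) \<le> (LINT x|lborel. \<bar>f x\<bar>)" for \<xi> by (rule norm_ft_le)
  have iL: "integrable lborel (\<lambda>\<xi>. (cmod (ft f \<xi>))\<^sup>2 * gaussian (\<xi> /\<^sub>R real (Suc n)))" for n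
    by (rule integrable_bounded_mult[where c="(LINT x|lborel. \<bar>f x\<bar>)\<^sup>2"])
       (use ftb in \<open>auto intro!: integrable_gaussian_scaled power_mono\<close>)
  have L_eq: "L n = 2 * pi * (LINT z|lborel. gaussian z * c n z)" for n
  proof -
    have n: "real (Suc n) > 0" by simp
    define g where "g \<xi> = cnj (ft f \<xi>) * of_real (gaussian (\<xi> /\<^sub>R real (Suc n)))" for \<xi>
    have ig: "integrable lborel g"
      unfolding g_def by (rule integrable_bounded_mult[where c="(LINT x|lborel. \<bar>f x\<bar>)"])
       (use ftb integrable_gaussian_scaled[OF n] in auto)
    have inner: "(LINT \<xi>|lborel. cis (- (x \<bullet> \<xi>)) * g \<xi>) = of_real (2 * pi * (LINT z|lborel. f (x + z /\<^sub>R real (Suc n)) * gaussian z))" for x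
    proof -
      have "(LINT \<xi>|lborel. cis (- (x \<bullet> \<xi>)) * g \<xi>) =
         (LINT \<xi>|lborel. cnj (ft f \<xi> * (cis (x \<bullet> \<xi>) * of_real (gaussian (\<xi> /\<^sub>R real (Suc n))))))"
        by (simp add: g_def cis_cnj mult_ac)
      also have "\<dots> = cnj (LINT \<xi>|lborel. ft f \<xi> * (cis (x \<bullet> \<xi>) * of_real (gaussian (\<xi> /\<^sub>R real (Suc n)))))"
      proof (rule integral_bounded_linear[OF bounded_linear_cnj])
        have "integrable lborel (\<lambda>\<xi>. cis (x \<bullet> \<xi>) * (of_real (gaussian (\<xi> /\<^sub>R real (Suc n))) :: complex))"
          using gaussian_fourier_scaled(1)[OF n, of "-x"] by simp
        thus "integrable lborel (\<lambda>\<xi>. ft f \<xi> * (cis (x \<bullet> \<xi>) * of_real (gaussian (\<xi> /\<^sub>R real (Suc n)))))"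
          by (rule integrable_bounded_mult[where c="(LINT x|lborel. \<bar>f x\<bar>)"]) (use ftb in auto)
      qed
      also have "\<dots> = of_real (2 * pi * (LINT z|lborel. f (x + z /\<^sub>R real (Suc n)) * gaussian z))"
        by (subst gaussian_inversion[OF f n]) simp
      finally show ?thesis .
    qed
    define K where "K z x = gaussian z * (f x * f (x + z /\<^sub>R real (Suc n)))" for x z :: "real^2"
    have [measurable]: "case_prod K \<in> borel_measurable (lborel \<Otimes>\<^sub>M lborel)" unfolding K_def by measurable
    have iK: "integrable (lborel \<Otimes>\<^sub>M lborel) (case_prod K)"
    proof (rule lborel_pair.Fubini_integrable)
      show "integrable lborel (\<lambda>z. LINT x|lborel. norm (case_prod K (z, x)))"
      proof (rule Bochner_Integration.integrable_bound)
        show "integrable lborel (\<lambda>z::real^2. gaussian z * A)" by (simp add: integrable_gaussian)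
        show "AE z in lborel. norm (LINT x|lborel. norm (case_prod K (z, x))) \<le> norm (gaussian z * A)"
          using cle by (auto simp: K_def abs_mult A_def intro!: AE_I2 mult_left_mono)
      qed measurable
      show "AE z in lborel. integrable lborel (\<lambda>x. case_prod K (z, x))" using iff by (simp add: K_def)
    qed measurable
    have "of_real (L n) = (LINT \<xi>|lborel. ft f \<xi> * g \<xi>)"
      unfolding L_def integral_complex_of_real[symmetric]
      by (simp only: g_def of_real_mult complex_norm_square mult.assoc)
    also have "\<dots> = (LINT x|lborel. of_real (f x) * (LINT \<xi>|lborel. cis (- (x \<bullet> \<xi>)) * g \<xi>))"
      by (rule integral_ft_mult[OF f ig])
    also have "\<dots> = (LINT x|lborel. of_real (2 * pi * (LINT z|lborel. K z x)))"
    proof (rule Bochner_Integration.integral_cong[OF refl])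
      fix x
      have "(LINT z|lborel. K z x) = (LINT z|lborel. f x * (f (x + z /\<^sub>R real (Suc n)) * gaussian z))"
        by (rule Bochner_Integration.integral_cong) (auto simp: K_def)
      thus "of_real (f x) * (LINT \<xi>|lborel. cis (- (x \<bullet> \<xi>)) * g \<xi>) = of_real (2 * pi * (LINT z|lborel. K z x))"
        unfolding inner integral_mult_right_zero by simp
    qed
    also have "\<dots> = of_real (2 * pi * (LINT x|lborel. LINT z|lborel. K z x))" by simp
    also have "(LINT x|lborel. LINT z|lborel. K z x) = (LINT z|lborel. LINT x|lborel. K z x)"
      by (rule lborel_pair.Fubini_integral[OF iK])
    also have "\<dots> = (LINT z|lborel. gaussian z * c n z)" by (simp add: K_def c_def)
    finally show ?thesis by (simp only: of_real_eq_iff)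
  qed
  have "(\<lambda>n. LINT z|lborel. gaussian z * c n z) \<longlonglongrightarrow> (LINT z|lborel. gaussian (z::real^2) * A)"
  proof (rule integral_dominated_convergence[where w="\<lambda>z. gaussian z * A"])
    show "AE z in lborel. (\<lambda>n. gaussian z * c n z) \<longlonglongrightarrow> gaussian z * A"
      by (intro AE_I2 tendsto_intros c_lim)
    show "AE z in lborel. norm (gaussian z * c n z) \<le> gaussian z * A" for n
      using c_le by (auto simp: abs_mult intro!: AE_I2 mult_left_mono)
  qed (auto simp: integrable_gaussian)
  hence "(\<lambda>n. 2 * pi * (LINT z|lborel. gaussian z * c n z)) \<longlonglongrightarrow> 2 * pi * (2 * pi * A)"
    by (intro tendsto_mult_left) (simp add: I)
  hence Llim: "L \<longlonglongrightarrow> (2 * pi * l2_norm f)\<^sup>2" by (simp only: L_eq[abs_def] A_def power2_eq_square mult_ac)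
  \<comment> \<open>Integrability of the squared transform is not known yet, so the convergence
    factor is removed by Fatou, which gives square integrability and the upper bound together. Only
    then can \<open>L n\<close> be compared with the full integral, which gives the lower
    bound.\<close>
  have glim: "(\<lambda>n. gaussian (\<xi> /\<^sub>R real (Suc n))) \<longlonglongrightarrow> 1" for \<xi> :: "real^2"
  proof -
    have "(\<lambda>n. inverse (real (Suc n)) *\<^sub>R \<xi>) \<longlonglongrightarrow> 0 *\<^sub>R \<xi>"
      by (intro tendsto_scaleR LIMSEQ_inverse_real_of_nat tendsto_const)
    hence "(\<lambda>n. exp (- (norm (inverse (real (Suc n)) *\<^sub>R \<xi>))\<^sup>2 / 2)) \<longlonglongrightarrow> exp (- (norm (0 *\<^sub>R \<xi>))\<^sup>2 / 2)"
      by (intro tendsto_exp tendsto_divide tendsto_minus tendsto_power tendsto_norm tendsto_const) auto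
    thus ?thesis by (simp add: gaussian_def)
  qed
  have "(\<integral>\<^sup>+\<xi>. ennreal ((norm (ft f \<xi>))\<^sup>2) \<partial>lborel)
     = (\<integral>\<^sup>+\<xi>. liminf (\<lambda>n. ennreal ((norm (ft f \<xi>))\<^sup>2 * gaussian (\<xi> /\<^sub>R real (Suc n)))) \<partial>lborel)"
  proof (rule nn_integral_cong)
    fix \<xi>
    have "(\<lambda>n. ennreal ((norm (ft f \<xi>))\<^sup>2 * gaussian (\<xi> /\<^sub>R real (Suc n)))) \<longlonglongrightarrow> ennreal ((norm (ft f \<xi>))\<^sup>2 * 1)"
      by (intro tendsto_ennrealI tendsto_mult_left glim)
    thus "ennreal ((norm (ft f \<xi>))\<^sup>2) = liminf (\<lambda>n. ennreal ((norm (ft f \<xi>))\<^sup>2 * gaussian (\<xi> /\<^sub>R real (Suc n))))"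
      by (intro lim_imp_Liminf[symmetric]) simp_all
  qed
  also have "\<dots> \<le> liminf (\<lambda>n. \<integral>\<^sup>+\<xi>. ennreal ((norm (ft f \<xi>))\<^sup>2 * gaussian (\<xi> /\<^sub>R real (Suc n))) \<partial>lborel)"
    by (rule nn_integral_liminf) measurable
  also have "(\<lambda>n. \<integral>\<^sup>+\<xi>. ennreal ((norm (ft f \<xi>))\<^sup>2 * gaussian (\<xi> /\<^sub>R real (Suc n))) \<partial>lborel) = (\<lambda>n. ennreal (L n))"
    unfolding L_def by (intro ext nn_integral_eq_integral iL) auto
  also have "liminf (\<lambda>n. ennreal (L n)) = ennreal ((2 * pi * l2_norm f)\<^sup>2)"
    by (intro lim_imp_Liminf tendsto_ennrealI Llim) simp
  finally have "(\<integral>\<^sup>+\<xi>. ennreal ((norm (ft f \<xi>))\<^sup>2) \<partial>lborel) \<le> ennreal ((2 * pi * l2_norm f)\<^sup>2)" .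
  note sq = square_integrableI_nn[OF _ this]
  show s: "square_integrable (ft f)" by (rule sq) auto
  have le: "l2_norm (ft f) \<le> 2 * pi * l2_norm f" by (rule sq) auto
  have "L n \<le> (l2_norm (ft f))\<^sup>2" for n
    unfolding l2_norm_power2 L_def using s
    by (intro integral_mono iL) (auto simp: square_integrable_def mult_left_le)
  hence "(2 * pi * l2_norm f)\<^sup>2 \<le> (l2_norm (ft f))\<^sup>2" by (intro LIMSEQ_le_const2[OF Llim]) auto
  hence "2 * pi * l2_norm f \<le> l2_norm (ft f)" by (rule power2_le_imp_le) simp
  thus "l2_norm (ft f) = 2 * pi * l2_norm f" using le by simp
qed

section \<open>The Fourier transform on \<open>L\<^sup>2\<close>\<close>

text \<open>The cutoff in Plancherel's definition: it brings an L2 function into L1, where the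
  transform is an integral.\<close>

definition trunc :: "real \<Rightarrow> (real^2 \<Rightarrow> real) \<Rightarrow> real^2 \<Rightarrow> real" where
  "trunc R f x = indicator (cball 0 R) x * f x"

lemma measurable_cball [measurable]: "cball (a::'a::euclidean_space) r \<in> sets borel"
  by (rule borel_closed) simp

lemma square_integrable_indicator_cball:
  "square_integrable (\<lambda>\<xi>. indicator (cball (0::real^2) R) \<xi> :: real)"
proof -
  have "(\<lambda>x::real^2. (norm (indicator (cball 0 R) x :: real))\<^sup>2) = indicator (cball 0 R)"
    by (auto simp: indicator_def)
  thus ?thesis
    using emeasure_lborel_cball_finite[of "0::real^2" R] by (simp add: square_integrable_def borel_measurable_indicator)
qed

text \<open>On bounded sets L2 lies in L1, by Cauchy-Schwarz against the indicator of a
  ball.\<close>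

lemma integrable_if_bounded_support:
  assumes f: "square_integrable f" and K: "\<And>x. norm x > R \<Longrightarrow> f x = (0::real)"
  shows "integrable lborel f"
proof -
  note [measurable] = square_integrable_measurable[OF f]
  show ?thesis
    by (rule Bochner_Integration.integrable_bound[OF integrable_norm_mult[OF square_integrable_indicator_cball f]])
       (use K in \<open>auto intro!: AE_I2 simp: indicator_def not_le\<close>)
qed

lemma square_integrable_trunc:
  assumes "square_integrable f" shows "square_integrable (trunc R f)"
  unfolding trunc_def by (rule square_integrable_cmult_bounded[OF assms, where c=1]) (auto simp: indicator_def)

lemma integrable_trunc:
  assumes "square_integrable f" shows "integrable lborel (trunc R f)"
  by (rule integrable_if_bounded_support[OF square_integrable_trunc[OF assms], of R]) (auto simp: trunc_def)

lemma tendsto_trunc: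
  assumes f: "square_integrable f"
  shows "((\<lambda>R. l2_norm (\<lambda>x. trunc R f x - f x)) \<longlongrightarrow> 0) at_top"
proof -
  have [measurable]: "f \<in> borel_measurable borel" using square_integrable_measurable[OF f] by simp
  have "((\<lambda>R. LINT x|lborel. (norm (trunc R f x - f x))\<^sup>2) \<longlongrightarrow> (LINT x::real^2|lborel. 0)) at_top"
  proof (rule integral_dominated_convergence_at_top[where w="\<lambda>x. (norm (f x))\<^sup>2"])
    show "integrable lborel (\<lambda>x. (norm (f x))\<^sup>2)" by (rule square_integrable_integrable[OF f])
    show "\<forall>\<^sub>F R in at_top. AE x in lborel. norm ((norm (trunc R f x - f x))\<^sup>2) \<le> (norm (f x))\<^sup>2"
      by (intro always_eventually allI AE_I2) (auto simp: trunc_def indicator_def)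
    show "AE x in lborel. ((\<lambda>R. (norm (trunc R f x - f x))\<^sup>2) \<longlongrightarrow> 0) at_top"
    proof (intro AE_I2 tendsto_eventually)
      fix x :: "real^2"
      show "\<forall>\<^sub>F R in at_top. (norm (trunc R f x - f x))\<^sup>2 = 0"
        using eventually_ge_at_top[of "norm x"] by eventually_elim (simp add: trunc_def)
    qed
  qed (auto simp: trunc_def)
  from tendsto_real_sqrt[OF this] show ?thesis by (simp add: l2_norm_def)
qed

lemma tendsto_trunc_seq:
  assumes "square_integrable f"
  shows "(\<lambda>n. l2_norm (\<lambda>x. trunc (real n) f x - f x)) \<longlonglongrightarrow> 0"
  by (rule filterlim_compose[OF tendsto_trunc[OF assms] filterlim_real_sequentially])

lemma l2_norm_ft_diff:
  assumes "square_integrable f" "integrable lborel f" "square_integrable g" "integrable lborel g"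
  shows "l2_norm (\<lambda>\<xi>. ft f \<xi> - ft g \<xi>) = 2 * pi * l2_norm (\<lambda>x. f x - g x)"
  using plancherel_integrable(2)[of "\<lambda>x. f x - g x"] assms square_integrable_diff[OF assms(1,3)]
  by (simp add: ft_diff[OF assms(2,4), abs_def])

lemma fourier_exists:
  assumes f: "square_integrable f"
  shows "\<exists>g. square_integrable g \<and> ((\<lambda>R. l2_norm (\<lambda>\<xi>. ft (trunc R f) \<xi> - g \<xi>)) \<longlongrightarrow> 0) at_top"
proof -
  note st = square_integrable_trunc[OF f] and it = integrable_trunc[OF f]
  note sft = plancherel_integrable(1)[OF it st]
  have d: "l2_norm (\<lambda>\<xi>. ft (trunc R f) \<xi> - ft (trunc S f) \<xi>)
     \<le> 2 * pi * (l2_norm (\<lambda>x. trunc R f x - f x) + l2_norm (\<lambda>x. trunc S f x - f x))" for R S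
    unfolding l2_norm_ft_diff[OF st it st it]
    using l2_norm_triangle3[OF st f st, of R S] l2_norm_minus_commute[of f "trunc S f"]
    by (intro mult_left_mono) auto
  have "\<exists>N. \<forall>m\<ge>N. \<forall>n\<ge>N. l2_norm (\<lambda>\<xi>. ft (trunc (real m) f) \<xi> - ft (trunc (real n) f) \<xi>) < e" if "e > 0" for e
  proof -
    have "e / (4 * pi) > 0" using that by simp
    then obtain N where N: "\<And>n. n \<ge> N \<Longrightarrow> l2_norm (\<lambda>x. trunc (real n) f x - f x) < e / (4 * pi)"
      using LIMSEQ_D[OF tendsto_trunc_seq[OF f], of "e / (4 * pi)"] by auto
    have "l2_norm (\<lambda>\<xi>. ft (trunc (real m) f) \<xi> - ft (trunc (real n) f) \<xi>) < e" if "m \<ge> N" "n \<ge> N" for m n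
    proof -
      have "2 * pi * (l2_norm (\<lambda>x. trunc m f x - f x) + l2_norm (\<lambda>x. trunc n f x - f x))
         < 2 * pi * (e / (4 * pi) + e / (4 * pi))"
        using N[OF that(1)] N[OF that(2)] by (intro mult_strict_left_mono add_strict_mono) auto
      also have "\<dots> = e" by simp
      finally show ?thesis using d[of m n] by simp
    qed
    thus ?thesis by blast
  qed
  then obtain g where g: "square_integrable g" "(\<lambda>n. l2_norm (\<lambda>\<xi>. ft (trunc (real n) f) \<xi> - g \<xi>)) \<longlonglongrightarrow> 0"
    by (rule l2_complete[OF sft])
  \<comment> \<open>Completeness was applied along integer radii. Letting n grow in the triangle
    inequality gives an error bound for every real radius R, as the definition of
    \<open>fourier\<close> requires.\<close>
  have "l2_norm (\<lambda>\<xi>. ft (trunc R f) \<xi> - g \<xi>) \<le> 2 * pi * l2_norm (\<lambda>x. trunc R f x - f x)" for R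
  proof -
    have lim: "(\<lambda>n. 2 * pi * (l2_norm (\<lambda>x. trunc R f x - f x) + l2_norm (\<lambda>x. trunc (real n) f x - f x))
        + l2_norm (\<lambda>\<xi>. ft (trunc (real n) f) \<xi> - g \<xi>)) \<longlonglongrightarrow> 2 * pi * (l2_norm (\<lambda>x. trunc R f x - f x) + 0) + 0"
      by (intro tendsto_intros g tendsto_trunc_seq f)
    have "l2_norm (\<lambda>\<xi>. ft (trunc R f) \<xi> - g \<xi>) \<le> 2 * pi * (l2_norm (\<lambda>x. trunc R f x - f x)
       + l2_norm (\<lambda>x. trunc (real n) f x - f x)) + l2_norm (\<lambda>\<xi>. ft (trunc (real n) f) \<xi> - g \<xi>)" for n
      using l2_norm_triangle3[OF sft sft g(1), of R "real n"] d[of R "real n"] by linarith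
    thus ?thesis by (intro LIMSEQ_le_const[OF lim[simplified]]) auto
  qed
  hence "((\<lambda>R. l2_norm (\<lambda>\<xi>. ft (trunc R f) \<xi> - g \<xi>)) \<longlongrightarrow> 0) at_top"
    by (intro Lim_null_comparison[OF always_eventually tendsto_mult_left[OF tendsto_trunc[OF f], of "2 * pi", simplified]]) simp
  thus ?thesis using g(1) by blast
qed

text \<open>\<open>l2_norm\<close> returns the default 0 when the square is not integrable, whereas
  the nonnegative integral in the definition of \<open>fourier\<close> is infinite there. Here the
  errors are square integrable, so the two notions of convergence agree.\<close>

lemma fourier_limit_iff:
  assumes f: "square_integrable f" and g: "square_integrable g"
  shows "((\<lambda>R. \<integral>\<^sup>+\<xi>. ennreal ((cmod ((LINT x:cball 0 R|lborel. cis (- (x \<bullet> \<xi>)) * of_real (f x)) - g \<xi>))\<^sup>2)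
        \<partial>lborel) \<longlongrightarrow> 0) at_top \<longleftrightarrow> ((\<lambda>R. l2_norm (\<lambda>\<xi>. ft (trunc R f) \<xi> - g \<xi>)) \<longlongrightarrow> 0) at_top"
    (is "?L \<longleftrightarrow> ?R")
proof -
  have eq: "(LINT x:cball 0 R|lborel. cis (- (x \<bullet> \<xi>)) * of_real (f x)) = ft (trunc R f) \<xi>" for R \<xi>
    unfolding set_lebesgue_integral_def ft_def trunc_def
    by (rule Bochner_Integration.integral_cong) (auto simp: indicator_def)
  have "(\<integral>\<^sup>+\<xi>. ennreal ((cmod (ft (trunc R f) \<xi> - g \<xi>))\<^sup>2) \<partial>lborel) = ennreal ((l2_norm (\<lambda>\<xi>. ft (trunc R f) \<xi> - g \<xi>))\<^sup>2)" for R
    by (intro nn_integral_l2_norm square_integrable_diff g plancherel_integrable integrable_trunc square_integrable_trunc f)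
  hence "?L \<longleftrightarrow> ((\<lambda>R. ennreal ((l2_norm (\<lambda>\<xi>. ft (trunc R f) \<xi> - g \<xi>))\<^sup>2)) \<longlongrightarrow> ennreal 0) at_top"
    unfolding eq by simp
  also have "\<dots> \<longleftrightarrow> ((\<lambda>R. (l2_norm (\<lambda>\<xi>. ft (trunc R f) \<xi> - g \<xi>))\<^sup>2) \<longlongrightarrow> 0) at_top"
    by (rule tendsto_ennreal_iff) auto
  also have "\<dots> \<longleftrightarrow> ?R"
  proof
    assume "((\<lambda>R. (l2_norm (\<lambda>\<xi>. ft (trunc R f) \<xi> - g \<xi>))\<^sup>2) \<longlongrightarrow> 0) at_top"
    from tendsto_real_sqrt[OF this] show ?R by simp
  next
    assume ?R
    from tendsto_power[OF this, of 2] show "((\<lambda>R. (l2_norm (\<lambda>\<xi>. ft (trunc R f) \<xi> - g \<xi>))\<^sup>2) \<longlongrightarrow> 0) at_top" by simp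
  qed
  finally show ?thesis .
qed

text \<open>Discharges the choice in \<open>fourier\<close>: a limit exists, so the chosen function
  is one. Since the limit is unique only up to null sets, the rules that follow hold almost
  everywhere.\<close>

lemma fourier_spec:
  assumes f: "square_integrable f"
  shows "square_integrable (fourier f)"
    "((\<lambda>R. l2_norm (\<lambda>\<xi>. ft (trunc R f) \<xi> - fourier f \<xi>)) \<longlongrightarrow> 0) at_top"
proof -
  obtain g where "square_integrable g" "((\<lambda>R. l2_norm (\<lambda>\<xi>. ft (trunc R f) \<xi> - g \<xi>)) \<longlongrightarrow> 0) at_top"
    using fourier_exists[OF f] by blast
  hence "\<exists>g. square_integrable g \<and> ((\<lambda>R. \<integral>\<^sup>+\<xi>. ennreal ((cmod ((LINT x:cball 0 R|lborel. cis (- (x \<bullet> \<xi>)) * of_real (f x)) - g \<xi>))\<^sup>2)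
        \<partial>lborel) \<longlongrightarrow> 0) at_top"
    using fourier_limit_iff[OF f] by blast
  from someI_ex[OF this, folded fourier_def]
  show "square_integrable (fourier f)" "((\<lambda>R. l2_norm (\<lambda>\<xi>. ft (trunc R f) \<xi> - fourier f \<xi>)) \<longlongrightarrow> 0) at_top"
    using fourier_limit_iff[OF f] by blast+
qed

text \<open>Plancherel for the difference of h and a truncation of f, in the limit of large radius.
  It frees later arguments from using truncations as the approximants.\<close>

lemma l2_norm_ft_fourier_le:
  assumes f: "square_integrable f" and h: "square_integrable h" "integrable lborel h"
  shows "l2_norm (\<lambda>\<xi>. ft h \<xi> - fourier f \<xi>) \<le> 2 * pi * l2_norm (\<lambda>x. h x - f x)"
proof -
  note st = square_integrable_trunc[OF f] and it = integrable_trunc[OF f]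
  have lim: "((\<lambda>R. 2 * pi * (l2_norm (\<lambda>x. h x - f x) + l2_norm (\<lambda>x. trunc R f x - f x))
     + l2_norm (\<lambda>\<xi>. ft (trunc R f) \<xi> - fourier f \<xi>)) \<longlongrightarrow> 2 * pi * (l2_norm (\<lambda>x. h x - f x) + 0) + 0) at_top"
    by (intro tendsto_intros tendsto_trunc fourier_spec f)
  have "l2_norm (\<lambda>\<xi>. ft h \<xi> - fourier f \<xi>) \<le> 2 * pi * (l2_norm (\<lambda>x. h x - f x) + l2_norm (\<lambda>x. trunc R f x - f x))
     + l2_norm (\<lambda>\<xi>. ft (trunc R f) \<xi> - fourier f \<xi>)" for R
  proof -
    have "l2_norm (\<lambda>\<xi>. ft h \<xi> - ft (trunc R f) \<xi>) \<le> 2 * pi * (l2_norm (\<lambda>x. h x - f x) + l2_norm (\<lambda>x. trunc R f x - f x))"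
      unfolding l2_norm_ft_diff[OF h st it]
      using l2_norm_triangle3[OF h(1) f st, of R] l2_norm_minus_commute[of f "trunc R f"]
      by (intro mult_left_mono) auto
    thus ?thesis
      using l2_norm_triangle3[OF plancherel_integrable(1)[OF h(2,1)] plancherel_integrable(1)[OF it st] fourier_spec(1)[OF f], of R]
      by linarith
  qed
  thus ?thesis by (intro tendsto_lowerbound[OF lim[simplified]] always_eventually) (auto simp: trivial_limit_at_top_linorder)
qed

lemma tendsto_ft_fourier:
  fixes h :: "'i \<Rightarrow> real^2 \<Rightarrow> real"
  assumes f: "square_integrable f" and h: "\<And>n. square_integrable (h n)" "\<And>n. integrable lborel (h n)"
    and lim: "((\<lambda>n. l2_norm (\<lambda>x. h n x - f x)) \<longlongrightarrow> 0) F"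
  shows "((\<lambda>n. l2_norm (\<lambda>\<xi>. ft (h n) \<xi> - fourier f \<xi>)) \<longlongrightarrow> 0) F"
  by (rule Lim_null_comparison[OF always_eventually tendsto_mult_left[OF lim, of "2 * pi", simplified]])
     (use l2_norm_ft_fourier_le[OF f h] in simp)

lemma plancherel:
  assumes f: "square_integrable f" shows "l2_norm (fourier f) = 2 * pi * l2_norm f"
proof -
  note st = square_integrable_trunc[OF f] and it = integrable_trunc[OF f]
  have "((\<lambda>R. l2_norm (ft (trunc R f))) \<longlongrightarrow> l2_norm (fourier f)) at_top"
    by (intro tendsto_l2_norm plancherel_integrable st it fourier_spec f)
  moreover have "((\<lambda>R. 2 * pi * l2_norm (trunc R f)) \<longlongrightarrow> 2 * pi * l2_norm f) at_top"
    by (intro tendsto_mult_left tendsto_l2_norm st f tendsto_trunc)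
  ultimately show ?thesis
    unfolding plancherel_integrable(2)[OF it st]
    by (rule tendsto_unique[rotated]) (simp add: trivial_limit_at_top_linorder)
qed

text \<open>To identify a transform it suffices to know the Fourier integrals of one approximating
  sequence in L1 and L2; the algebraic rules below apply this to combinations and shifts of
  truncations.\<close>

lemma fourier_eqI:
  fixes h :: "nat \<Rightarrow> real^2 \<Rightarrow> real"
  assumes f: "square_integrable f" and g: "square_integrable g"
    and h: "\<And>n. square_integrable (h n)" "\<And>n. integrable lborel (h n)"
    and lim: "(\<lambda>n. l2_norm (\<lambda>x. h n x - f x)) \<longlonglongrightarrow> 0"
    and lim': "(\<lambda>n. l2_norm (\<lambda>\<xi>. ft (h n) \<xi> - g \<xi>)) \<longlonglongrightarrow> 0"
  shows "AE \<xi> in lborel. fourier f \<xi> = g \<xi>"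
  by (rule AE_eq_if_l2_limit[OF _ _ _ _ tendsto_ft_fourier[OF f h lim] lim'])
     (use plancherel_integrable(1)[OF h(2,1)] fourier_spec[OF f] g in auto)

lemma fourier_eq_ft:
  assumes "square_integrable f" "integrable lborel f"
  shows "AE \<xi> in lborel. fourier f \<xi> = ft f \<xi>"
  by (rule fourier_eqI[where h="\<lambda>_. f"])
     (use assms plancherel_integrable(1)[OF assms(2,1)] in \<open>auto simp: l2_norm_def\<close>)

text \<open>An equality of functions, not merely almost everywhere: the integrals in the definition
  do not see null sets, so both choices are made from the same predicate.\<close>

lemma fourier_cong_AE:
  assumes "AE x in lborel. f x = g x" "f \<in> borel_measurable lborel" "g \<in> borel_measurable lborel"
  shows "fourier f = fourier g"
proof -
  have "(LINT x:cball 0 R|lborel. cis (- (x \<bullet> \<xi>)) * of_real (f x)) =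
    (LINT x:cball 0 R|lborel. cis (- (x \<bullet> \<xi>)) * of_real (g x))" for R \<xi>
  proof -
    have [measurable]: "f \<in> borel_measurable borel" "g \<in> borel_measurable borel" using assms by auto
    show ?thesis unfolding set_lebesgue_integral_def
      by (rule integral_cong_AE) (measurable, use assms(1) in auto)
  qed
  thus ?thesis unfolding fourier_def by simp
qed

section \<open>Linearity and shift rule for the transform on L2\<close>

lemma fourier_add:
  assumes f: "square_integrable f" and g: "square_integrable g"
  shows "AE \<xi> in lborel. fourier (\<lambda>x. f x + g x) \<xi> = fourier f \<xi> + fourier g \<xi>"
proof (rule fourier_eqI[where h="\<lambda>n x. trunc (real n) f x + trunc (real n) g x"])
  note t = square_integrable_trunc[OF f] square_integrable_trunc[OF g] integrable_trunc[OF f] integrable_trunc[OF g]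
  note s = plancherel_integrable(1)[OF t(3,1)] plancherel_integrable(1)[OF t(4,2)]
  show "(\<lambda>n. l2_norm (\<lambda>x. trunc (real n) f x + trunc (real n) g x - (f x + g x))) \<longlonglongrightarrow> 0"
  proof (rule Lim_null_comparison)
    show "(\<lambda>n. l2_norm (\<lambda>x. trunc (real n) f x - f x) + l2_norm (\<lambda>x. trunc (real n) g x - g x)) \<longlonglongrightarrow> 0"
      using tendsto_add[OF tendsto_trunc_seq[OF f] tendsto_trunc_seq[OF g]] by simp
    show "\<forall>\<^sub>F n in sequentially. norm (l2_norm (\<lambda>x. trunc (real n) f x + trunc (real n) g x - (f x + g x)))
       \<le> l2_norm (\<lambda>x. trunc (real n) f x - f x) + l2_norm (\<lambda>x. trunc (real n) g x - g x)"
      using l2_norm_triangle[OF square_integrable_diff[OF t(1) f] square_integrable_diff[OF t(2) g]]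
      by (simp add: algebra_simps)
  qed
  show "(\<lambda>n. l2_norm (\<lambda>\<xi>. ft (\<lambda>x. trunc (real n) f x + trunc (real n) g x) \<xi> - (fourier f \<xi> + fourier g \<xi>))) \<longlonglongrightarrow> 0"
  proof (rule Lim_null_comparison)
    show "(\<lambda>n. l2_norm (\<lambda>x. ft (trunc (real n) f) x - fourier f x) + l2_norm (\<lambda>x. ft (trunc (real n) g) x - fourier g x)) \<longlonglongrightarrow> 0"
      using tendsto_add[OF tendsto_ft_fourier[OF f t(1,3) tendsto_trunc_seq[OF f]] tendsto_ft_fourier[OF g t(2,4) tendsto_trunc_seq[OF g]]] by simp
    show "\<forall>\<^sub>F n in sequentially. norm (l2_norm (\<lambda>\<xi>. ft (\<lambda>x. trunc (real n) f x + trunc (real n) g x) \<xi> - (fourier f \<xi> + fourier g \<xi>)))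
       \<le> l2_norm (\<lambda>x. ft (trunc (real n) f) x - fourier f x) + l2_norm (\<lambda>x. ft (trunc (real n) g) x - fourier g x)"
      using l2_norm_triangle[OF square_integrable_diff[OF s(1) fourier_spec(1)[OF f]] square_integrable_diff[OF s(2) fourier_spec(1)[OF g]]]
      by (simp add: algebra_simps ft_add[OF t(3,4), abs_def])
  qed
qed (use f g fourier_spec in \<open>auto intro!: square_integrable_trunc integrable_trunc\<close>)

lemma fourier_cmult:
  assumes f: "square_integrable f"
  shows "AE \<xi> in lborel. fourier (\<lambda>x. c * f x) \<xi> = of_real c * fourier f \<xi>"
proof (rule fourier_eqI[where h="\<lambda>n x. c * trunc (real n) f x"])
  note t = square_integrable_trunc[OF f] integrable_trunc[OF f]
  have eq: "l2_norm (\<lambda>x. c * g x - c * h x) = \<bar>c\<bar> * l2_norm (\<lambda>x. g x - h x)" for g h :: "real^2 \<Rightarrow> real"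
    using l2_norm_scaleR[of c "\<lambda>x. g x - h x"] by (simp add: algebra_simps)
  have eq': "l2_norm (\<lambda>x. of_real c * g x - of_real c * h x) = \<bar>c\<bar> * l2_norm (\<lambda>x. g x - h x)" for g h :: "real^2 \<Rightarrow> complex"
    using l2_norm_scaleR[of c "\<lambda>x. g x - h x"] by (simp add: algebra_simps scaleR_conv_of_real)
  show "(\<lambda>n. l2_norm (\<lambda>x. c * trunc (real n) f x - c * f x)) \<longlonglongrightarrow> 0"
    unfolding eq using tendsto_mult_left[OF tendsto_trunc_seq[OF f], of "\<bar>c\<bar>"] by simp
  show "(\<lambda>n. l2_norm (\<lambda>\<xi>. ft (\<lambda>x. c * trunc (real n) f x) \<xi> - of_real c * fourier f \<xi>)) \<longlonglongrightarrow> 0"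
    unfolding ft_cmult eq' using tendsto_mult_left[OF tendsto_ft_fourier[OF f t tendsto_trunc_seq[OF f]], of "\<bar>c\<bar>"] by simp
  show "square_integrable (\<lambda>x. c * f x)" "square_integrable (\<lambda>x. c * trunc (real n) f x)" for n
    using square_integrable_scaleR[OF f, of c] square_integrable_scaleR[OF t(1), of c] by auto
  show "square_integrable (\<lambda>x. of_real c * fourier f x)"
    using square_integrable_scaleR[OF fourier_spec(1)[OF f], of c] by (simp add: scaleR_conv_of_real)
qed (use f in \<open>auto intro!: integrable_trunc\<close>)

lemma fourier_diff:
  assumes f: "square_integrable f" and g: "square_integrable g"
  shows "AE \<xi> in lborel. fourier (\<lambda>x. f x - g x) \<xi> = fourier f \<xi> - fourier g \<xi>"
proof -
  have "square_integrable (\<lambda>x. -1 * g x)" using square_integrable_uminus[OF g] by simp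
  from fourier_add[OF f this] fourier_cmult[OF g, of "-1"] show ?thesis
    by eventually_elim simp
qed

lemma fourier_zero: "AE \<xi> in lborel. fourier (\<lambda>x. 0) \<xi> = 0"
  using fourier_cmult[OF square_integrable_zero, of 0] by simp

lemma fourier_shift:
  assumes f: "square_integrable f"
  shows "AE \<xi> in lborel. fourier (\<lambda>x. f (x + h)) \<xi> = cis (h \<bullet> \<xi>) * fourier f \<xi>"
proof (rule fourier_eqI[where h="\<lambda>n x. trunc (real n) f (x + h)"])
  note t = square_integrable_trunc[OF f] integrable_trunc[OF f]
  show "(\<lambda>n. l2_norm (\<lambda>x. trunc (real n) f (x + h) - f (x + h))) \<longlonglongrightarrow> 0"
    using square_integrable_shift(2)[OF square_integrable_diff[OF t(1) f], of _ h] tendsto_trunc_seq[OF f] by simp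
  have "l2_norm (\<lambda>\<xi>. cis (h \<bullet> \<xi>) * g \<xi> - cis (h \<bullet> \<xi>) * k \<xi>) = l2_norm (\<lambda>\<xi>. g \<xi> - k \<xi>)" for g k
    by (simp add: l2_norm_def norm_mult flip: right_diff_distrib)
  thus "(\<lambda>n. l2_norm (\<lambda>\<xi>. ft (\<lambda>x. trunc (real n) f (x + h)) \<xi> - cis (h \<bullet> \<xi>) * fourier f \<xi>)) \<longlonglongrightarrow> 0"
    using tendsto_ft_fourier[OF f t tendsto_trunc_seq[OF f]] by (simp add: ft_shift[OF t(2)])
  show "square_integrable (\<lambda>x. cis (h \<bullet> x) * fourier f x)"
    by (rule square_integrable_cmult_bounded[OF fourier_spec(1)[OF f], where c=1]) auto
  show "square_integrable (\<lambda>x. f (x + h))" "square_integrable (\<lambda>x. trunc (real n) f (x + h))" for n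
    using square_integrable_shift(1) f t(1) by auto
  show "integrable lborel (\<lambda>x. trunc (real n) f (x + h))" for n
    by (rule lborel_integrable_shift(1)[OF t(2)])
qed

section \<open>Test functions and uniqueness of weak derivatives\<close>

lemma partial_derivativeI:
  "(f has_derivative f') (at x) \<Longrightarrow> partial_derivative k f x = f' (axis k 1)"
  unfolding partial_derivative_def by (simp flip: frechet_derivative_at)

lemma smooth_differentiable: "smooth f \<Longrightarrow> f differentiable (at x)"
  unfolding smooth_def by (drule spec[of _ "[]"]) (simp add: differentiable_on_def)

lemma smooth_partial_derivative: "smooth f \<Longrightarrow> smooth (partial_derivative k f)"
  unfolding smooth_def
proof (intro allI)
  fix ks assume "\<forall>ks. foldr partial_derivative ks f differentiable_on UNIV"
  hence "foldr partial_derivative (ks @ [k]) f differentiable_on UNIV" by blast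
  thus "foldr partial_derivative ks (partial_derivative k f) differentiable_on UNIV" by simp
qed

text \<open>Iterated partial derivatives of a concrete function are awkward to compute. A class of
  differentiable functions that is closed under partial derivatives contains them all without
  computing any.\<close>

lemma smooth_coinduct:
  assumes "f \<in> C" "\<And>g x. g \<in> C \<Longrightarrow> g differentiable (at x)" "\<And>g k. g \<in> C \<Longrightarrow> partial_derivative k g \<in> C"
  shows "smooth f"
  unfolding smooth_def
proof (intro allI)
  fix ks
  have "foldr partial_derivative ks f \<in> C" by (induction ks) (auto simp: assms)
  thus "foldr partial_derivative ks f differentiable_on UNIV"
    using assms(2) by (auto simp: differentiable_on_def intro: differentiable_at_withinI)
qed

lemma has_derivative_smooth: "smooth f \<Longrightarrow> (f has_derivative frechet_derivative f (at x)) (at x)"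
  using smooth_differentiable frechet_derivative_works by blast

lemma partial_derivative_mult:
  assumes "smooth f" "smooth g"
  shows "partial_derivative k (\<lambda>x. f x * g x) x = partial_derivative k f x * g x + f x * partial_derivative k g x"
  using partial_derivativeI[OF has_derivative_mult[OF assms[THEN has_derivative_smooth]]]
  by (simp add: partial_derivative_def)

text \<open>A class for \<open>smooth_coinduct\<close>: the Leibniz rule turns a product of smooth
  functions into a sum of such products, so sums have to be included.\<close>

inductive_set product_sums :: "(real^2 \<Rightarrow> real) set" where
  prod: "smooth f \<Longrightarrow> smooth g \<Longrightarrow> (\<lambda>x. f x * g x) \<in> product_sums"
| add: "f \<in> product_sums \<Longrightarrow> g \<in> product_sums \<Longrightarrow> (\<lambda>x. f x + g x) \<in> product_sums"

lemma smooth_mult: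
  assumes "smooth f" "smooth g" shows "smooth (\<lambda>x. f x * g x)"
proof (rule smooth_coinduct)
  show "(\<lambda>x. f x * g x) \<in> product_sums" by (intro product_sums.prod assms)
  show diff: "g differentiable (at x)" if "g \<in> product_sums" for g x
    using that by induction (auto intro: smooth_differentiable differentiable_mult)
  show "partial_derivative k g \<in> product_sums" if "g \<in> product_sums" for g k
    using that
  proof induction
    case (prod f g)
    thus ?case
      by (subst ext[OF partial_derivative_mult[OF prod]])
         (intro product_sums.add product_sums.prod smooth_partial_derivative prod)
  next
    case (add f g)
    have "partial_derivative k (\<lambda>x. f x + g x) x = partial_derivative k f x + partial_derivative k g x" for x
      using partial_derivativeI[OF has_derivative_add[OF frechet_derivative_works[THEN iffD1, OF diff[OF add(1)]]
        frechet_derivative_works[THEN iffD1, OF diff[OF add(2)]]]]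
      by (simp add: partial_derivative_def)
    hence "partial_derivative k (\<lambda>x. f x + g x) = (\<lambda>x. partial_derivative k f x + partial_derivative k g x)" ..
    thus ?case using add product_sums.add by simp
  qed
qed

lemma has_derivative_trig:
  fixes \<xi> :: "real^2"
  shows "((\<lambda>x. a * cos (x \<bullet> \<xi>) + b * sin (x \<bullet> \<xi>)) has_derivative
    (\<lambda>h. (h \<bullet> \<xi>) * (b * cos (x \<bullet> \<xi>) - a * sin (x \<bullet> \<xi>)))) (at x)"
  by (auto intro!: derivative_eq_intros simp: algebra_simps)

lemma partial_derivative_trig:
  "partial_derivative k (\<lambda>x. a * cos (x \<bullet> \<xi>) + b * sin (x \<bullet> \<xi>)) =
    (\<lambda>x. (\<xi> $ k * b) * cos (x \<bullet> \<xi>) + (- (\<xi> $ k * a)) * sin (x \<bullet> \<xi>))"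
  by (rule ext, subst partial_derivativeI[OF has_derivative_trig]) (simp add: inner_axis' algebra_simps)

text \<open>Plane waves in real form, since test functions are real. Differentiation exchanges
  cosine and sine, so the closed class has both, with free coefficients.\<close>

lemma smooth_trig: "smooth (\<lambda>x. a * cos (x \<bullet> \<xi>) + b * sin (x \<bullet> \<xi>))"
proof (rule smooth_coinduct[where C="{f. \<exists>a b. f = (\<lambda>x. a * cos (x \<bullet> \<xi>) + b * sin (x \<bullet> \<xi>))}"])
  show "partial_derivative k g \<in> {f. \<exists>a b. f = (\<lambda>x. a * cos (x \<bullet> \<xi>) + b * sin (x \<bullet> \<xi>))}"
    if "g \<in> {f. \<exists>a b. f = (\<lambda>x. a * cos (x \<bullet> \<xi>) + b * sin (x \<bullet> \<xi>))}" for g k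
    using that partial_derivative_trig by blast
  show "g differentiable (at x)" if "g \<in> {f. \<exists>a b. f = (\<lambda>x. a * cos (x \<bullet> \<xi>) + b * sin (x \<bullet> \<xi>))}" for g x
    using that has_derivative_trig unfolding differentiable_def by blast
qed auto

lemma has_derivative_scale_smooth:
  assumes "smooth f"
  shows "((\<lambda>x. c * f (r *\<^sub>R x)) has_derivative (\<lambda>h. c * frechet_derivative f (at (r *\<^sub>R x)) (r *\<^sub>R h))) (at x)"
proof -
  have "((\<lambda>x. f (r *\<^sub>R x)) has_derivative (\<lambda>h. frechet_derivative f (at (r *\<^sub>R x)) (r *\<^sub>R h))) (at x)"
    by (rule has_derivative_compose[of "\<lambda>x. r *\<^sub>R x", OF _ has_derivative_smooth[OF assms]])
       (auto intro!: derivative_eq_intros)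
  thus ?thesis by (rule has_derivative_mult_right)
qed

lemma partial_derivative_scale:
  assumes "smooth f"
  shows "partial_derivative k (\<lambda>x. c * f (r *\<^sub>R x)) = (\<lambda>x. (c * r) * partial_derivative k f (r *\<^sub>R x))"
proof
  fix x
  have "linear (frechet_derivative f (at (r *\<^sub>R x)))"
    by (rule linear_frechet_derivative[OF smooth_differentiable[OF assms]])
  thus "partial_derivative k (\<lambda>x. c * f (r *\<^sub>R x)) x = (c * r) * partial_derivative k f (r *\<^sub>R x)"
    unfolding partial_derivativeI[OF has_derivative_scale_smooth[OF assms]]
    by (simp add: linear_scale partial_derivative_def)
qed

lemma smooth_scale: "smooth f \<Longrightarrow> smooth (\<lambda>x. c * f (r *\<^sub>R x))"
proof (rule smooth_coinduct[where C="{g. \<exists>c f. smooth f \<and> g = (\<lambda>x. c * f (r *\<^sub>R x))}"])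
  show "g differentiable (at x)" if "g \<in> {g. \<exists>c f. smooth f \<and> g = (\<lambda>x. c * f (r *\<^sub>R x))}" for g x
    using that has_derivative_scale_smooth unfolding differentiable_def by blast
  show "partial_derivative k g \<in> {g. \<exists>c f. smooth f \<and> g = (\<lambda>x. c * f (r *\<^sub>R x))}"
    if "g \<in> {g. \<exists>c f. smooth f \<and> g = (\<lambda>x. c * f (r *\<^sub>R x))}" for g k
    using that partial_derivative_scale smooth_partial_derivative by blast
qed auto

lemma smooth_continuous: "smooth f \<Longrightarrow> continuous_on UNIV f"
  using smooth_differentiable by (auto simp: continuous_on_eq_continuous_at intro: differentiable_imp_continuous_within)

section \<open>Test functions and local integrability\<close>

lemma test_function_smooth: "test_function \<psi> \<Longrightarrow> smooth \<psi>"
  by (simp add: test_function_def)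

lemma test_function_measurable [measurable_dest]:
  "test_function \<psi> \<Longrightarrow> \<psi> \<in> borel_measurable borel"
  by (intro borel_measurable_continuous_onI smooth_continuous test_function_smooth)

lemma test_function_support:
  assumes "test_function \<psi>" obtains r where "r > 0" "\<And>x. norm x > r \<Longrightarrow> \<psi> x = 0"
proof -
  obtain K where K: "compact K" "\<And>x. x \<notin> K \<Longrightarrow> \<psi> x = 0" using assms by (auto simp: test_function_def)
  obtain r where "r > 0" "\<And>x. x \<in> K \<Longrightarrow> norm x \<le> r" using compact_imp_bounded[OF K(1)] bounded_pos by blast
  thus thesis using K(2) that[of r] by force
qed

lemma test_functionI:
  assumes "smooth \<psi>" "\<And>x. norm x > r \<Longrightarrow> \<psi> x = 0"
  shows "test_function \<psi>"
  unfolding test_function_def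
  by (intro conjI assms exI[of _ "cball 0 r"]) (use assms(2) in auto)

lemma partial_derivative_support:
  assumes "\<And>x. norm x > r \<Longrightarrow> \<psi> x = 0" "norm x > r"
  shows "partial_derivative k \<psi> x = 0"
proof -
  have "open {x::real^2. norm x > r}" by (intro open_Collect_less continuous_intros)
  hence "(\<psi> has_derivative (\<lambda>h. 0)) (at x)"
    by (rule has_derivative_transform_within_open[OF has_derivative_const[of 0]]) (use assms in auto)
  from partial_derivativeI[OF this] show ?thesis .
qed

lemma test_function_partial_derivative:
  assumes "test_function \<psi>" shows "test_function (partial_derivative k \<psi>)"
proof -
  obtain r where "\<And>x. norm x > r \<Longrightarrow> \<psi> x = 0" using test_function_support[OF assms] by blast
  thus ?thesis
    by (intro test_functionI[where r=r, OF smooth_partial_derivative[OF test_function_smooth[OF assms]]]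
        partial_derivative_support) auto
qed

lemma test_function_bounded:
  assumes "test_function \<psi>" obtains B where "B > 0" "\<And>x. \<bar>\<psi> x\<bar> \<le> B"
proof -
  obtain r where r: "r > 0" "\<And>x. norm x > r \<Longrightarrow> \<psi> x = 0" using test_function_support[OF assms] by blast
  have "compact (\<psi> ` cball 0 r)"
    by (intro compact_continuous_image continuous_on_subset[OF smooth_continuous[OF test_function_smooth[OF assms]]]) auto
  then obtain B where B: "B > 0" "\<And>x. x \<in> cball 0 r \<Longrightarrow> \<bar>\<psi> x\<bar> \<le> B"
    using compact_imp_bounded bounded_pos[of "\<psi> ` cball 0 r"] by auto
  have "\<bar>\<psi> x\<bar> \<le> B" for x
    using B r(2)[of x] by (cases "norm x \<le> r") auto
  with B(1) show thesis by (rule that)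
qed

lemma test_function_trig_mult:
  assumes "test_function \<psi>"
  shows "test_function (\<lambda>x. (a * cos (x \<bullet> \<xi>) + b * sin (x \<bullet> \<xi>)) * \<psi> x)"
proof -
  obtain r where "\<And>x. norm x > r \<Longrightarrow> \<psi> x = 0" using test_function_support[OF assms] by blast
  thus ?thesis
    by (intro test_functionI[where r=r, OF smooth_mult[OF smooth_trig test_function_smooth[OF assms]]]) auto
qed

lemma test_function_scale:
  assumes "test_function \<psi>" "r > 0" shows "test_function (\<lambda>x. \<psi> (r *\<^sub>R x))"
proof -
  obtain s where "\<And>x. norm x > s \<Longrightarrow> \<psi> x = 0" using test_function_support[OF assms(1)] by blast
  thus ?thesis using smooth_scale[OF test_function_smooth[OF assms(1)], of 1 r] assms(2)
    by (intro test_functionI[where r="s / r"]) (auto simp: field_simps)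
qed

lemma locally_integrable_measurable:
  assumes "locally_integrable f" shows "f \<in> borel_measurable borel"
proof (rule borel_measurable_LIMSEQ_real)
  fix n :: nat
  have "set_integrable lborel (cball 0 (real n)) f" using assms by (simp add: locally_integrable_def)
  thus "(\<lambda>x. indicator (cball 0 (real n)) x *\<^sub>R f x) \<in> borel_measurable borel"
    unfolding set_integrable_def by (auto dest: borel_measurable_integrable)
next
  fix x :: "real^2"
  obtain N :: nat where "norm x \<le> N" using real_arch_simple by blast
  hence "\<forall>\<^sub>F n in sequentially. indicator (cball 0 (real n)) x *\<^sub>R f x = f x"
    by (intro eventually_sequentiallyI[of N]) (auto simp: indicator_def)
  thus "(\<lambda>n. indicator (cball 0 (real n)) x *\<^sub>R f x) \<longlonglongrightarrow> f x" by (rule tendsto_eventually)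
qed

lemma locally_integrable_mult_test:
  assumes f: "locally_integrable f" and \<psi>: "test_function \<psi>"
  shows "integrable lborel (\<lambda>x. f x * \<psi> x)"
proof -
  obtain r where r: "\<And>x. norm x > r \<Longrightarrow> \<psi> x = 0" using test_function_support[OF \<psi>] by blast
  obtain B where B: "\<And>x. \<bar>\<psi> x\<bar> \<le> B" using test_function_bounded[OF \<psi>] by blast
  have "integrable lborel (\<lambda>x. indicator (cball 0 r) x *\<^sub>R f x)"
    using f by (simp add: locally_integrable_def set_integrable_def)
  hence "integrable lborel (\<lambda>x. \<psi> x * (indicator (cball 0 r) x *\<^sub>R f x))"
    by (rule integrable_bounded_mult[where c=B]) (use \<psi> B in auto)
  moreover have "(\<lambda>x. \<psi> x * (indicator (cball 0 r) x *\<^sub>R f x)) = (\<lambda>x. f x * \<psi> x)"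
  proof
    fix x show "\<psi> x * (indicator (cball 0 r) x *\<^sub>R f x) = f x * \<psi> x"
      using r[of x] by (cases "norm x \<le> r") auto
  qed
  ultimately show ?thesis by metis
qed

lemma locally_integrable_square_integrable:
  assumes f: "square_integrable f" shows "locally_integrable f"
  unfolding locally_integrable_def set_integrable_def
proof (intro allI impI)
  fix K :: "(real^2) set" assume K: "compact K"
  obtain r where r: "\<And>x. x \<in> K \<Longrightarrow> norm x \<le> r"
    using compact_imp_bounded[OF K] unfolding bounded_iff by blast
  have [measurable]: "K \<in> sets borel" using K by (simp add: compact_imp_closed)
  have "square_integrable (\<lambda>x. indicator K x * f x)"
    by (rule square_integrable_cmult_bounded[OF f, where c=1]) (auto simp: indicator_def)
  hence "integrable lborel (\<lambda>x. indicator K x * f x)"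
    by (rule integrable_if_bounded_support[of _ r]) (use r in \<open>force simp: indicator_def\<close>)
  thus "integrable lborel (\<lambda>x. indicator K x *\<^sub>R f x)" by simp
qed

lemma ft_conv_trig:
  assumes "integrable lborel f"
  shows "ft f \<xi> = Complex (LINT x|lborel. cos (x \<bullet> \<xi>) * f x) (- (LINT x|lborel. sin (x \<bullet> \<xi>) * f x))"
proof -
  note i = integrable_ft'[OF assms, of \<xi>]
  have "Re (ft f \<xi>) = (LINT x|lborel. cos (x \<bullet> \<xi>) * f x)"
    unfolding ft_def by (subst integral_Re[OF i, symmetric]) simp
  moreover have "Im (ft f \<xi>) = - (LINT x|lborel. sin (x \<bullet> \<xi>) * f x)"
    unfolding ft_def by (subst integral_Im[OF i, symmetric]) simp
  ultimately show ?thesis by (simp add: complex_eq_iff)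
qed

lemma tendsto_scale_0:
  fixes x :: "real^2"
  assumes "test_function \<psi>" shows "(\<lambda>n. \<psi> (inverse (real (Suc n)) *\<^sub>R x)) \<longlonglongrightarrow> \<psi> 0"
proof -
  have "(\<lambda>n. inverse (real (Suc n)) *\<^sub>R x) \<longlonglongrightarrow> 0 *\<^sub>R x"
    by (intro tendsto_scaleR LIMSEQ_inverse_real_of_nat tendsto_const)
  hence "(\<lambda>n. inverse (real (Suc n)) *\<^sub>R x) \<longlonglongrightarrow> 0" by simp
  moreover have "isCont \<psi> 0"
    using smooth_continuous[OF test_function_smooth[OF assms]] by (simp add: continuous_on_eq_continuous_at)
  ultimately show ?thesis by (rule isCont_tendsto_compose[rotated])
qed

text \<open>Testing with a cutoff times cosine and sine yields every Fourier integral of h times the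
  cutoff, so injectivity of the transform on L1 takes the place of mollification. Widening the
  cutoff makes it tend to 1 pointwise. The bump function is a hypothesis because it is later
  supplied by \<open>littlewood_paley_cutoff\<close>.\<close>

lemma AE_0_if_test_integrals_0:
  assumes \<theta>: "test_function \<theta>" "\<theta> 0 = 1" and h: "locally_integrable h"
    and 0: "\<And>\<psi>. test_function \<psi> \<Longrightarrow> (LINT x|lborel. h x * \<psi> x) = 0"
  shows "AE x in lborel. h x = 0"
proof -
  define \<theta>n where "\<theta>n n x = \<theta> (inverse (real (Suc n)) *\<^sub>R x)" for n and x :: "real^2"
  have t: "test_function (\<theta>n n)" for n unfolding \<theta>n_def by (rule test_function_scale[OF \<theta>(1)]) simp
  have i: "integrable lborel (\<lambda>x. h x * \<theta>n n x)" for n by (rule locally_integrable_mult_test[OF h t])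
  have "AE x in lborel. h x * \<theta>n n x = 0" for n
  proof (rule ft_eq_0_imp_AE_0[OF i])
    fix \<xi>
    have "(LINT x|lborel. (a * cos (x \<bullet> \<xi>) + b * sin (x \<bullet> \<xi>)) * (h x * \<theta>n n x)) = 0" for a b
      using 0[OF test_function_trig_mult[OF t[of n], of a \<xi> b]] by (simp add: mult_ac)
    from this[of 1 0] this[of 0 1]
    show "ft (\<lambda>x. h x * \<theta>n n x) \<xi> = 0" unfolding ft_conv_trig[OF i] by (simp add: zero_complex.code)
  qed
  hence "AE x in lborel. \<forall>n. h x * \<theta>n n x = 0" unfolding AE_all_countable by blast
  thus ?thesis
  proof eventually_elim
    case (elim x)
    have "(\<lambda>n. h x * \<theta>n n x) \<longlonglongrightarrow> h x * \<theta> 0"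
      unfolding \<theta>n_def by (intro tendsto_mult_left tendsto_scale_0 \<theta>)
    moreover have "(\<lambda>n. h x * \<theta>n n x) = (\<lambda>n. 0)" using elim by auto
    ultimately show ?case using \<theta>(2) by (simp add: LIMSEQ_const_iff)
  qed
qed

lemma is_weak_partial_unique:
  assumes \<theta>: "test_function \<theta>" "\<theta> 0 = 1" and "is_weak_partial k f g" "is_weak_partial k f h"
  shows "AE x in lborel. g x = h x"
proof -
  note l = assms(3,4)[unfolded is_weak_partial_def]
  have "locally_integrable (\<lambda>x. g x - h x)"
    using l unfolding locally_integrable_def by (auto intro: set_integral_diff(1))
  moreover have "(LINT x|lborel. (g x - h x) * \<psi> x) = 0" if "test_function \<psi>" for \<psi>
  proof -
    have "(LINT x|lborel. (g x - h x) * \<psi> x) = (LINT x|lborel. g x * \<psi> x) - (LINT x|lborel. h x * \<psi> x)"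
      using l that by (simp add: left_diff_distrib locally_integrable_mult_test)
    also have "\<dots> = 0" using l that by (auto dest!: spec[of _ \<psi>])
    finally show ?thesis .
  qed
  ultimately have "AE x in lborel. g x - h x = 0" by (rule AE_0_if_test_integrals_0[OF \<theta>])
  thus ?thesis by simp
qed

text \<open>Makes the choice in \<open>weak_partial\<close> harmless: any weak derivative that can
  be exhibited agrees with the chosen one almost everywhere, and the chosen one inherits the
  integration by parts formula.\<close>

lemma AE_weak_partial_eq:
  assumes \<theta>: "test_function \<theta>" "\<theta> 0 = 1" and g: "is_weak_partial k f g"
  shows "AE x in lborel. weak_partial k f x = g x" "is_weak_partial k f (weak_partial k f)"
proof -
  show *: "is_weak_partial k f (weak_partial k f)"
    unfolding weak_partial_def by (rule someI[where P="is_weak_partial k f"], rule g)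
  show "AE x in lborel. weak_partial k f x = g x" by (rule is_weak_partial_unique[OF \<theta> * g])
qed

text \<open>The domination needed for difference quotients under an integral. The mean value theorem
  gives the bound; the radius of the support grows by 1, because a step of length at most 1 can
  carry a point into the support.\<close>

lemma test_function_diff_quotient:
  assumes \<psi>: "test_function \<psi>"
  obtains B r where "B > 0"
    "\<And>x t. \<bar>t\<bar> \<le> 1 \<Longrightarrow> \<bar>\<psi> (x + t *\<^sub>R axis k 1) - \<psi> x\<bar> \<le> \<bar>t\<bar> * (B * indicator (cball 0 r) x)"
proof -
  let ?e = "axis k 1 :: real^2"
  obtain r where r: "r > 0" "\<And>x. norm x > r \<Longrightarrow> \<psi> x = 0" using test_function_support[OF \<psi>] by blast
  obtain B where B: "B > 0" "\<And>x. \<bar>partial_derivative k \<psi> x\<bar> \<le> B"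
    using test_function_bounded[OF test_function_partial_derivative[OF \<psi>]] by blast
  have d: "((\<lambda>t. \<psi> (x + t *\<^sub>R ?e)) has_real_derivative partial_derivative k \<psi> (x + t *\<^sub>R ?e)) (at t)" for x t
  proof -
    have "((\<lambda>t. \<psi> (x + t *\<^sub>R ?e)) has_derivative (\<lambda>s. frechet_derivative \<psi> (at (x + t *\<^sub>R ?e)) (s *\<^sub>R ?e))) (at t)"
      by (rule has_derivative_compose[of "\<lambda>t. x + t *\<^sub>R ?e", OF _ has_derivative_smooth[OF test_function_smooth[OF \<psi>]]])
         (auto intro!: derivative_eq_intros)
    moreover have "linear (frechet_derivative \<psi> (at (x + t *\<^sub>R ?e)))"
      by (rule linear_frechet_derivative[OF smooth_differentiable[OF test_function_smooth[OF \<psi>]]])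
    ultimately show ?thesis
      by (simp add: has_field_derivative_def linear_scale partial_derivative_def mult_commute_abs)
  qed
  have "\<bar>\<psi> (x + t *\<^sub>R ?e) - \<psi> x\<bar> \<le> \<bar>t\<bar> * (B * indicator (cball 0 (r + 1)) x)" if t: "\<bar>t\<bar> \<le> 1" for x t
  proof (cases "norm x \<le> r + 1")
    case True
    have "norm (\<psi> (x + t *\<^sub>R ?e) - \<psi> (x + 0 *\<^sub>R ?e)) \<le> B * norm (t - 0)"
      by (rule field_differentiable_bound[of UNIV "\<lambda>t. \<psi> (x + t *\<^sub>R ?e)" "\<lambda>t. partial_derivative k \<psi> (x + t *\<^sub>R ?e)"])
         (use d B in auto)
    thus ?thesis using True by (simp add: mult.commute)
  next
    case False
    have "norm x \<le> norm (x + t *\<^sub>R ?e) + norm (t *\<^sub>R ?e)"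
      using norm_triangle_ineq4[of "x + t *\<^sub>R ?e" "t *\<^sub>R ?e"] by simp
    also have "norm (t *\<^sub>R ?e) \<le> 1" using t by simp
    finally have "norm (x + t *\<^sub>R ?e) > r" using False by simp
    thus ?thesis using False r by simp
  qed
  with B(1) show thesis by (rule that)
qed

lemma tendsto_diff_quotient:
  assumes \<psi>: "smooth \<psi>" and t: "t \<longlonglongrightarrow> 0" "\<And>n. t n \<noteq> 0"
  shows "(\<lambda>n::nat. (\<psi> (x + t n *\<^sub>R axis k 1) - \<psi> x) / t n) \<longlonglongrightarrow> partial_derivative k \<psi> x"
proof -
  let ?e = "axis k 1 :: real^2"
  have "((\<lambda>t. \<psi> (x + t *\<^sub>R ?e)) has_derivative (\<lambda>s. frechet_derivative \<psi> (at (x + 0 *\<^sub>R ?e)) (s *\<^sub>R ?e))) (at 0)"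
    by (rule has_derivative_compose[of "\<lambda>t. x + t *\<^sub>R ?e", OF _ has_derivative_smooth[OF \<psi>]])
       (auto intro!: derivative_eq_intros)
  moreover have "linear (frechet_derivative \<psi> (at x))"
    by (rule linear_frechet_derivative[OF smooth_differentiable[OF \<psi>]])
  ultimately have "((\<lambda>t. \<psi> (x + t *\<^sub>R ?e)) has_real_derivative partial_derivative k \<psi> x) (at 0)"
    by (simp add: has_field_derivative_def linear_scale partial_derivative_def mult_commute_abs)
  hence "((\<lambda>t. (\<psi> (x + t *\<^sub>R ?e) - \<psi> x) / t) \<longlongrightarrow> partial_derivative k \<psi> x) (at 0)"
    by (simp add: DERIV_def)
  moreover have "filterlim t (at 0) sequentially" using t by (simp add: filterlim_at)
  ultimately show ?thesis by (rule filterlim_compose)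
qed

lemma tendsto_integral_diff_quotient:
  assumes f: "locally_integrable f" and \<psi>: "test_function \<psi>"
    and t: "t \<longlonglongrightarrow> 0" "\<And>n. t n \<noteq> 0" "\<And>n. \<bar>t n\<bar> \<le> 1"
  shows "(\<lambda>n::nat. LINT x|lborel. f x * ((\<psi> (x + t n *\<^sub>R axis k 1) - \<psi> x) / t n))
     \<longlonglongrightarrow> (LINT x|lborel. f x * partial_derivative k \<psi> x)"
proof -
  obtain B r where B: "B > 0"
    "\<And>x t. \<bar>t\<bar> \<le> 1 \<Longrightarrow> \<bar>\<psi> (x + t *\<^sub>R axis k 1) - \<psi> x\<bar> \<le> \<bar>t\<bar> * (B * indicator (cball 0 r) x)"
    using test_function_diff_quotient[OF \<psi>, where k=k] by blast
  have [measurable]: "f \<in> borel_measurable borel" by (rule locally_integrable_measurable[OF f])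
  note [measurable] = test_function_measurable[OF \<psi>] test_function_measurable[OF test_function_partial_derivative[OF \<psi>]]
  have le: "\<bar>(\<psi> (x + t n *\<^sub>R axis k 1) - \<psi> x) / t n\<bar> \<le> B * indicator (cball 0 r) x" for n x
    using B(2)[OF t(3), of x n] t(2)[of n] by (simp add: field_simps)
  show ?thesis
  proof (rule integral_dominated_convergence[where w="\<lambda>x. B * \<bar>indicator (cball 0 r) x *\<^sub>R f x\<bar>"])
    show "integrable lborel (\<lambda>x. B * \<bar>indicator (cball 0 r) x *\<^sub>R f x\<bar>)"
      using f by (simp add: locally_integrable_def set_integrable_def)
    show "AE x in lborel. (\<lambda>n. f x * ((\<psi> (x + t n *\<^sub>R axis k 1) - \<psi> x) / t n)) \<longlonglongrightarrow> f x * partial_derivative k \<psi> x"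
      by (intro AE_I2 tendsto_mult_left tendsto_diff_quotient test_function_smooth \<psi> t)
    show "AE x in lborel. norm (f x * ((\<psi> (x + t n *\<^sub>R axis k 1) - \<psi> x) / t n)) \<le> B * \<bar>indicator (cball 0 r) x *\<^sub>R f x\<bar>" for n
    proof (rule AE_I2)
      fix x
      have "norm (f x * ((\<psi> (x + t n *\<^sub>R axis k 1) - \<psi> x) / t n)) \<le> \<bar>f x\<bar> * (B * indicator (cball 0 r) x)"
        unfolding norm_mult by (intro mult_mono) (use le in auto)
      thus "norm (f x * ((\<psi> (x + t n *\<^sub>R axis k 1) - \<psi> x) / t n)) \<le> B * \<bar>indicator (cball 0 r) x *\<^sub>R f x\<bar>"
        by (simp add: abs_mult mult_ac)
    qed
  qed measurable
qed

section \<open>Existence of weak derivatives\<close>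

lemma integrable_mult_square_integrable:
  fixes f g :: "real^2 \<Rightarrow> real"
  assumes "square_integrable f" "square_integrable g"
  shows "integrable lborel (\<lambda>x. f x * g x)" "(LINT x|lborel. \<bar>f x * g x\<bar>) \<le> l2_norm f * l2_norm g"
    "\<bar>LINT x|lborel. f x * g x\<bar> \<le> l2_norm f * l2_norm g"
proof -
  have [measurable]: "f \<in> borel_measurable borel" "g \<in> borel_measurable borel"
    using assms by (auto simp: square_integrable_def)
  show i: "integrable lborel (\<lambda>x. f x * g x)"
    by (rule Bochner_Integration.integrable_bound[OF integrable_norm_mult[OF assms]]) (auto simp: abs_mult)
  show le: "(LINT x|lborel. \<bar>f x * g x\<bar>) \<le> l2_norm f * l2_norm g"
    using integral_norm_mult_le[OF assms] by (simp add: abs_mult)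
  show "\<bar>LINT x|lborel. f x * g x\<bar> \<le> l2_norm f * l2_norm g"
    by (rule order_trans[OF integral_abs_bound le])
qed

lemma square_integrable_test_function:
  assumes "test_function \<psi>" shows "square_integrable \<psi>"
proof -
  obtain r where r: "\<And>x. norm x > r \<Longrightarrow> \<psi> x = 0" using test_function_support[OF assms] by blast
  obtain B where B: "B > 0" "\<And>x. \<bar>\<psi> x\<bar> \<le> B" using test_function_bounded[OF assms] by blast
  show ?thesis
  proof (rule square_integrable_bound[OF square_integrable_indicator_cball[of r], where c=B])
    show "\<psi> \<in> borel_measurable lborel" using test_function_measurable[OF assms] by simp
    have "norm (\<psi> x) \<le> B * norm (indicator (cball 0 r) x :: real)" for x
      using B(2)[of x] r[of x] by (cases "norm x \<le> r") auto
    thus "AE x in lborel. norm (\<psi> x) \<le> B * norm (indicator (cball 0 r) x :: real)" by simp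
  qed
qed

lemma integrable_test_function:
  assumes "test_function \<psi>" shows "integrable lborel \<psi>"
proof -
  obtain r where r: "\<And>x. norm x > r \<Longrightarrow> \<psi> x = 0" using test_function_support[OF assms] by blast
  show ?thesis
    by (rule integrable_if_bounded_support[OF square_integrable_test_function[OF assms], of r]) (rule r)
qed

lemma l2_norm_fourier_diff:
  assumes "square_integrable f" "square_integrable g"
  shows "l2_norm (\<lambda>\<xi>. fourier f \<xi> - fourier g \<xi>) = 2 * pi * l2_norm (\<lambda>x. f x - g x)"
  unfolding plancherel[OF square_integrable_diff[OF assms], symmetric]
  by (rule l2_norm_cong_AE[symmetric])
     (intro square_integrable_diff fourier_spec(1) fourier_diff assms)+

text \<open>The range of the transform is closed: by Plancherel, convergent transforms come from a
  Cauchy sequence of functions. This does the work of an inverse transform and keeps the limit real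
  valued.\<close>

lemma fourier_l2_limit:
  fixes h :: "nat \<Rightarrow> real^2 \<Rightarrow> real"
  assumes h: "\<And>n. square_integrable (h n)" and G: "square_integrable G"
    and lim: "(\<lambda>n. l2_norm (\<lambda>\<xi>. fourier (h n) \<xi> - G \<xi>)) \<longlonglongrightarrow> 0"
  obtains g where "square_integrable g" "(\<lambda>n. l2_norm (\<lambda>x. h n x - g x)) \<longlonglongrightarrow> 0"
    "AE \<xi> in lborel. fourier g \<xi> = G \<xi>"
proof -
  note F = fourier_spec(1)[OF h]
  have "\<exists>N. \<forall>m\<ge>N. \<forall>n\<ge>N. l2_norm (\<lambda>x. h m x - h n x) < e" if e: "e > 0" for e
  proof -
    obtain N where N: "\<And>n. n \<ge> N \<Longrightarrow> l2_norm (\<lambda>\<xi>. fourier (h n) \<xi> - G \<xi>) < pi * e"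
      using LIMSEQ_D[OF lim, of "pi * e"] mult_pos_pos[OF pi_gt_zero e] by auto
    have "l2_norm (\<lambda>x. h m x - h n x) < e" if "m \<ge> N" "n \<ge> N" for m n
    proof -
      have "2 * pi * l2_norm (\<lambda>x. h m x - h n x) \<le> l2_norm (\<lambda>\<xi>. fourier (h m) \<xi> - G \<xi>) + l2_norm (\<lambda>\<xi>. fourier (h n) \<xi> - G \<xi>)"
        unfolding l2_norm_fourier_diff[OF h h, symmetric]
        using l2_norm_triangle3[OF F G F, of m n] l2_norm_minus_commute[of G "fourier (h n)"] by simp
      also have "\<dots> < pi * e + pi * e" using N[OF that(1)] N[OF that(2)] by (rule add_strict_mono)
      also have "\<dots> = 2 * pi * e" by simp
      finally show ?thesis by (simp add: mult_less_cancel_left_pos)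
    qed
    thus ?thesis by blast
  qed
  then obtain g where g: "square_integrable g" "(\<lambda>n. l2_norm (\<lambda>x. h n x - g x)) \<longlonglongrightarrow> 0"
    by (rule l2_complete[OF h])
  have "(\<lambda>n. l2_norm (\<lambda>\<xi>. fourier (h n) \<xi> - fourier g \<xi>)) \<longlonglongrightarrow> 0"
    unfolding l2_norm_fourier_diff[OF h g(1)] using tendsto_mult_left[OF g(2), of "2 * pi"] by simp
  from AE_eq_if_l2_limit[OF F fourier_spec(1)[OF g(1)] G _ this lim]
  have "AE \<xi> in lborel. fourier g \<xi> = G \<xi>" by simp
  with g show thesis by (rule that)
qed

text \<open>The Fourier multiplier of the difference quotient with step t along a coordinate axis,
  where a is the frequency component in that direction.\<close>

definition dq_symbol :: "real \<Rightarrow> real \<Rightarrow> complex" where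
  "dq_symbol t a = of_real (1 / t) * (cis (t * a) - 1)"

lemma norm_dq_symbol_le: "t \<noteq> 0 \<Longrightarrow> norm (dq_symbol t a) \<le> \<bar>a\<bar>"
proof -
  assume t: "t \<noteq> 0"
  have "norm (cis (t * a) - 1) \<le> \<bar>t * a\<bar>"
    using iexp_approx1[of "t * a" 0] by (simp add: cis_conv_exp)
  hence "\<bar>1 / t\<bar> * norm (cis (t * a) - 1) \<le> \<bar>1 / t\<bar> * \<bar>t * a\<bar>" by (intro mult_left_mono) auto
  also have "\<dots> = \<bar>a\<bar>" using t by (simp add: abs_mult)
  finally show ?thesis by (simp only: dq_symbol_def norm_mult norm_of_real)
qed

lemma tendsto_dq_symbol:
  assumes t: "t \<longlonglongrightarrow> 0" "\<And>n. t n \<noteq> 0"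
  shows "(\<lambda>n::nat. dq_symbol (t n) a) \<longlonglongrightarrow> \<i> * of_real a"
proof -
  have le: "norm (dq_symbol s a - \<i> * of_real a) \<le> \<bar>s\<bar> * (a\<^sup>2 / 2)" if "s \<noteq> 0" for s
  proof -
    have "norm (cis (s * a) - (1 + \<i> * of_real (s * a))) \<le> \<bar>s * a\<bar>\<^sup>2 / 2"
      using iexp_approx1[of "s * a" 1] by (simp add: cis_conv_exp power2_eq_square)
    moreover have "dq_symbol s a - \<i> * of_real a = of_real (1 / s) * (cis (s * a) - (1 + \<i> * of_real (s * a)))"
      using that by (simp add: dq_symbol_def field_simps)
    ultimately have "norm (dq_symbol s a - \<i> * of_real a) \<le> \<bar>1 / s\<bar> * (\<bar>s * a\<bar>\<^sup>2 / 2)"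
      by (simp only: norm_mult norm_of_real) (rule mult_left_mono, auto)
    also have "\<dots> = \<bar>s\<bar> * (a\<^sup>2 / 2)" using that by (simp add: abs_mult power2_eq_square field_simps)
    finally show ?thesis .
  qed
  have lim: "(\<lambda>n. \<bar>t n\<bar> * (a\<^sup>2 / 2)) \<longlonglongrightarrow> 0"
    using tendsto_mult_right[OF tendsto_rabs[OF t(1)], of "a\<^sup>2 / 2"] by simp
  have "(\<lambda>n. dq_symbol (t n) a - \<i> * of_real a) \<longlonglongrightarrow> 0"
    by (rule Lim_null_comparison[OF always_eventually lim]) (use le t(2) in auto)
  thus ?thesis by (simp add: LIM_zero_iff)
qed

lemma borel_measurable_vec_nth [measurable]: "(\<lambda>\<xi>::real^2. \<xi> $ k) \<in> borel_measurable borel"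
  by (intro borel_measurable_continuous_onI continuous_intros)

text \<open>The transforms of the difference quotients are dominated by |\<xi>| times the transform
  of f and converge to the expected multiple of it, so the quotients converge in L2. Shifting the
  difference onto a test function shows that their limit is the weak derivative.\<close>

lemma weak_partial_exists:
  fixes f :: "real^2 \<Rightarrow> real"
  assumes f: "square_integrable f"
    and H: "integrable lborel (\<lambda>\<xi>. (norm \<xi>)\<^sup>2 * (cmod (fourier f \<xi>))\<^sup>2)"
  obtains g where "square_integrable g" "is_weak_partial k f g"
    "AE \<xi> in lborel. fourier g \<xi> = \<i> * of_real (\<xi> $ k) * fourier f \<xi>"
proof -
  let ?e = "axis k 1 :: real^2"
  define t where "t n = inverse (real (Suc n))" for n
  have t: "t \<longlonglongrightarrow> 0" "\<And>n. t n \<noteq> 0" "\<And>n. \<bar>t n\<bar> \<le> 1"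
    using LIMSEQ_inverse_real_of_nat by (auto simp: t_def[abs_def] divide_simps)
  define d where "d n x = (1 / t n) * (f (x + t n *\<^sub>R ?e) - f x)" for n x
  have sh: "square_integrable (\<lambda>x. f (x + h))" for h by (rule square_integrable_shift(1)[OF f])
  have sd: "square_integrable (d n)" for n
    using square_integrable_scaleR[OF square_integrable_diff[OF sh f], of "1 / t n"] by (simp add: d_def[abs_def])
  note F = fourier_spec(1)[OF f]
  have [measurable]: "fourier f \<in> borel_measurable borel" using square_integrable_measurable[OF F] by simp
  define G where "G \<xi> = \<i> * of_real (\<xi> $ k) * fourier f \<xi>" for \<xi>
  have [measurable]: "(\<lambda>\<xi>::real^2. dq_symbol s (\<xi> $ k)) \<in> borel_measurable borel" for s
    unfolding dq_symbol_def by measurable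
  have sN: "square_integrable (\<lambda>\<xi>. norm \<xi> *\<^sub>R fourier f \<xi>)"
    using H by (simp add: square_integrable_def power_mult_distrib)
  have sG: "square_integrable G"
    unfolding G_def
    by (rule square_integrable_bound[OF sN, where c=1])
       (auto simp: norm_mult intro!: AE_I2 mult_right_mono component_le_norm_cart)
  have Fd: "AE \<xi> in lborel. fourier (d n) \<xi> = dq_symbol (t n) (\<xi> $ k) * fourier f \<xi>" for n
    using fourier_cmult[OF square_integrable_diff[OF sh f], of "1 / t n" "t n *\<^sub>R ?e"]
      fourier_diff[OF sh f, of "t n *\<^sub>R ?e"] fourier_shift[OF f, of "t n *\<^sub>R ?e"]
  proof eventually_elim
    case (elim \<xi>)
    have "?e \<bullet> \<xi> = \<xi> $ k" by (simp add: inner_axis')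
    thus ?case using elim by (simp add: d_def[abs_def] dq_symbol_def algebra_simps)
  qed
  have "(\<lambda>n. (l2_norm (\<lambda>\<xi>. fourier (d n) \<xi> - G \<xi>))\<^sup>2) \<longlonglongrightarrow> 0"
  proof -
    have "(\<lambda>n. LINT \<xi>|lborel. (norm ((dq_symbol (t n) (\<xi> $ k) - \<i> * of_real (\<xi> $ k)) * fourier f \<xi>))\<^sup>2) \<longlonglongrightarrow> (LINT \<xi>::real^2|lborel. 0)"
    proof (rule integral_dominated_convergence[where w="\<lambda>\<xi>. 4 * ((norm \<xi>)\<^sup>2 * (cmod (fourier f \<xi>))\<^sup>2)"])
      show "integrable lborel (\<lambda>\<xi>. 4 * ((norm \<xi>)\<^sup>2 * (cmod (fourier f \<xi>))\<^sup>2))" using H by simp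
      show "AE \<xi> in lborel. (\<lambda>n. (norm ((dq_symbol (t n) (\<xi> $ k) - \<i> * of_real (\<xi> $ k)) * fourier f \<xi>))\<^sup>2) \<longlonglongrightarrow> 0"
      proof (rule AE_I2)
        fix \<xi> :: "real^2"
        have "(\<lambda>n. (norm ((dq_symbol (t n) (\<xi> $ k) - \<i> * of_real (\<xi> $ k)) * fourier f \<xi>))\<^sup>2) \<longlonglongrightarrow>
           (norm ((\<i> * of_real (\<xi> $ k) - \<i> * of_real (\<xi> $ k)) * fourier f \<xi>))\<^sup>2"
          by (intro tendsto_intros tendsto_dq_symbol t)
        thus "(\<lambda>n. (norm ((dq_symbol (t n) (\<xi> $ k) - \<i> * of_real (\<xi> $ k)) * fourier f \<xi>))\<^sup>2) \<longlonglongrightarrow> 0" by simp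
      qed
      show "AE \<xi> in lborel. norm ((norm ((dq_symbol (t n) (\<xi> $ k) - \<i> * of_real (\<xi> $ k)) * fourier f \<xi>))\<^sup>2)
         \<le> 4 * ((norm \<xi>)\<^sup>2 * (cmod (fourier f \<xi>))\<^sup>2)" for n
      proof (rule AE_I2)
        fix \<xi> :: "real^2"
        have "norm (dq_symbol (t n) (\<xi> $ k) - \<i> * of_real (\<xi> $ k)) \<le> \<bar>\<xi> $ k\<bar> + \<bar>\<xi> $ k\<bar>"
          using norm_triangle_ineq4[of "dq_symbol (t n) (\<xi> $ k)" "\<i> * of_real (\<xi> $ k)"]
            norm_dq_symbol_le[OF t(2), of n "\<xi> $ k"] by (simp add: norm_mult)
        also have "\<dots> \<le> 2 * norm \<xi>" using component_le_norm_cart[of \<xi> k] by simp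
        finally have "(norm (dq_symbol (t n) (\<xi> $ k) - \<i> * of_real (\<xi> $ k)))\<^sup>2 \<le> (2 * norm \<xi>)\<^sup>2"
          by (intro power_mono) auto
        hence "(norm (dq_symbol (t n) (\<xi> $ k) - \<i> * of_real (\<xi> $ k)))\<^sup>2 * (cmod (fourier f \<xi>))\<^sup>2
           \<le> (2 * norm \<xi>)\<^sup>2 * (cmod (fourier f \<xi>))\<^sup>2" by (intro mult_right_mono) auto
        thus "norm ((norm ((dq_symbol (t n) (\<xi> $ k) - \<i> * of_real (\<xi> $ k)) * fourier f \<xi>))\<^sup>2)
         \<le> 4 * ((norm \<xi>)\<^sup>2 * (cmod (fourier f \<xi>))\<^sup>2)" by (simp add: norm_mult power_mult_distrib)
      qed
    qed measurable
    moreover have "(l2_norm (\<lambda>\<xi>. fourier (d n) \<xi> - G \<xi>))\<^sup>2 =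
      (LINT \<xi>|lborel. (norm ((dq_symbol (t n) (\<xi> $ k) - \<i> * of_real (\<xi> $ k)) * fourier f \<xi>))\<^sup>2)" for n
    proof -
      have [measurable]: "fourier (d n) \<in> borel_measurable borel" "G \<in> borel_measurable borel"
        using square_integrable_measurable[OF fourier_spec(1)[OF sd]] square_integrable_measurable[OF sG] by auto
      show ?thesis
        unfolding l2_norm_power2
      proof (rule integral_cong_AE)
        show "AE \<xi> in lborel. (norm (fourier (d n) \<xi> - G \<xi>))\<^sup>2 =
          (norm ((dq_symbol (t n) (\<xi> $ k) - \<i> * of_real (\<xi> $ k)) * fourier f \<xi>))\<^sup>2"
          using Fd[of n] by eventually_elim (simp add: G_def left_diff_distrib)
      qed measurable
    qed
    ultimately show ?thesis by simp
  qed
  from tendsto_real_sqrt[OF this] have "(\<lambda>n. l2_norm (\<lambda>\<xi>. fourier (d n) \<xi> - G \<xi>)) \<longlonglongrightarrow> 0" by simp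
  then obtain g where g: "square_integrable g" "(\<lambda>n. l2_norm (\<lambda>x. d n x - g x)) \<longlonglongrightarrow> 0"
    "AE \<xi> in lborel. fourier g \<xi> = G \<xi>"
    by (rule fourier_l2_limit[OF sd sG])
  have "(LINT x|lborel. f x * partial_derivative k \<psi> x) = - (LINT x|lborel. g x * \<psi> x)" if \<psi>: "test_function \<psi>" for \<psi>
  proof -
    note s\<psi> = square_integrable_test_function[OF \<psi>]
    \<comment> \<open>Moving the shift from f to the test function reverses its direction, which is
      why the quotients here have step \<open>- t n\<close>.\<close>
    have "(\<lambda>n. LINT x|lborel. f x * ((\<psi> (x + (- t n) *\<^sub>R ?e) - \<psi> x) / (- t n))) \<longlonglongrightarrow> (LINT x|lborel. f x * partial_derivative k \<psi> x)"
      by (rule tendsto_integral_diff_quotient[OF locally_integrable_square_integrable[OF f] \<psi>])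
         (use t tendsto_minus[OF t(1)] in auto)
    moreover have "(LINT x|lborel. f x * ((\<psi> (x + (- t n) *\<^sub>R ?e) - \<psi> x) / (- t n))) = - (LINT x|lborel. d n x * \<psi> x)" for n
    proof -
      let ?h = "t n *\<^sub>R ?e"
      note i1 = integrable_mult_square_integrable(1)[OF sh s\<psi>, of ?h]
      note i2 = integrable_mult_square_integrable(1)[OF f s\<psi>]
      note i3 = integrable_mult_square_integrable(1)[OF f square_integrable_shift(1)[OF s\<psi>], of "- ?h"]
      have eq: "(LINT x|lborel. f x * \<psi> (x + - ?h)) = (LINT x|lborel. f (x + ?h) * \<psi> x)"
        using lborel_integrable_shift(2)[OF i3, of ?h] by simp
      have "(LINT x|lborel. f x * ((\<psi> (x + (- t n) *\<^sub>R ?e) - \<psi> x) / (- t n)))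
         = (LINT x|lborel. (- 1 / t n) * (f x * \<psi> (x + - ?h) - f x * \<psi> x))"
        using t(2)[of n] by (intro Bochner_Integration.integral_cong) (auto simp: field_simps)
      also have "\<dots> = (- 1 / t n) * ((LINT x|lborel. f (x + ?h) * \<psi> x) - (LINT x|lborel. f x * \<psi> x))"
        unfolding eq[symmetric] using i2 i3 by simp
      also have "\<dots> = - (LINT x|lborel. (1 / t n) * (f (x + ?h) * \<psi> x - f x * \<psi> x))"
        using i1 i2 by simp
      also have "\<dots> = - (LINT x|lborel. d n x * \<psi> x)" by (simp add: d_def algebra_simps)
      finally show ?thesis .
    qed
    ultimately have lim1: "(\<lambda>n. - (LINT x|lborel. d n x * \<psi> x)) \<longlonglongrightarrow> (LINT x|lborel. f x * partial_derivative k \<psi> x)"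
      by simp
    have "(\<lambda>n. (LINT x|lborel. d n x * \<psi> x) - (LINT x|lborel. g x * \<psi> x)) \<longlonglongrightarrow> 0"
    proof (rule Lim_null_comparison[OF always_eventually])
      show "(\<lambda>n. l2_norm (\<lambda>x. d n x - g x) * l2_norm \<psi>) \<longlonglongrightarrow> 0"
        using tendsto_mult_right[OF g(2), of "l2_norm \<psi>"] by simp
      show "\<forall>n. norm ((LINT x|lborel. d n x * \<psi> x) - (LINT x|lborel. g x * \<psi> x)) \<le> l2_norm (\<lambda>x. d n x - g x) * l2_norm \<psi>"
        using integrable_mult_square_integrable(3)[OF square_integrable_diff[OF sd g(1)] s\<psi>]
          integrable_mult_square_integrable(1)[OF sd s\<psi>] integrable_mult_square_integrable(1)[OF g(1) s\<psi>]
        by (simp add: left_diff_distrib)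
    qed
    hence "(\<lambda>n. LINT x|lborel. d n x * \<psi> x) \<longlonglongrightarrow> (LINT x|lborel. g x * \<psi> x)" by (simp add: LIM_zero_iff)
    from LIMSEQ_unique[OF lim1 tendsto_minus[OF this]] show ?thesis .
  qed
  hence "is_weak_partial k f g"
    using locally_integrable_square_integrable f g(1) by (auto simp: is_weak_partial_def)
  with g(1) show thesis using g(3) unfolding G_def by (rule that)
qed

text \<open>Difference quotients of \<psi> have transforms given by the shift rule. Cosine and sine
  are locally integrable, so \<open>tendsto_integral_diff_quotient\<close> passes to the limit in
  the real and imaginary parts.\<close>

lemma ft_partial_derivative:
  assumes \<psi>: "test_function \<psi>"
  shows "ft (partial_derivative k \<psi>) \<xi> = \<i> * of_real (\<xi> $ k) * ft \<psi> \<xi>"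
proof -
  let ?e = "axis k 1 :: real^2"
  define t where "t n = inverse (real (Suc n))" for n
  have t: "t \<longlonglongrightarrow> 0" "\<And>n. t n \<noteq> 0" "\<And>n. \<bar>t n\<bar> \<le> 1"
    using LIMSEQ_inverse_real_of_nat by (auto simp: t_def[abs_def] divide_simps)
  note i = integrable_test_function[OF \<psi>]
  note ip = integrable_test_function[OF test_function_partial_derivative[OF \<psi>]]
  note ish = lborel_integrable_shift(1)[OF i]
  define d where "d n x = (\<psi> (x + t n *\<^sub>R ?e) - \<psi> x) / t n" for n x
  have id: "integrable lborel (d n)" for n unfolding d_def using i ish by simp
  have li: "locally_integrable (\<lambda>x. cos (x \<bullet> \<xi>))" "locally_integrable (\<lambda>x. sin (x \<bullet> \<xi>))"
    unfolding locally_integrable_def set_integrable_def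
    by (intro conjI allI impI borel_integrable_compact continuous_intros; assumption)+
  have "(\<lambda>n. Complex (LINT x|lborel. cos (x \<bullet> \<xi>) * d n x) (- (LINT x|lborel. sin (x \<bullet> \<xi>) * d n x))) \<longlonglongrightarrow>
    Complex (LINT x|lborel. cos (x \<bullet> \<xi>) * partial_derivative k \<psi> x) (- (LINT x|lborel. sin (x \<bullet> \<xi>) * partial_derivative k \<psi> x))"
    unfolding d_def by (intro tendsto_Complex tendsto_minus tendsto_integral_diff_quotient li \<psi> t)
  hence "(\<lambda>n. ft (d n) \<xi>) \<longlonglongrightarrow> ft (partial_derivative k \<psi>) \<xi>"
    by (simp add: ft_conv_trig[OF id] ft_conv_trig[OF ip])
  moreover have "ft (d n) \<xi> = dq_symbol (t n) (\<xi> $ k) * ft \<psi> \<xi>" for n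
  proof -
    have "?e \<bullet> \<xi> = \<xi> $ k" by (simp add: inner_axis')
    hence "ft (\<lambda>x. \<psi> (x + t n *\<^sub>R ?e) - \<psi> x) \<xi> = (cis (t n * \<xi> $ k) - 1) * ft \<psi> \<xi>"
      by (simp add: ft_diff[OF ish i] ft_shift[OF i] left_diff_distrib)
    thus ?thesis using ft_cmult[of "1 / t n" "\<lambda>x. \<psi> (x + t n *\<^sub>R ?e) - \<psi> x"]
      by (simp add: d_def[abs_def] dq_symbol_def)
  qed
  ultimately have "(\<lambda>n. dq_symbol (t n) (\<xi> $ k) * ft \<psi> \<xi>) \<longlonglongrightarrow> ft (partial_derivative k \<psi>) \<xi>" by simp
  moreover have "(\<lambda>n. dq_symbol (t n) (\<xi> $ k) * ft \<psi> \<xi>) \<longlonglongrightarrow> \<i> * of_real (\<xi> $ k) * ft \<psi> \<xi>"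
    by (intro tendsto_mult_right tendsto_dq_symbol t)
  ultimately show ?thesis by (rule LIMSEQ_unique)
qed

text \<open>Both orders of differentiation have the same Fourier transform, which is injective on
  L1. Equality almost everywhere is enough under an integral.\<close>

lemma AE_mixed_partial_derivatives:
  assumes "test_function \<psi>"
  shows "AE x in lborel. partial_derivative j (partial_derivative k \<psi>) x = partial_derivative k (partial_derivative j \<psi>) x"
proof -
  note t = test_function_partial_derivative
  note i = integrable_test_function[OF t[OF t[OF assms]]]
  have "AE x in lborel. partial_derivative j (partial_derivative k \<psi>) x - partial_derivative k (partial_derivative j \<psi>) x = 0"
  proof (rule ft_eq_0_imp_AE_0)
    show "integrable lborel (\<lambda>x. partial_derivative j (partial_derivative k \<psi>) x - partial_derivative k (partial_derivative j \<psi>) x)"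
      using i by simp
    show "ft (\<lambda>x. partial_derivative j (partial_derivative k \<psi>) x - partial_derivative k (partial_derivative j \<psi>) x) \<xi> = 0" for \<xi>
      unfolding ft_diff[OF i i] ft_partial_derivative[OF t[OF assms]] ft_partial_derivative[OF assms] by simp
  qed
  thus ?thesis by simp
qed

text \<open>Integration by parts puts both derivatives on the test function, where they
  commute.\<close>

lemma weak_gradient_curl_free:
  assumes "is_weak_partial j P q" "is_weak_partial k P r" "test_function \<psi>"
  shows "(LINT x|lborel. q x * partial_derivative k \<psi> x) = (LINT x|lborel. r x * partial_derivative j \<psi> x)"
proof -
  note t = test_function_partial_derivative[OF assms(3)]
  have P: "locally_integrable P" using assms(1) by (simp add: is_weak_partial_def)
  have [measurable]: "P \<in> borel_measurable borel" by (rule locally_integrable_measurable[OF P])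
  note [measurable] = test_function_measurable[OF test_function_partial_derivative[OF t]]
  have "(LINT x|lborel. P x * partial_derivative j (partial_derivative k \<psi>) x)
     = (LINT x|lborel. P x * partial_derivative k (partial_derivative j \<psi>) x)"
  proof (rule integral_cong_AE)
    show "AE x in lborel. P x * partial_derivative j (partial_derivative k \<psi>) x = P x * partial_derivative k (partial_derivative j \<psi>) x"
      using AE_mixed_partial_derivatives[OF assms(3), of j k] by eventually_elim simp
  qed measurable
  thus ?thesis using assms(1,2) t by (simp add: is_weak_partial_def)
qed

section \<open>Curl-free fields\<close>

text \<open>The annulus that supports \<phi> excludes the origin, so at 0 the dyadic sum has only
  zero terms. This is the bump function that the statements on weak derivatives ask for.\<close>

lemma littlewood_paley_cutoff:
  assumes "littlewood_paley \<theta> \<phi>" shows "test_function \<theta>" "\<theta> 0 = 1"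
proof -
  note lp = assms[unfolded littlewood_paley_def]
  have "\<forall>\<xi>. \<theta> \<xi> \<noteq> 0 \<longrightarrow> norm \<xi> \<le> 4/3" using lp by blast
  moreover have "smooth \<theta>" using lp by blast
  ultimately show "test_function \<theta>" by (intro test_functionI[where r="4/3"]) force+
  have "\<phi> 0 = 0" using lp by (metis divide_le_0_iff norm_zero not_numeral_le_zero)
  moreover have "(\<lambda>j. \<phi> ((1/2)^j *\<^sub>R 0)) sums (1 - \<theta> 0)" using lp by blast
  ultimately have "(\<lambda>j::nat. 0) sums (1 - \<theta> 0)" by simp
  from sums_unique2[OF this sums_zero] show "\<theta> 0 = 1" by simp
qed

lemma weak_partial_fourier:
  assumes \<theta>: "test_function \<theta>" "\<theta> 0 = 1" and f: "square_integrable f"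
    and H: "integrable lborel (\<lambda>\<xi>. (norm \<xi>)\<^sup>2 * (cmod (fourier f \<xi>))\<^sup>2)"
  shows "square_integrable (weak_partial k f)"
    "AE \<xi> in lborel. fourier (weak_partial k f) \<xi> = \<i> * of_real (\<xi> $ k) * fourier f \<xi>"
    "is_weak_partial k f (weak_partial k f)"
proof -
  obtain g where g: "square_integrable g" "is_weak_partial k f g"
    "AE \<xi> in lborel. fourier g \<xi> = \<i> * of_real (\<xi> $ k) * fourier f \<xi>"
    by (rule weak_partial_exists[OF f H])
  note w = AE_weak_partial_eq[OF \<theta> g(2)]
  show "is_weak_partial k f (weak_partial k f)" by (rule w(2))
  hence m: "weak_partial k f \<in> borel_measurable lborel"
    using locally_integrable_measurable by (simp add: is_weak_partial_def)
  show "square_integrable (weak_partial k f)"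
    by (rule square_integrable_bound[OF g(1) m, where c=1]) (use w(1) in auto)
  have "fourier (weak_partial k f) = fourier g"
    by (rule fourier_cong_AE[OF w(1) m square_integrable_measurable[OF g(1)]])
  with g(3) show "AE \<xi> in lborel. fourier (weak_partial k f) \<xi> = \<i> * of_real (\<xi> $ k) * fourier f \<xi>" by simp
qed

text \<open>Stated for an arbitrary test function \<kappa> because both \<theta> and its partial
  derivatives occur as cutoffs. As the cutoff is widened, \<kappa>(x/n) tends to the constant
  \<kappa>(0), so the limit is a multiple of the transform of G.\<close>

lemma fourier_scaled_cutoff:
  assumes \<kappa>: "test_function \<kappa>" and G: "square_integrable G"
  shows "square_integrable (\<lambda>x. G x * \<kappa> (inverse (real (Suc n)) *\<^sub>R x))"
    "integrable lborel (\<lambda>x. G x * \<kappa> (inverse (real (Suc n)) *\<^sub>R x))"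
    "(\<lambda>n. l2_norm (\<lambda>\<xi>. ft (\<lambda>x. G x * \<kappa> (inverse (real (Suc n)) *\<^sub>R x)) \<xi> - fourier (\<lambda>x. \<kappa> 0 * G x) \<xi>)) \<longlonglongrightarrow> 0"
proof -
  obtain B where B: "B > 0" "\<And>x. \<bar>\<kappa> x\<bar> \<le> B" using test_function_bounded[OF \<kappa>] by blast
  have t: "test_function (\<lambda>x. \<kappa> (inverse (real (Suc n)) *\<^sub>R x))" for n
    by (rule test_function_scale[OF \<kappa>]) simp
  note [measurable] = test_function_measurable[OF t]
  have [measurable]: "G \<in> borel_measurable borel" using square_integrable_measurable[OF G] by simp
  show s: "square_integrable (\<lambda>x. G x * \<kappa> (inverse (real (Suc n)) *\<^sub>R x))" for n
    using square_integrable_cmult_bounded[OF G test_function_measurable[OF t[of n]], where c=B] B by (simp add: mult.commute)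
  show i: "integrable lborel (\<lambda>x. G x * \<kappa> (inverse (real (Suc n)) *\<^sub>R x))" for n
    by (rule locally_integrable_mult_test[OF locally_integrable_square_integrable[OF G] t])
  have sc: "square_integrable (\<lambda>x. \<kappa> 0 * G x)" using square_integrable_scaleR[OF G, of "\<kappa> 0"] by simp
  have "(\<lambda>n. LINT x|lborel. (norm (G x * \<kappa> (inverse (real (Suc n)) *\<^sub>R x) - \<kappa> 0 * G x))\<^sup>2) \<longlonglongrightarrow> (LINT x::real^2|lborel. 0)"
  proof (rule integral_dominated_convergence[where w="\<lambda>x. (2 * B)\<^sup>2 * (norm (G x))\<^sup>2"])
    show "integrable lborel (\<lambda>x. (2 * B)\<^sup>2 * (norm (G x))\<^sup>2)" using square_integrable_integrable[OF G] by simp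
    show "AE x in lborel. (\<lambda>n. (norm (G x * \<kappa> (inverse (real (Suc n)) *\<^sub>R x) - \<kappa> 0 * G x))\<^sup>2) \<longlonglongrightarrow> 0"
    proof (rule AE_I2)
      fix x :: "real^2"
      have "(\<lambda>n. (norm (G x * \<kappa> (inverse (real (Suc n)) *\<^sub>R x) - \<kappa> 0 * G x))\<^sup>2) \<longlonglongrightarrow> (norm (G x * \<kappa> 0 - \<kappa> 0 * G x))\<^sup>2"
        by (intro tendsto_power tendsto_norm tendsto_diff tendsto_mult_left tendsto_scale_0 \<kappa> tendsto_const)
      thus "(\<lambda>n. (norm (G x * \<kappa> (inverse (real (Suc n)) *\<^sub>R x) - \<kappa> 0 * G x))\<^sup>2) \<longlonglongrightarrow> 0" by simp
    qed
    show "AE x in lborel. norm ((norm (G x * \<kappa> (inverse (real (Suc n)) *\<^sub>R x) - \<kappa> 0 * G x))\<^sup>2) \<le> (2 * B)\<^sup>2 * (norm (G x))\<^sup>2" for n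
    proof (rule AE_I2)
      fix x :: "real^2"
      have "norm (G x * \<kappa> (inverse (real (Suc n)) *\<^sub>R x) - \<kappa> 0 * G x) = \<bar>\<kappa> (inverse (real (Suc n)) *\<^sub>R x) - \<kappa> 0\<bar> * norm (G x)"
        by (simp add: abs_mult[symmetric] algebra_simps)
      also have "\<dots> \<le> (2 * B) * norm (G x)"
        using B(2)[of "inverse (real (Suc n)) *\<^sub>R x"] B(2)[of 0] by (intro mult_right_mono) auto
      finally have "(norm (G x * \<kappa> (inverse (real (Suc n)) *\<^sub>R x) - \<kappa> 0 * G x))\<^sup>2 \<le> ((2 * B) * norm (G x))\<^sup>2"
        by (intro power_mono) auto
      thus "norm ((norm (G x * \<kappa> (inverse (real (Suc n)) *\<^sub>R x) - \<kappa> 0 * G x))\<^sup>2) \<le> (2 * B)\<^sup>2 * (norm (G x))\<^sup>2"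
        by (simp add: power_mult_distrib)
    qed
  qed measurable
  from tendsto_real_sqrt[OF this]
  have "(\<lambda>n. l2_norm (\<lambda>x. G x * \<kappa> (inverse (real (Suc n)) *\<^sub>R x) - \<kappa> 0 * G x)) \<longlonglongrightarrow> 0"
    by (simp add: l2_norm_def)
  thus "(\<lambda>n. l2_norm (\<lambda>\<xi>. ft (\<lambda>x. G x * \<kappa> (inverse (real (Suc n)) *\<^sub>R x)) \<xi> - fourier (\<lambda>x. \<kappa> 0 * G x) \<xi>)) \<longlonglongrightarrow> 0"
    by (rule tendsto_ft_fourier[OF sc s i])
qed

text \<open>The L1 counterpart: by dominated convergence the limit exists at every frequency, not
  just in norm.\<close>

lemma ft_scaled_cutoff:
  assumes \<kappa>: "test_function \<kappa>" and C: "integrable lborel C"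
  shows "integrable lborel (\<lambda>x. C x * \<kappa> (inverse (real (Suc n)) *\<^sub>R x))"
    "(\<lambda>n. ft (\<lambda>x. C x * \<kappa> (inverse (real (Suc n)) *\<^sub>R x)) \<xi>) \<longlonglongrightarrow> of_real (\<kappa> 0) * ft C \<xi>"
proof -
  obtain B where B: "B > 0" "\<And>x. \<bar>\<kappa> x\<bar> \<le> B" using test_function_bounded[OF \<kappa>] by blast
  have t: "test_function (\<lambda>x. \<kappa> (inverse (real (Suc n)) *\<^sub>R x))" for n
    by (rule test_function_scale[OF \<kappa>]) simp
  note [measurable] = test_function_measurable[OF t]
  have [measurable]: "C \<in> borel_measurable borel" using borel_measurable_integrable[OF C] by simp
  show "integrable lborel (\<lambda>x. C x * \<kappa> (inverse (real (Suc n)) *\<^sub>R x))" for n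
    using integrable_bounded_mult[OF C, of "\<lambda>x. \<kappa> (inverse (real (Suc n)) *\<^sub>R x)" B] B
      test_function_measurable[OF t[of n]] by (simp add: mult.commute)
  have "(\<lambda>n. LINT x|lborel. cis (- (x \<bullet> \<xi>)) * of_real (C x * \<kappa> (inverse (real (Suc n)) *\<^sub>R x)))
    \<longlonglongrightarrow> (LINT x|lborel. cis (- (x \<bullet> \<xi>)) * of_real (C x * \<kappa> 0))"
  proof (rule integral_dominated_convergence[where w="\<lambda>x. B * \<bar>C x\<bar>"])
    show "integrable lborel (\<lambda>x. B * \<bar>C x\<bar>)" using C by simp
    show "AE x in lborel. (\<lambda>n. cis (- (x \<bullet> \<xi>)) * of_real (C x * \<kappa> (inverse (real (Suc n)) *\<^sub>R x)))
      \<longlonglongrightarrow> cis (- (x \<bullet> \<xi>)) * of_real (C x * \<kappa> 0)"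
      by (intro AE_I2 tendsto_mult_left tendsto_of_real tendsto_scale_0 \<kappa>)
    show "AE x in lborel. norm (cis (- (x \<bullet> \<xi>)) * of_real (C x * \<kappa> (inverse (real (Suc n)) *\<^sub>R x))) \<le> B * \<bar>C x\<bar>" for n
    proof (rule AE_I2)
      fix x :: "real^2"
      have "\<bar>C x\<bar> * \<bar>\<kappa> (inverse (real (Suc n)) *\<^sub>R x)\<bar> \<le> \<bar>C x\<bar> * B"
        by (intro mult_left_mono B) auto
      thus "norm (cis (- (x \<bullet> \<xi>)) * of_real (C x * \<kappa> (inverse (real (Suc n)) *\<^sub>R x))) \<le> B * \<bar>C x\<bar>"
        by (simp only: norm_mult norm_cis norm_of_real abs_mult mult_1 mult.commute)
    qed
  qed measurable
  hence "(\<lambda>n. ft (\<lambda>x. C x * \<kappa> (inverse (real (Suc n)) *\<^sub>R x)) \<xi>) \<longlonglongrightarrow> ft (\<lambda>x. \<kappa> 0 * C x) \<xi>"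
    by (simp only: ft_def mult.commute[of "\<kappa> 0"])
  thus "(\<lambda>n. ft (\<lambda>x. C x * \<kappa> (inverse (real (Suc n)) *\<^sub>R x)) \<xi>) \<longlonglongrightarrow> of_real (\<kappa> 0) * ft C \<xi>"
    by (simp only: ft_cmult)
qed

text \<open>Both sides are formally the transform of the mixed second derivative of P times the
  cutoff. Testing the curl-free identity with a plane wave times the cutoff avoids second
  derivatives of P; the derivative of the cutoff costs the term with the factor s.\<close>

lemma weak_gradient_cutoff_identity:
  fixes \<xi> :: "real^2" and n :: nat
  assumes \<theta>: "test_function \<theta>" and q: "is_weak_partial j P q" and r: "is_weak_partial k P r"
  defines "s \<equiv> inverse (real (Suc n))"
  shows "\<i> * of_real (\<xi> $ k) * ft (\<lambda>x. q x * \<theta> (s *\<^sub>R x)) \<xi> - of_real s * ft (\<lambda>x. q x * partial_derivative k \<theta> (s *\<^sub>R x)) \<xi>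
    = \<i> * of_real (\<xi> $ j) * ft (\<lambda>x. r x * \<theta> (s *\<^sub>R x)) \<xi> - of_real s * ft (\<lambda>x. r x * partial_derivative j \<theta> (s *\<^sub>R x)) \<xi>"
proof -
  have s: "s > 0" by (simp add: s_def)
  have l: "locally_integrable q" "locally_integrable r" using q r by (auto simp: is_weak_partial_def)
  note p = test_function_partial_derivative[OF \<theta>]
  define c where "c f \<kappa> = (LINT x|lborel. cos (x \<bullet> \<xi>) * (f x * \<kappa> (s *\<^sub>R x)))" for f \<kappa> :: "real^2 \<Rightarrow> real"
  define d where "d f \<kappa> = (LINT x|lborel. sin (x \<bullet> \<xi>) * (f x * \<kappa> (s *\<^sub>R x)))" for f \<kappa> :: "real^2 \<Rightarrow> real"
  have i: "integrable lborel (\<lambda>x. f x * \<kappa> (s *\<^sub>R x))" if "locally_integrable f" "test_function \<kappa>" for f \<kappa>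
    by (rule locally_integrable_mult_test[OF that(1) test_function_scale[OF that(2) s]])
  have ic: "integrable lborel (\<lambda>x. cos (x \<bullet> \<xi>) * (f x * \<kappa> (s *\<^sub>R x)))"
    "integrable lborel (\<lambda>x. sin (x \<bullet> \<xi>) * (f x * \<kappa> (s *\<^sub>R x)))" if "locally_integrable f" "test_function \<kappa>" for f \<kappa>
    by (rule integrable_bounded_mult[OF i[OF that], where c=1]; simp)+
  have ft: "ft (\<lambda>x. f x * \<kappa> (s *\<^sub>R x)) \<xi> = Complex (c f \<kappa>) (- d f \<kappa>)" if "locally_integrable f" "test_function \<kappa>" for f \<kappa>
    unfolding ft_conv_trig[OF i[OF that]] c_def d_def ..
  define \<psi> where "\<psi> a b x = (a * cos (x \<bullet> \<xi>) + b * sin (x \<bullet> \<xi>)) * \<theta> (s *\<^sub>R x)" for a b x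
  have t\<psi>: "test_function (\<psi> a b)" for a b
    unfolding \<psi>_def by (rule test_function_trig_mult[OF test_function_scale[OF \<theta> s]])
  have pd: "partial_derivative m (\<psi> a b) x =
    (\<xi> $ m * b * cos (x \<bullet> \<xi>) - \<xi> $ m * a * sin (x \<bullet> \<xi>)) * \<theta> (s *\<^sub>R x)
    + (a * cos (x \<bullet> \<xi>) + b * sin (x \<bullet> \<xi>)) * (s * partial_derivative m \<theta> (s *\<^sub>R x))" for m a b x
  proof -
    have "smooth (\<lambda>x. \<theta> (s *\<^sub>R x))" using smooth_scale[OF test_function_smooth[OF \<theta>], of 1 s] by simp
    note m = partial_derivative_mult[OF smooth_trig this]
    have "partial_derivative m (\<lambda>x. \<theta> (s *\<^sub>R x)) = (\<lambda>x. s * partial_derivative m \<theta> (s *\<^sub>R x))"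
      using partial_derivative_scale[OF test_function_smooth[OF \<theta>], of m 1 s] by simp
    thus ?thesis unfolding \<psi>_def m partial_derivative_trig by simp
  qed
  have int: "(LINT x|lborel. f x * partial_derivative m (\<psi> a b) x) =
     \<xi> $ m * b * c f \<theta> - \<xi> $ m * a * d f \<theta> + s * (a * c f (partial_derivative m \<theta>) + b * d f (partial_derivative m \<theta>))"
    if f: "locally_integrable f" for f m a b
  proof -
    have "(LINT x|lborel. f x * partial_derivative m (\<psi> a b) x) =
      (LINT x|lborel. \<xi> $ m * b * (cos (x \<bullet> \<xi>) * (f x * \<theta> (s *\<^sub>R x))) - \<xi> $ m * a * (sin (x \<bullet> \<xi>) * (f x * \<theta> (s *\<^sub>R x)))
        + (s * a * (cos (x \<bullet> \<xi>) * (f x * partial_derivative m \<theta> (s *\<^sub>R x)))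
         + s * b * (sin (x \<bullet> \<xi>) * (f x * partial_derivative m \<theta> (s *\<^sub>R x)))))"
      unfolding pd by (simp add: algebra_simps)
    also have "\<dots> = \<xi> $ m * b * c f \<theta> - \<xi> $ m * a * d f \<theta> +
       (s * a * c f (partial_derivative m \<theta>) + s * b * d f (partial_derivative m \<theta>))"
      unfolding c_def d_def using ic[OF f \<theta>] ic[OF f p[of m]] by simp
    finally show ?thesis by (simp add: algebra_simps)
  qed
  have "(LINT x|lborel. q x * partial_derivative k (\<psi> a b) x) = (LINT x|lborel. r x * partial_derivative j (\<psi> a b) x)" for a b
    by (rule weak_gradient_curl_free[OF q r t\<psi>])
  \<comment> \<open>The coefficients (1, 0) and (0, 1) test against the cosine and the sine, which
    give the two real components of the complex identity.\<close>
  from this[of 1 0] this[of 0 1] show ?thesis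
    unfolding int[OF l(1)] int[OF l(2)] ft[OF l(1) \<theta>] ft[OF l(1) p] ft[OF l(2) \<theta>] ft[OF l(2) p]
    by (simp add: complex_eq_iff)
qed

text \<open>
  The pressure gradient is the difference of an \<open>L\<^sup>2\<close> and an \<open>L\<^sup>1\<close> field, and curl free.  No Fourier
  transform of the pressure gradient itself is used, only of its localisations.
\<close>

lemma fourier_curl_free:
  assumes \<theta>: "test_function \<theta>" "\<theta> 0 = 1" and q: "is_weak_partial j P q" and r: "is_weak_partial k P r"
    and G: "square_integrable G" and H: "square_integrable H"
    and C: "integrable lborel C" and D: "integrable lborel D"
    and qe: "AE x in lborel. q x = G x - C x" and re: "AE x in lborel. r x = H x - D x"
  shows "AE \<xi> in lborel. of_real (\<xi> $ k) * fourier G \<xi> - of_real (\<xi> $ j) * fourier H \<xi>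
     = of_real (\<xi> $ k) * ft C \<xi> - of_real (\<xi> $ j) * ft D \<xi>"
proof -
  define s where "s n = inverse (real (Suc n))" for n
  note p = test_function_partial_derivative[OF \<theta>(1)]
  have l: "locally_integrable q" "locally_integrable r" using q r by (auto simp: is_weak_partial_def)
  have [measurable]: "q \<in> borel_measurable borel" "r \<in> borel_measurable borel" "G \<in> borel_measurable borel"
    "H \<in> borel_measurable borel" "C \<in> borel_measurable borel" "D \<in> borel_measurable borel"
    using locally_integrable_measurable l borel_measurable_integrable[OF C] borel_measurable_integrable[OF D]
      square_integrable_measurable[OF G] square_integrable_measurable[OF H] by auto
  have split: "ft (\<lambda>x. f x * \<kappa> (s n *\<^sub>R x)) \<xi> = ft (\<lambda>x. g x * \<kappa> (s n *\<^sub>R x)) \<xi> - ft (\<lambda>x. h x * \<kappa> (s n *\<^sub>R x)) \<xi>"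
    if "AE x in lborel. f x = g x - h x" "square_integrable g" "integrable lborel h" "test_function \<kappa>"
      and [measurable]: "f \<in> borel_measurable borel" for f g h \<kappa> n \<xi>
  proof -
    have [measurable]: "g \<in> borel_measurable borel" "h \<in> borel_measurable borel" "\<kappa> \<in> borel_measurable borel"
      using that square_integrable_measurable borel_measurable_integrable test_function_measurable by auto
    have "ft (\<lambda>x. f x * \<kappa> (s n *\<^sub>R x)) \<xi> = ft (\<lambda>x. g x * \<kappa> (s n *\<^sub>R x) - h x * \<kappa> (s n *\<^sub>R x)) \<xi>"
    proof (rule ft_cong_AE)
      show "AE x in lborel. f x * \<kappa> (s n *\<^sub>R x) = g x * \<kappa> (s n *\<^sub>R x) - h x * \<kappa> (s n *\<^sub>R x)"
        using that(1) by eventually_elim (simp add: left_diff_distrib)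
    qed measurable
    also have "\<dots> = ft (\<lambda>x. g x * \<kappa> (s n *\<^sub>R x)) \<xi> - ft (\<lambda>x. h x * \<kappa> (s n *\<^sub>R x)) \<xi>"
      unfolding s_def by (intro ft_diff fourier_scaled_cutoff ft_scaled_cutoff that)
    finally show ?thesis .
  qed
  \<comment> \<open>The L2 parts converge only in norm, whereas the identity is to be read at a
    fixed frequency; the four limits are therefore taken along one subsequence that converges almost
    everywhere. The L1 parts converge at every frequency anyway.\<close>
  define I where "I = {(G, \<theta>), (G, partial_derivative k \<theta>), (H, \<theta>), (H, partial_derivative j \<theta>)}"
  have I: "square_integrable (fst i)" "test_function (snd i)" if "i \<in> I" for i
    using that G H \<theta> p by (auto simp: I_def)
  obtain \<rho> :: "nat \<Rightarrow> nat" where \<rho>: "strict_mono \<rho>" "AE \<xi> in lborel. \<forall>i\<in>I.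
     (\<lambda>n. ft (\<lambda>x. fst i x * snd i (s (\<rho> n) *\<^sub>R x)) \<xi>) \<longlonglongrightarrow> fourier (\<lambda>x. snd i 0 * fst i x) \<xi>"
  proof (rule AE_subsequence_l2_limit[of I "\<lambda>i n. ft (\<lambda>x. fst i x * snd i (s n *\<^sub>R x))" "\<lambda>i. fourier (\<lambda>x. snd i 0 * fst i x)"])
    show "finite I" by (simp add: I_def)
    fix i n assume "i \<in> I"
    note I = I[OF this]
    show "square_integrable (ft (\<lambda>x. fst i x * snd i (s n *\<^sub>R x)))"
      unfolding s_def by (intro plancherel_integrable fourier_scaled_cutoff I)
    show "square_integrable (fourier (\<lambda>x. snd i 0 * fst i x))"
      using square_integrable_scaleR[OF I(1), of "snd i 0"] by (intro fourier_spec) simp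
    show "(\<lambda>n. l2_norm (\<lambda>x. ft (\<lambda>x. fst i x * snd i (s n *\<^sub>R x)) x - fourier (\<lambda>x. snd i 0 * fst i x) x)) \<longlonglongrightarrow> 0"
      unfolding s_def by (rule fourier_scaled_cutoff(3)[OF I(2,1)])
  qed
  \<comment> \<open>The terms with a differentiated cutoff carry this factor and disappear in the
    limit.\<close>
  have s0: "(\<lambda>n. complex_of_real (s (\<rho> n))) \<longlonglongrightarrow> of_real 0"
    unfolding s_def
    by (intro tendsto_of_real LIMSEQ_subseq_LIMSEQ[OF LIMSEQ_inverse_real_of_nat \<rho>(1), unfolded o_def])
  from \<rho>(2) show ?thesis
  proof eventually_elim
    case (elim \<xi>)
    have lim: "(\<lambda>n. ft (\<lambda>x. f x * \<kappa> (s (\<rho> n) *\<^sub>R x)) \<xi>) \<longlonglongrightarrow> fourier (\<lambda>x. \<kappa> 0 * g x) \<xi> - of_real (\<kappa> 0) * ft h \<xi>"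
      if "AE x in lborel. f x = g x - h x" "(g, \<kappa>) \<in> I" "integrable lborel h" "f \<in> borel_measurable borel" for f g h \<kappa>
    proof -
      note gI = I[OF that(2), simplified]
      have "(\<lambda>n. ft (\<lambda>x. h x * \<kappa> (s (\<rho> n) *\<^sub>R x)) \<xi>) \<longlonglongrightarrow> of_real (\<kappa> 0) * ft h \<xi>"
        using LIMSEQ_subseq_LIMSEQ[OF ft_scaled_cutoff(2)[OF gI(2) that(3)] \<rho>(1)] by (simp add: s_def o_def)
      moreover have "(\<lambda>n. ft (\<lambda>x. g x * \<kappa> (s (\<rho> n) *\<^sub>R x)) \<xi>) \<longlonglongrightarrow> fourier (\<lambda>x. \<kappa> 0 * g x) \<xi>"
        using bspec[OF elim that(2)] by simp
      ultimately show ?thesis unfolding split[OF that(1) gI(1) that(3) gI(2) that(4)] by (intro tendsto_diff)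
    qed
    have mem: "(G, \<theta>) \<in> I" "(G, partial_derivative k \<theta>) \<in> I" "(H, \<theta>) \<in> I" "(H, partial_derivative j \<theta>) \<in> I"
      by (auto simp: I_def)
    have m: "q \<in> borel_measurable borel" "r \<in> borel_measurable borel" by auto
    have "(\<lambda>n. \<i> * of_real (\<xi> $ k) * ft (\<lambda>x. q x * \<theta> (s (\<rho> n) *\<^sub>R x)) \<xi>
         - of_real (s (\<rho> n)) * ft (\<lambda>x. q x * partial_derivative k \<theta> (s (\<rho> n) *\<^sub>R x)) \<xi>)
       \<longlonglongrightarrow> \<i> * of_real (\<xi> $ k) * (fourier (\<lambda>x. \<theta> 0 * G x) \<xi> - of_real (\<theta> 0) * ft C \<xi>) -
         of_real 0 * (fourier (\<lambda>x. partial_derivative k \<theta> 0 * G x) \<xi> - of_real (partial_derivative k \<theta> 0) * ft C \<xi>)"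
      by (intro tendsto_diff tendsto_mult tendsto_const s0 lim[OF qe mem(1) C m(1)] lim[OF qe mem(2) C m(1)])
    moreover have "(\<lambda>n. \<i> * of_real (\<xi> $ j) * ft (\<lambda>x. r x * \<theta> (s (\<rho> n) *\<^sub>R x)) \<xi>
         - of_real (s (\<rho> n)) * ft (\<lambda>x. r x * partial_derivative j \<theta> (s (\<rho> n) *\<^sub>R x)) \<xi>)
       \<longlonglongrightarrow> \<i> * of_real (\<xi> $ j) * (fourier (\<lambda>x. \<theta> 0 * H x) \<xi> - of_real (\<theta> 0) * ft D \<xi>) -
         of_real 0 * (fourier (\<lambda>x. partial_derivative j \<theta> 0 * H x) \<xi> - of_real (partial_derivative j \<theta> 0) * ft D \<xi>)"
      by (intro tendsto_diff tendsto_mult tendsto_const s0 lim[OF re mem(3) D m(2)] lim[OF re mem(4) D m(2)])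
    ultimately have "\<i> * of_real (\<xi> $ k) * (fourier G \<xi> - ft C \<xi>) = \<i> * of_real (\<xi> $ j) * (fourier H \<xi> - ft D \<xi>)"
      unfolding s_def weak_gradient_cutoff_identity[OF \<theta>(1) q r] by (drule_tac LIMSEQ_unique) (auto simp: \<theta>(2))
    hence "\<i> * (of_real (\<xi> $ k) * (fourier G \<xi> - ft C \<xi>)) = \<i> * (of_real (\<xi> $ j) * (fourier H \<xi> - ft D \<xi>))"
      by (simp only: mult.assoc)
    hence "of_real (\<xi> $ k) * (fourier G \<xi> - ft C \<xi>) = of_real (\<xi> $ j) * (fourier H \<xi> - ft D \<xi>)" by simp
    thus ?case by (simp add: algebra_simps)
  qed
qed

section \<open>The energy at low frequencies\<close>

text \<open>The disc is enclosed in a square of side 2 R. Only the order R^2 matters: it is the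
  source of every power of R in the low-frequency estimates.\<close>

lemma emeasure_cball_plane_le: "emeasure lborel (cball (0::real^2) R) \<le> ennreal ((2 * R)\<^sup>2)"
proof (cases "R \<ge> 0")
  case True
  have sub: "cball (0::real^2) R \<subseteq> cbox (\<chi> i. - R) (\<chi> i. R)"
  proof
    fix x :: "real^2" assume "x \<in> cball 0 R"
    hence "norm x \<le> R" by simp
    hence "\<bar>x $ i\<bar> \<le> R" for i using component_le_norm_cart[of x i] by simp
    thus "x \<in> cbox (\<chi> i. - R) (\<chi> i. R)" by (auto simp: mem_box_cart abs_le_iff intro: minus_le_iff[THEN iffD1])
  qed
  have fin: "emeasure lborel (cbox (\<chi> i. - R) (\<chi> i. R) :: (real^2) set) \<noteq> \<infinity>"
    using emeasure_lborel_cbox_finite[of "\<chi> i. - R" "(\<chi> i. R) :: real^2"] by simp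
  have "cbox (\<chi> i. - R) ((\<chi> i. R) :: real^2) \<noteq> {}"
    using True by (auto simp: interval_ne_empty_cart)
  hence "measure lborel (cbox (\<chi> i. - R) (\<chi> i. R) :: (real^2) set) = (2 * R)\<^sup>2"
    by (simp add: content_cbox_cart power2_eq_square UNIV_2)
  hence "emeasure lborel (cbox (\<chi> i. - R) (\<chi> i. R) :: (real^2) set) = ennreal ((2 * R)\<^sup>2)"
    using fin by (simp add: emeasure_eq_ennreal_measure)
  moreover have "emeasure lborel (cball (0::real^2) R) \<le> emeasure lborel (cbox (\<chi> i. - R) (\<chi> i. R) :: (real^2) set)"
    by (rule emeasure_mono[OF sub]) simp
  ultimately show ?thesis by simp
qed simp

lemma l2_norm_indicator_cball_le:
  assumes R: "R \<ge> 0"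
  shows "l2_norm (\<lambda>\<xi>. indicator (cball (0::real^2) R) \<xi> :: real) \<le> 2 * R"
proof -
  have eq: "(\<lambda>x::real^2. (norm (indicator (cball 0 R) x :: real))\<^sup>2) = indicator (cball 0 R)"
    by (auto simp: indicator_def)
  have "measure lborel (cball (0::real^2) R) \<le> (2 * R)\<^sup>2"
    unfolding measure_def by (rule enn2real_leI[OF _ emeasure_cball_plane_le]) simp
  hence "l2_norm (\<lambda>\<xi>. indicator (cball (0::real^2) R) \<xi> :: real) \<le> sqrt ((2 * R)\<^sup>2)"
    unfolding l2_norm_def eq by (intro real_sqrt_le_mono) simp
  thus ?thesis unfolding real_sqrt_abs using R by simp
qed

text \<open>The real L2 product of the parts with frequencies in the ball of radius R, computed in
  frequency. The factor (2 pi)^(-2) of Plancherel is left out, so a constant (2 pi)^2 appears in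
  comparisons with \<open>l2_norm\<close>.\<close>

definition low_inner :: "real \<Rightarrow> (real^2 \<Rightarrow> real) \<Rightarrow> (real^2 \<Rightarrow> real) \<Rightarrow> real" where
  "low_inner R f g = (LINT \<xi>|lborel. indicator (cball 0 R) \<xi> * Re (fourier f \<xi> * cnj (fourier g \<xi>)))"

lemma integrable_low_inner:
  assumes f: "square_integrable f" and g: "square_integrable g"
  shows "integrable lborel (\<lambda>\<xi>. indicator (cball 0 R) \<xi> * Re (fourier f \<xi> * cnj (fourier g \<xi>)))"
    "\<bar>low_inner R f g\<bar> \<le> (2 * pi)\<^sup>2 * (l2_norm f * l2_norm g)"
proof -
  note F = fourier_spec(1)[OF f] fourier_spec(1)[OF g]
  have [measurable]: "fourier f \<in> borel_measurable borel" "fourier g \<in> borel_measurable borel"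
    using F[THEN square_integrable_measurable] by auto
  have le: "norm (indicator (cball 0 R) \<xi> * Re (fourier f \<xi> * cnj (fourier g \<xi>))) \<le> norm (fourier f \<xi>) * norm (fourier g \<xi>)" for \<xi>
    using abs_Re_le_cmod[of "fourier f \<xi> * cnj (fourier g \<xi>)"]
    by (auto simp: indicator_def norm_mult)
  show i: "integrable lborel (\<lambda>\<xi>. indicator (cball 0 R) \<xi> * Re (fourier f \<xi> * cnj (fourier g \<xi>)))"
    by (rule Bochner_Integration.integrable_bound[OF integrable_norm_mult[OF F]]) (measurable, use le in auto)
  have "\<bar>low_inner R f g\<bar> \<le> (LINT \<xi>|lborel. norm (fourier f \<xi>) * norm (fourier g \<xi>))"
    unfolding low_inner_def real_norm_def[symmetric]
    by (rule Bochner_Integration.integral_norm_bound_integral[OF i integrable_norm_mult[OF F]]) (rule le)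
  also have "\<dots> \<le> l2_norm (fourier f) * l2_norm (fourier g)" by (rule integral_norm_mult_le[OF F])
  also have "\<dots> = (2 * pi)\<^sup>2 * (l2_norm f * l2_norm g)"
    by (simp add: plancherel f g power2_eq_square)
  finally show "\<bar>low_inner R f g\<bar> \<le> (2 * pi)\<^sup>2 * (l2_norm f * l2_norm g)" .
qed

lemma low_inner_commute: "low_inner R f g = low_inner R g f"
  by (simp add: low_inner_def mult.commute)

text \<open>Formulated through an identity of transforms, so that one integral computation covers
  differences (c = -1) and multiples (f = 0).\<close>

lemma low_inner_AE_left:
  assumes f: "square_integrable f" and g: "square_integrable g" and h: "square_integrable h" and k: "square_integrable k"
    and ae: "AE \<xi> in lborel. fourier k \<xi> = fourier f \<xi> + of_real c * fourier h \<xi>"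
  shows "low_inner R k g = low_inner R f g + c * low_inner R h g"
proof -
  note i = integrable_low_inner(1)[OF f g, of R] integrable_low_inner(1)[OF h g, of R]
  have "low_inner R k g = (LINT \<xi>|lborel. indicator (cball 0 R) \<xi> * Re (fourier f \<xi> * cnj (fourier g \<xi>))
     + c * (indicator (cball 0 R) \<xi> * Re (fourier h \<xi> * cnj (fourier g \<xi>))))"
    unfolding low_inner_def
  proof (rule integral_cong_AE)
    show "(\<lambda>\<xi>. indicator (cball 0 R) \<xi> * Re (fourier k \<xi> * cnj (fourier g \<xi>))) \<in> borel_measurable lborel"
      by (rule borel_measurable_integrable[OF integrable_low_inner(1)[OF k g]])
    show "(\<lambda>\<xi>. indicator (cball 0 R) \<xi> * Re (fourier f \<xi> * cnj (fourier g \<xi>))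
     + c * (indicator (cball 0 R) \<xi> * Re (fourier h \<xi> * cnj (fourier g \<xi>)))) \<in> borel_measurable lborel"
      by (rule borel_measurable_integrable) (use i in auto)
    show "AE \<xi> in lborel. indicator (cball 0 R) \<xi> * Re (fourier k \<xi> * cnj (fourier g \<xi>)) =
      indicator (cball 0 R) \<xi> * Re (fourier f \<xi> * cnj (fourier g \<xi>))
     + c * (indicator (cball 0 R) \<xi> * Re (fourier h \<xi> * cnj (fourier g \<xi>)))"
      using ae by eventually_elim (simp add: algebra_simps)
  qed
  also have "\<dots> = low_inner R f g + c * low_inner R h g" unfolding low_inner_def using i by simp
  finally show ?thesis .
qed

lemma low_inner_diff_left:
  assumes f: "square_integrable f" and g: "square_integrable g" and h: "square_integrable h"
  shows "low_inner R (\<lambda>x. f x - h x) g = low_inner R f g - low_inner R h g"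
proof -
  have "AE \<xi> in lborel. fourier (\<lambda>x. f x - h x) \<xi> = fourier f \<xi> + of_real (-1) * fourier h \<xi>"
    using fourier_diff[OF f h] by simp
  from low_inner_AE_left[OF f g h square_integrable_diff[OF f h] this] show ?thesis by simp
qed

lemma low_inner_cmult_left:
  assumes f: "square_integrable f" and g: "square_integrable g"
  shows "low_inner R (\<lambda>x. c * f x) g = c * low_inner R f g"
proof -
  have sc: "square_integrable (\<lambda>x. c * f x)" using square_integrable_scaleR[OF f, of c] by simp
  have "AE \<xi> in lborel. fourier (\<lambda>x. c * f x) \<xi> = fourier (\<lambda>x. 0) \<xi> + of_real c * fourier f \<xi>"
    using fourier_cmult[OF f, of c] fourier_zero by eventually_elim simp
  from low_inner_AE_left[OF square_integrable_zero g f sc this]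
  have "low_inner R (\<lambda>x. c * f x) g = low_inner R (\<lambda>x. 0) g + c * low_inner R f g" .
  moreover have "low_inner R (\<lambda>x. 0) g = 0"
    using integrable_low_inner(2)[OF square_integrable_zero g, of R] by (simp add: l2_norm_def)
  ultimately show ?thesis by simp
qed

text \<open>Square integrability is asked only eventually along the filter, because solutions are
  constrained at nonnegative times only.\<close>

lemma tendsto_low_inner:
  fixes a b :: "'i \<Rightarrow> real^2 \<Rightarrow> real"
  assumes a: "\<forall>\<^sub>F n in F. square_integrable (a n)" "square_integrable a0" "((\<lambda>n. l2_norm (\<lambda>x. a n x - a0 x)) \<longlongrightarrow> 0) F"
    and b: "\<forall>\<^sub>F n in F. square_integrable (b n)" "square_integrable b0" "((\<lambda>n. l2_norm (\<lambda>x. b n x - b0 x)) \<longlongrightarrow> 0) F"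
  shows "((\<lambda>n. low_inner R (a n) (b n)) \<longlongrightarrow> low_inner R a0 b0) F"
proof -
  let ?\<alpha> = "\<lambda>n. l2_norm (\<lambda>x. a n x - a0 x)" and ?\<beta> = "\<lambda>n. l2_norm (\<lambda>x. b n x - b0 x)"
  have "((\<lambda>n. (2 * pi)\<^sup>2 * (?\<alpha> n * (l2_norm b0 + ?\<beta> n)) + (2 * pi)\<^sup>2 * (l2_norm a0 * ?\<beta> n)) \<longlongrightarrow>
     (2 * pi)\<^sup>2 * (0 * (l2_norm b0 + 0)) + (2 * pi)\<^sup>2 * (l2_norm a0 * 0)) F"
    by (intro tendsto_intros a b)
  hence lim: "((\<lambda>n. (2 * pi)\<^sup>2 * (?\<alpha> n * (l2_norm b0 + ?\<beta> n)) + (2 * pi)\<^sup>2 * (l2_norm a0 * ?\<beta> n)) \<longlongrightarrow> 0) F" by simp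
  have "((\<lambda>n. low_inner R (a n) (b n) - low_inner R a0 b0) \<longlongrightarrow> 0) F"
  proof (rule Lim_null_comparison[OF _ lim])
    show "\<forall>\<^sub>F n in F. norm (low_inner R (a n) (b n) - low_inner R a0 b0) \<le>
      (2 * pi)\<^sup>2 * (?\<alpha> n * (l2_norm b0 + ?\<beta> n)) + (2 * pi)\<^sup>2 * (l2_norm a0 * ?\<beta> n)"
      using a(1) b(1)
    proof eventually_elim
      case (elim n)
      note da = square_integrable_diff[OF elim(1) a(2)] and db = square_integrable_diff[OF elim(2) b(2)]
      have "low_inner R (a n) (b n) - low_inner R a0 b0 =
        low_inner R (\<lambda>x. a n x - a0 x) (b n) + low_inner R (\<lambda>x. b n x - b0 x) a0"
        unfolding low_inner_diff_left[OF elim(1,2) a(2)] low_inner_diff_left[OF elim(2) a(2) b(2)]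
        by (simp add: low_inner_commute[of R a0])
      hence "norm (low_inner R (a n) (b n) - low_inner R a0 b0) \<le>
        (2 * pi)\<^sup>2 * (?\<alpha> n * l2_norm (b n)) + (2 * pi)\<^sup>2 * (l2_norm a0 * ?\<beta> n)"
        using integrable_low_inner(2)[OF da elim(2), of R] integrable_low_inner(2)[OF db a(2), of R]
        by (simp add: mult.commute)
      moreover have "l2_norm (b n) \<le> l2_norm b0 + ?\<beta> n"
        using l2_norm_triangle_diff[OF elim(2) b(2)] by simp
      hence "(2 * pi)\<^sup>2 * (?\<alpha> n * l2_norm (b n)) \<le> (2 * pi)\<^sup>2 * (?\<alpha> n * (l2_norm b0 + ?\<beta> n))"
        by (intro mult_left_mono) auto
      ultimately show ?case by linarith
    qed
  qed
  thus ?thesis by (simp add: LIM_zero_iff)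
qed

text \<open>Differentiability in L2 suffices because the form is bounded and bilinear. The
  derivative is taken within the half line, hence one-sided at time 0, like
  \<open>has_time_derivative\<close>.\<close>

lemma has_derivative_low_inner:
  fixes f :: "real \<Rightarrow> real^2 \<Rightarrow> real"
  assumes f: "\<And>r. r \<ge> 0 \<Longrightarrow> square_integrable (f r)" and v: "square_integrable v" and t: "t \<ge> 0"
    and lim: "((\<lambda>r. l2_norm (\<lambda>x. (1 / (r - t)) * (f r x - f t x) - v x)) \<longlongrightarrow> 0) (at t within {0..})"
  shows "((\<lambda>r. low_inner R (f r) (f r)) has_real_derivative 2 * low_inner R v (f t)) (at t within {0..})"
proof -
  let ?F = "at t within {0..}"
  define d where "d r x = (1 / (r - t)) * (f r x - f t x)" for r x
  have ev: "\<forall>\<^sub>F r in ?F. r \<ge> 0 \<and> r \<noteq> t" by (simp add: eventually_at_filter)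
  have sd: "square_integrable (d r)" if "r \<ge> 0" for r
    using square_integrable_scaleR[OF square_integrable_diff[OF f[OF that] f[OF t]], of "1 / (r - t)"]
    by (simp add: d_def[abs_def])
  have evd: "\<forall>\<^sub>F r in ?F. square_integrable (d r)" using ev by eventually_elim (simp add: sd)
  have evf: "\<forall>\<^sub>F r in ?F. square_integrable (f r)" using ev by eventually_elim (simp add: f)
  have limd: "((\<lambda>r. l2_norm (\<lambda>x. d r x - v x)) \<longlongrightarrow> 0) ?F" using lim by (simp add: d_def)
  have limf: "((\<lambda>r. l2_norm (\<lambda>x. f r x - f t x)) \<longlongrightarrow> 0) ?F"
  proof (rule Lim_null_comparison)
    have "((\<lambda>r. \<bar>r - t\<bar> * (l2_norm v + l2_norm (\<lambda>x. d r x - v x))) \<longlongrightarrow> \<bar>t - t\<bar> * (l2_norm v + 0)) ?F"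
      by (intro tendsto_intros limd)
    thus "((\<lambda>r. \<bar>r - t\<bar> * (l2_norm v + l2_norm (\<lambda>x. d r x - v x))) \<longlongrightarrow> 0) ?F" by simp
    show "\<forall>\<^sub>F r in ?F. norm (l2_norm (\<lambda>x. f r x - f t x)) \<le> \<bar>r - t\<bar> * (l2_norm v + l2_norm (\<lambda>x. d r x - v x))"
      using ev
    proof eventually_elim
      case (elim r)
      have "l2_norm (\<lambda>x. f r x - f t x) = l2_norm (\<lambda>x. (r - t) *\<^sub>R d r x)" using elim by (simp add: d_def)
      also have "\<dots> = \<bar>r - t\<bar> * l2_norm (d r)" by (rule l2_norm_scaleR)
      also have "\<dots> \<le> \<bar>r - t\<bar> * (l2_norm v + l2_norm (\<lambda>x. d r x - v x))"
        using l2_norm_triangle_diff[OF sd v, of r] elim by (intro mult_left_mono) auto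
      finally show ?case by simp
    qed
  qed
  \<comment> \<open>By symmetry the quotient of a quadratic form splits as <d, f r> + <d, f t>,
    where d is the quotient of f; both summands tend to <v, f t>.\<close>
  have "((\<lambda>r. low_inner R (d r) (f r) + low_inner R (d r) (f t)) \<longlongrightarrow> low_inner R v (f t) + low_inner R v (f t)) ?F"
    by (intro tendsto_add tendsto_low_inner evd v limd evf f t limf) (auto simp: f t l2_norm_def)
  moreover have "\<forall>\<^sub>F r in ?F. low_inner R (d r) (f r) + low_inner R (d r) (f t) =
     (low_inner R (f r) (f r) - low_inner R (f t) (f t)) / (r - t)"
    using ev
  proof eventually_elim
    case (elim r)
    hence r: "r \<ge> 0" "r \<noteq> t" by auto
    note df = square_integrable_diff[OF f[OF r(1)] f[OF t]]
    have "low_inner R (d r) g = (low_inner R (f r) g - low_inner R (f t) g) / (r - t)" if "square_integrable g" for g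
      unfolding d_def low_inner_cmult_left[OF df that] low_inner_diff_left[OF f[OF r(1)] that f[OF t]] by simp
    thus ?case using r by (simp add: f t low_inner_commute[of R "f t" "f r"] flip: add_divide_distrib)
  qed
  ultimately have "((\<lambda>r. (low_inner R (f r) (f r) - low_inner R (f t) (f t)) / (r - t)) \<longlongrightarrow> low_inner R v (f t) + low_inner R v (f t)) ?F"
    by (rule Lim_transform_eventually)
  thus ?thesis by (simp add: has_field_derivative_iff)
qed

lemma low_inner_self: "low_inner R f f = (LINT \<xi>|lborel. indicator (cball 0 R) \<xi> * (cmod (fourier f \<xi>))\<^sup>2)"
proof -
  have "Re (fourier f \<xi> * cnj (fourier f \<xi>)) = (cmod (fourier f \<xi>))\<^sup>2" for \<xi>
    by (simp only: complex_norm_square[symmetric] Re_complex_of_real)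
  thus ?thesis by (simp add: low_inner_def)
qed

lemma low_inner_self_nonneg [simp]: "low_inner R f f \<ge> 0"
  unfolding low_inner_self by (intro integral_nonneg_AE) auto

text \<open>The transform of an integrable function is bounded by its L1 norm, and the ball has area
  O(R^2). This is where integrability of the initial data yields decay.\<close>

lemma low_inner_self_integrable:
  assumes "square_integrable f" "integrable lborel f" "R \<ge> 0"
  shows "low_inner R f f \<le> (2 * R)\<^sup>2 * (LINT x|lborel. \<bar>f x\<bar>)\<^sup>2"
proof -
  note F = fourier_spec(1)[OF assms(1)]
  let ?c = "LINT x|lborel. \<bar>f x\<bar>"
  note si = square_integrable_indicator_cball[of R]
  have eq: "(\<lambda>x::real^2. (norm (indicator (cball 0 R) x :: real))\<^sup>2) = indicator (cball 0 R)"
    by (auto simp: indicator_def)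
  have ii: "integrable lborel (\<lambda>\<xi>::real^2. indicator (cball 0 R) \<xi> :: real)"
    using square_integrable_integrable[OF si] unfolding eq .
  have "low_inner R f f \<le> (LINT \<xi>::real^2|lborel. indicator (cball 0 R) \<xi> * ?c\<^sup>2)"
    unfolding low_inner_self
  proof (rule integral_mono_AE)
    show "integrable lborel (\<lambda>\<xi>. indicator (cball 0 R) \<xi> * (cmod (fourier f \<xi>))\<^sup>2)"
      by (rule integrable_bounded_mult[OF square_integrable_integrable[OF F], where c=1]) (auto simp: indicator_def)
    show "AE \<xi> in lborel. indicator (cball 0 R) \<xi> * (cmod (fourier f \<xi>))\<^sup>2 \<le> indicator (cball 0 R) \<xi> * ?c\<^sup>2"
      using fourier_eq_ft[OF assms(1,2)]
      by eventually_elim (auto intro!: mult_left_mono power_mono norm_ft_le)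
  qed (use ii in auto)
  also have "\<dots> = (l2_norm (\<lambda>\<xi>. indicator (cball (0::real^2) R) \<xi> :: real))\<^sup>2 * ?c\<^sup>2"
    unfolding l2_norm_power2 eq using ii by simp
  also have "\<dots> \<le> (2 * R)\<^sup>2 * ?c\<^sup>2"
    by (intro mult_right_mono power_mono l2_norm_indicator_cball_le assms) auto
  finally show ?thesis .
qed

text \<open>Cauchy-Schwarz on the ball. It turns a uniform bound on the transform of a nonlinear
  term into an energy estimate with one factor R.\<close>

lemma low_L1_norm_le:
  assumes f: "square_integrable f" and R: "R \<ge> 0"
  shows "integrable lborel (\<lambda>\<xi>. indicator (cball 0 R) \<xi> * cmod (fourier f \<xi>))"
    "(LINT \<xi>|lborel. indicator (cball 0 R) \<xi> * cmod (fourier f \<xi>)) \<le> 2 * R * sqrt (low_inner R f f)"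
proof -
  note F = fourier_spec(1)[OF f]
  note si = square_integrable_indicator_cball[of R]
  define g where "g \<xi> = indicator (cball 0 R) \<xi> *\<^sub>R fourier f \<xi>" for \<xi>
  have sg: "square_integrable g"
    unfolding g_def using square_integrable_measurable[OF F]
    by (intro square_integrable_bound[OF F, where c=1]) (auto simp: indicator_def)
  have eq: "indicator (cball 0 R) \<xi> * cmod (fourier f \<xi>) = norm (indicator (cball 0 R) \<xi> :: real) * norm (g \<xi>)" for \<xi>
    by (auto simp: g_def indicator_def)
  show "integrable lborel (\<lambda>\<xi>. indicator (cball 0 R) \<xi> * cmod (fourier f \<xi>))"
    unfolding eq by (rule integrable_norm_mult[OF si sg])
  have "(LINT \<xi>|lborel. indicator (cball 0 R) \<xi> * cmod (fourier f \<xi>)) \<le>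
     l2_norm (\<lambda>\<xi>. indicator (cball (0::real^2) R) \<xi> :: real) * l2_norm g"
    unfolding eq by (rule integral_norm_mult_le[OF si sg])
  also have "l2_norm g = sqrt (low_inner R f f)"
    unfolding l2_norm_def low_inner_self g_def
    by (intro arg_cong[of _ _ sqrt] Bochner_Integration.integral_cong) (auto simp: indicator_def)
  also have "l2_norm (\<lambda>\<xi>. indicator (cball (0::real^2) R) \<xi> :: real) * sqrt (low_inner R f f) \<le> 2 * R * sqrt (low_inner R f f)"
    by (intro mult_right_mono l2_norm_indicator_cball_le R) auto
  finally show "(LINT \<xi>|lborel. indicator (cball 0 R) \<xi> * cmod (fourier f \<xi>)) \<le> 2 * R * sqrt (low_inner R f f)" .
qed

text \<open>The vector a is orthogonal to the real frequency (x, y), and g is parallel to it.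
  Multiplying the product by x and by y avoids dividing by a component that could vanish.\<close>

lemma divergence_free_inner_curl_free:
  fixes x y :: real and a1 a2 g1 g2 :: complex
  assumes "x \<noteq> 0 \<or> y \<noteq> 0" "of_real x * a1 + of_real y * a2 = 0" "of_real y * g1 = of_real x * g2"
  shows "g1 * cnj a1 + g2 * cnj a2 = 0"
proof -
  have c: "of_real x * cnj a1 + of_real y * cnj a2 = 0"
    using arg_cong[OF assms(2), of cnj] by simp
  have "of_real x * (g1 * cnj a1 + g2 * cnj a2) = g1 * (of_real x * cnj a1) + (of_real x * g2) * cnj a2"
    by (simp add: algebra_simps)
  also have "\<dots> = g1 * (of_real x * cnj a1 + of_real y * cnj a2)"
    unfolding assms(3)[symmetric] by (simp add: algebra_simps)
  finally have 1: "of_real x * (g1 * cnj a1 + g2 * cnj a2) = 0" unfolding c by simp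
  have "of_real y * (g1 * cnj a1 + g2 * cnj a2) = (of_real y * g1) * cnj a1 + g2 * (of_real y * cnj a2)"
    by (simp add: algebra_simps)
  also have "\<dots> = g2 * (of_real x * cnj a1 + of_real y * cnj a2)"
    unfolding assms(3) by (simp add: algebra_simps)
  finally have 2: "of_real y * (g1 * cnj a1 + g2 * cnj a2) = 0" unfolding c by simp
  show ?thesis using 1 2 assms(1) by auto
qed

text \<open>
  The cancellation between \<open>div \<tau>\<close> and \<open>D(u)\<close>: for vectors \<open>a\<close> and symmetric tensors \<open>t\<close>, both at
  frequency \<open>(x, y)\<close>.
\<close>

lemma linear_cancellation:
  fixes x y :: real and a1 a2 t11 t12 t22 :: complex
  shows "Re ((\<i> * of_real x * t11 + \<i> * of_real y * t12) * cnj a1 + (\<i> * of_real x * t12 + \<i> * of_real y * t22) * cnj a2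
     + (\<i> * of_real x * a1) * cnj t11 + (\<i> * of_real y * a1 + \<i> * of_real x * a2) * cnj t12 + (\<i> * of_real y * a2) * cnj t22) = 0"
  by (simp add: algebra_simps)

text \<open>The energy balance at one frequency. Here g stands for convection plus pressure gradient
  and c for convection alone, so g - c is parallel to the frequency and drops out against the
  divergence-free a. The coupling terms cancel by \<open>linear_cancellation\<close>, the term with
  k = 1 + |\<xi>|^2 has a good sign and is discarded, and the quadratic terms are at most M. The
  off-diagonal stress entries share one transform t12 by symmetry.\<close>

lemma energy_density_bound:
  fixes x y :: real and a1 a2 t11 t12 t22 g1 g2 c1 c2 n11 n12 n21 n22 :: complex
  assumes xy: "x \<noteq> 0 \<or> y \<noteq> 0" and div: "of_real x * a1 + of_real y * a2 = 0"
    and curl: "of_real y * g1 - of_real x * g2 = of_real y * c1 - of_real x * c2"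
    and M: "cmod c1 \<le> M" "cmod c2 \<le> M" "cmod n11 \<le> M" "cmod n12 \<le> M" "cmod n21 \<le> M" "cmod n22 \<le> M"
    and k: "k \<ge> 0"
  shows "Re ((\<i> * of_real x * t11 + \<i> * of_real y * t12 - g1) * cnj a1)
    + Re ((\<i> * of_real x * t12 + \<i> * of_real y * t22 - g2) * cnj a2)
    + Re ((\<i> * of_real x * a1 - of_real k * t11 - n11) * cnj t11)
    + Re (((\<i> * of_real y * a1 + \<i> * of_real x * a2) / 2 - of_real k * t12 - n12) * cnj t12)
    + Re (((\<i> * of_real y * a1 + \<i> * of_real x * a2) / 2 - of_real k * t12 - n21) * cnj t12)
    + Re ((\<i> * of_real y * a2 - of_real k * t22 - n22) * cnj t22)
    \<le> M * (cmod a1 + cmod a2 + cmod t11 + 2 * cmod t12 + cmod t22)" (is "?L \<le> ?R")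
proof -
  have "(g1 - c1) * cnj a1 + (g2 - c2) * cnj a2 = 0"
    by (rule divergence_free_inner_curl_free[OF xy div]) (use curl in \<open>simp add: algebra_simps\<close>)
  hence g: "Re (g1 * cnj a1 + g2 * cnj a2) = Re (c1 * cnj a1 + c2 * cnj a2)"
    by (metis (no_types, lifting) add_diff_add eq_iff_diff_eq_0 left_diff_distrib)
  have sq: "Re (of_real k * t * cnj t) \<ge> 0" for t
  proof -
    have "Re (of_real k * t * cnj t) = k * (cmod t)\<^sup>2"
      by (simp only: mult.assoc complex_norm_square[symmetric] of_real_mult[symmetric] Re_complex_of_real)
    thus ?thesis using k by simp
  qed
  have b: "- Re (z * cnj w) \<le> M * cmod w" if "cmod z \<le> M" for z w
  proof -
    have "- Re (z * cnj w) \<le> cmod (z * cnj w)" using abs_Re_le_cmod[of "z * cnj w"] by linarith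
    also have "\<dots> \<le> M * cmod w" using that by (simp add: norm_mult mult_right_mono)
    finally show ?thesis .
  qed
  have "?L = Re ((\<i> * of_real x * t11 + \<i> * of_real y * t12) * cnj a1 + (\<i> * of_real x * t12 + \<i> * of_real y * t22) * cnj a2
     + (\<i> * of_real x * a1) * cnj t11 + (\<i> * of_real y * a1 + \<i> * of_real x * a2) * cnj t12 + (\<i> * of_real y * a2) * cnj t22)
    - Re (g1 * cnj a1 + g2 * cnj a2)
    - Re (of_real k * t11 * cnj t11) - 2 * Re (of_real k * t12 * cnj t12) - Re (of_real k * t22 * cnj t22)
    - Re (n11 * cnj t11) - Re (n12 * cnj t12) - Re (n21 * cnj t12) - Re (n22 * cnj t22)"
    by (simp add: field_simps)
  also have "\<dots> \<le> - Re (c1 * cnj a1) - Re (c2 * cnj a2)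
    - Re (n11 * cnj t11) - Re (n12 * cnj t12) - Re (n21 * cnj t12) - Re (n22 * cnj t22)"
    unfolding linear_cancellation g using sq[of t11] sq[of t12] sq[of t22] by simp
  also have "\<dots> \<le> M * cmod a1 + M * cmod a2 + M * cmod t11 + M * cmod t12 + M * cmod t12 + M * cmod t22"
    using b[OF M(1), of a1] b[OF M(2), of a2] b[OF M(3), of t11] b[OF M(4), of t12] b[OF M(5), of t12] b[OF M(6), of t22]
    by linarith
  also have "\<dots> = ?R" by (simp add: algebra_simps)
  finally show ?thesis .
qed

text \<open>The density bound integrated over the ball. There are six scalar components, each with
  L1 norm at most 2 R sqrt Y on the ball by \<open>low_L1_norm_le\<close>, whence the constant
  12.\<close>

lemma low_energy_rate_bound:
  fixes u u_t G C :: "2 \<Rightarrow> real^2 \<Rightarrow> real" and \<tau> \<tau>_t N :: "2 \<Rightarrow> 2 \<Rightarrow> real^2 \<Rightarrow> real"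
  assumes su: "\<And>i. square_integrable (u i)" and sut: "\<And>i. square_integrable (u_t i)"
    and st: "\<And>i j. square_integrable (\<tau> i j)" and stt: "\<And>i j. square_integrable (\<tau>_t i j)"
    and div: "AE \<xi> in lborel. of_real (\<xi> $ 1) * fourier (u 1) \<xi> + of_real (\<xi> $ 2) * fourier (u 2) \<xi> = 0"
    and curl: "AE \<xi> in lborel. of_real (\<xi> $ 2) * fourier (G 1) \<xi> - of_real (\<xi> $ 1) * fourier (G 2) \<xi>
        = of_real (\<xi> $ 2) * ft (C 1) \<xi> - of_real (\<xi> $ 1) * ft (C 2) \<xi>"
    and eu: "\<And>i. AE \<xi> in lborel. fourier (u_t i) \<xi> =
        \<i> * of_real (\<xi> $ 1) * fourier (\<tau> i 1) \<xi> + \<i> * of_real (\<xi> $ 2) * fourier (\<tau> i 2) \<xi> - fourier (G i) \<xi>"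
    and et: "\<And>i j. AE \<xi> in lborel. fourier (\<tau>_t i j) \<xi> =
        (\<i> * of_real (\<xi> $ j) * fourier (u i) \<xi> + \<i> * of_real (\<xi> $ i) * fourier (u j) \<xi>) / 2
        - of_real (1 + (norm \<xi>)\<^sup>2) * fourier (\<tau> i j) \<xi> - fourier (N i j) \<xi>"
    and sym: "fourier (\<tau> 2 1) = fourier (\<tau> 1 2)"
    and M: "\<And>i \<xi>. cmod (ft (C i) \<xi>) \<le> M" "\<And>i j. AE \<xi> in lborel. cmod (fourier (N i j) \<xi>) \<le> M"
    and R: "R \<ge> 0"
  defines "Y \<equiv> (\<Sum>i\<in>UNIV. low_inner R (u i) (u i)) + (\<Sum>i\<in>UNIV. \<Sum>j\<in>UNIV. low_inner R (\<tau> i j) (\<tau> i j))"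
  shows "(\<Sum>i\<in>UNIV. low_inner R (u_t i) (u i)) + (\<Sum>i\<in>UNIV. \<Sum>j\<in>UNIV. low_inner R (\<tau>_t i j) (\<tau> i j))
     \<le> 12 * M * R * sqrt Y"
proof -
  let ?I = "\<lambda>\<xi>. indicator (cball 0 R) \<xi> :: real"
  define q where "q f g \<xi> = ?I \<xi> * Re (fourier f \<xi> * cnj (fourier g \<xi>))" for f g \<xi>
  define p where "p f \<xi> = ?I \<xi> * cmod (fourier f \<xi>)" for f \<xi>
  have iq: "integrable lborel (q f g)" if "square_integrable f" "square_integrable g" for f g
    unfolding q_def by (rule integrable_low_inner[OF that])
  have ip: "integrable lborel (p f)" if "square_integrable f" for f
    unfolding p_def by (rule low_L1_norm_le[OF that R])
  have lq: "low_inner R f g = (LINT \<xi>|lborel. q f g \<xi>)" for f g by (simp add: low_inner_def q_def)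
  have M0: "M \<ge> 0" using M(1)[of 1 0] norm_ge_zero order_trans by blast
  have "(\<Sum>i\<in>UNIV. low_inner R (u_t i) (u i)) + (\<Sum>i\<in>UNIV. \<Sum>j\<in>UNIV. low_inner R (\<tau>_t i j) (\<tau> i j)) =
    (LINT \<xi>|lborel. q (u_t 1) (u 1) \<xi> + q (u_t 2) (u 2) \<xi> + q (\<tau>_t 1 1) (\<tau> 1 1) \<xi> + q (\<tau>_t 1 2) (\<tau> 1 2) \<xi>
      + q (\<tau>_t 2 1) (\<tau> 2 1) \<xi> + q (\<tau>_t 2 2) (\<tau> 2 2) \<xi>)"
    unfolding lq using iq[OF sut su] iq[OF stt st] by (simp add: UNIV_2)
  also have "\<dots> \<le> (LINT \<xi>|lborel. M * (p (u 1) \<xi> + p (u 2) \<xi> + p (\<tau> 1 1) \<xi> + p (\<tau> 1 2) \<xi> + p (\<tau> 2 1) \<xi> + p (\<tau> 2 2) \<xi>))"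
  proof (rule integral_mono_AE)
    show "AE \<xi> in lborel. q (u_t 1) (u 1) \<xi> + q (u_t 2) (u 2) \<xi> + q (\<tau>_t 1 1) (\<tau> 1 1) \<xi> + q (\<tau>_t 1 2) (\<tau> 1 2) \<xi>
      + q (\<tau>_t 2 1) (\<tau> 2 1) \<xi> + q (\<tau>_t 2 2) (\<tau> 2 2) \<xi> \<le>
      M * (p (u 1) \<xi> + p (u 2) \<xi> + p (\<tau> 1 1) \<xi> + p (\<tau> 1 2) \<xi> + p (\<tau> 2 1) \<xi> + p (\<tau> 2 2) \<xi>)"
      using div curl eu[of 1] eu[of 2] et[of 1 1] et[of 1 2] et[of 2 1] et[of 2 2]
        M(2)[of 1 1] M(2)[of 1 2] M(2)[of 2 1] M(2)[of 2 2] AE_lborel_singleton[of "0::real^2"]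
    proof eventually_elim
      case (elim \<xi>)
      show ?case
      proof (cases "\<xi> \<in> cball 0 R")
        case True
        \<comment> \<open>At frequency 0 the divergence and curl conditions carry no information;
          the origin was removed as a null set.\<close>
        have "\<xi> $ 1 \<noteq> 0 \<or> \<xi> $ 2 \<noteq> 0" using elim(13) by (auto simp: vec_eq_iff forall_2)
        note b = energy_density_bound[OF this elim(1,2) M(1) M(1) elim(9-12), of "1 + (norm \<xi>)\<^sup>2"
              "fourier (\<tau> 1 1) \<xi>" "fourier (\<tau> 1 2) \<xi>" "fourier (\<tau> 2 2) \<xi>"]
        have I1: "?I \<xi> = 1" using True by simp
        have e: "fourier (\<tau>_t 1 1) \<xi> = \<i> * of_real (\<xi> $ 1) * fourier (u 1) \<xi>
            - of_real (1 + (norm \<xi>)\<^sup>2) * fourier (\<tau> 1 1) \<xi> - fourier (N 1 1) \<xi>"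
          "fourier (\<tau>_t 2 1) \<xi> = (\<i> * of_real (\<xi> $ 2) * fourier (u 1) \<xi> + \<i> * of_real (\<xi> $ 1) * fourier (u 2) \<xi>) / 2
            - of_real (1 + (norm \<xi>)\<^sup>2) * fourier (\<tau> 1 2) \<xi> - fourier (N 2 1) \<xi>"
          "fourier (\<tau>_t 2 2) \<xi> = \<i> * of_real (\<xi> $ 2) * fourier (u 2) \<xi>
            - of_real (1 + (norm \<xi>)\<^sup>2) * fourier (\<tau> 2 2) \<xi> - fourier (N 2 2) \<xi>"
          unfolding elim(5) elim(7) elim(8) sym by (simp_all add: add.commute)
        have rhs: "M * (p (u 1) \<xi> + p (u 2) \<xi> + p (\<tau> 1 1) \<xi> + p (\<tau> 1 2) \<xi> + p (\<tau> 2 1) \<xi> + p (\<tau> 2 2) \<xi>)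
          = M * (cmod (fourier (u 1) \<xi>) + cmod (fourier (u 2) \<xi>) + cmod (fourier (\<tau> 1 1) \<xi>)
            + 2 * cmod (fourier (\<tau> 1 2) \<xi>) + cmod (fourier (\<tau> 2 2) \<xi>))"
          by (simp add: p_def I1 sym)
        show ?thesis unfolding rhs
          by (simp only: q_def I1 mult_1_left e elim(3,4,6) sym) (rule b, simp)
      next
        case False
        thus ?thesis by (simp add: q_def p_def)
      qed
    qed
  qed (use iq[OF sut su] iq[OF stt st] ip[OF su] ip[OF st] in auto)
  also have "\<dots> = M * ((LINT \<xi>|lborel. p (u 1) \<xi>) + (LINT \<xi>|lborel. p (u 2) \<xi>) + (LINT \<xi>|lborel. p (\<tau> 1 1) \<xi>)
     + (LINT \<xi>|lborel. p (\<tau> 1 2) \<xi>) + (LINT \<xi>|lborel. p (\<tau> 2 1) \<xi>) + (LINT \<xi>|lborel. p (\<tau> 2 2) \<xi>))"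
    using ip[OF su] ip[OF st] by simp
  also have "\<dots> \<le> M * (2 * R * sqrt Y + 2 * R * sqrt Y + 2 * R * sqrt Y + 2 * R * sqrt Y + 2 * R * sqrt Y + 2 * R * sqrt Y)"
  proof -
    have A: "(LINT \<xi>|lborel. p f \<xi>) \<le> 2 * R * sqrt Y" if "square_integrable f" "low_inner R f f \<le> Y" for f
    proof -
      have "2 * R * sqrt (low_inner R f f) \<le> 2 * R * sqrt Y"
        using that R by (intro mult_left_mono real_sqrt_le_mono) auto
      thus ?thesis using low_L1_norm_le(2)[OF that(1) R] unfolding p_def by linarith
    qed
    have B: "low_inner R (u i) (u i) \<le> Y" "low_inner R (\<tau> i j) (\<tau> i j) \<le> Y" for i j
      using exhaust_2[of i] exhaust_2[of j] by (auto simp: Y_def UNIV_2)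
    show ?thesis by (intro mult_left_mono add_mono A B su st M0)
  qed
  also have "\<dots> = 12 * M * R * sqrt Y" by simp
  finally show ?thesis .
qed

section \<open>Sobolev spaces\<close>

lemma sum_Basis_vec:
  fixes h :: "'a::euclidean_space ^ 'n \<Rightarrow> real"
  shows "(\<Sum>e\<in>Basis. h e) = (\<Sum>i\<in>UNIV. \<Sum>b\<in>Basis. h (axis i b))"
proof -
  have "(\<Sum>i\<in>UNIV. \<Sum>b\<in>(Basis :: 'a set). h (axis i b)) = (\<Sum>(i, b)\<in>UNIV \<times> Basis. h (axis i b))"
    by (rule sum.cartesian_product)
  also have "\<dots> = (\<Sum>e\<in>Basis. h e)"
  proof -
    have b: "bij_betw (\<lambda>p. axis (fst p) (snd p)) (UNIV \<times> Basis) (Basis :: ('a ^ 'n) set)"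
      unfolding bij_betw_def inj_on_def Basis_vec_def by (force simp: axis_eq_axis image_iff)
    show ?thesis using sum.reindex_bij_betw[OF b, of h] by (simp add: split_def)
  qed
  finally show ?thesis ..
qed

lemma sum_Basis_prod:
  fixes h :: "'a::euclidean_space \<times> 'b::euclidean_space \<Rightarrow> real"
  shows "(\<Sum>e\<in>Basis. h e) = (\<Sum>e\<in>Basis. h (e, 0)) + (\<Sum>e\<in>Basis. h (0, e))"
proof -
  have "inj_on (\<lambda>u. (u::'a, 0::'b)) Basis" "inj_on (\<lambda>u. (0::'a, u::'b)) Basis"
    by (auto intro!: inj_onI)
  thus ?thesis unfolding Basis_prod_def
    by (subst sum.union_disjoint) (auto simp: sum.reindex)
qed

lemma in_sobolev_square_integrable: "in_sobolev s f \<Longrightarrow> square_integrable f"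
  by (simp add: in_sobolev_def)

lemma in_sobolev_integrable:
  fixes f :: "real^2 \<Rightarrow> real"
  assumes "in_sobolev s f" shows "integrable lborel (\<lambda>\<xi>. (1 + (norm \<xi>)\<^sup>2) powr s * (cmod (fourier f \<xi>))\<^sup>2)"
  using assms by (simp add: in_sobolev_def)

lemma in_sobolev_component:
  assumes "in_sobolev s f" "e \<in> Basis" shows "in_sobolev s (\<lambda>x. f x \<bullet> e)"
  using assms by (auto simp: in_sobolev_def)

text \<open>A common source of integrability in frequency: multipliers such as |\<xi>|^2, a squared
  coordinate, or the indicator of a ball lie below the Sobolev weight.\<close>

lemma sobolev_weight_bound:
  fixes f :: "real^2 \<Rightarrow> real"
  assumes f: "in_sobolev s f" and [measurable]: "m \<in> borel_measurable borel"
    and le: "\<And>\<xi>. \<bar>m \<xi>\<bar> \<le> (1 + (norm \<xi>)\<^sup>2) powr s"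
  shows "integrable lborel (\<lambda>\<xi>. m \<xi> * (cmod (fourier f \<xi>))\<^sup>2)"
    "(LINT \<xi>|lborel. m \<xi> * (cmod (fourier f \<xi>))\<^sup>2) \<le> (LINT \<xi>|lborel. (1 + (norm \<xi>)\<^sup>2) powr s * (cmod (fourier f \<xi>))\<^sup>2)"
proof -
  have [measurable]: "fourier f \<in> borel_measurable borel"
    using square_integrable_measurable[OF fourier_spec(1)[OF in_sobolev_square_integrable[OF f]]] by simp
  show i: "integrable lborel (\<lambda>\<xi>. m \<xi> * (cmod (fourier f \<xi>))\<^sup>2)"
    by (rule Bochner_Integration.integrable_bound[OF in_sobolev_integrable[OF f]])
       (use le in \<open>auto simp: abs_mult intro!: AE_I2 mult_right_mono\<close>)
  show "(LINT \<xi>|lborel. m \<xi> * (cmod (fourier f \<xi>))\<^sup>2) \<le> (LINT \<xi>|lborel. (1 + (norm \<xi>)\<^sup>2) powr s * (cmod (fourier f \<xi>))\<^sup>2)"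
    by (rule integral_mono[OF i in_sobolev_integrable[OF f]])
       (use le in \<open>auto intro!: mult_right_mono intro: order_trans[OF abs_ge_self]\<close>)
qed

lemma sobolev_weight_mono:
  fixes \<xi> :: "real^2"
  assumes "r \<le> s" shows "(1 + (norm \<xi>)\<^sup>2) powr r \<le> (1 + (norm \<xi>)\<^sup>2) powr s"
  using assms by (intro powr_mono) auto

lemma sobolev_weight_ge:
  fixes \<xi> :: "real^2"
  assumes "1 \<le> s" shows "1 + (norm \<xi>)\<^sup>2 \<le> (1 + (norm \<xi>)\<^sup>2) powr s"
  using sobolev_weight_mono[OF assms, of \<xi>] by simp

lemma in_sobolev_mono:
  assumes f: "in_sobolev s f" and rs: "r \<le> s" shows "in_sobolev r f"
  unfolding in_sobolev_def
proof (intro conjI ballI)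
  fix e assume "e \<in> (Basis :: 'a set)"
  show "integrable lborel (\<lambda>\<xi>. (1 + (norm \<xi>)\<^sup>2) powr r * (cmod (fourier (\<lambda>x. f x \<bullet> e) \<xi>))\<^sup>2)"
    by (rule sobolev_weight_bound[OF in_sobolev_component[OF f \<open>e \<in> Basis\<close>]])
       (use sobolev_weight_mono[OF rs] in auto)
qed (rule in_sobolev_square_integrable[OF f])

lemma sobolev_norm_nonneg [simp]: "0 \<le> sobolev_norm s f"
  unfolding sobolev_norm_def by (intro real_sqrt_ge_zero sum_nonneg mult_nonneg_nonneg integral_nonneg_AE) auto

lemma sobolev_norm_real_power2:
  fixes f :: "real^2 \<Rightarrow> real"
  shows "(sobolev_norm s f)\<^sup>2 = (1 / (2 * pi)\<^sup>2) * (LINT \<xi>|lborel. (1 + (norm \<xi>)\<^sup>2) powr s * (cmod (fourier f \<xi>))\<^sup>2)"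
proof -
  have "0 \<le> (1 / (2 * pi)\<^sup>2) * (LINT \<xi>|lborel. (1 + (norm \<xi>)\<^sup>2) powr s * (cmod (fourier f \<xi>))\<^sup>2)"
    by (intro mult_nonneg_nonneg integral_nonneg_AE) auto
  thus ?thesis by (simp add: sobolev_norm_def)
qed

lemma sobolev_norm_power2:
  fixes f :: "real^2 \<Rightarrow> 'b::euclidean_space"
  shows "(sobolev_norm s f)\<^sup>2 = (\<Sum>e\<in>Basis. (sobolev_norm s (\<lambda>x. f x \<bullet> e))\<^sup>2)"
proof -
  have "0 \<le> (\<Sum>e\<in>(Basis :: 'b set). (1 / (2 * pi)\<^sup>2) * (LINT \<xi>|lborel. (1 + (norm \<xi>)\<^sup>2) powr s * (cmod (fourier (\<lambda>x. f x \<bullet> e) \<xi>))\<^sup>2))"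
    by (intro sum_nonneg mult_nonneg_nonneg integral_nonneg_AE) auto
  thus ?thesis unfolding sobolev_norm_real_power2 by (simp add: sobolev_norm_def)
qed

lemma sobolev_norm_tensor_power2:
  fixes \<tau> :: "real^2 \<Rightarrow> real^2^2"
  shows "(sobolev_norm s \<tau>)\<^sup>2 = (\<Sum>i\<in>UNIV. \<Sum>j\<in>UNIV. (sobolev_norm s (\<lambda>x. \<tau> x $ i $ j))\<^sup>2)"
  by (subst sobolev_norm_power2) (simp add: sum_Basis_vec inner_axis)

lemma sobolev_norm_pair_power2:
  fixes u :: "real^2 \<Rightarrow> real^2" and \<tau> :: "real^2 \<Rightarrow> real^2^2"
  shows "(sobolev_norm s (\<lambda>x. (u x, \<tau> x)))\<^sup>2 = (\<Sum>i\<in>UNIV. (sobolev_norm s (\<lambda>x. u x $ i))\<^sup>2) + (sobolev_norm s \<tau>)\<^sup>2"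
  unfolding sobolev_norm_tensor_power2
  by (subst sobolev_norm_power2) (simp add: sum_Basis_prod sum_Basis_vec inner_axis)

lemma in_sobolev_pair:
  fixes u :: "real^2 \<Rightarrow> real^2" and \<tau> :: "real^2 \<Rightarrow> real^2^2"
  assumes "in_sobolev s (\<lambda>x. (u x, \<tau> x))"
  shows "in_sobolev s (\<lambda>x. u x $ i)" "in_sobolev s (\<lambda>x. \<tau> x $ i $ j)"
proof -
  have "(axis i 1, 0) \<in> (Basis :: ((real^2) \<times> (real^2^2)) set)" by (simp add: Basis_prod_def)
  from in_sobolev_component[OF assms this] show "in_sobolev s (\<lambda>x. u x $ i)" by (simp add: inner_axis)
  have "(0, axis i (axis j 1)) \<in> (Basis :: ((real^2) \<times> (real^2^2)) set)" by (simp add: Basis_prod_def)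
  from in_sobolev_component[OF assms this] show "in_sobolev s (\<lambda>x. \<tau> x $ i $ j)" by (simp add: inner_axis)
qed

lemma sobolev_norm_real_mono:
  fixes f :: "real^2 \<Rightarrow> real"
  assumes f: "in_sobolev s f" and rs: "r \<le> s"
  shows "sobolev_norm r f \<le> sobolev_norm s f"
proof (rule power2_le_imp_le)
  show "(sobolev_norm r f)\<^sup>2 \<le> (sobolev_norm s f)\<^sup>2"
    unfolding sobolev_norm_real_power2
    by (intro mult_left_mono sobolev_weight_bound[OF f]) (use sobolev_weight_mono[OF rs] in auto)
qed simp

lemma sobolev_norm_mono:
  fixes f :: "real^2 \<Rightarrow> 'b::euclidean_space"
  assumes f: "in_sobolev s f" and rs: "r \<le> s"
  shows "sobolev_norm r f \<le> sobolev_norm s f"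
proof (rule power2_le_imp_le)
  show "(sobolev_norm r f)\<^sup>2 \<le> (sobolev_norm s f)\<^sup>2"
    unfolding sobolev_norm_power2[of r f] sobolev_norm_power2[of s f]
  proof (rule sum_mono)
    fix e assume "e \<in> (Basis :: 'b set)"
    from sobolev_norm_real_mono[OF in_sobolev_component[OF f this] rs]
    show "(sobolev_norm r (\<lambda>x. f x \<bullet> e))\<^sup>2 \<le> (sobolev_norm s (\<lambda>x. f x \<bullet> e))\<^sup>2" by (rule power_mono) simp
  qed
qed simp

lemma l2_norm_fourier_power2:
  assumes "square_integrable f"
  shows "(l2_norm f)\<^sup>2 = (1 / (2 * pi)\<^sup>2) * (LINT \<xi>|lborel. (cmod (fourier f \<xi>))\<^sup>2)"
proof -
  have "(LINT \<xi>|lborel. (cmod (fourier f \<xi>))\<^sup>2) = (2 * pi * l2_norm f)\<^sup>2"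
    using l2_norm_power2[of "fourier f"] plancherel[OF assms] by simp
  thus ?thesis by (simp add: power_mult_distrib)
qed

lemma l2_norm_le_sobolev_norm:
  fixes f :: "real^2 \<Rightarrow> real"
  assumes f: "in_sobolev s f" and s: "0 \<le> s"
  shows "l2_norm f \<le> sobolev_norm s f"
proof (rule power2_le_imp_le)
  have "(1::real) \<le> (1 + (norm \<xi>)\<^sup>2) powr s" for \<xi> :: "real^2"
    by (rule ge_one_powr_ge_zero) (use s in auto)
  thus "(l2_norm f)\<^sup>2 \<le> (sobolev_norm s f)\<^sup>2"
    unfolding sobolev_norm_real_power2 l2_norm_fourier_power2[OF in_sobolev_square_integrable[OF f]]
    using sobolev_weight_bound(2)[OF f, of "\<lambda>_. 1"] by (intro mult_left_mono) auto
qed simp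

lemma in_sobolev_gradient_integrable:
  fixes f :: "real^2 \<Rightarrow> real"
  assumes "in_sobolev s f" "1 \<le> s"
  shows "integrable lborel (\<lambda>\<xi>. (norm \<xi>)\<^sup>2 * (cmod (fourier f \<xi>))\<^sup>2)"
proof (rule sobolev_weight_bound(1)[OF assms(1)])
  show "\<bar>(norm \<xi>)\<^sup>2\<bar> \<le> (1 + (norm \<xi>)\<^sup>2) powr s" for \<xi> :: "real^2"
    using sobolev_weight_ge[OF assms(2), of \<xi>] by simp
qed measurable

lemma norm_power2_plane: "(norm (\<xi> :: real^2))\<^sup>2 = (\<xi> $ 1)\<^sup>2 + (\<xi> $ 2)\<^sup>2"
  unfolding power2_norm_eq_inner by (simp add: inner_vec_def UNIV_2 power2_eq_square)

lemma vec_nth_power2_le: "(\<xi> $ k)\<^sup>2 \<le> (norm (\<xi> :: real^2))\<^sup>2"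
  using power_mono[OF component_le_norm_cart[of \<xi> k], of 2] by simp

context
  fixes \<theta> :: "real^2 \<Rightarrow> real"
  assumes \<theta>: "test_function \<theta>" "\<theta> 0 = 1"
begin

lemma weak_partial_sobolev:
  fixes f :: "real^2 \<Rightarrow> real"
  assumes f: "in_sobolev s f" "1 \<le> s"
  shows "square_integrable (weak_partial k f)"
    "AE \<xi> in lborel. fourier (weak_partial k f) \<xi> = \<i> * of_real (\<xi> $ k) * fourier f \<xi>"
    "is_weak_partial k f (weak_partial k f)"
    "(l2_norm (weak_partial k f))\<^sup>2 = (1 / (2 * pi)\<^sup>2) * (LINT \<xi>|lborel. (\<xi> $ k)\<^sup>2 * (cmod (fourier f \<xi>))\<^sup>2)"
    "l2_norm (weak_partial k f) \<le> sobolev_norm s f"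
proof -
  note w = weak_partial_fourier[OF \<theta> in_sobolev_square_integrable[OF f(1)] in_sobolev_gradient_integrable[OF f], of k]
  show "square_integrable (weak_partial k f)"
    "AE \<xi> in lborel. fourier (weak_partial k f) \<xi> = \<i> * of_real (\<xi> $ k) * fourier f \<xi>"
    "is_weak_partial k f (weak_partial k f)" by (rule w)+
  have [measurable]: "fourier f \<in> borel_measurable borel" "fourier (weak_partial k f) \<in> borel_measurable borel"
    using square_integrable_measurable[OF fourier_spec(1)[OF in_sobolev_square_integrable[OF f(1)]]]
      square_integrable_measurable[OF fourier_spec(1)[OF w(1)]] by auto
  have "(LINT \<xi>|lborel. (cmod (fourier (weak_partial k f) \<xi>))\<^sup>2) = (LINT \<xi>|lborel. (\<xi> $ k)\<^sup>2 * (cmod (fourier f \<xi>))\<^sup>2)"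
  proof (rule integral_cong_AE)
    show "AE \<xi> in lborel. (cmod (fourier (weak_partial k f) \<xi>))\<^sup>2 = (\<xi> $ k)\<^sup>2 * (cmod (fourier f \<xi>))\<^sup>2"
      using w(2) by eventually_elim (simp add: norm_mult power_mult_distrib)
  qed measurable
  thus eq: "(l2_norm (weak_partial k f))\<^sup>2 = (1 / (2 * pi)\<^sup>2) * (LINT \<xi>|lborel. (\<xi> $ k)\<^sup>2 * (cmod (fourier f \<xi>))\<^sup>2)"
    unfolding l2_norm_fourier_power2[OF w(1)] by simp
  show "l2_norm (weak_partial k f) \<le> sobolev_norm s f"
  proof (rule power2_le_imp_le)
    have "\<bar>(\<xi> $ k)\<^sup>2\<bar> \<le> (1 + (norm \<xi>)\<^sup>2) powr s" for \<xi> :: "real^2"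
      using vec_nth_power2_le[of \<xi> k] sobolev_weight_ge[OF f(2), of \<xi>] by simp
    thus "(l2_norm (weak_partial k f))\<^sup>2 \<le> (sobolev_norm s f)\<^sup>2"
      unfolding eq sobolev_norm_real_power2
      by (intro mult_left_mono sobolev_weight_bound(2)[OF f(1)]) auto
  qed simp
qed

text \<open>A weight of order 2 controls |\<xi>|^2 times the squared transform of the first
  derivative, which is the hypothesis for differentiating once more.\<close>

lemma weak_second_partial_sobolev:
  fixes f :: "real^2 \<Rightarrow> real"
  assumes f: "in_sobolev s f" "2 \<le> s"
  shows "square_integrable (weak_partial k (weak_partial k f))"
    "AE \<xi> in lborel. fourier (weak_partial k (weak_partial k f)) \<xi> = - of_real ((\<xi> $ k)\<^sup>2) * fourier f \<xi>"
proof -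
  have s1: "1 \<le> s" using f by simp
  note w = weak_partial_sobolev[OF f(1) s1, of k]
  have [measurable]: "fourier f \<in> borel_measurable borel" "fourier (weak_partial k f) \<in> borel_measurable borel"
    using square_integrable_measurable[OF fourier_spec(1)[OF in_sobolev_square_integrable[OF f(1)]]]
      square_integrable_measurable[OF fourier_spec(1)[OF w(1)]] by auto
  have "integrable lborel (\<lambda>\<xi>. ((norm \<xi>)\<^sup>2 * (\<xi> $ k)\<^sup>2) * (cmod (fourier f \<xi>))\<^sup>2)"
  proof (rule sobolev_weight_bound(1)[OF f(1)])
    fix \<xi> :: "real^2"
    have "(norm \<xi>)\<^sup>2 * (\<xi> $ k)\<^sup>2 \<le> (1 + (norm \<xi>)\<^sup>2) * (1 + (norm \<xi>)\<^sup>2)"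
      using vec_nth_power2_le[of \<xi> k] by (intro mult_mono) auto
    also have "\<dots> = (1 + (norm \<xi>)\<^sup>2) powr (of_nat 2)"
      by (subst powr_realpow) (auto simp: power2_eq_square add_pos_nonneg)
    also have "\<dots> \<le> (1 + (norm \<xi>)\<^sup>2) powr s" using f(2) by (intro sobolev_weight_mono) simp
    finally show "\<bar>(norm \<xi>)\<^sup>2 * (\<xi> $ k)\<^sup>2\<bar> \<le> (1 + (norm \<xi>)\<^sup>2) powr s" by (simp add: abs_mult)
  qed measurable
  hence i: "integrable lborel (\<lambda>\<xi>. (norm \<xi>)\<^sup>2 * (\<xi> $ k)\<^sup>2 * (cmod (fourier f \<xi>))\<^sup>2)" by simp
  have ae: "AE \<xi> in lborel. ((norm \<xi>)\<^sup>2 * (\<xi> $ k)\<^sup>2) * (cmod (fourier f \<xi>))\<^sup>2 = (norm \<xi>)\<^sup>2 * (cmod (fourier (weak_partial k f) \<xi>))\<^sup>2"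
    using w(2) by eventually_elim (simp add: norm_mult power_mult_distrib)
  have H: "integrable lborel (\<lambda>\<xi>. (norm \<xi>)\<^sup>2 * (cmod (fourier (weak_partial k f) \<xi>))\<^sup>2)"
    by (rule integrable_cong_AE_imp[OF i _ ae]) measurable
  note w2 = weak_partial_fourier[OF \<theta> w(1) H, of k]
  show "square_integrable (weak_partial k (weak_partial k f))" by (rule w2)
  show "AE \<xi> in lborel. fourier (weak_partial k (weak_partial k f)) \<xi> = - of_real ((\<xi> $ k)\<^sup>2) * fourier f \<xi>"
    using w(2) w2(2)
  proof eventually_elim
    case (elim \<xi>)
    have "\<i> * of_real (\<xi> $ k) * (\<i> * of_real (\<xi> $ k) * fourier f \<xi>) = (\<i> * \<i>) * (of_real ((\<xi> $ k)\<^sup>2) * fourier f \<xi>)"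
      by (simp only: power2_eq_square of_real_mult mult_ac)
    thus ?case unfolding elim(2) elim(1) by simp
  qed
qed

text \<open>Fourier splitting of the weight 1 + |\<xi>|^2: on the ball it is at most 2 because R <=
  1, and outside both 1 and |\<xi>|^2 are at most |\<xi>|^2 / R^2.\<close>

lemma sobolev_norm_1_split:
  fixes f :: "real^2 \<Rightarrow> real"
  assumes f: "in_sobolev 1 f" and R: "0 < R" "R \<le> 1"
  shows "(sobolev_norm 1 f)\<^sup>2 \<le> low_inner R f f + (2 / R\<^sup>2) * (\<Sum>k\<in>UNIV. (l2_norm (weak_partial k f))\<^sup>2)"
proof -
  let ?F = "\<lambda>\<xi>. (cmod (fourier f \<xi>))\<^sup>2"
  have one: "(1::real) \<le> 1" by simp
  have i1: "integrable lborel (\<lambda>\<xi>. indicator (cball 0 R) \<xi> * ?F \<xi>)"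
    by (rule sobolev_weight_bound(1)[OF f]) (auto simp: indicator_def)
  have ik: "integrable lborel (\<lambda>\<xi>. (\<xi> $ k)\<^sup>2 * ?F \<xi>)" for k
    by (rule sobolev_weight_bound(1)[OF f]) (use vec_nth_power2_le[of _ k] in \<open>auto simp: add_increasing\<close>)
  have "(LINT \<xi>|lborel. (1 + (norm \<xi>)\<^sup>2) powr 1 * ?F \<xi>)
     \<le> (LINT \<xi>|lborel. 2 * (indicator (cball 0 R) \<xi> * ?F \<xi>) + (2 / R\<^sup>2) * ((\<xi> $ 1)\<^sup>2 * ?F \<xi> + (\<xi> $ 2)\<^sup>2 * ?F \<xi>))"
  proof (rule integral_mono[OF in_sobolev_integrable[OF f]])
    show "integrable lborel (\<lambda>\<xi>. 2 * (indicator (cball 0 R) \<xi> * ?F \<xi>) + (2 / R\<^sup>2) * ((\<xi> $ 1)\<^sup>2 * ?F \<xi> + (\<xi> $ 2)\<^sup>2 * ?F \<xi>))"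
      using i1 ik by auto
    fix \<xi> :: "real^2"
    have "1 + (norm \<xi>)\<^sup>2 \<le> 2 * indicator (cball 0 R) \<xi> + (2 / R\<^sup>2) * (norm \<xi>)\<^sup>2"
    proof (cases "norm \<xi> \<le> R")
      case True
      hence "(norm \<xi>)\<^sup>2 \<le> 1" using R by (intro power_le_one) auto
      moreover have "0 \<le> (2 / R\<^sup>2) * (norm \<xi>)\<^sup>2" by (intro mult_nonneg_nonneg) auto
      moreover have "indicator (cball 0 R) \<xi> = (1::real)" using True by simp
      ultimately show ?thesis by linarith
    next
      case False
      have "R\<^sup>2 \<le> (norm \<xi>)\<^sup>2" using False R by (intro power_mono) auto
      hence "1 \<le> (norm \<xi>)\<^sup>2 / R\<^sup>2" using R by (simp add: field_simps)
      moreover have "R\<^sup>2 \<le> 1" using R by (intro power_le_one) auto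
      hence "(norm \<xi>)\<^sup>2 * R\<^sup>2 \<le> (norm \<xi>)\<^sup>2 * 1" by (intro mult_left_mono) auto
      hence "(norm \<xi>)\<^sup>2 \<le> (norm \<xi>)\<^sup>2 / R\<^sup>2" using R by (simp add: field_simps)
      ultimately show ?thesis using False by simp
    qed
    hence "(1 + (norm \<xi>)\<^sup>2) * ?F \<xi> \<le> (2 * indicator (cball 0 R) \<xi> + (2 / R\<^sup>2) * (norm \<xi>)\<^sup>2) * ?F \<xi>"
      by (rule mult_right_mono) simp
    thus "(1 + (norm \<xi>)\<^sup>2) powr 1 * ?F \<xi> \<le> 2 * (indicator (cball 0 R) \<xi> * ?F \<xi>) + (2 / R\<^sup>2) * ((\<xi> $ 1)\<^sup>2 * ?F \<xi> + (\<xi> $ 2)\<^sup>2 * ?F \<xi>)"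
      unfolding norm_power2_plane by (simp add: algebra_simps add_nonneg_nonneg)
  qed
  also have "\<dots> = 2 * low_inner R f f + (2 / R\<^sup>2) * ((LINT \<xi>|lborel. (\<xi> $ 1)\<^sup>2 * ?F \<xi>) + (LINT \<xi>|lborel. (\<xi> $ 2)\<^sup>2 * ?F \<xi>))"
    unfolding low_inner_self using i1 ik[of 1] ik[of 2] by simp
  finally have "(sobolev_norm 1 f)\<^sup>2 \<le> (1 / (2 * pi)\<^sup>2) * (2 * low_inner R f f +
     (2 / R\<^sup>2) * ((LINT \<xi>|lborel. (\<xi> $ 1)\<^sup>2 * ?F \<xi>) + (LINT \<xi>|lborel. (\<xi> $ 2)\<^sup>2 * ?F \<xi>)))"
    unfolding sobolev_norm_real_power2 by (intro mult_left_mono) auto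
  also have "\<dots> = (2 / (2 * pi)\<^sup>2) * low_inner R f f + (2 / R\<^sup>2) * (\<Sum>k\<in>UNIV. (l2_norm (weak_partial k f))\<^sup>2)"
    unfolding UNIV_2 weak_partial_sobolev(4)[OF f one] by (simp add: algebra_simps weak_partial_sobolev(4)[OF f one])
  \<comment> \<open>The Sobolev norm carries the Plancherel factor and \<open>low_inner\<close> does
    not; the resulting coefficient is below 1 and is dropped.\<close>
  also have "(2 / (2 * pi)\<^sup>2) * low_inner R f f \<le> 1 * low_inner R f f"
  proof (rule mult_right_mono)
    have "1 \<le> pi\<^sup>2" using pi_gt3 by (intro one_le_power) simp
    thus "2 / (2 * pi)\<^sup>2 \<le> 1" by (simp add: power_mult_distrib divide_le_eq)
  qed simp
  finally show ?thesis by simp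
qed

end

section \<open>The rate of change of the low-frequency energy\<close>

text \<open>Integrability and the norm bound are bundled so that estimates for sums of products can
  be composed by introduction rules; the integral alone would be 0 for a nonintegrable
  function.\<close>

definition L1_le :: "(real^2 \<Rightarrow> real) \<Rightarrow> real \<Rightarrow> bool" where
  "L1_le f c \<longleftrightarrow> integrable lborel f \<and> (LINT x|lborel. \<bar>f x\<bar>) \<le> c"

lemma L1_le_add: "L1_le f a \<Longrightarrow> L1_le g b \<Longrightarrow> L1_le (\<lambda>x. f x + g x) (a + b)"
proof -
  assume *: "L1_le f a" "L1_le g b"
  have "(LINT x|lborel. \<bar>f x + g x\<bar>) \<le> (LINT x|lborel. \<bar>f x\<bar> + \<bar>g x\<bar>)"
    by (rule integral_mono) (use * in \<open>auto simp: L1_le_def\<close>)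
  thus ?thesis using * by (auto simp: L1_le_def)
qed

lemma L1_le_mult:
  assumes "square_integrable f" "square_integrable g" "l2_norm f \<le> a" "l2_norm g \<le> b"
  shows "L1_le (\<lambda>x. f x * g x) (a * b)"
proof -
  have "l2_norm f * l2_norm g \<le> a * b"
    using assms(3,4) order_trans[OF l2_norm_nonneg assms(3)] by (intro mult_mono) auto
  thus ?thesis using integrable_mult_square_integrable[OF assms(1,2)] by (simp add: L1_le_def)
qed

text \<open>For b = 1 the symmetric and skew parts recombine: T D + T \<Omega> = T G and D T -
  \<Omega> T = G^T T, where D and \<Omega> are the two parts of G.\<close>

lemma Q_term_1_entry:
  "Q_term 1 G T $ i $ j = T $ i $ 1 * G $ 1 $ j + T $ i $ 2 * G $ 2 $ j + G $ 1 $ i * T $ 1 $ j + G $ 2 $ i * T $ 2 $ j"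
  by (simp add: Q_term_def sym_part_def skew_part_def matrix_matrix_mult_def transpose_def UNIV_2 field_simps)

lemma l2_norm_matrix_power2:
  fixes G :: "real^2 \<Rightarrow> real^2^2"
  assumes "\<And>i j. square_integrable (\<lambda>x. G x $ i $ j)"
  shows "square_integrable G" "(l2_norm G)\<^sup>2 = (\<Sum>i\<in>UNIV. \<Sum>j\<in>UNIV. (l2_norm (\<lambda>x. G x $ i $ j))\<^sup>2)"
proof -
  have [measurable]: "(\<lambda>x. G x $ i $ j) \<in> borel_measurable borel" for i j
    using square_integrable_measurable[OF assms] by simp
  have n: "(norm (G x))\<^sup>2 = (\<Sum>i\<in>UNIV. \<Sum>j\<in>UNIV. (norm (G x $ i $ j))\<^sup>2)" for x
    unfolding power2_norm_eq_inner inner_vec_def by (simp add: power2_eq_square)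
  have m: "G \<in> borel_measurable lborel"
  proof (subst borel_measurable_euclidean_space, intro ballI)
    fix b :: "real^2^2" assume "b \<in> Basis"
    then obtain i j where "b = axis i (axis j 1)" by (auto simp: Basis_vec_def)
    thus "(\<lambda>x. G x \<bullet> b) \<in> borel_measurable lborel" by (simp add: inner_axis)
  qed
  show "square_integrable G"
    unfolding square_integrable_def n using square_integrable_integrable[OF assms] m by auto
  show "(l2_norm G)\<^sup>2 = (\<Sum>i\<in>UNIV. \<Sum>j\<in>UNIV. (l2_norm (\<lambda>x. G x $ i $ j))\<^sup>2)"
    unfolding l2_norm_power2 n using square_integrable_integrable[OF assms] by simp
qed

lemma square_integrable_vec_nth:
  fixes f :: "real^2 \<Rightarrow> 'a::euclidean_space ^ 2"
  assumes "square_integrable f" shows "square_integrable (\<lambda>x. f x $ i)"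
proof (rule square_integrable_bound[OF assms, where c=1])
  show "(\<lambda>x. f x $ i) \<in> borel_measurable lborel"
    by (rule measurable_compose[OF square_integrable_measurable[OF assms]])
       (intro borel_measurable_continuous_onI continuous_intros)
qed (auto intro: Finite_Cartesian_Product.norm_nth_le)

lemma fourier_lincomb_diff:
  assumes "square_integrable f" "square_integrable g" "square_integrable h"
  shows "AE \<xi> in lborel. fourier (\<lambda>x. f x + g x - h x) \<xi> = fourier f \<xi> + fourier g \<xi> - fourier h \<xi>"
  using fourier_diff[OF square_integrable_add[OF assms(1,2)] assms(3)] fourier_add[OF assms(1,2)]
  by eventually_elim simp

definition low_energy :: "real \<Rightarrow> (real^2 \<Rightarrow> real^2) \<Rightarrow> (real^2 \<Rightarrow> real^2^2) \<Rightarrow> real" where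
  "low_energy R u \<tau> = (\<Sum>i\<in>UNIV. low_inner R (\<lambda>x. u x $ i) (\<lambda>x. u x $ i))
     + (\<Sum>i\<in>UNIV. \<Sum>j\<in>UNIV. low_inner R (\<lambda>x. \<tau> x $ i $ j) (\<lambda>x. \<tau> x $ i $ j))"

text \<open>The quantity that the Elgindi-Rousset inequality bounds by minus the derivative of the
  energy.\<close>

definition dissipation :: "(real^2 \<Rightarrow> real^2) \<Rightarrow> (real^2 \<Rightarrow> real^2^2) \<Rightarrow> real" where
  "dissipation u \<tau> = (l2_norm (velocity_gradient u))\<^sup>2 + (sobolev_norm 2 \<tau>)\<^sup>2"

lemma dissipation_nonneg [simp]: "dissipation u \<tau> \<ge> 0"
  by (simp add: dissipation_def)

lemma low_energy_nonneg [simp]: "low_energy R u \<tau> \<ge> 0"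
  by (simp add: low_energy_def add_nonneg_nonneg sum_nonneg)

context
  fixes \<theta> :: "real^2 \<Rightarrow> real"
  assumes \<theta>: "test_function \<theta>" "\<theta> 0 = 1"
begin

section \<open>Estimates for the solution at a fixed time\<close>

context
  fixes s :: real and u :: "real^2 \<Rightarrow> real^2" and \<tau> :: "real^2 \<Rightarrow> real^2^2"
  assumes s: "2 < s" and w: "in_sobolev s (\<lambda>x. (u x, \<tau> x))"
begin

lemma sobolev_components:
  assumes "r \<le> s"
  shows "in_sobolev r (\<lambda>x. u x $ i)" "in_sobolev r (\<lambda>x. \<tau> x $ i $ j)"
  by (rule in_sobolev_mono[OF _ assms], rule in_sobolev_pair[OF w])+

lemmas u_partial = weak_partial_sobolev[OF \<theta> sobolev_components(1)[of 1] order_refl]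
lemmas \<tau>_partial = weak_partial_sobolev[OF \<theta> sobolev_components(2)[of 2]]

lemma l2_norm_velocity_gradient:
  "(l2_norm (velocity_gradient u))\<^sup>2 = (\<Sum>i\<in>UNIV. \<Sum>k\<in>UNIV. (l2_norm (weak_partial k (\<lambda>x. u x $ i)))\<^sup>2)"
  using l2_norm_matrix_power2(2)[of "velocity_gradient u"] u_partial(1) s by (simp add: velocity_gradient_def)

text \<open>Each quadratic term is an undifferentiated factor times a first derivative. The former
  is measured by the H1 norm and the latter by the square root of the dissipation, so every product
  has L1 norm at most the product of the two.\<close>

lemma component_norm_bounds:
  shows "l2_norm (\<lambda>x. u x $ i) \<le> sobolev_norm 1 (\<lambda>x. (u x, \<tau> x))"
    "l2_norm (\<lambda>x. \<tau> x $ i $ j) \<le> sobolev_norm 1 (\<lambda>x. (u x, \<tau> x))"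
    "l2_norm (weak_partial k (\<lambda>x. u x $ i)) \<le> sqrt (dissipation u \<tau>)"
    "l2_norm (weak_partial k (\<lambda>x. \<tau> x $ i $ j)) \<le> sqrt (dissipation u \<tau>)"
proof -
  have s1: "1 \<le> s" "2 \<le> s" using s by auto
  have pair: "(sobolev_norm 1 (\<lambda>x. (u x, \<tau> x)))\<^sup>2 = (\<Sum>i\<in>UNIV. (sobolev_norm 1 (\<lambda>x. u x $ i))\<^sup>2)
     + (\<Sum>i\<in>UNIV. \<Sum>j\<in>UNIV. (sobolev_norm 1 (\<lambda>x. \<tau> x $ i $ j))\<^sup>2)"
    unfolding sobolev_norm_pair_power2 sobolev_norm_tensor_power2 ..
  have "(sobolev_norm 1 (\<lambda>x. u x $ i))\<^sup>2 \<le> (sobolev_norm 1 (\<lambda>x. (u x, \<tau> x)))\<^sup>2"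
    unfolding pair using exhaust_2[of i] by (auto simp: UNIV_2)
  hence "sobolev_norm 1 (\<lambda>x. u x $ i) \<le> sobolev_norm 1 (\<lambda>x. (u x, \<tau> x))" by (rule power2_le_imp_le) simp
  thus "l2_norm (\<lambda>x. u x $ i) \<le> sobolev_norm 1 (\<lambda>x. (u x, \<tau> x))"
    using l2_norm_le_sobolev_norm[OF sobolev_components(1)[OF s1(1)], of i] by simp
  have "(sobolev_norm 1 (\<lambda>x. \<tau> x $ i $ j))\<^sup>2 \<le> (sobolev_norm 1 (\<lambda>x. (u x, \<tau> x)))\<^sup>2"
    unfolding pair using exhaust_2[of i] exhaust_2[of j] by (auto simp: UNIV_2)
  hence "sobolev_norm 1 (\<lambda>x. \<tau> x $ i $ j) \<le> sobolev_norm 1 (\<lambda>x. (u x, \<tau> x))" by (rule power2_le_imp_le) simp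
  thus "l2_norm (\<lambda>x. \<tau> x $ i $ j) \<le> sobolev_norm 1 (\<lambda>x. (u x, \<tau> x))"
    using l2_norm_le_sobolev_norm[OF sobolev_components(2)[OF s1(1)], of i j] by simp
  have "(l2_norm (weak_partial k (\<lambda>x. u x $ i)))\<^sup>2 \<le> dissipation u \<tau>"
    unfolding dissipation_def l2_norm_velocity_gradient
    using exhaust_2[of i] exhaust_2[of k] by (auto simp: UNIV_2)
  thus "l2_norm (weak_partial k (\<lambda>x. u x $ i)) \<le> sqrt (dissipation u \<tau>)" by (rule real_le_rsqrt)
  have "(l2_norm (weak_partial k (\<lambda>x. \<tau> x $ i $ j)))\<^sup>2 \<le> (sobolev_norm 2 (\<lambda>x. \<tau> x $ i $ j))\<^sup>2"
    by (intro power_mono \<tau>_partial s1) auto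
  also have "\<dots> \<le> dissipation u \<tau>"
    unfolding dissipation_def sobolev_norm_tensor_power2
    using exhaust_2[of i] exhaust_2[of j] by (auto simp: UNIV_2)
  finally show "l2_norm (weak_partial k (\<lambda>x. \<tau> x $ i $ j)) \<le> sqrt (dissipation u \<tau>)" by (rule real_le_rsqrt)
qed

text \<open>Splitting is needed for the velocity alone, of which the dissipation controls just the
  gradient. The full H2 norm of \<tau> is dissipated, and the low-frequency energy of \<tau> is
  added as a nonnegative term to complete \<open>low_energy\<close>.\<close>

lemma sobolev_norm_split:
  assumes R: "0 < R" "R \<le> 1"
  shows "(sobolev_norm 1 (\<lambda>x. (u x, \<tau> x)))\<^sup>2 \<le> low_energy R u \<tau> + (2 / R\<^sup>2) * dissipation u \<tau>"
proof -
  have s1: "1 \<le> s" "2 \<le> s" using s by auto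
  have "(sobolev_norm 1 (\<lambda>x. (u x, \<tau> x)))\<^sup>2 = (\<Sum>i\<in>UNIV. (sobolev_norm 1 (\<lambda>x. u x $ i))\<^sup>2)
     + (\<Sum>i\<in>UNIV. \<Sum>j\<in>UNIV. (sobolev_norm 1 (\<lambda>x. \<tau> x $ i $ j))\<^sup>2)"
    unfolding sobolev_norm_pair_power2 sobolev_norm_tensor_power2 ..
  also have "\<dots> \<le> (\<Sum>i\<in>UNIV. low_inner R (\<lambda>x. u x $ i) (\<lambda>x. u x $ i)
       + (2 / R\<^sup>2) * (\<Sum>k\<in>UNIV. (l2_norm (weak_partial k (\<lambda>x. u x $ i)))\<^sup>2))
     + (\<Sum>i\<in>UNIV. \<Sum>j\<in>UNIV. low_inner R (\<lambda>x. \<tau> x $ i $ j) (\<lambda>x. \<tau> x $ i $ j) + (2 / R\<^sup>2) * (sobolev_norm 2 (\<lambda>x. \<tau> x $ i $ j))\<^sup>2)"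
  proof (intro add_mono sum_mono)
    fix i :: 2
    show "(sobolev_norm 1 (\<lambda>x. u x $ i))\<^sup>2 \<le> low_inner R (\<lambda>x. u x $ i) (\<lambda>x. u x $ i)
       + (2 / R\<^sup>2) * (\<Sum>k\<in>UNIV. (l2_norm (weak_partial k (\<lambda>x. u x $ i)))\<^sup>2)"
      by (rule sobolev_norm_1_split[OF \<theta> sobolev_components(1)[OF s1(1)] R])
    fix j :: 2
    have "(sobolev_norm 1 (\<lambda>x. \<tau> x $ i $ j))\<^sup>2 \<le> (sobolev_norm 2 (\<lambda>x. \<tau> x $ i $ j))\<^sup>2"
      by (intro power_mono sobolev_norm_real_mono sobolev_components s1) auto
    also have "\<dots> = 1 * (sobolev_norm 2 (\<lambda>x. \<tau> x $ i $ j))\<^sup>2" by simp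
    also have "\<dots> \<le> (2 / R\<^sup>2) * (sobolev_norm 2 (\<lambda>x. \<tau> x $ i $ j))\<^sup>2"
    proof (rule mult_right_mono)
      have "R\<^sup>2 \<le> 1" using R by (intro power_le_one) auto
      thus "1 \<le> 2 / R\<^sup>2" using R by (simp add: le_divide_eq)
    qed simp
    finally show "(sobolev_norm 1 (\<lambda>x. \<tau> x $ i $ j))\<^sup>2 \<le> low_inner R (\<lambda>x. \<tau> x $ i $ j) (\<lambda>x. \<tau> x $ i $ j)
       + (2 / R\<^sup>2) * (sobolev_norm 2 (\<lambda>x. \<tau> x $ i $ j))\<^sup>2"
      using low_inner_self_nonneg[of R "\<lambda>x. \<tau> x $ i $ j"] by linarith
  qed
  also have "\<dots> = low_energy R u \<tau> + (2 / R\<^sup>2) * dissipation u \<tau>"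
    unfolding dissipation_def l2_norm_velocity_gradient sobolev_norm_tensor_power2 low_energy_def
    by (simp add: sum.distrib sum_distrib_left distrib_left)
  finally show ?thesis .
qed

text \<open>Translates the equations to frequency space for \<open>low_energy_rate_bound\<close>. A
  stress equation has two convection products and four from Q, each with L1 norm at most A B; hence
  M = 6 A B and the constant 72 = 12 * 6.\<close>

lemma low_energy_rate:
  fixes P :: "real^2 \<Rightarrow> real" and u_t :: "real^2 \<Rightarrow> real^2" and \<tau>_t :: "real^2 \<Rightarrow> real^2^2"
  assumes P: "weakly_differentiable P" and sut: "square_integrable u_t" and stt: "square_integrable \<tau>_t"
    and eqs: "AE x in lborel.
           transpose (\<tau> x) = \<tau> x \<and>
           divergence u x = 0 \<and>
           u_t x + velocity_convection u u x + gradient P x = tensor_divergence \<tau> x \<and>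
           \<tau>_t x + tensor_convection u \<tau> x + \<tau> x + Q_term 1 (velocity_gradient u x) (\<tau> x)
             = sym_part (velocity_gradient u x) + tensor_laplacian \<tau> x"
    and R: "R \<ge> 0"
  shows "(\<Sum>i\<in>UNIV. low_inner R (\<lambda>x. u_t x $ i) (\<lambda>x. u x $ i))
     + (\<Sum>i\<in>UNIV. \<Sum>j\<in>UNIV. low_inner R (\<lambda>x. \<tau>_t x $ i $ j) (\<lambda>x. \<tau> x $ i $ j))
     \<le> 72 * (sobolev_norm 1 (\<lambda>x. (u x, \<tau> x)) * sqrt (dissipation u \<tau>)) * R * sqrt (low_energy R u \<tau>)"
proof -
  have s1: "1 \<le> s" "2 \<le> s" using s by auto
  define A where "A = sobolev_norm 1 (\<lambda>x. (u x, \<tau> x))"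
  define B where "B = sqrt (dissipation u \<tau>)"
  define U where "U i x = u x $ i" for i x
  define T where "T i j x = \<tau> x $ i $ j" for i j x
  define dU where "dU k i = weak_partial k (U i)" for i k
  define dT where "dT k i j = weak_partial k (T i j)" for i j k
  define ddT where "ddT k i j = weak_partial k (dT k i j)" for i j k
  \<comment> \<open>The velocity equation solved for the pressure: the pressure gradient is
    \<open>G\<close> minus \<open>C\<close>, with \<open>G\<close> in L2 since it is linear and
    \<open>C\<close> in L1 since it is quadratic. This is the decomposition that
    \<open>fourier_curl_free\<close> expects.\<close>
  define G where "G i x = dT 1 i 1 x + dT 2 i 2 x - u_t x $ i" for i x
  define C where "C i x = U 1 x * dU 1 i x + U 2 x * dU 2 i x" for i x
  \<comment> \<open>The nonlinear stress term is written through the linear terms of the equation,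
    which are in L2 and have known transforms. The equation identifies it with the products
    \<open>N'\<close>, which are in L1; thus its transform is both computable and bounded.\<close>
  define N where "N i j x = (1/2) * (dU j i x + dU i j x) + (ddT 1 i j x + ddT 2 i j x) - (T i j x + \<tau>_t x $ i $ j)" for i j x
  define N' where "N' i j x = (U 1 x * dT 1 i j x + U 2 x * dT 2 i j x) +
    (T i 1 x * dU j 1 x + T i 2 x * dU j 2 x + dU i 1 x * T 1 j x + dU i 2 x * T 2 j x)" for i j x
  have hU: "in_sobolev 1 (U i)" and hT: "in_sobolev 2 (T i j)" for i j
    unfolding U_def[abs_def] T_def[abs_def] using sobolev_components s1 by auto
  note sU = in_sobolev_square_integrable[OF hU] and sT = in_sobolev_square_integrable[OF hT]
  note wU = weak_partial_sobolev[OF \<theta> hU order_refl, folded dU_def]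
  have "(1::real) \<le> 2" by simp
  note wT = weak_partial_sobolev[OF \<theta> hT this, folded dT_def]
  note wwT = weak_second_partial_sobolev[OF \<theta> hT order_refl, folded dT_def, folded ddT_def]
  have bU: "l2_norm (U i) \<le> A" and bT: "l2_norm (T i j) \<le> A" and bdU: "l2_norm (dU k i) \<le> B" and bdT: "l2_norm (dT k i j) \<le> B" for i j k
    unfolding A_def B_def U_def[abs_def] T_def[abs_def] dU_def dT_def by (rule component_norm_bounds)+
  have sut': "square_integrable (\<lambda>x. u_t x $ i)" for i by (rule square_integrable_vec_nth[OF sut])
  have stt': "square_integrable (\<lambda>x. \<tau>_t x $ i $ j)" for i j
    by (rule square_integrable_vec_nth[OF square_integrable_vec_nth[OF stt]])
  have sG: "square_integrable (G i)" for i
    unfolding G_def[abs_def] by (intro square_integrable_diff square_integrable_add wT sut')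
  have FG: "AE \<xi> in lborel. fourier (G i) \<xi> = fourier (dT 1 i 1) \<xi> + fourier (dT 2 i 2) \<xi> - fourier (\<lambda>x. u_t x $ i) \<xi>" for i
    unfolding G_def[abs_def] by (intro fourier_lincomb_diff wT sut')
  have C_le: "L1_le (C i) (A * B + A * B)" for i
    unfolding C_def[abs_def] by (intro L1_le_add L1_le_mult sU wU(1) bU bdU)
  have N'_le: "L1_le (N' i j) (A * B + A * B + (A * B + A * B + B * A + B * A))" for i j
    unfolding N'_def[abs_def] by (intro L1_le_add L1_le_mult sU sT wU(1) wT(1) bU bT bdU bdT)
  have wP: "is_weak_partial k P (weak_partial k P)" for k
  proof -
    obtain g where "is_weak_partial k P g" using P by (auto simp: weakly_differentiable_def)
    thus ?thesis unfolding weak_partial_def by (rule someI[where P="is_weak_partial k P"])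
  qed
  have tr: "AE x in lborel. \<tau> x $ 2 $ 1 = \<tau> x $ 1 $ 2"
    using eqs
  proof eventually_elim
    case (elim x)
    have "transpose (\<tau> x) $ 1 $ 2 = \<tau> x $ 1 $ 2" using elim by simp
    thus ?case by (simp add: transpose_def)
  qed
  have div: "AE x in lborel. dU 1 1 x + dU 2 2 x = 0"
    using eqs by eventually_elim (simp add: divergence_def UNIV_2 dU_def U_def[abs_def])
  have qe: "AE x in lborel. weak_partial i P x = G i x - C i x" for i
    using eqs
  proof eventually_elim
    case (elim x)
    hence "(u_t x + velocity_convection u u x + gradient P x) $ i = tensor_divergence \<tau> x $ i" by simp
    thus ?case
      by (simp add: velocity_convection_def gradient_def tensor_divergence_def UNIV_2 G_def C_def U_def[abs_def]
          T_def[abs_def] dU_def dT_def algebra_simps)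
  qed
  have NN': "AE x in lborel. N i j x = N' i j x" for i j
    using eqs
  proof eventually_elim
    case (elim x)
    hence "(\<tau>_t x + tensor_convection u \<tau> x + \<tau> x + Q_term 1 (velocity_gradient u x) (\<tau> x)) $ i $ j
             = (sym_part (velocity_gradient u x) + tensor_laplacian \<tau> x) $ i $ j" by simp
    hence "\<tau>_t x $ i $ j + tensor_convection u \<tau> x $ i $ j + \<tau> x $ i $ j + Q_term 1 (velocity_gradient u x) (\<tau> x) $ i $ j
             = sym_part (velocity_gradient u x) $ i $ j + tensor_laplacian \<tau> x $ i $ j" by simp
    moreover have "tensor_convection u \<tau> x $ i $ j = U 1 x * dT 1 i j x + U 2 x * dT 2 i j x"
      by (simp add: tensor_convection_def UNIV_2 U_def dT_def T_def[abs_def])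
    moreover have vg: "velocity_gradient u x $ k $ l = dU l k x" for k l
      by (simp add: velocity_gradient_def dU_def U_def[abs_def])
    moreover have "Q_term 1 (velocity_gradient u x) (\<tau> x) $ i $ j =
       T i 1 x * dU j 1 x + T i 2 x * dU j 2 x + dU i 1 x * T 1 j x + dU i 2 x * T 2 j x"
      unfolding Q_term_1_entry vg by (simp add: T_def)
    moreover have "sym_part (velocity_gradient u x) $ i $ j = (1/2) * (dU j i x + dU i j x)"
      by (simp add: sym_part_def transpose_def vg)
    moreover have "tensor_laplacian \<tau> x $ i $ j = ddT 1 i j x + ddT 2 i j x"
      by (simp add: tensor_laplacian_def UNIV_2 ddT_def dT_def T_def[abs_def])
    ultimately show ?case by (simp add: N_def N'_def T_def)
  qed
  have sN1: "square_integrable (\<lambda>x. (1/2) * (dU j i x + dU i j x))" for i j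
    using square_integrable_scaleR[OF square_integrable_add[OF wU(1)[of j i] wU(1)[of i j]], of "1/2"] by simp
  have sN2: "square_integrable (\<lambda>x. ddT 1 i j x + ddT 2 i j x)" for i j by (intro square_integrable_add wwT)
  have sN3: "square_integrable (\<lambda>x. T i j x + \<tau>_t x $ i $ j)" for i j by (intro square_integrable_add sT stt')
  have sN: "square_integrable (N i j)" for i j
    unfolding N_def[abs_def] by (intro square_integrable_diff square_integrable_add[OF sN1 sN2] sN3)
  have "(\<Sum>i\<in>UNIV. low_inner R (\<lambda>x. u_t x $ i) (U i)) + (\<Sum>i\<in>UNIV. \<Sum>j\<in>UNIV. low_inner R (\<lambda>x. \<tau>_t x $ i $ j) (T i j))
    \<le> 12 * (6 * (A * B)) * R * sqrt ((\<Sum>i\<in>UNIV. low_inner R (U i) (U i)) + (\<Sum>i\<in>UNIV. \<Sum>j\<in>UNIV. low_inner R (T i j) (T i j)))"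
  proof (rule low_energy_rate_bound[where G=G and C=C and N=N])
    show "AE \<xi> in lborel. of_real (\<xi> $ 1) * fourier (U 1) \<xi> + of_real (\<xi> $ 2) * fourier (U 2) \<xi> = 0"
    proof -
      have "fourier (\<lambda>x. dU 1 1 x + dU 2 2 x) = fourier (\<lambda>x. 0)"
        by (rule fourier_cong_AE[OF div]) (use square_integrable_measurable[OF square_integrable_add[OF wU(1)[of 1 1] wU(1)[of 2 2]]] in auto)
      with fourier_add[OF wU(1)[of 1 1] wU(1)[of 2 2]] have "AE \<xi> in lborel. fourier (\<lambda>x. 0) \<xi> = fourier (dU 1 1) \<xi> + fourier (dU 2 2) \<xi>"
        by simp
      with fourier_zero wU(2)[of 1 1] wU(2)[of 2 2]
      show ?thesis
      proof eventually_elim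
        case (elim \<xi>)
        hence "\<i> * (of_real (\<xi> $ 1) * fourier (U 1) \<xi> + of_real (\<xi> $ 2) * fourier (U 2) \<xi>) = 0"
          by (simp add: distrib_left mult.assoc)
        thus ?case by simp
      qed
    qed
    show "AE \<xi> in lborel. of_real (\<xi> $ 2) * fourier (G 1) \<xi> - of_real (\<xi> $ 1) * fourier (G 2) \<xi>
        = of_real (\<xi> $ 2) * ft (C 1) \<xi> - of_real (\<xi> $ 1) * ft (C 2) \<xi>"
      by (rule fourier_curl_free[OF \<theta> wP[of 1] wP[of 2] sG sG _ _ qe qe]) (use C_le in \<open>auto simp: L1_le_def\<close>)
    show "AE \<xi> in lborel. fourier (\<lambda>x. u_t x $ i) \<xi> =
        \<i> * of_real (\<xi> $ 1) * fourier (T i 1) \<xi> + \<i> * of_real (\<xi> $ 2) * fourier (T i 2) \<xi> - fourier (G i) \<xi>" for i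
      using FG[of i] wT(2)[of 1 i 1] wT(2)[of 2 i 2] by eventually_elim simp
    show "AE \<xi> in lborel. fourier (\<lambda>x. \<tau>_t x $ i $ j) \<xi> =
        (\<i> * of_real (\<xi> $ j) * fourier (U i) \<xi> + \<i> * of_real (\<xi> $ i) * fourier (U j) \<xi>) / 2
        - of_real (1 + (norm \<xi>)\<^sup>2) * fourier (T i j) \<xi> - fourier (N i j) \<xi>" for i j
    proof -
      have "AE \<xi> in lborel. fourier (N i j) \<xi> = fourier (\<lambda>x. (1/2) * (dU j i x + dU i j x)) \<xi>
         + fourier (\<lambda>x. ddT 1 i j x + ddT 2 i j x) \<xi> - fourier (\<lambda>x. T i j x + \<tau>_t x $ i $ j) \<xi>"
        unfolding N_def[abs_def] by (rule fourier_lincomb_diff[OF sN1 sN2 sN3])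
      thus ?thesis
        using fourier_cmult[OF square_integrable_add[OF wU(1)[of j i] wU(1)[of i j]], of "1/2"]
          fourier_add[OF wU(1)[of j i] wU(1)[of i j]] fourier_add[OF wwT(1)[of 1 i j] wwT(1)[of 2 i j]]
          fourier_add[OF sT[of i j] stt'[of i j]] wU(2)[of j i] wU(2)[of i j] wwT(2)[of 1 i j] wwT(2)[of 2 i j]
      proof eventually_elim
        case (elim \<xi>)
        show ?case unfolding norm_power2_plane using elim by (simp add: algebra_simps)
      qed
    qed
    show "fourier (T 2 1) = fourier (T 1 2)"
      by (rule fourier_cong_AE) (use tr square_integrable_measurable[OF sT] in \<open>auto simp: T_def\<close>)
    show "cmod (ft (C i) \<xi>) \<le> 6 * (A * B)" for i \<xi>
    proof -
      have "cmod (ft (C i) \<xi>) \<le> A * B + A * B"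
        using norm_ft_le[of "C i" \<xi>] C_le[of i] by (simp add: L1_le_def)
      moreover have "0 \<le> A * B" by (simp add: A_def B_def)
      ultimately show ?thesis by linarith
    qed
    show "AE \<xi> in lborel. cmod (fourier (N i j) \<xi>) \<le> 6 * (A * B)" for i j
    proof -
      have iN': "integrable lborel (N' i j)" using N'_le by (simp add: L1_le_def)
      have "AE x in lborel. N' i j x = N i j x" using NN'[of i j] by eventually_elim simp
      hence iN: "integrable lborel (N i j)"
        by (rule integrable_cong_AE_imp[OF iN' square_integrable_measurable[OF sN]])
      have "(LINT x|lborel. \<bar>N i j x\<bar>) = (LINT x|lborel. \<bar>N' i j x\<bar>)"
      proof (rule integral_cong_AE)
        show "AE x in lborel. \<bar>N i j x\<bar> = \<bar>N' i j x\<bar>" using NN'[of i j] by eventually_elim simp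
      qed (use iN iN' in auto)
      also have "\<dots> \<le> 6 * (A * B)" using N'_le[of i j] by (simp add: L1_le_def algebra_simps)
      finally have le: "cmod (ft (N i j) \<xi>) \<le> 6 * (A * B)" for \<xi> using norm_ft_le[of "N i j" \<xi>] by linarith
      show ?thesis using fourier_eq_ft[OF sN iN] by eventually_elim (simp add: le)
    qed
  qed (use sU sT sut' stt' R in auto)
  thus ?thesis by (simp add: low_energy_def A_def B_def U_def[abs_def] T_def[abs_def])
qed

end

end

section \<open>A differential inequality of Fourier splitting type\<close>

text \<open>The argument in time, with E the energy and Z R the square root of the energy below
  frequency R. Nothing is required of E' beyond being the derivative of E, so instead of an integral
  of sqrt(E |E'|) the growth of Z is stated for every primitive \<Phi> of a majorant \<phi>.\<close>

context
  fixes E E' :: "real \<Rightarrow> real" and Z :: "real \<Rightarrow> real \<Rightarrow> real" and c C :: real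
  assumes c: "c > 0" and C: "C > 0"
    and E_nonneg: "\<And>t. E t \<ge> 0" and E_cont: "continuous_on {0..} E"
    and E_deriv: "\<And>t. t > 0 \<Longrightarrow> (E has_real_derivative E' t) (at t)" and E'_nonpos: "\<And>t. t > 0 \<Longrightarrow> E' t \<le> 0"
    and Z_nonneg: "\<And>R t. Z R t \<ge> 0"
    and Z_init: "\<And>R. 0 < R \<Longrightarrow> R \<le> 1 \<Longrightarrow> Z R 0 \<le> C * R"
    and Z_growth: "\<And>R a b \<Phi> \<phi>. 0 < R \<Longrightarrow> R \<le> 1 \<Longrightarrow> 0 \<le> a \<Longrightarrow> a < b \<Longrightarrow> continuous_on {a..b} \<Phi> \<Longrightarrow>
      (\<And>t. a < t \<Longrightarrow> t < b \<Longrightarrow> (\<Phi> has_real_derivative \<phi> t) (at t)) \<Longrightarrow>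
      (\<And>t. a < t \<Longrightarrow> t < b \<Longrightarrow> sqrt (E t * - E' t) \<le> \<phi> t) \<Longrightarrow> Z R b \<le> Z R a + C * R * (\<Phi> b - \<Phi> a)"
    and E_split: "\<And>R t. 0 < R \<Longrightarrow> R \<le> 1 \<Longrightarrow> 0 < t \<Longrightarrow> E' t + c * R\<^sup>2 * E t \<le> C * R\<^sup>2 * (Z R t)\<^sup>2"
begin

lemma E_cont_on: "0 \<le> a \<Longrightarrow> continuous_on {a..b} E"
  by (rule continuous_on_subset[OF E_cont]) auto

lemma E_decreasing:
  assumes ab: "0 \<le> a" "a \<le> b" shows "E b \<le> E a"
proof (cases "a = b")
  case False
  show ?thesis
  proof (rule DERIV_nonpos_imp_decreasing_open[of a b])
    show "a \<le> b" by (rule ab)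
    show "\<exists>y. DERIV E x :> y \<and> y \<le> 0" if "a < x" "x < b" for x
      using E_deriv[of x] E'_nonpos[of x] that ab by auto
    show "continuous_on {a..b} E" by (rule E_cont_on[OF ab(1)])
  qed
qed simp

lemma sqrt_mult_le:
  assumes "(x::real) \<ge> 0" "y \<ge> 0" "l > 0" shows "sqrt (x * y) \<le> (l * x + y / l) / 2"
proof -
  have "x * y = (l * x) * (y / l)" using assms by simp
  thus ?thesis using arith_geo_mean_sqrt[of "l * x" "y / l"] assms by simp
qed

text \<open>If nonlinear effects have enlarged the low frequencies by no more than a factor S up to
  time T, the heat rate holds at T with constant K S^2. It matters that K depends neither on T nor
  on S, since S is later coupled to the unknown size of E.\<close>

lemma low_frequency_decay:
  obtains K where "K > 0" "\<And>T S. T \<ge> 0 \<Longrightarrow> S \<ge> 1 \<Longrightarrow>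
     (\<And>R t. 0 < R \<Longrightarrow> R \<le> 1 \<Longrightarrow> 0 \<le> t \<Longrightarrow> t \<le> T \<Longrightarrow> Z R t \<le> C * R * S) \<Longrightarrow> (1 + T) * E T \<le> K * S\<^sup>2"
proof -
  \<comment> \<open>With R^2 = k / (1 + t) the damping rate c R^2 equals 2 / (1 + t), the
    logarithmic derivative of (1 + t)^2.\<close>
  define k where "k = 2 / c"
  have k: "k > 0" using c by (simp add: k_def)
  define K where "K = (1 + k)\<^sup>2 * E 0 + C^3 * k\<^sup>2 + 1"
  have K0: "K > 0" unfolding K_def using E_nonneg[of 0] C k by (intro add_nonneg_pos add_nonneg_nonneg mult_nonneg_nonneg) auto
  have "(1 + T) * E T \<le> K * S\<^sup>2" if T: "T \<ge> 0" and S: "S \<ge> 1"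
    and Z: "\<And>R t. 0 < R \<Longrightarrow> R \<le> 1 \<Longrightarrow> 0 \<le> t \<Longrightarrow> t \<le> T \<Longrightarrow> Z R t \<le> C * R * S" for T S
  proof -
    have S2: "S\<^sup>2 \<ge> 1" using S by (rule one_le_power)
    have Kle: "(1 + k)\<^sup>2 * E 0 + C^3 * k\<^sup>2 * S\<^sup>2 \<le> K * S\<^sup>2"
    proof -
      have "(1 + k)\<^sup>2 * E 0 * 1 \<le> (1 + k)\<^sup>2 * E 0 * S\<^sup>2"
        using E_nonneg[of 0] S2 by (intro mult_left_mono) auto
      thus ?thesis using S2 by (simp add: K_def algebra_simps)
    qed
    have Ck: "C^3 * k\<^sup>2 * S\<^sup>2 \<ge> 0" using C by simp
    show ?thesis
    proof (cases "T \<le> k")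
      case True
      \<comment> \<open>At early times the radius sqrt (k / (1 + t)) may exceed 1, and there
        monotonicity of E suffices.\<close>
      have "(1 + T) * E T \<le> (1 + k) * E 0"
        using E_decreasing[of 0 T] True T k E_nonneg[of T] by (intro mult_mono) auto
      also have "\<dots> \<le> (1 + k)\<^sup>2 * E 0"
        using k E_nonneg[of 0] by (intro mult_right_mono) (auto simp: power2_eq_square)
      finally show ?thesis using Kle Ck by linarith
    next
      case False
      \<comment> \<open>After multiplication by (1 + t)^2 the forcing is this constant: one R^2
        comes from the inequality and another from the bound on Z squared. Thus (1 + t)^2 E grows at
        most linearly, which is one power of 1 + t better than E itself is known to be.\<close>
      define B where "B = C^3 * k\<^sup>2 * S\<^sup>2"
      have "(1 + T)\<^sup>2 * E T - B * T \<le> (1 + k)\<^sup>2 * E k - B * k"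
      proof (rule DERIV_nonpos_imp_decreasing_open[of k T "\<lambda>t. (1 + t)\<^sup>2 * E t - B * t"])
        show "k \<le> T" using False by simp
        show "continuous_on {k..T} (\<lambda>t. (1 + t)\<^sup>2 * E t - B * t)"
          by (intro continuous_intros E_cont_on) (use k in auto)
        show "\<exists>y. DERIV (\<lambda>t. (1 + t)\<^sup>2 * E t - B * t) t :> y \<and> y \<le> 0" if t: "k < t" "t < T" for t
        proof (intro exI conjI)
          have t0: "t > 0" using t k by simp
          show "DERIV (\<lambda>t. (1 + t)\<^sup>2 * E t - B * t) t :> (1 + t)\<^sup>2 * E' t + 2 * (1 + t) * E t - B"
            by (auto intro!: derivative_eq_intros E_deriv[OF t0] simp: algebra_simps)
          define R where "R = sqrt (k / (1 + t))"
          have R2: "R\<^sup>2 = k / (1 + t)" using t0 k by (simp add: R_def)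
          have R: "0 < R" "R \<le> 1" using t t0 k by (auto simp: R_def)
          have "E' t + c * R\<^sup>2 * E t \<le> C * R\<^sup>2 * (Z R t)\<^sup>2" by (rule E_split[OF R t0])
          also have "\<dots> \<le> C * R\<^sup>2 * (C * R * S)\<^sup>2"
            using Z[OF R] t t0 C Z_nonneg by (intro mult_left_mono power_mono) auto
          also have "\<dots> = C^3 * S\<^sup>2 * (R\<^sup>2)\<^sup>2" by (simp add: power_mult_distrib power2_eq_square power3_eq_cube)
          finally have "E' t + c * R\<^sup>2 * E t \<le> C^3 * S\<^sup>2 * (R\<^sup>2)\<^sup>2" .
          hence "(1 + t)\<^sup>2 * (E' t + c * R\<^sup>2 * E t) \<le> (1 + t)\<^sup>2 * (C^3 * S\<^sup>2 * (R\<^sup>2)\<^sup>2)"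
            by (rule mult_left_mono) simp
          also have "\<dots> = B" using t0 by (simp add: R2 B_def power_divide)
          also have "c * R\<^sup>2 = 2 / (1 + t)" using c by (simp add: R2 k_def)
          also have "(1 + t)\<^sup>2 * (E' t + 2 / (1 + t) * E t) = (1 + t)\<^sup>2 * E' t + 2 * (1 + t) * E t"
            using t0 by (simp add: field_simps power2_eq_square)
          finally show "(1 + t)\<^sup>2 * E' t + 2 * (1 + t) * E t - B \<le> 0" by simp
        qed
      qed
      moreover have "(1 + k)\<^sup>2 * E k \<le> (1 + k)\<^sup>2 * E 0"
        using E_decreasing[of 0 k] k by (intro mult_left_mono) auto
      moreover have "B * k \<ge> 0" using Ck k by (simp add: B_def)
      ultimately have "(1 + T)\<^sup>2 * E T \<le> (1 + k)\<^sup>2 * E 0 + B * T" by linarith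
      also have "\<dots> \<le> (1 + T) * ((1 + k)\<^sup>2 * E 0 + B)"
        using T E_nonneg[of 0] Ck by (simp add: algebra_simps B_def add_nonneg_nonneg)
      finally have "(1 + T) * ((1 + T) * E T) \<le> (1 + T) * ((1 + k)\<^sup>2 * E 0 + B)"
        by (simp add: power2_eq_square mult.assoc)
      hence "(1 + T) * E T \<le> (1 + k)\<^sup>2 * E 0 + B" using T by simp
      thus ?thesis using Kle by (simp add: B_def)
    qed
  qed
  with K0 show thesis by (rule that)
qed

text \<open>The weighted arithmetic-geometric inequality with a constant weight l. The primitive of
  |E'| is -E, while g is a majorant of E with explicit primitive G; choosing l afterwards amounts to
  Cauchy-Schwarz in time.\<close>

lemma Z_growth_weight:
  assumes R: "0 < R" "R \<le> 1" and ab: "0 \<le> a" "a \<le> b" and l: "l > 0"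
    and G: "continuous_on {a..b} G" "\<And>t. a < t \<Longrightarrow> t < b \<Longrightarrow> (G has_real_derivative g t) (at t)"
      "\<And>t. a < t \<Longrightarrow> t < b \<Longrightarrow> E t \<le> g t"
  shows "Z R b \<le> Z R a + C * R * ((l * (G b - G a) + (E a - E b) / l) / 2)"
proof (cases "a = b")
  case False
  define \<Phi> where "\<Phi> t = (l * G t - E t / l) / 2" for t
  have "Z R b \<le> Z R a + C * R * (\<Phi> b - \<Phi> a)"
  proof (rule Z_growth[OF R ab(1), of b \<Phi> "\<lambda>t. (l * g t - E' t / l) / 2"])
    show "a < b" using ab False by simp
    show "continuous_on {a..b} \<Phi>" unfolding \<Phi>_def
      by (intro continuous_intros G E_cont_on) (use ab l in auto)
    fix t assume t: "a < t" "t < b"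
    have t0: "t > 0" using t ab by simp
    show "(\<Phi> has_real_derivative (l * g t - E' t / l) / 2) (at t)"
      unfolding \<Phi>_def using l by (auto intro!: derivative_eq_intros E_deriv[OF t0] G(2)[OF t])
    have "sqrt (E t * - E' t) \<le> (l * E t + - E' t / l) / 2"
      using E_nonneg E'_nonpos[OF t0] l by (intro sqrt_mult_le) auto
    also have "\<dots> \<le> (l * g t - E' t / l) / 2" using G(3)[OF t] l by simp
    finally show "sqrt (E t * - E' t) \<le> (l * g t - E' t / l) / 2" .
  qed
  also have "\<Phi> b - \<Phi> a = (l * (G b - G a) + (E a - E b) / l) / 2"
    by (simp add: \<Phi>_def algebra_simps diff_divide_distrib add_divide_distrib)
  finally show ?thesis .
qed simp

lemma has_derivative_one_plus_powr:
  fixes t :: real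
  assumes "t > - 1" shows "((\<lambda>t. (1 + t) powr a) has_real_derivative a * (1 + t) powr (a - 1)) (at t)"
proof -
  have "((\<lambda>t. 1 + t) has_real_derivative 1) (at t)" by (auto intro!: derivative_eq_intros)
  from DERIV_chain2[OF has_real_derivative_powr this, of a] assms show ?thesis by simp
qed

text \<open>On [0, T] let A be the maximum of (1 + t)^(3/4) E. Then the integral of E up to the
  maximum is at most 4 A (1 + m)^(1/4), and the decay lemma returns a bound for A (1 + m)^(1/4) by
  the same quantity times a multiple of \<epsilon>. Absorbing it gives a bound that is independent
  of T.\<close>

lemma E_decay_preliminary:
  obtains M where "M > 0" "\<And>t. t \<ge> 0 \<Longrightarrow> (1 + t) powr (3/4) * E t \<le> M"
proof -
  obtain K where K: "K > 0" "\<And>T S. T \<ge> 0 \<Longrightarrow> S \<ge> 1 \<Longrightarrow>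
     (\<And>R t. 0 < R \<Longrightarrow> R \<le> 1 \<Longrightarrow> 0 \<le> t \<Longrightarrow> t \<le> T \<Longrightarrow> Z R t \<le> C * R * S) \<Longrightarrow> (1 + T) * E T \<le> K * S\<^sup>2"
    using low_frequency_decay by blast
  \<comment> \<open>Chosen so that 8 K \<epsilon> = 1/2 when the quadratic term is absorbed at the
    end.\<close>
  define \<epsilon> where "\<epsilon> = 1 / (16 * K)"
  have \<epsilon>: "\<epsilon> > 0" using K by (simp add: \<epsilon>_def)
  text \<open>The total dissipation is finite, so that it is at most \<open>\<epsilon>\<close> after some time.\<close>
  obtain t0 where t0: "t0 \<ge> 0" "\<And>t. t \<ge> t0 \<Longrightarrow> E t0 - E t \<le> \<epsilon>"
  proof -
    define L where "L = Inf (E ` {0..})"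
    have bdd: "bdd_below (E ` {0..})" using E_nonneg by (intro bdd_belowI[of _ 0]) auto
    have "\<exists>y\<in>E ` {0..}. y < L + \<epsilon>" using \<epsilon> bdd unfolding L_def by (intro cInf_lessD) auto
    then obtain t0 where "t0 \<ge> 0" "E t0 < L + \<epsilon>" by auto
    moreover have "L \<le> E t" if "t \<ge> 0" for t unfolding L_def using that bdd by (intro cInf_lower) auto
    ultimately show thesis by (intro that[of t0]) (auto, smt (verit))
  qed
  \<comment> \<open>On [0, t0] crude bounds suffice: weight l = 1, E at most E 0, and total decrease
    of E at most E 0.\<close>
  define S0 where "S0 = 1 + (E 0 * t0 + E 0) / 2"
  have S0: "S0 \<ge> 1" unfolding S0_def using E_nonneg[of 0] t0(1) by simp
  have Z0: "Z R t \<le> C * R * S0" if R: "0 < R" "R \<le> 1" and t: "0 \<le> t" "t \<le> t0" for R t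
  proof -
    have "Z R t \<le> Z R 0 + C * R * ((1 * (E 0 * t - E 0 * 0) + (E 0 - E t) / 1) / 2)"
    proof (rule Z_growth_weight[OF R _ t(1), where g="\<lambda>_. E 0"])
      show "((*) (E 0) has_real_derivative E 0) (at t)" for t by (auto intro!: derivative_eq_intros)
    qed (auto intro!: continuous_intros E_decreasing)
    also have "\<dots> \<le> C * R + C * R * ((E 0 * t0 + E 0) / 2)"
    proof (intro add_mono mult_left_mono)
      have "E 0 * t \<le> E 0 * t0" using t E_nonneg[of 0] by (intro mult_left_mono) auto
      thus "(1 * (E 0 * t - E 0 * 0) + (E 0 - E t) / 1) / 2 \<le> (E 0 * t0 + E 0) / 2" using E_nonneg[of t] by simp
    qed (use Z_init[OF R] C R in auto)
    also have "\<dots> = C * R * S0" by (simp add: S0_def algebra_simps)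
    finally show ?thesis .
  qed
  define e where "e t = (1 + t) powr (3/4) * E t" for t
  \<comment> \<open>The first summand covers a maximum attained by time t0, the second a later one,
    where the absorption leaves A <= 4 K S0^2.\<close>
  define M where "M = (1 + t0) powr (3/4) * E 0 + 4 * K * S0\<^sup>2"
  have M: "M > 0"
  proof -
    have "0 \<le> (1 + t0) powr (3/4) * E 0" using E_nonneg[of 0] by simp
    moreover have "0 < 4 * K * S0\<^sup>2" using K S0 by simp
    ultimately show ?thesis unfolding M_def by linarith
  qed
  have "e T \<le> M" if T: "T \<ge> 0" for T
  proof -
    have "continuous_on {0..T} e"
      unfolding e_def by (intro continuous_intros E_cont_on) auto
    \<comment> \<open>At the maximum point all earlier values are controlled by the very quantity to
      be estimated, which closes the argument without a continuity method.\<close>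
    then obtain m where m: "m \<in> {0..T}" "\<And>t. t \<in> {0..T} \<Longrightarrow> e t \<le> e m"
      using continuous_attains_sup[of "{0..T}" e] T by auto
    have "e m \<le> M"
    proof (cases "m \<le> t0 \<or> e m = 0")
      case True
      have "e m \<le> (1 + t0) powr (3/4) * E 0"
      proof (cases "m \<le> t0")
        case le: True
        thus ?thesis unfolding e_def using m(1) E_decreasing[of 0 m] E_nonneg[of m]
          by (intro mult_mono powr_mono2) auto
      next
        case False
        hence "e m = 0" using True by simp
        thus ?thesis using E_nonneg[of 0] by simp
      qed
      thus ?thesis using K(1) by (simp add: M_def add_increasing2)
    next
      case False
      define A where "A = e m"
      have "A \<ge> 0" unfolding A_def e_def using E_nonneg by simp
      hence A: "A > 0" using False by (simp add: A_def)
      have m0: "m > t0" "m \<ge> 0" using False m(1) by auto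
      define q where "q = (1 + m) powr (1/8)"
      have q: "q \<ge> 1" unfolding q_def using m0 by (intro ge_one_powr_ge_zero) auto
      have q2: "(1 + m) powr (1/4) = q\<^sup>2"
        using m0 by (simp add: q_def power2_eq_square powr_add[symmetric])
      \<comment> \<open>The optimal weight: since G m = 4 A q^2, it makes l * G m and \<epsilon> / l
        both equal to 2 sqrt(\<epsilon> A) q, the increment in \<open>S\<close>.\<close>
      define l where "l = sqrt \<epsilon> / (2 * sqrt A * q)"
      have l: "l > 0" using \<epsilon> A q by (simp add: l_def)
      define S where "S = S0 + 2 * sqrt (\<epsilon> * A) * q"
      have S: "S \<ge> S0" using \<epsilon> A q by (simp add: S_def)
      have ZS: "Z R t \<le> C * R * S" if R: "0 < R" "R \<le> 1" and t: "0 \<le> t" "t \<le> m" for R t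
      proof (cases "t \<le> t0")
        case True
        have "C * R * S0 \<le> C * R * S" using S C R by (intro mult_left_mono) auto
        thus ?thesis using Z0[OF R t(1) True] by simp
      next
        case False
        define G where "G t = 4 * A * (1 + t) powr (1/4)" for t
        have "Z R t \<le> Z R t0 + C * R * ((l * (G t - G t0) + (E t0 - E t) / l) / 2)"
        proof (rule Z_growth_weight[OF R t0(1) _ l, where g="\<lambda>t. A * (1 + t) powr (-3/4)"])
          show "continuous_on {t0..t} G" unfolding G_def by (intro continuous_intros) (use t0 in auto)
          fix r assume r: "t0 < r" "r < t"
          show "(G has_real_derivative A * (1 + r) powr (- 3 / 4)) (at r)"
          proof -
            have "((\<lambda>t. (1 + t) powr (1/4)) has_real_derivative (1/4) * (1 + r) powr (1/4 - 1)) (at r)"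
              by (rule has_derivative_one_plus_powr) (use r t0 in simp)
            from DERIV_cmult[OF this, of "4 * A"] show ?thesis by (simp add: G_def[abs_def])
          qed
          have "(1 + r) powr (3/4) * E r \<le> A" using m(2)[of r] r t t0 m(1) by (simp add: A_def e_def)
          moreover have "(1 + r) powr (-3/4) * (1 + r) powr (3/4) = 1" using r t0 by (simp add: powr_add[symmetric])
          ultimately show "E r \<le> A * (1 + r) powr (-3/4)"
          proof -
            assume *: "(1 + r) powr (3/4) * E r \<le> A" "(1 + r) powr (-3/4) * (1 + r) powr (3/4) = 1"
            have "E r = (1 + r) powr (-3/4) * ((1 + r) powr (3/4) * E r)"
              unfolding mult.assoc[symmetric] *(2) by simp
            also have "\<dots> \<le> (1 + r) powr (-3/4) * A" by (intro mult_left_mono *) simp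
            finally show "E r \<le> A * (1 + r) powr (-3/4)" by (simp only: mult.commute)
          qed
        qed (use False in simp)
        also have "\<dots> \<le> C * R * S0 + C * R * (2 * sqrt (\<epsilon> * A) * q)"
        proof (intro add_mono mult_left_mono)
          show "Z R t0 \<le> C * R * S0" by (rule Z0[OF R t0(1)]) simp
          have "G t - G t0 \<le> G m"
          proof -
            have "(1 + t) powr (1/4) \<le> (1 + m) powr (1/4)" using t by (intro powr_mono2) auto
            hence "G t \<le> G m" using A by (simp add: G_def)
            moreover have "G t0 \<ge> 0" using A by (simp add: G_def)
            ultimately show ?thesis by simp
          qed
          hence "l * (G t - G t0) \<le> l * G m" using l by simp
          also have "l * G m = 2 * sqrt (\<epsilon> * A) * q"
          proof -
            have "l * G m = 4 * (sqrt A * sqrt A) * q\<^sup>2 * (sqrt \<epsilon> / (2 * sqrt A * q))" using A by (simp add: l_def G_def q2)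
            also have "\<dots> = 2 * (sqrt \<epsilon> * sqrt A) * q"
            proof -
              have "4 * (x * x) * q\<^sup>2 * (y / (2 * x * q)) = 2 * (y * x) * q" if "x > 0" for x y :: real
                using that q by (simp add: power2_eq_square)
              from this[of "sqrt A" "sqrt \<epsilon>"] A show ?thesis by simp
            qed
            finally show ?thesis by (simp add: real_sqrt_mult)
          qed
          finally have lG: "l * (G t - G t0) \<le> 2 * sqrt (\<epsilon> * A) * q" .
          have "(E t0 - E t) / l \<le> \<epsilon> / l" using t0(2)[of t] False l by (intro divide_right_mono) auto
          also have "\<epsilon> / l = 2 * sqrt (\<epsilon> * A) * q"
          proof -
            have "\<epsilon> / l = (sqrt \<epsilon> * sqrt \<epsilon>) * (2 * sqrt A * q) / sqrt \<epsilon>" using \<epsilon> by (simp add: l_def)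
            also have "\<dots> = 2 * (sqrt \<epsilon> * sqrt A) * q"
            proof -
              have "(x * x) * (2 * y * q) / x = 2 * (x * y) * q" if "x > 0" for x y :: real using that by simp
              from this[of "sqrt \<epsilon>" "sqrt A"] \<epsilon> show ?thesis by simp
            qed
            finally show ?thesis by (simp add: real_sqrt_mult)
          qed
          finally have "l * (G t - G t0) + (E t0 - E t) / l \<le> 2 * sqrt (\<epsilon> * A) * q + 2 * sqrt (\<epsilon> * A) * q"
            by (rule add_mono[OF lG])
          moreover have "x / 2 \<le> y" if "x \<le> y + y" for x y :: real using that by simp
          ultimately show "(l * (G t - G t0) + (E t0 - E t) / l) / 2 \<le> 2 * sqrt (\<epsilon> * A) * q" by blast
        qed (use C R in auto)
        also have "\<dots> = C * R * S" by (simp add: S_def algebra_simps)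
        finally show ?thesis .
      qed
      have "(1 + m) * E m \<le> K * S\<^sup>2" by (rule K(2)) (use m0 S S0 ZS in auto)
      moreover have "(1 + m) * E m = q\<^sup>2 * A"
      proof -
        have "(1 + m) powr (1/4) * (1 + m) powr (3/4) = 1 + m" using m0 by (simp add: powr_add[symmetric])
        thus ?thesis unfolding A_def e_def q2[symmetric] mult.assoc[symmetric] by simp
      qed
      moreover have "S\<^sup>2 \<le> 2 * S0\<^sup>2 + 8 * (\<epsilon> * A) * q\<^sup>2"
      proof -
        have "S\<^sup>2 \<le> 2 * S0\<^sup>2 + 2 * (2 * sqrt (\<epsilon> * A) * q)\<^sup>2"
          using norm_add_power2_le[of S0 "2 * sqrt (\<epsilon> * A) * q"] by (simp add: S_def)
        also have "(2 * sqrt (\<epsilon> * A) * q)\<^sup>2 = 4 * (\<epsilon> * A) * q\<^sup>2" using \<epsilon> A by (simp add: power_mult_distrib)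
        finally show ?thesis by simp
      qed
      ultimately have "q\<^sup>2 * A \<le> K * (2 * S0\<^sup>2 + 8 * (\<epsilon> * A) * q\<^sup>2)"
        using K(1) mult_left_mono[of "S\<^sup>2" "2 * S0\<^sup>2 + 8 * (\<epsilon> * A) * q\<^sup>2" K] by linarith
      also have "\<dots> = 2 * K * S0\<^sup>2 + q\<^sup>2 * A / 2" using K(1) by (simp add: \<epsilon>_def field_simps)
      finally have "q\<^sup>2 * A \<le> 4 * K * S0\<^sup>2" by simp
      moreover have "1 * A \<le> q\<^sup>2 * A" using q A by (intro mult_right_mono one_le_power) auto
      ultimately show ?thesis using E_nonneg[of 0] by (simp add: A_def M_def add_increasing)
    qed
    moreover have "e T \<le> e m" using T by (intro m(2)) simp
    ultimately show ?thesis by simp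
  qed
  with M show thesis unfolding e_def by (rule that)
qed

text \<open>With E = O((1 + t)^(-3/4)) the time-dependent weight (1 + t)^(-1/2) makes sqrt(E |E'|)
  integrable, so Z stays below C R S with S independent of time and the decay lemma gives the full
  rate.\<close>

lemma E_decay:
  obtains K where "K > 0" "\<And>t. t \<ge> 0 \<Longrightarrow> (1 + t) * E t \<le> K"
proof -
  obtain M where M: "M > 0" "\<And>t. t \<ge> 0 \<Longrightarrow> (1 + t) powr (3/4) * E t \<le> M"
    using E_decay_preliminary by blast
  obtain K where K: "K > 0" "\<And>T S. T \<ge> 0 \<Longrightarrow> S \<ge> 1 \<Longrightarrow>
     (\<And>R t. 0 < R \<Longrightarrow> R \<le> 1 \<Longrightarrow> 0 \<le> t \<Longrightarrow> t \<le> T \<Longrightarrow> Z R t \<le> C * R * S) \<Longrightarrow> (1 + T) * E T \<le> K * S\<^sup>2"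
    using low_frequency_decay by blast
  \<comment> \<open>The 1 accounts for the initial value of Z, the rest bounds the increment of
    \<Phi> below.\<close>
  define S where "S = 1 + (E 0 / 2 + 3 * M)"
  have S: "S \<ge> 1" using E_nonneg[of 0] M by (simp add: S_def)
  have ZS: "Z R T \<le> C * R * S" if R: "0 < R" "R \<le> 1" and T: "0 \<le> T" for R T
  proof (cases "T = 0")
    case True
    have "C * R * 1 \<le> C * R * S" using S C R by (intro mult_left_mono) auto
    thus ?thesis using True Z_init[OF R] by simp
  next
    case False
    \<comment> \<open>The first term integrates -(1 + t)^(1/2) E' / 2 by parts, which leaves (1/4)
      (1 + t)^(-1/2) E; together with the 1/2 from the weighted mean the coefficient is 3/4. The
      preliminary decay bounds this by (3/4) M (1 + t)^(-5/4), whose primitive is the second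
      term.\<close>
    define \<Phi> where "\<Phi> t = - ((1 + t) powr (1/2) * E t) / 2 - 3 * M * (1 + t) powr (-1/4)" for t
    define \<phi> where "\<phi> t = - ((1/2) * (1 + t) powr (-1/2) * E t + (1 + t) powr (1/2) * E' t) / 2
      + 3/4 * M * (1 + t) powr (-5/4)" for t
    have "Z R T \<le> Z R 0 + C * R * (\<Phi> T - \<Phi> 0)"
    proof (rule Z_growth[OF R, of 0 T \<Phi> \<phi>])
      show "0 < T" using T False by simp
      show "continuous_on {0..T} \<Phi>"
        unfolding \<Phi>_def by (intro continuous_intros E_cont_on) auto
      fix t assume t: "0 < t" "t < T"
      show "(\<Phi> has_real_derivative \<phi> t) (at t)"
      proof -
        have t1: "t > -1" using t by simp
        have "(\<Phi> has_real_derivative - ((1/2) * (1 + t) powr (1/2 - 1) * E t + E' t * (1 + t) powr (1/2)) / 2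
            - 3 * M * ((-1/4) * (1 + t) powr (-1/4 - 1))) (at t)"
          unfolding \<Phi>_def
          by (intro DERIV_diff DERIV_cdivide DERIV_minus DERIV_mult DERIV_cmult has_derivative_one_plus_powr t1 E_deriv[OF t(1)])
        thus ?thesis by (rule DERIV_cong) (simp add: \<phi>_def)
      qed
      define l where "l = (1 + t) powr (-1/2)"
      have l: "l > 0" using t by (simp add: l_def)
      have "l = inverse ((1 + t) powr (1/2))" unfolding l_def using powr_minus[of "1 + t" "1/2"] by simp
      hence il: "1 / l = (1 + t) powr (1/2)" by (simp only: divide_inverse inverse_inverse_eq mult_1)
      have "sqrt (E t * - E' t) \<le> (l * E t + - E' t / l) / 2"
        using E_nonneg E'_nonpos[OF t(1)] l by (intro sqrt_mult_le) auto
      also have "\<dots> = - ((1/2) * (1 + t) powr (-1/2) * E t + (1 + t) powr (1/2) * E' t) / 2 + 3/4 * (l * E t)"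
        unfolding il[symmetric] l_def[symmetric] using l by (simp add: field_simps)
      also have "\<dots> \<le> \<phi> t"
      proof -
        have "l * E t = (1 + t) powr (-5/4) * ((1 + t) powr (3/4) * E t)"
          using t by (simp add: l_def mult.assoc[symmetric] powr_add[symmetric])
        also have "\<dots> \<le> (1 + t) powr (-5/4) * M" using M(2)[of t] t by (intro mult_left_mono) auto
        finally show ?thesis by (simp add: \<phi>_def mult.commute)
      qed
      finally show "sqrt (E t * - E' t) \<le> \<phi> t" .
    qed simp
    also have "\<dots> \<le> C * R + C * R * (E 0 / 2 + 3 * M)"
    proof (intro add_mono Z_init[OF R] mult_left_mono)
      have "(1 + T) powr (1/2) * E T \<ge> 0" "3 * M * (1 + T) powr (-1/4) \<ge> 0" using E_nonneg M by auto
      thus "\<Phi> T - \<Phi> 0 \<le> E 0 / 2 + 3 * M" by (simp add: \<Phi>_def)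
    qed (use C R in auto)
    also have "\<dots> = C * R * S" by (simp add: S_def algebra_simps)
    finally show ?thesis .
  qed
  have "K * S\<^sup>2 > 0" using K(1) S by simp
  moreover have "(1 + t) * E t \<le> K * S\<^sup>2" if "t \<ge> 0" for t
    by (rule K(2)[OF that S]) (rule ZS)
  ultimately show thesis by (rule that)
qed

end

section \<open>Decay of solutions\<close>

lemma in_sobolev_diff:
  assumes f: "in_sobolev s f" and g: "in_sobolev s g"
  shows "in_sobolev s (\<lambda>x. f x - g x)"
  unfolding in_sobolev_def
proof (intro conjI ballI)
  show "square_integrable (\<lambda>x. f x - g x)"
    by (intro square_integrable_diff in_sobolev_square_integrable[OF f] in_sobolev_square_integrable[OF g])
  fix e :: 'a assume e: "e \<in> Basis"
  note fe = in_sobolev_component[OF f e] and ge = in_sobolev_component[OF g e]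
  note sf = in_sobolev_square_integrable[OF fe] and sg = in_sobolev_square_integrable[OF ge]
  have eq: "(\<lambda>x. (f x - g x) \<bullet> e) = (\<lambda>x. f x \<bullet> e - g x \<bullet> e)" by (simp add: inner_diff_left)
  have [measurable]: "fourier (\<lambda>x. f x \<bullet> e - g x \<bullet> e) \<in> borel_measurable borel"
    using square_integrable_measurable[OF fourier_spec(1)[OF square_integrable_diff[OF sf sg]]] by simp
  show "integrable lborel (\<lambda>\<xi>. (1 + (norm \<xi>)\<^sup>2) powr s * (cmod (fourier (\<lambda>x. (f x - g x) \<bullet> e) \<xi>))\<^sup>2)"
    unfolding eq
  proof (rule Bochner_Integration.integrable_bound)
    show "integrable lborel (\<lambda>\<xi>. 2 * ((1 + (norm \<xi>)\<^sup>2) powr s * (cmod (fourier (\<lambda>x. f x \<bullet> e) \<xi>))\<^sup>2)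
       + 2 * ((1 + (norm \<xi>)\<^sup>2) powr s * (cmod (fourier (\<lambda>x. g x \<bullet> e) \<xi>))\<^sup>2))"
      using in_sobolev_integrable[OF fe] in_sobolev_integrable[OF ge] by simp
    show "AE \<xi> in lborel. norm ((1 + (norm \<xi>)\<^sup>2) powr s * (cmod (fourier (\<lambda>x. f x \<bullet> e - g x \<bullet> e) \<xi>))\<^sup>2)
       \<le> norm (2 * ((1 + (norm \<xi>)\<^sup>2) powr s * (cmod (fourier (\<lambda>x. f x \<bullet> e) \<xi>))\<^sup>2)
       + 2 * ((1 + (norm \<xi>)\<^sup>2) powr s * (cmod (fourier (\<lambda>x. g x \<bullet> e) \<xi>))\<^sup>2))"
      using fourier_diff[OF sf sg]
    proof eventually_elim
      case (elim \<xi>)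
      have "(cmod (fourier (\<lambda>x. f x \<bullet> e) \<xi> - fourier (\<lambda>x. g x \<bullet> e) \<xi>))\<^sup>2
        \<le> 2 * (cmod (fourier (\<lambda>x. f x \<bullet> e) \<xi>))\<^sup>2 + 2 * (cmod (fourier (\<lambda>x. g x \<bullet> e) \<xi>))\<^sup>2"
        using norm_add_power2_le[of "fourier (\<lambda>x. f x \<bullet> e) \<xi>" "- fourier (\<lambda>x. g x \<bullet> e) \<xi>"] by simp
      hence "(1 + (norm \<xi>)\<^sup>2) powr s * (cmod (fourier (\<lambda>x. f x \<bullet> e) \<xi> - fourier (\<lambda>x. g x \<bullet> e) \<xi>))\<^sup>2
        \<le> (1 + (norm \<xi>)\<^sup>2) powr s * (2 * (cmod (fourier (\<lambda>x. f x \<bullet> e) \<xi>))\<^sup>2 + 2 * (cmod (fourier (\<lambda>x. g x \<bullet> e) \<xi>))\<^sup>2)"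
        by (rule mult_left_mono) simp
      thus ?case unfolding elim by (simp add: algebra_simps)
    qed
  qed measurable
qed

lemma has_time_derivative_component:
  fixes w :: "real \<Rightarrow> real^2 \<Rightarrow> 'a::euclidean_space ^ 2"
  assumes w: "has_time_derivative w v t" and t: "t \<ge> 0"
  shows "has_time_derivative (\<lambda>r x. w r x $ i) (\<lambda>x. v x $ i) t"
  unfolding has_time_derivative_def
proof (intro conjI allI impI)
  have sw: "\<And>r. r \<ge> 0 \<Longrightarrow> square_integrable (w r)" and sv: "square_integrable v"
    and lim: "((\<lambda>r. l2_norm (\<lambda>x. (1 / (r - t)) *\<^sub>R (w r x - w t x) - v x)) \<longlongrightarrow> 0) (at t within {0..})"
    using w by (auto simp: has_time_derivative_def)
  show "square_integrable (\<lambda>x. w r x $ i)" if "r \<ge> 0" for r by (rule square_integrable_vec_nth[OF sw[OF that]])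
  show "square_integrable (\<lambda>x. v x $ i)" by (rule square_integrable_vec_nth[OF sv])
  show "((\<lambda>r. l2_norm (\<lambda>x. (1 / (r - t)) *\<^sub>R (w r x $ i - w t x $ i) - v x $ i)) \<longlongrightarrow> 0) (at t within {0..})"
  proof (rule Lim_null_comparison[OF _ lim])
    have "\<forall>\<^sub>F r in at t within {0..}. r \<ge> 0" by (simp add: eventually_at_filter)
    thus "\<forall>\<^sub>F r in at t within {0..}. norm (l2_norm (\<lambda>x. (1 / (r - t)) *\<^sub>R (w r x $ i - w t x $ i) - v x $ i))
       \<le> l2_norm (\<lambda>x. (1 / (r - t)) *\<^sub>R (w r x - w t x) - v x)"
    proof eventually_elim
      case (elim r)
      have sq: "square_integrable (\<lambda>x. (1 / (r - t)) *\<^sub>R (w r x - w t x) - v x)"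
        by (intro square_integrable_diff[OF square_integrable_scaleR[OF square_integrable_diff[OF sw[OF elim] sw[OF t]]] sv])
      have eq: "(1 / (r - t)) *\<^sub>R (w r x $ i - w t x $ i) - v x $ i = ((1 / (r - t)) *\<^sub>R (w r x - w t x) - v x) $ i" for x
        by simp
      show ?case unfolding eq real_norm_def abs_of_nonneg[OF l2_norm_nonneg]
        by (rule l2_norm_mono_AE[OF sq square_integrable_measurable[OF square_integrable_vec_nth[OF sq]]])
           (intro AE_I2 Finite_Cartesian_Product.norm_nth_le)
    qed
  qed
qed

lemma has_derivative_low_inner_time:
  fixes f :: "real \<Rightarrow> real^2 \<Rightarrow> real"
  assumes "has_time_derivative f v t" "t \<ge> 0"
  shows "((\<lambda>r. low_inner R (f r) (f r)) has_real_derivative 2 * low_inner R v (f t)) (at t within {0..})"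
  using assms by (intro has_derivative_low_inner) (auto simp: has_time_derivative_def)

lemma has_derivative_low_energy:
  assumes u: "has_time_derivative u u_t t" and \<tau>: "has_time_derivative \<tau> \<tau>_t t" and t: "t \<ge> 0"
  shows "((\<lambda>r. low_energy R (u r) (\<tau> r)) has_real_derivative
    2 * ((\<Sum>i\<in>UNIV. low_inner R (\<lambda>x. u_t x $ i) (\<lambda>x. u t x $ i))
     + (\<Sum>i\<in>UNIV. \<Sum>j\<in>UNIV. low_inner R (\<lambda>x. \<tau>_t x $ i $ j) (\<lambda>x. \<tau> t x $ i $ j)))) (at t within {0..})"
  unfolding low_energy_def distrib_left sum_distrib_left
  by (intro DERIV_add DERIV_sum has_derivative_low_inner_time t
      has_time_derivative_component[OF u t] has_time_derivative_component[OF has_time_derivative_component[OF \<tau> t] t])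

text \<open>The square root is not differentiable at 0 and Y may vanish, so sqrt(Y + e^2) is
  differentiated instead; its initial value exceeds sqrt Y by at most e, which then tends to
  0.\<close>

lemma sqrt_growth:
  fixes Y Y' \<Phi> \<phi> :: "real \<Rightarrow> real"
  assumes ab: "a < b" and Y: "\<And>t. Y t \<ge> 0" and cY: "continuous_on {a..b} Y" and c\<Phi>: "continuous_on {a..b} \<Phi>"
    and dY: "\<And>t. a < t \<Longrightarrow> t < b \<Longrightarrow> (Y has_real_derivative Y' t) (at t)"
    and d\<Phi>: "\<And>t. a < t \<Longrightarrow> t < b \<Longrightarrow> (\<Phi> has_real_derivative \<phi> t) (at t)"
    and \<phi>: "\<And>t. a < t \<Longrightarrow> t < b \<Longrightarrow> \<phi> t \<ge> 0"
    and le: "\<And>t. a < t \<Longrightarrow> t < b \<Longrightarrow> Y' t \<le> 2 * K * \<phi> t * sqrt (Y t)" and K: "K \<ge> 0"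
  shows "sqrt (Y b) \<le> sqrt (Y a) + K * (\<Phi> b - \<Phi> a)"
proof (rule field_le_epsilon)
  fix e :: real assume e: "e > 0"
  have p: "Y t + e\<^sup>2 > 0" for t using Y[of t] e by (simp add: add_nonneg_pos)
  have "sqrt (Y b + e\<^sup>2) - K * \<Phi> b \<le> sqrt (Y a + e\<^sup>2) - K * \<Phi> a"
  proof (rule DERIV_nonpos_imp_decreasing_open[of a b "\<lambda>t. sqrt (Y t + e\<^sup>2) - K * \<Phi> t"])
    show "continuous_on {a..b} (\<lambda>t. sqrt (Y t + e\<^sup>2) - K * \<Phi> t)"
      by (intro continuous_intros cY c\<Phi>)
    fix t assume t: "a < t" "t < b"
    show "\<exists>y. DERIV (\<lambda>t. sqrt (Y t + e\<^sup>2) - K * \<Phi> t) t :> y \<and> y \<le> 0"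
    proof (intro exI conjI)
      have "((\<lambda>t. Y t + e\<^sup>2) has_real_derivative Y' t) (at t)"
        using DERIV_add[OF dY[OF t] DERIV_const[of "e\<^sup>2"]] by simp
      from DERIV_chain2[OF DERIV_real_sqrt[OF p] this]
      show "DERIV (\<lambda>t. sqrt (Y t + e\<^sup>2) - K * \<Phi> t) t :> inverse (sqrt (Y t + e\<^sup>2)) / 2 * Y' t - K * \<phi> t"
        by (intro DERIV_diff DERIV_cmult d\<Phi> t)
      have "Y' t \<le> 2 * K * \<phi> t * sqrt (Y t)" by (rule le[OF t])
      also have "\<dots> \<le> 2 * K * \<phi> t * sqrt (Y t + e\<^sup>2)"
        using K \<phi>[OF t] by (intro mult_left_mono) auto
      finally have "inverse (sqrt (Y t + e\<^sup>2)) / 2 * Y' t \<le> inverse (sqrt (Y t + e\<^sup>2)) / 2 * (2 * K * \<phi> t * sqrt (Y t + e\<^sup>2))"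
        using p[of t] by (intro mult_left_mono) auto
      also have "\<dots> = K * \<phi> t" using p[of t] by (simp add: field_simps)
      finally show "inverse (sqrt (Y t + e\<^sup>2)) / 2 * Y' t - K * \<phi> t \<le> 0" by simp
    qed
  qed (use ab in simp)
  moreover have "sqrt (Y b) \<le> sqrt (Y b + e\<^sup>2)" by simp
  moreover have "sqrt (Y a + e\<^sup>2) \<le> sqrt (Y a) + e"
    using sqrt_add_le_add_sqrt[of "Y a" "e\<^sup>2"] Y[of a] e by simp
  ultimately show "sqrt (Y b) \<le> sqrt (Y a) + K * (\<Phi> b - \<Phi> a) + e"
    unfolding right_diff_distrib by linarith
qed

text \<open>The initial state agrees with the integrable data only almost everywhere; transforms do
  not see the difference, so the L1 bound can be read off the data.\<close>

lemma low_inner_integrable_data: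
  fixes f g :: "real^2 \<Rightarrow> real"
  assumes f: "square_integrable f" and g: "integrable lborel g" and ae: "AE x in lborel. f x = g x" and R: "R \<ge> 0"
  shows "low_inner R f f \<le> (2 * R)\<^sup>2 * (LINT x|lborel. \<bar>g x\<bar>)\<^sup>2"
proof -
  have m: "g \<in> borel_measurable lborel" using borel_measurable_integrable[OF g] .
  have sg: "square_integrable g" by (rule square_integrable_bound[OF f m, where c=1]) (use ae in auto)
  have "fourier f = fourier g" by (rule fourier_cong_AE[OF ae square_integrable_measurable[OF f] m])
  hence "low_inner R f f = low_inner R g g" by (simp add: low_inner_def)
  thus ?thesis using low_inner_self_integrable[OF sg g R] by simp
qed

lemma low_energy_integrable_data:
  fixes u u0 :: "real^2 \<Rightarrow> real^2" and \<tau> \<tau>0 :: "real^2 \<Rightarrow> real^2^2"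
  assumes w: "in_sobolev s (\<lambda>x. (u x, \<tau> x))" and i: "integrable lborel (\<lambda>x. (u0 x, \<tau>0 x))"
    and ae: "AE x in lborel. u x = u0 x \<and> \<tau> x = \<tau>0 x"
  obtains B where "B \<ge> 0" "\<And>R. R \<ge> 0 \<Longrightarrow> low_energy R u \<tau> \<le> (2 * R)\<^sup>2 * B\<^sup>2"
proof -
  define B where "B = sqrt ((\<Sum>i\<in>UNIV. (LINT x|lborel. \<bar>u0 x $ i\<bar>)\<^sup>2) + (\<Sum>i\<in>UNIV. \<Sum>j\<in>UNIV. (LINT x|lborel. \<bar>\<tau>0 x $ i $ j\<bar>)\<^sup>2))"
  have B2: "B\<^sup>2 = (\<Sum>i\<in>UNIV. (LINT x|lborel. \<bar>u0 x $ i\<bar>)\<^sup>2) + (\<Sum>i\<in>UNIV. \<Sum>j\<in>UNIV. (LINT x|lborel. \<bar>\<tau>0 x $ i $ j\<bar>)\<^sup>2)"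
    unfolding B_def by (rule real_sqrt_pow2) (intro add_nonneg_nonneg sum_nonneg zero_le_power2)
  have iu: "integrable lborel (\<lambda>x. u0 x $ i)" for i
    using integrable_inner_left[OF i, of "(axis i 1, 0)"] by (simp add: inner_axis)
  have it: "integrable lborel (\<lambda>x. \<tau>0 x $ i $ j)" for i j
    using integrable_inner_left[OF i, of "(0, axis i (axis j 1))"] by (simp add: inner_axis)
  have "low_energy R u \<tau> \<le> (2 * R)\<^sup>2 * B\<^sup>2" if R: "R \<ge> 0" for R
    unfolding low_energy_def B2 distrib_left sum_distrib_left
  proof (intro add_mono sum_mono low_inner_integrable_data R iu it
      in_sobolev_square_integrable[OF in_sobolev_pair(1)[OF w]] in_sobolev_square_integrable[OF in_sobolev_pair(2)[OF w]])
    show "AE x in lborel. u x $ i = u0 x $ i" for i using ae by eventually_elim simp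
    show "AE x in lborel. \<tau> x $ i $ j = \<tau>0 x $ i $ j" for i j using ae by eventually_elim simp
  qed
  moreover have "B \<ge> 0" unfolding B_def by (intro real_sqrt_ge_zero add_nonneg_nonneg sum_nonneg zero_le_power2)
  ultimately show thesis using that by blast
qed

text \<open>The energy inequality concerns positive times, whereas the decay argument starts at 0.
  Continuity of the energy down to 0 comes from the reverse triangle inequality for N, the
  equivalence of norms and continuity of the solution in H^s.\<close>

lemma equivalent_H1_norm_continuous:
  assumes N: "equivalent_H1_norm N" and w: "continuous_in_sobolev s w" and s: "1 \<le> s" and t: "t \<ge> 0"
  shows "((\<lambda>r. N (w r)) \<longlongrightarrow> N (w t)) (at t within {0..})"
proof -
  obtain a A where aA: "a > 0" "A > 0" "\<And>f. in_sobolev 1 f \<Longrightarrow> a * sobolev_norm 1 f \<le> N f \<and> N f \<le> A * sobolev_norm 1 f"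
    using N unfolding equivalent_H1_norm_def by blast
  have tri: "N (\<lambda>x. f x + g x) \<le> N f + N g" if "in_sobolev 1 f" "in_sobolev 1 g" for f g
    using N that unfolding equivalent_H1_norm_def by blast
  have ws: "in_sobolev s (w r)" if "r \<ge> 0" for r using w that by (simp add: continuous_in_sobolev_def)
  note w1 = in_sobolev_mono[OF ws s]
  have lim: "((\<lambda>r. A * sobolev_norm s (\<lambda>x. w r x - w t x)) \<longlongrightarrow> 0) (at t within {0..})"
    using tendsto_mult_left[of "\<lambda>r. sobolev_norm s (\<lambda>x. w r x - w t x)" 0 "at t within {0..}" A] w t
    by (simp add: continuous_in_sobolev_def)
  have neg: "N (\<lambda>x. w p x - w q x) = N (\<lambda>x. w q x - w p x)" if "p \<ge> 0" "q \<ge> 0" for p q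
  proof -
    have "N (\<lambda>x. (-1) *\<^sub>R (w p x - w q x)) = \<bar>-1\<bar> * N (\<lambda>x. w p x - w q x)"
      using N in_sobolev_diff[OF w1[OF that(1)] w1[OF that(2)]] unfolding equivalent_H1_norm_def by blast
    thus ?thesis by simp
  qed
  have le: "N (w p) - N (w q) \<le> N (\<lambda>x. w p x - w q x)" if "p \<ge> 0" "q \<ge> 0" for p q
    using tri[OF in_sobolev_diff[OF w1[OF that(1)] w1[OF that(2)]] w1[OF that(2)]] by simp
  have "((\<lambda>r. N (w r) - N (w t)) \<longlongrightarrow> 0) (at t within {0..})"
  proof (rule Lim_null_comparison[OF _ lim])
    have "\<forall>\<^sub>F r in at t within {0..}. r \<ge> 0" by (simp add: eventually_at_filter)
    thus "\<forall>\<^sub>F r in at t within {0..}. norm (N (w r) - N (w t)) \<le> A * sobolev_norm s (\<lambda>x. w r x - w t x)"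
    proof eventually_elim
      case (elim r)
      note d = in_sobolev_diff[OF ws[OF elim] ws[OF t]]
      have "norm (N (w r) - N (w t)) \<le> N (\<lambda>x. w r x - w t x)"
        using le[OF elim t] le[OF t elim] neg[OF elim t] by (simp add: abs_le_iff)
      also have "\<dots> \<le> A * sobolev_norm 1 (\<lambda>x. w r x - w t x)" using aA(3)[OF in_sobolev_mono[OF d s]] by simp
      also have "\<dots> \<le> A * sobolev_norm s (\<lambda>x. w r x - w t x)"
        using aA(2) by (intro mult_left_mono sobolev_norm_mono[OF d s]) simp
      finally show ?case .
    qed
  qed
  thus ?thesis by (simp add: LIM_zero_iff)
qed

theorem theorem1p7:
  fixes \<theta> \<phi> :: "real^2 \<Rightarrow> real"
    and s \<delta> :: real
    and u0 :: "real^2 \<Rightarrow> real^2" and \<tau>0 :: "real^2 \<Rightarrow> real^2^2"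
    and u :: "real \<Rightarrow> real^2 \<Rightarrow> real^2" and \<tau> :: "real \<Rightarrow> real^2 \<Rightarrow> real^2^2"
  assumes "littlewood_paley \<theta> \<phi>"
    and "2 < s"
    and "elgindi_rousset_constant \<theta> \<phi> s \<delta>"
    and "admissible_data s u0 \<tau>0"
    and "small_data \<theta> \<phi> \<delta> u0 \<tau>0"
    and "oldroyd_b_solution s u0 \<tau>0 u \<tau>"
    and "integrable lborel (\<lambda>x. (u0 x, \<tau>0 x))"
  shows "\<exists>C>0. \<forall>t>0. sobolev_norm 1 (\<lambda>x. (u t x, \<tau> t x)) \<le> C * (1 + t) powr (-1/2)"
proof -
  note \<theta> = littlewood_paley_cutoff[OF assms(1)]
  have s1: "1 \<le> s" using assms(2) by simp
  define w where "w t = (\<lambda>x. (u t x, \<tau> t x))" for t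
  have cont: "continuous_in_sobolev s w" and init: "AE x in lborel. u 0 x = u0 x \<and> \<tau> 0 x = \<tau>0 x"
    using assms(6) by (auto simp: oldroyd_b_solution_def w_def[abs_def])
  obtain P u_t \<tau>_t where sol: "\<forall>t\<ge>0. weakly_differentiable (P t) \<and> has_time_derivative u (u_t t) t \<and>
        has_time_derivative \<tau> (\<tau>_t t) t \<and>
        (AE x in lborel.
           transpose (\<tau> t x) = \<tau> t x \<and>
           divergence (u t) x = 0 \<and>
           u_t t x + velocity_convection (u t) (u t) x + gradient (P t) x
             = tensor_divergence (\<tau> t) x \<and>
           \<tau>_t t x + tensor_convection (u t) (\<tau> t) x + \<tau> t x
               + Q_term 1 (velocity_gradient (u t) x) (\<tau> t x)
             = sym_part (velocity_gradient (u t) x) + tensor_laplacian (\<tau> t) x)"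
    using assms(6) unfolding oldroyd_b_solution_def by blast
  have ws: "in_sobolev s (\<lambda>x. (u t x, \<tau> t x))" if "t \<ge> 0" for t
    using cont that by (simp add: continuous_in_sobolev_def w_def)
  note w1 = in_sobolev_mono[OF ws s1]
  obtain N where N: "equivalent_H1_norm N" and all: "\<forall>u0 \<tau>0. admissible_data s u0 \<tau>0 \<longrightarrow> small_data \<theta> \<phi> \<delta> u0 \<tau>0 \<longrightarrow>
          (\<exists>u \<tau>. oldroyd_b_solution s u0 \<tau>0 u \<tau>) \<and>
          (\<forall>u \<tau> v \<sigma>. oldroyd_b_solution s u0 \<tau>0 u \<tau> \<longrightarrow> oldroyd_b_solution s u0 \<tau>0 v \<sigma> \<longrightarrow>
             (\<forall>t\<ge>0. AE x in lborel. u t x = v t x \<and> \<tau> t x = \<sigma> t x)) \<and>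
          (\<forall>u \<tau>. oldroyd_b_solution s u0 \<tau>0 u \<tau> \<longrightarrow>
             (\<forall>t>0. \<exists>E'.
                ((\<lambda>r. (N (\<lambda>x. (u r x, \<tau> r x)))\<^sup>2) has_real_derivative E') (at t) \<and>
                E' + (l2_norm (velocity_gradient (u t)))\<^sup>2 + (sobolev_norm 2 (\<tau> t))\<^sup>2 \<le> 0))"
    using assms(3) unfolding elgindi_rousset_constant_def by (elim conjE exE)
  note diss = mp[OF spec[OF spec[OF conjunct2[OF conjunct2[OF
    mp[OF mp[OF spec[OF spec[OF all]] assms(4)] assms(5)]]]]] assms(6)]
  obtain a A where a: "a > 0" and A: "A > 0"
    and aA: "\<And>f. in_sobolev 1 f \<Longrightarrow> a * sobolev_norm 1 f \<le> N f \<and> N f \<le> A * sobolev_norm 1 f"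
    using N unfolding equivalent_H1_norm_def by blast
  define E where "E t = (N (w t))\<^sup>2" for t
  obtain E' where E': "\<And>t. t > 0 \<Longrightarrow> (E has_real_derivative E' t) (at t)"
    "\<And>t. t > 0 \<Longrightarrow> E' t + dissipation (u t) (\<tau> t) \<le> 0"
  proof -
    from diss have "\<forall>t. \<exists>e. t > 0 \<longrightarrow> (E has_real_derivative e) (at t) \<and> e + dissipation (u t) (\<tau> t) \<le> 0"
      unfolding E_def[abs_def] w_def dissipation_def by (auto simp: add.assoc)
    thus thesis using that by metis
  qed
  have E'_le: "E' t \<le> 0" if "t > 0" for t
    using E'(2)[OF that] dissipation_nonneg[of "u t" "\<tau> t"] by linarith
  define Z where "Z R t = sqrt (low_energy R (u t) (\<tau> t))" for R t
  obtain B where B: "B \<ge> 0" "\<And>R. R \<ge> 0 \<Longrightarrow> low_energy R (u 0) (\<tau> 0) \<le> (2 * R)\<^sup>2 * B\<^sup>2"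
    using low_energy_integrable_data[OF ws[OF order_refl] assms(7) init] by blast
  \<comment> \<open>One constant for three duties: 72 / a in the growth of Z, 2 B in its initial
    value, and 1, which exceeds the coefficient 1/2 in the splitting inequality.\<close>
  define C where "C = 72 / a + 2 * B + 1"
  have C: "C > 0" "C \<ge> 72 / a" "C \<ge> 2 * B" "C \<ge> 1" using a B(1) by (auto simp: C_def add_nonneg_pos add_nonneg_nonneg)
  have Nle: "sobolev_norm 1 (w t) \<le> sqrt (E t) / a" "sqrt (E t) \<le> A * sobolev_norm 1 (w t)" if "t \<ge> 0" for t
  proof -
    have b: "a * sobolev_norm 1 (w t) \<le> N (w t)" "N (w t) \<le> A * sobolev_norm 1 (w t)"
      using aA[OF w1[OF that]] by (auto simp: w_def)
    \<comment> \<open>Nonnegativity of N is not one of its axioms; it follows from the lower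
      equivalence bound and is what makes sqrt E equal to N.\<close>
    have "0 \<le> a * sobolev_norm 1 (w t)" using a by simp
    hence "N (w t) \<ge> 0" using b(1) by linarith
    hence "sqrt (E t) = N (w t)" by (simp add: E_def)
    thus "sobolev_norm 1 (w t) \<le> sqrt (E t) / a" "sqrt (E t) \<le> A * sobolev_norm 1 (w t)"
      using b a by (auto simp: field_simps)
  qed
  have "\<exists>K>0. \<forall>t\<ge>0. (1 + t) * E t \<le> K"
  \<comment> \<open>The value c = 1 / (2 A^2) makes the high-frequency part of the split exactly the
    dissipation, since c R^2 times A^2 times 2 / R^2 equals 1.\<close>
  proof (rule E_decay[of "1 / (2 * A\<^sup>2)" C E E' Z])
    show "1 / (2 * A\<^sup>2) > 0" using A by simp
    show "C > 0" by (rule C)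
    show "E t \<ge> 0" for t by (simp add: E_def)
    show "continuous_on {0..} E"
      unfolding E_def continuous_on_def
      by (intro ballI tendsto_power equivalent_H1_norm_continuous[OF N cont s1]) simp
    show "(E has_real_derivative E' t) (at t)" if "t > 0" for t by (rule E'(1)[OF that])
    show "E' t \<le> 0" if "t > 0" for t by (rule E'_le[OF that])
    show "Z R t \<ge> 0" for R t by (simp add: Z_def)
    show "Z R 0 \<le> C * R" if R: "0 < R" "R \<le> 1" for R
    proof -
      have "Z R 0 \<le> sqrt ((2 * R * B)\<^sup>2)"
        unfolding Z_def using B(2)[of R] R by (intro real_sqrt_le_mono) (simp add: power_mult_distrib)
      also have "\<dots> = (2 * B) * R" using R B(1) by simp
      also have "\<dots> \<le> C * R" using C R by (intro mult_right_mono) auto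
      finally show ?thesis .
    qed
    show "Z R q \<le> Z R p + C * R * (\<Phi> q - \<Phi> p)"
      if R: "0 < R" "R \<le> 1" and p: "0 \<le> p" "p < q" and c\<Phi>: "continuous_on {p..q} \<Phi>"
        and d\<Phi>: "\<And>t. p < t \<Longrightarrow> t < q \<Longrightarrow> (\<Phi> has_real_derivative \<phi> t) (at t)"
        and \<phi>: "\<And>t. p < t \<Longrightarrow> t < q \<Longrightarrow> sqrt (E t * - E' t) \<le> \<phi> t" for R p q \<Phi> \<phi>
    proof -
      define Y' where "Y' t = 2 * ((\<Sum>i\<in>UNIV. low_inner R (\<lambda>x. u_t t x $ i) (\<lambda>x. u t x $ i))
         + (\<Sum>i\<in>UNIV. \<Sum>j\<in>UNIV. low_inner R (\<lambda>x. \<tau>_t t x $ i $ j) (\<lambda>x. \<tau> t x $ i $ j)))" for t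
      have d: "((\<lambda>r. low_energy R (u r) (\<tau> r)) has_real_derivative Y' t) (at t within {0..})" if "t \<ge> 0" for t
        unfolding Y'_def using sol that by (intro has_derivative_low_energy) auto
      show ?thesis unfolding Z_def
      proof (rule sqrt_growth[where Y="\<lambda>t. low_energy R (u t) (\<tau> t)" and Y'=Y' and \<phi>=\<phi>])
        show "p < q" by (rule p)
        show "low_energy R (u t) (\<tau> t) \<ge> 0" for t by simp
        show "continuous_on {p..q} (\<lambda>t. low_energy R (u t) (\<tau> t))"
        proof (rule continuous_on_subset)
          show "continuous_on {0..} (\<lambda>t. low_energy R (u t) (\<tau> t))"
            using d by (intro DERIV_continuous_on) auto
        qed (use p in auto)
        show "continuous_on {p..q} \<Phi>" by (rule c\<Phi>)
        show "C * R \<ge> 0" using C R by simp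
        fix t assume t: "p < t" "t < q"
        have t0: "t > 0" using t p by simp
        have "t \<in> interior {0..}" using t0 by (simp add: interior_real_atLeast)
        thus "((\<lambda>t. low_energy R (u t) (\<tau> t)) has_real_derivative Y' t) (at t)"
          using d[of t] t0 at_within_interior[of t "{0..}"] by simp
        show "(\<Phi> has_real_derivative \<phi> t) (at t)" by (rule d\<Phi>[OF t])
        have E0: "E t * - E' t \<ge> 0"
          using E'_le[OF t0] by (simp add: E_def mult_nonneg_nonpos)
        have "0 \<le> sqrt (E t * - E' t)" using E0 by simp
        also note \<phi>[OF t]
        finally show \<phi>0: "\<phi> t \<ge> 0" .
        \<comment> \<open>The dissipation is at most \<open>- E' t\<close>, and the H1 norm at most
          sqrt E / a, so the coefficient in \<open>low_energy_rate\<close> becomes a multiple of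
          sqrt(E |E'|).\<close>
        have "sobolev_norm 1 (w t) * sqrt (dissipation (u t) (\<tau> t)) \<le> (sqrt (E t) / a) * sqrt (- E' t)"
          using Nle(1)[of t] t0 E'(2)[OF t0] a by (intro mult_mono real_sqrt_le_mono) (auto simp: E_def)
        also have "\<dots> = sqrt (E t * - E' t) / a" by (simp only: real_sqrt_mult times_divide_eq_left)
        also have "\<dots> \<le> \<phi> t / a" using \<phi>[OF t] a by (intro divide_right_mono) auto
        finally have *: "sobolev_norm 1 (w t) * sqrt (dissipation (u t) (\<tau> t)) \<le> \<phi> t / a" .
        have "Y' t \<le> 2 * (72 * (sobolev_norm 1 (w t) * sqrt (dissipation (u t) (\<tau> t))) * R * sqrt (low_energy R (u t) (\<tau> t)))"
          unfolding Y'_def w_def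
        proof (intro mult_left_mono low_energy_rate[OF \<theta> assms(2) ws])
          show "t \<ge> 0" using t0 by simp
          thus "weakly_differentiable (P t)" "square_integrable (u_t t)" "square_integrable (\<tau>_t t)"
            using sol by (auto simp: has_time_derivative_def)
          show "AE x in lborel.
           transpose (\<tau> t x) = \<tau> t x \<and>
           divergence (u t) x = 0 \<and>
           u_t t x + velocity_convection (u t) (u t) x + gradient (P t) x
             = tensor_divergence (\<tau> t) x \<and>
           \<tau>_t t x + tensor_convection (u t) (\<tau> t) x + \<tau> t x
               + Q_term 1 (velocity_gradient (u t) x) (\<tau> t x)
             = sym_part (velocity_gradient (u t) x) + tensor_laplacian (\<tau> t) x"
            using sol \<open>t \<ge> 0\<close> by blast
        qed (use R in auto)
        also have "\<dots> \<le> 2 * (72 * (\<phi> t / a) * R * sqrt (low_energy R (u t) (\<tau> t)))"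
          using * R by (intro mult_left_mono mult_right_mono) auto
        also have "\<dots> = 2 * ((72 / a) * R) * \<phi> t * sqrt (low_energy R (u t) (\<tau> t))" by simp
        also have "\<dots> \<le> 2 * (C * R) * \<phi> t * sqrt (low_energy R (u t) (\<tau> t))"
          using C(2) R \<phi>0 by (intro mult_left_mono mult_right_mono) auto
        finally show "Y' t \<le> 2 * (C * R) * \<phi> t * sqrt (low_energy R (u t) (\<tau> t))" .
      qed
    qed
    show "E' t + 1 / (2 * A\<^sup>2) * R\<^sup>2 * E t \<le> C * R\<^sup>2 * (Z R t)\<^sup>2" if R: "0 < R" "R \<le> 1" and t: "0 < t" for R t
    proof -
      have "E t = (sqrt (E t))\<^sup>2" by (simp add: E_def)
      also have "\<dots> \<le> (A * sobolev_norm 1 (w t))\<^sup>2"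
        using Nle(2)[of t] t by (intro power_mono) (auto simp: E_def)
      also have "\<dots> = A\<^sup>2 * (sobolev_norm 1 (w t))\<^sup>2" by (rule power_mult_distrib)
      also have "\<dots> \<le> A\<^sup>2 * (low_energy R (u t) (\<tau> t) + (2 / R\<^sup>2) * dissipation (u t) (\<tau> t))"
        unfolding w_def by (intro mult_left_mono sobolev_norm_split[OF \<theta> assms(2) ws] R) (use t in auto)
      finally have "1 / (2 * A\<^sup>2) * R\<^sup>2 * E t \<le> 1 / (2 * A\<^sup>2) * R\<^sup>2 * (A\<^sup>2 * (low_energy R (u t) (\<tau> t) + (2 / R\<^sup>2) * dissipation (u t) (\<tau> t)))"
        by (rule mult_left_mono) simp
      also have "\<dots> = (1/2) * (R\<^sup>2 * low_energy R (u t) (\<tau> t)) + dissipation (u t) (\<tau> t)"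
        using A R by (simp add: field_simps)
      also have "\<dots> \<le> C * (R\<^sup>2 * low_energy R (u t) (\<tau> t)) + dissipation (u t) (\<tau> t)"
        using C(4) by (intro add_right_mono mult_right_mono) auto
      finally show ?thesis using E'(2)[OF t] by (simp add: Z_def mult.assoc)
    qed
    show "\<exists>K>0. \<forall>t\<ge>0. (1 + t) * E t \<le> K" if "K > 0" "\<And>t. t \<ge> 0 \<Longrightarrow> (1 + t) * E t \<le> K" for K
      using that by blast
  qed
  then obtain K where K: "K > 0" "\<And>t. t \<ge> 0 \<Longrightarrow> (1 + t) * E t \<le> K" by blast
  show ?thesis
  proof (intro exI conjI allI impI)
    show "sqrt K / a > 0" using K(1) a by simp
    fix t :: real assume t: "t > 0"
    have "E t \<le> K / (1 + t)" using K(2)[of t] t by (simp add: field_simps)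
    hence "sqrt (E t) \<le> sqrt (K / (1 + t))" by (rule real_sqrt_le_mono)
    also have "\<dots> = sqrt K * (1 + t) powr (-1/2)"
    proof -
      have e: "(1 + t) powr (-1/2) = inverse (sqrt (1 + t))"
        using powr_minus[of "1 + t" "1/2"] powr_half_sqrt[of "1 + t"] t by simp
      show ?thesis unfolding e real_sqrt_divide by (rule divide_inverse)
    qed
    finally have "sqrt (E t) / a \<le> sqrt K * (1 + t) powr (-1/2) / a" using a by (intro divide_right_mono) auto
    thus "sobolev_norm 1 (\<lambda>x. (u t x, \<tau> t x)) \<le> sqrt K / a * (1 + t) powr (-1/2)"
      using Nle(1)[of t] t by (simp add: w_def)
  qed
qed

end
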